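(* Let $n\ge 1$, let $A$ be a Young function with $A\in\nabla_2$, let $\beta>0$, let $0\leq s_1<s$, and set $\theta=\frac{s-s_1}{\beta+s}<1$. Then there is a constant $C>0$ (independent of $f$) such that for every measurable function $f:\mathbb{R}^n\to\mathbb{R}$ with $(-\Delta)^{\frac s2}(f)\in L^A(\mathbb{R}^n)$ and $f\in\dot{B}^{-\beta,\infty}_{\infty}(\mathbb{R}^n)$, one has $(-\Delta)^{\frac{s_1}{2}}(f)\in L^A_{1/(1-\theta)}(\mathbb{R}^n)$ and $$\left\|(-\Delta)^{\frac{s_1}{2}}(f)\right\|_{L^A_{1/(1-\theta)}(\mathbb{R}^n)}\leq C\,\left\|(-\Delta)^{\frac s2}(f)\right\|_{L^A(\mathbb{R}^n)}^{1-\theta}\,\|f\|_{\dot{B}^{-\beta,\infty}_{\infty}(\mathbb{R}^n)}^{\theta}.$$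
   Context: Young function: given a left-continuous non-decreasing function $a:[0,+\infty[\to[0,+\infty[$ with $a(0)=0$, the corresponding Young function is $A(t)=\int_0^t a(\tau)\,d\tau$, $t\ge 0$. A Young function $A$ satisfies the $\nabla_2$-condition, written $A\in\nabla_2$, if there is some $C>1$ such that $A(r)\leq\frac{1}{2C}A(Cr)$ for all $r\geq0$. Orlicz space: $L^A(\mathbb{R}^n)$ is the set of measurable functions $f:\mathbb{R}^n\to\mathbb{R}$ for which $\|f\|_{L^A(\mathbb{R}^n)}=\inf\{\lambda>0:\int_{\mathbb{R}^n}A(|f(x)|/\lambda)\,dx\leq1\}$ is finite. Rescaled Orlicz space: for real $\sigma>0$ let $A_\sigma(t)=A(t^\sigma)$; $L^A_\sigma(\mathbb{R}^n)$ is the set of measurable functions $f:\mathbb{R}^n\to\mathbb{R}$ for which $\|f\|_{L^A_\sigma(\mathbb{R}^n)}=\inf\{\lambda>0:\int_{\mathbb{R}^n}A_\sigma(|f(x)|/\lambda)\,dx\leq1\}$ is finite. With this definition $\||f|^\sigma\|_{L^A(\mathbb{R}^n)}=\|f\|_{L^A_\sigma(\mathbb{R}^n)}^\sigma$. Fractional Laplacian: for $s>0$, $\widehat{(-\Delta)^{\frac s2}(f)}(\xi)=|\xi|^s\widehat{f}(\xi)$, extended to tempered distributions by standard procedures; for $s_1=0$, $(-\Delta)^{\frac{s_1}{2}}(f)=f$. Besov space: for $\beta>0$, $\dot{B}^{-\beta,\infty}_{\infty}(\mathbb{R}^n)$ is the set of tempered distributions $f$ for which $\|f\|_{\dot{B}^{-\beta,\infty}_{\infty}(\mathbb{R}^n)}=\sup_{t>0}t^{\frac{\beta}{2}}\|h_t\ast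 f\|_{L^\infty(\mathbb{R}^n)}$ is finite, where $h_t(x)=(4\pi t)^{-\frac n2}e^{-\frac{|x|^2}{4t}}$ is the heat kernel. *)

theory Defs
  imports "HOL-Probability.Probability"
begin

definition young_function :: "(real \<Rightarrow> real) \<Rightarrow> bool" where
  "young_function A \<longleftrightarrow>
     (\<exists>a. a 0 = 0 \<and> (\<forall>t\<ge>0. 0 \<le> a t) \<and> mono_on {0..} a \<and>
          (\<forall>t>0. continuous (at_left t) a) \<and>
          (\<forall>t\<ge>0. A t = integral {0..t} a))"

definition nabla2 :: "(real \<Rightarrow> real) \<Rightarrow> bool" where
  "nabla2 A \<longleftrightarrow> (\<exists>C>1. \<forall>r\<ge>0. A r \<le> 1 / (2 * C) * A (C * r))"

text \<open>The value is \<open>\<infinity>\<close> when no \<open>\<lambda>\<close> is admissible, the infimum of the empty set in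
  \<^typ>\<open>ennreal\<close>.\<close>

definition orlicz_norm :: "(real \<Rightarrow> real) \<Rightarrow> (real ^ 'n \<Rightarrow> real) \<Rightarrow> ennreal" where
  "orlicz_norm A f =
     Inf {ennreal l | l. 0 < l \<and> (\<integral>\<^sup>+ x. ennreal (A (\<bar>f x\<bar> / l)) \<partial>lebesgue) \<le> 1}"

definition orlicz_space :: "(real \<Rightarrow> real) \<Rightarrow> (real ^ 'n \<Rightarrow> real) set" where
  "orlicz_space A = {f \<in> borel_measurable lebesgue. orlicz_norm A f < \<infinity>}"

definition rescaled :: "real \<Rightarrow> (real \<Rightarrow> real) \<Rightarrow> real \<Rightarrow> real" where
  "rescaled \<sigma> A t = A (t powr \<sigma>)"

definition partials :: "'n list \<Rightarrow> (real ^ 'n \<Rightarrow> complex) \<Rightarrow> real ^ 'n \<Rightarrow> complex" where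
  "partials is \<phi> = foldr (\<lambda>i g x. frechet_derivative g (at x) (axis i 1)) is \<phi>"

text \<open>Once all iterated partial derivatives are Frechet differentiable, all are continuous, so this is
  \<open>C\<^sup>\<infinity>\<close>; the order of the indices in the list is then immaterial.\<close>

definition smooth :: "(real ^ 'n \<Rightarrow> complex) \<Rightarrow> bool" where
  "smooth \<phi> \<longleftrightarrow> (\<forall>is x. partials is \<phi> differentiable (at x))"

definition test_function :: "(real ^ 'n \<Rightarrow> complex) \<Rightarrow> bool" where
  "test_function \<phi> \<longleftrightarrow> smooth \<phi> \<and> compact (closure {x. \<phi> x \<noteq> 0})"

definition schwartz :: "(real ^ 'n \<Rightarrow> complex) \<Rightarrow> bool" where
  "schwartz \<phi> \<longleftrightarrow> smooth \<phi> \<and>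
     (\<forall>k is. bounded (range (\<lambda>x. norm x ^ k * cmod (partials is \<phi> x))))"

definition schwartz_seminorm :: "nat \<Rightarrow> (real ^ 'n \<Rightarrow> complex) \<Rightarrow> real" where
  "schwartz_seminorm N \<phi> =
     (SUP (is, x) \<in> {is. length is \<le> N} \<times> UNIV. (1 + norm x) ^ N * cmod (partials is \<phi> x))"

text \<open>A distribution is a functional on all functions, of which only the values on Schwartz
  functions are meaningful.\<close>

definition tempered_distribution :: "((real ^ 'n \<Rightarrow> complex) \<Rightarrow> complex) \<Rightarrow> bool" where
  "tempered_distribution T \<longleftrightarrow>
     (\<forall>\<phi> \<psi>. schwartz \<phi> \<longrightarrow> schwartz \<psi> \<longrightarrow> T (\<lambda>x. \<phi> x + \<psi> x) = T \<phi> + T \<psi>) \<and>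
     (\<forall>c \<phi>. schwartz \<phi> \<longrightarrow> T (\<lambda>x. c * \<phi> x) = c * T \<phi>) \<and>
     (\<exists>C N. \<forall>\<phi>. schwartz \<phi> \<longrightarrow> cmod (T \<phi>) \<le> C * schwartz_seminorm N \<phi>)"

text \<open>The tempered distribution \<open>T\<close> is (given by) the locally integrable function \<open>f\<close>. Pairing
  with compactly supported test functions determines \<open>T\<close> by density, and does not require
  \<open>f * \<phi>\<close> to be integrable for every Schwartz function \<open>\<phi>\<close>.\<close>

definition given_by :: "((real ^ 'n \<Rightarrow> complex) \<Rightarrow> complex) \<Rightarrow> (real ^ 'n \<Rightarrow> real) \<Rightarrow> bool" where
  "given_by T f \<longleftrightarrow>
     (\<forall>K. compact K \<longrightarrow> set_integrable lebesgue K f) \<and>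
     (\<forall>\<phi>. test_function \<phi> \<longrightarrow> T \<phi> = (LINT x|lebesgue. complex_of_real (f x) * \<phi> x))"

definition fourier :: "(real ^ 'n \<Rightarrow> complex) \<Rightarrow> real ^ 'n \<Rightarrow> complex" where
  "fourier \<phi> \<xi> = (LINT x|lebesgue. cis (- (x \<bullet> \<xi>)) * \<phi> x)"

definition fourier_distr ::
    "((real ^ 'n \<Rightarrow> complex) \<Rightarrow> complex) \<Rightarrow> (real ^ 'n \<Rightarrow> complex) \<Rightarrow> complex" where
  "fourier_distr T \<phi> = T (fourier \<phi>)"

text \<open>\<open>frac_laplacian s T U\<close> says that \<open>U = (-\<Delta>)\<^bsup>s/2\<^esup> T\<close>, i.e. that the Fourier transform of \<open>U\<close>
  is \<open>|\<xi>|\<^bsup>s\<^esup>\<close> times that of \<open>T\<close>. As \<open>|\<xi>|\<^bsup>s\<^esup>\<close> is in general not smooth at the origin, it need not map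
  Schwartz functions to Schwartz functions. The product with a tempered distribution is therefore
  the weak limit, as \<open>\<epsilon> \<rightarrow> 0\<close>, of the products with the smooth symbols \<open>(\<epsilon>\<^sup>2 + |\<xi>|\<^sup>2)\<^bsup>s/2\<^esup>\<close>,
  which all do. There is no indeterminacy modulo polynomials: \<open>T\<close> determines \<open>U\<close> on Schwartz
  functions. The limit exists for every \<open>T\<close> in the Besov spaces below, and for every tempered
  \<open>T\<close> if \<open>s\<close> is an even integer.\<close>

definition frac_laplacian ::
    "real \<Rightarrow> ((real ^ 'n \<Rightarrow> complex) \<Rightarrow> complex) \<Rightarrow> ((real ^ 'n \<Rightarrow> complex) \<Rightarrow> complex) \<Rightarrow> bool" where
  "frac_laplacian s T U \<longleftrightarrow>
     (if s = 0 then \<forall>\<phi>. schwartz \<phi> \<longrightarrow> U \<phi> = T \<phi>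
      else \<forall>\<phi>. schwartz \<phi> \<longrightarrow>
        ((\<lambda>\<epsilon>. fourier_distr T (\<lambda>\<xi>. complex_of_real ((\<epsilon>\<^sup>2 + (norm \<xi>)\<^sup>2) powr (s / 2)) * \<phi> \<xi>))
           \<longlongrightarrow> fourier_distr U \<phi>) (at_right 0))"

definition heat_kernel :: "real \<Rightarrow> real ^ 'n \<Rightarrow> real" where
  "heat_kernel t x =
     (4 * pi * t) powr (- (real CARD('n) / 2)) * exp (- ((norm x)\<^sup>2 / (4 * t)))"

definition heat_conv :: "real \<Rightarrow> ((real ^ 'n \<Rightarrow> complex) \<Rightarrow> complex) \<Rightarrow> real ^ 'n \<Rightarrow> complex" where
  "heat_conv t T x = T (\<lambda>y. complex_of_real (heat_kernel t (x - y)))"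

text \<open>\<open>besov_norm \<beta>\<close> is the norm with regularity index \<open>-\<beta>\<close>.\<close>

definition besov_norm :: "real \<Rightarrow> ((real ^ 'n \<Rightarrow> complex) \<Rightarrow> complex) \<Rightarrow> ennreal" where
  "besov_norm \<beta> T =
     (SUP t \<in> {0<..}. ennreal (t powr (\<beta> / 2)) *
        esssup lebesgue (\<lambda>x. ennreal (cmod (heat_conv t T x))))"

definition besov_space :: "real \<Rightarrow> ((real ^ 'n \<Rightarrow> complex) \<Rightarrow> complex) set" where
  "besov_space \<beta> = {T. tempered_distribution T \<and> besov_norm \<beta> T < \<infinity>}"

end

theory Submission
  imports Defs "HOL-Real_Asymp.Real_Asymp"
begin

text \<open>Put \<open>\<alpha> = (s - s1) / 2\<close> and \<open>\<nu> = (s + \<beta>) / 2\<close>, so that \<open>\<theta> = \<alpha> / \<nu>\<close>, and let \<open>G t\<close> be the heat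
  extension of \<open>g = (-\<Delta>)\<^bsup>s/2\<^esup> f\<close>. The function \<open>u = 1 / \<Gamma>(\<alpha>) \<integral> t\<^bsup>\<alpha>-1\<^esup> G t dt\<close> represents
  \<open>(-\<Delta>)\<^bsup>s1/2\<^esup> f\<close>. The Besov norm gives \<open>|G t| \<le> S t\<^bsup>-\<nu>\<^esup> \<parallel>f\<parallel>\<close>, while \<open>|G t x|\<close> is at most the
  Hardy--Littlewood maximal function \<open>M g x\<close>. Splitting the integral where the two bounds agree gives
  Hedberg's inequality \<open>|u x| \<le> C (M g x)\<^bsup>1-\<theta>\<^esup> \<parallel>f\<parallel>\<^bsup>\<theta>\<^esup>\<close>. Since \<open>A \<in> \<nabla>\<^sub>2\<close>, the weak type estimate for
  \<open>M\<close> integrates to boundedness of \<open>M\<close> on the Orlicz space of \<open>A\<close>.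

  To see that \<open>u\<close> is the fractional Laplacian, the regularised symbols are written with
  \<open>(\<epsilon>\<^sup>2 + |\<xi>|\<^sup>2)\<^bsup>-\<kappa>\<^esup> = 1 / \<Gamma>(\<kappa>) \<integral> \<tau>\<^bsup>\<kappa>-1\<^esup> exp (-\<tau> (\<epsilon>\<^sup>2 + |\<xi>|\<^sup>2)) d\<tau>\<close>, where \<open>s / 2 = k - \<kappa>\<close> with an
  integer \<open>k > s / 2\<close>. The limit \<open>\<epsilon> \<rightarrow> 0\<close> is then a dominated limit of integrals of the heat flow of \<open>f\<close>,
  which decays in time, and the two fractional orders combine by the semigroup law of Weyl
  fractional integrals.\<close>

text \<open>Two obstacles shape the proof. First, \<open>f\<close> and \<open>g\<close> are only
  locally integrable, so they need not be integrable against a Gaussian: heat extensions are reached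
  through compactly supported truncations, and the truncation errors are controlled by temperedness.
  Second, since \<nu> > \<alpha>, the bound \<open>t powr (- \<nu>)\<close> is not integrable
  against \<open>t powr (\<alpha> - 1)\<close> near 0; small times are covered by a local L1 bound
  on the heat extension, which makes \<open>u\<close> locally integrable and lets the pairing with
  test functions be exchanged with the time integral.

  The integer k serves both ends of the \<tau>-integral: \<kappa> > 0 gives convergence at 0, and k
  Laplacians improve the decay of the heat flow to \<open>\<tau> powr (- \<beta> / 2 - k)\<close>,
  so that the integrand is of order \<open>\<tau> powr (- 1 - (s + \<beta>) / 2)\<close> at
  infinity.

  The maximal function enters only through its defining property: every level below
  \<open>w x\<close> is exceeded by the mean of |g| over some ball around x.\<close>

definition pd :: "'n::finite \<Rightarrow> (real ^ 'n \<Rightarrow> complex) \<Rightarrow> real ^ 'n \<Rightarrow> complex" where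
  "pd i g x = frechet_derivative g (at x) (axis i 1)"

lemma partials_Nil [simp]: "partials [] \<phi> = \<phi>"
  and partials_Cons: "partials (i # is) \<phi> = pd i (partials is \<phi>)"
  and partials_snoc: "partials (is @ [i]) \<phi> = partials is (pd i \<phi>)"
  by (auto simp: partials_def pd_def[abs_def])

lemma pd_eq:
  assumes "(f has_derivative f') (at x)"
  shows "pd i f x = f' (axis i 1)"
  using frechet_derivative_at[OF assms] by (simp add: pd_def)

lemma smooth_differentiable: "smooth f \<Longrightarrow> f differentiable (at x)"
  unfolding smooth_def by (metis partials_Nil)

lemma smooth_pd: "smooth f \<Longrightarrow> smooth (pd i f)"
  unfolding smooth_def by (metis partials_snoc)

lemma pd_add:
  assumes "f differentiable (at x)" "g differentiable (at x)"
  shows "pd i (\<lambda>x. f x + g x) x = pd i f x + pd i g x"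
proof -
  have "((\<lambda>x. f x + g x) has_derivative
      (\<lambda>h. frechet_derivative f (at x) h + frechet_derivative g (at x) h)) (at x)"
    using assms by (intro has_derivative_add) (auto simp: frechet_derivative_works)
  from pd_eq[OF this] show ?thesis by (simp add: pd_def)
qed

lemma pd_mult:
  assumes "f differentiable (at x)" "g differentiable (at x)"
  shows "pd i (\<lambda>x. f x * g x) x = f x * pd i g x + pd i f x * g x"
proof -
  have "((\<lambda>x. f x * g x) has_derivative
      (\<lambda>h. f x * frechet_derivative g (at x) h + frechet_derivative f (at x) h * g x)) (at x)"
    using assms by (intro has_derivative_mult) (auto simp: frechet_derivative_works)
  from pd_eq[OF this] show ?thesis by (simp add: pd_def)
qed

lemma pd_const [simp]: "pd i (\<lambda>x. c) = (\<lambda>x. 0)"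
  by (rule ext) (subst pd_eq[OF has_derivative_const], simp)

lemma pd_cmult:
  assumes "f differentiable (at x)"
  shows "pd i (\<lambda>x. c * f x) x = c * pd i f x"
  using pd_mult[of "\<lambda>x. c" x f i] assms by simp

lemma pd_coord: "pd i (\<lambda>x. complex_of_real (x $ j)) = (\<lambda>x. if i = j then 1 else 0)"
proof
  fix x :: "real ^ 'a"
  have "((\<lambda>x :: real ^ 'a. complex_of_real (x $ j)) has_derivative (\<lambda>h. complex_of_real (h $ j))) (at x)"
    by (intro bounded_linear_imp_has_derivative bounded_linear_compose[OF bounded_linear_of_real]
        bounded_linear_vec_nth)
  from pd_eq[OF this] show "pd i (\<lambda>x. complex_of_real (x $ j)) x = (if i = j then 1 else 0)"
    by (simp add: axis_def)
qed

text \<open>Schwartz seminorms control partial derivatives, the mean value inequality asks for the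
  operator norm; expanding the direction in the standard basis connects the two.\<close>

lemma norm_frechet_le_sum_pd:
  fixes f :: "real ^ 'n \<Rightarrow> complex"
  assumes "f differentiable (at x)"
  shows "cmod (frechet_derivative f (at x) h) \<le> norm h * (\<Sum>i\<in>UNIV. cmod (pd i f x))"
proof -
  let ?D = "frechet_derivative f (at x)"
  have lin: "linear ?D" using assms by (rule linear_frechet_derivative)
  have "?D h = ?D (\<Sum>i\<in>UNIV. (h $ i) *\<^sub>R axis i 1)"
    by (simp add: basis_expansion flip: scalar_mult_eq_scaleR)
  also have "\<dots> = (\<Sum>i\<in>UNIV. (h $ i) *\<^sub>R pd i f x)"
    by (simp add: linear_sum[OF lin] linear_scale[OF lin] pd_def)
  finally have "cmod (?D h) \<le> (\<Sum>i\<in>UNIV. cmod ((h $ i) *\<^sub>R pd i f x))"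
    using norm_sum[of "\<lambda>i. (h $ i) *\<^sub>R pd i f x" UNIV] by simp
  also have "\<dots> \<le> (\<Sum>i\<in>UNIV. norm h * cmod (pd i f x))"
    by (intro sum_mono) (auto intro!: mult_right_mono component_le_norm_cart)
  finally show ?thesis by (simp add: sum_distrib_left)
qed

subsection \<open>Smooth families\<close>

text \<open>Bounds on all iterated partial derivatives of functions indexed by \<open>i\<close>. With \<open>Q\<close> one of \<open>rapid I v\<close> and
  \<open>slow I v\<close> below they are uniform up to powers of the parameter \<open>v i\<close>; this is what bounds Schwartz
  seminorms in terms of the parameter.\<close>

definition smooth_family ::
    "(('i \<Rightarrow> real ^ 'n \<Rightarrow> complex) \<Rightarrow> bool) \<Rightarrow> ('i \<Rightarrow> real ^ 'n \<Rightarrow> complex) \<Rightarrow> bool" where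
  "smooth_family Q \<Phi> \<longleftrightarrow> (\<forall>i. smooth (\<Phi> i)) \<and> (\<forall>is. Q (\<lambda>i. partials is (\<Phi> i)))"

definition plus_closed :: "(('i \<Rightarrow> real ^ 'n \<Rightarrow> complex) \<Rightarrow> bool) \<Rightarrow> bool" where
  "plus_closed Q \<longleftrightarrow> (\<forall>\<Phi> \<Psi>. Q \<Phi> \<longrightarrow> Q \<Psi> \<longrightarrow> Q (\<lambda>i x. \<Phi> i x + \<Psi> i x))"

inductive_set sum_closure :: "('i \<Rightarrow> real ^ 'n \<Rightarrow> complex) set \<Rightarrow> ('i \<Rightarrow> real ^ 'n \<Rightarrow> complex) set"
  for S where
  base: "\<Phi> \<in> S \<Longrightarrow> \<Phi> \<in> sum_closure S"
| add: "\<Phi> \<in> sum_closure S \<Longrightarrow> \<Psi> \<in> sum_closure S \<Longrightarrow> (\<lambda>i x. \<Phi> i x + \<Psi> i x) \<in> sum_closure S"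

lemma smooth_familyD:
  assumes "smooth_family Q \<Phi>"
  shows "smooth (\<Phi> i)" "Q \<Phi>" "smooth_family Q (\<lambda>i. pd j (\<Phi> i))"
    and "\<Phi> i differentiable (at x)" "Q (\<lambda>i. partials is (\<Phi> i))"
proof -
  have "Q (\<lambda>i. partials [] (\<Phi> i))" using assms unfolding smooth_family_def by blast
  thus "Q \<Phi>" by simp
  show "smooth_family Q (\<lambda>i. pd j (\<Phi> i))"
    using assms unfolding smooth_family_def by (auto intro: smooth_pd simp flip: partials_snoc)
qed (use assms in \<open>auto simp: smooth_family_def intro: smooth_differentiable\<close>)

text \<open>Classes of explicit functions, such as polynomials times Gaussians, are closed under
  differentiation up to finite sums.\<close>

lemma smooth_family_coinduct:
  assumes "\<Phi> \<in> S"
    and Q: "plus_closed Q"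
    and diff: "\<And>\<Phi> i x. \<Phi> \<in> S \<Longrightarrow> \<Phi> i differentiable (at x)"
    and QS: "\<And>\<Phi>. \<Phi> \<in> S \<Longrightarrow> Q \<Phi>"
    and pd: "\<And>\<Phi> j. \<Phi> \<in> S \<Longrightarrow> (\<lambda>i. pd j (\<Phi> i)) \<in> sum_closure S"
  shows "smooth_family Q \<Phi>"
proof -
  have diff': "\<Phi> i differentiable (at x)" if "\<Phi> \<in> sum_closure S" for \<Phi> i x
    using that by induction (auto intro: diff differentiable_add)
  have Q': "Q \<Phi>" if "\<Phi> \<in> sum_closure S" for \<Phi>
    using that Q by induction (auto intro: QS simp: plus_closed_def)
  have pd': "(\<lambda>i. pd j (\<Phi> i)) \<in> sum_closure S" if "\<Phi> \<in> sum_closure S" for \<Phi> j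
    using that
  proof induction
    case (add \<Phi> \<Psi>)
    have "(\<lambda>i. pd j (\<lambda>x. \<Phi> i x + \<Psi> i x)) = (\<lambda>i x. pd j (\<Phi> i) x + pd j (\<Psi> i) x)"
      using add diff' by (auto intro!: ext pd_add)
    with add show ?case by (auto intro: sum_closure.add)
  qed (rule pd)
  \<comment> \<open>Peeling the list from the right applies one derivative to \<Phi> itself, which
    stays in the sum closure; hence the induction is general in \<Phi>.\<close>
  have *: "(\<lambda>i. partials is (\<Phi> i)) \<in> sum_closure S" if "\<Phi> \<in> sum_closure S" for \<Phi> "is"
    using that by (induction "is" arbitrary: \<Phi> rule: rev_induct) (auto simp: partials_snoc pd')
  have "\<Phi> \<in> sum_closure S" using assms(1) by (rule sum_closure.base)
  from *[OF this] show ?thesis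
    unfolding smooth_family_def smooth_def using diff' Q' by blast
qed

lemma smooth_family_mono:
  "smooth_family Q \<Phi> \<Longrightarrow> (\<And>\<Psi>. Q \<Psi> \<Longrightarrow> Q' \<Psi>) \<Longrightarrow> smooth_family Q' \<Phi>"
  unfolding smooth_family_def by blast

text \<open>With the trivial predicate the closure results for families specialise to plain
  smoothness, as in \<open>smooth_mult\<close> and \<open>smooth_add\<close>.\<close>

lemma smooth_family_True: "smooth_family (\<lambda>_. True) \<Phi> \<longleftrightarrow> (\<forall>i. smooth (\<Phi> i))"
  by (simp add: smooth_family_def)

lemma smooth_family_add:
  assumes "smooth_family Q \<Phi>" "smooth_family Q \<Psi>" "plus_closed Q"
  shows "smooth_family Q (\<lambda>i x. \<Phi> i x + \<Psi> i x)"
proof (rule smooth_family_coinduct[OF _ assms(3)])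
  let ?S = "{\<lambda>i x. \<Phi> i x + \<Psi> i x |\<Phi> \<Psi>. smooth_family Q \<Phi> \<and> smooth_family Q \<Psi>}"
  show "(\<lambda>i x. \<Phi> i x + \<Psi> i x) \<in> ?S" using assms by blast
  fix \<Theta> assume "\<Theta> \<in> ?S"
  then obtain \<Phi> \<Psi> where \<Theta>: "\<Theta> = (\<lambda>i x. \<Phi> i x + \<Psi> i x)" and fam: "smooth_family Q \<Phi>" "smooth_family Q \<Psi>"
    by blast
  note D = fam[THEN smooth_familyD(4)]
  show "\<Theta> i differentiable (at x)" for i x
    unfolding \<Theta> using D by (rule differentiable_add)
  show "Q \<Theta>" unfolding \<Theta> using fam[THEN smooth_familyD(2)] assms(3) by (auto simp: plus_closed_def)
  show "(\<lambda>i. pd j (\<Theta> i)) \<in> sum_closure ?S" for j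
  proof (rule sum_closure.base)
    have "(\<lambda>i. pd j (\<Theta> i)) = (\<lambda>i x. pd j (\<Phi> i) x + pd j (\<Psi> i) x)"
      unfolding \<Theta> using D by (auto intro!: ext pd_add)
    thus "(\<lambda>i. pd j (\<Theta> i)) \<in> ?S"
      using fam[THEN smooth_familyD(3), of j] by (intro CollectI exI[of _ "\<lambda>i. pd j (\<Phi> i)"] exI[of _ "\<lambda>i. pd j (\<Psi> i)"]) auto
  qed
qed

text \<open>The Leibniz rule keeps the class of products of two families closed up to sums, so the
  estimate \<open>Q\<close> on an undifferentiated product covers all derivatives.\<close>

lemma smooth_family_mult:
  assumes "smooth_family Q1 \<Phi>" "smooth_family Q2 \<Psi>" "plus_closed Q"
    and Q: "\<And>\<Phi> \<Psi>. Q1 \<Phi> \<Longrightarrow> Q2 \<Psi> \<Longrightarrow> Q (\<lambda>i x. \<Phi> i x * \<Psi> i x)"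
  shows "smooth_family Q (\<lambda>i x. \<Phi> i x * \<Psi> i x)"
proof (rule smooth_family_coinduct[OF _ assms(3)])
  let ?S = "{\<lambda>i x. \<Phi> i x * \<Psi> i x |\<Phi> \<Psi>. smooth_family Q1 \<Phi> \<and> smooth_family Q2 \<Psi>}"
  show "(\<lambda>i x. \<Phi> i x * \<Psi> i x) \<in> ?S" using assms by blast
  fix \<Theta> assume "\<Theta> \<in> ?S"
  then obtain \<Phi> \<Psi> where \<Theta>: "\<Theta> = (\<lambda>i x. \<Phi> i x * \<Psi> i x)" and fam: "smooth_family Q1 \<Phi>" "smooth_family Q2 \<Psi>"
    by blast
  note D = fam(1)[THEN smooth_familyD(4)] fam(2)[THEN smooth_familyD(4)]
  show "\<Theta> i differentiable (at x)" for i x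
    unfolding \<Theta> using D by (rule differentiable_mult)
  show "Q \<Theta>" unfolding \<Theta> using fam[THEN smooth_familyD(2)] by (rule Q)
  show "(\<lambda>i. pd j (\<Theta> i)) \<in> sum_closure ?S" for j
  proof -
    have "(\<lambda>i. pd j (\<Theta> i)) = (\<lambda>i x. \<Phi> i x * pd j (\<Psi> i) x + pd j (\<Phi> i) x * \<Psi> i x)"
      unfolding \<Theta> using D by (auto intro!: ext pd_mult)
    moreover have "(\<lambda>i x. \<Phi> i x * pd j (\<Psi> i) x) \<in> ?S"
      using fam smooth_familyD(3)[OF fam(2), of j]
      by (intro CollectI exI[of _ \<Phi>] exI[of _ "\<lambda>i. pd j (\<Psi> i)"]) auto
    moreover have "(\<lambda>i x. pd j (\<Phi> i) x * \<Psi> i x) \<in> ?S"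
      using fam smooth_familyD(3)[OF fam(1), of j]
      by (intro CollectI exI[of _ \<Psi>] exI[of _ "\<lambda>i. pd j (\<Phi> i)"]) auto
    ultimately show ?thesis by (simp only:) (intro sum_closure.intros)
  qed
qed

text \<open>A polynomial loss in \<open>v i\<close> is allowed because a tempered functional turns
  it into polynomial growth of the pairing, for instance in the centre x of a translated heat
  kernel. With \<open>v = 0\<close> the bounds are uniform.\<close>

definition rapid :: "'i set \<Rightarrow> ('i \<Rightarrow> real) \<Rightarrow> ('i \<Rightarrow> real ^ 'n \<Rightarrow> complex) \<Rightarrow> bool" where
  "rapid I v \<Phi> \<longleftrightarrow> (\<forall>k. \<exists>C m. \<forall>i\<in>I. \<forall>x. (1 + norm x) ^ k * cmod (\<Phi> i x) \<le> C * (1 + \<bar>v i\<bar>) ^ m)"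

definition slow :: "'i set \<Rightarrow> ('i \<Rightarrow> real) \<Rightarrow> ('i \<Rightarrow> real ^ 'n \<Rightarrow> complex) \<Rightarrow> bool" where
  "slow I v \<Phi> \<longleftrightarrow> (\<exists>k C m. \<forall>i\<in>I. \<forall>x. cmod (\<Phi> i x) \<le> C * (1 + norm x) ^ k * (1 + \<bar>v i\<bar>) ^ m)"

lemma rapid_plus_closed: "plus_closed (rapid I v)"
  unfolding plus_closed_def rapid_def
proof (intro allI impI)
  fix \<Phi> \<Psi> :: "'a \<Rightarrow> real ^ 'b \<Rightarrow> complex" and k
  assume "\<forall>k. \<exists>C m. \<forall>i\<in>I. \<forall>x. (1 + norm x) ^ k * cmod (\<Phi> i x) \<le> C * (1 + \<bar>v i\<bar>) ^ m"
    "\<forall>k. \<exists>C m. \<forall>i\<in>I. \<forall>x. (1 + norm x) ^ k * cmod (\<Psi> i x) \<le> C * (1 + \<bar>v i\<bar>) ^ m"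
  then obtain C m C' m' where
    1: "\<And>i x. i \<in> I \<Longrightarrow> (1 + norm x) ^ k * cmod (\<Phi> i x) \<le> C * (1 + \<bar>v i\<bar>) ^ m" and
    2: "\<And>i x. i \<in> I \<Longrightarrow> (1 + norm x) ^ k * cmod (\<Psi> i x) \<le> C' * (1 + \<bar>v i\<bar>) ^ m'" by metis
  have "(1 + norm x) ^ k * cmod (\<Phi> i x + \<Psi> i x) \<le> (\<bar>C\<bar> + \<bar>C'\<bar>) * (1 + \<bar>v i\<bar>) ^ (m + m')"
    if "i \<in> I" for i x
  proof -
    have "(1 + norm x) ^ k * cmod (\<Phi> i x + \<Psi> i x)
      \<le> (1 + norm x) ^ k * cmod (\<Phi> i x) + (1 + norm x) ^ k * cmod (\<Psi> i x)"
      unfolding distrib_left[symmetric] by (intro mult_left_mono norm_triangle_ineq) auto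
    also have "\<dots> \<le> C * (1 + \<bar>v i\<bar>) ^ m + C' * (1 + \<bar>v i\<bar>) ^ m'"
      using 1[OF that, of x] 2[OF that, of x] by linarith
    also have "\<dots> \<le> \<bar>C\<bar> * (1 + \<bar>v i\<bar>) ^ (m + m') + \<bar>C'\<bar> * (1 + \<bar>v i\<bar>) ^ (m + m')"
      by (intro add_mono mult_mono power_increasing) auto
    finally show ?thesis by (simp add: distrib_right)
  qed
  thus "\<exists>C m. \<forall>i\<in>I. \<forall>x. (1 + norm x) ^ k * cmod (\<Phi> i x + \<Psi> i x) \<le> C * (1 + \<bar>v i\<bar>) ^ m" by blast
qed

lemma slow_plus_closed: "plus_closed (slow I v)"
  unfolding plus_closed_def
proof (intro allI impI)
  fix \<Phi> \<Psi> :: "'a \<Rightarrow> real ^ 'b \<Rightarrow> complex"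
  assume "slow I v \<Phi>" "slow I v \<Psi>"
  then obtain k C m k' C' m' where
    1: "\<And>i x. i \<in> I \<Longrightarrow> cmod (\<Phi> i x) \<le> C * (1 + norm x) ^ k * (1 + \<bar>v i\<bar>) ^ m" and
    2: "\<And>i x. i \<in> I \<Longrightarrow> cmod (\<Psi> i x) \<le> C' * (1 + norm x) ^ k' * (1 + \<bar>v i\<bar>) ^ m'"
    unfolding slow_def by metis
  have "cmod (\<Phi> i x + \<Psi> i x) \<le> (\<bar>C\<bar> + \<bar>C'\<bar>) * (1 + norm x) ^ (k + k') * (1 + \<bar>v i\<bar>) ^ (m + m')"
    if "i \<in> I" for i x
  proof -
    have "cmod (\<Phi> i x + \<Psi> i x) \<le> cmod (\<Phi> i x) + cmod (\<Psi> i x)" by (rule norm_triangle_ineq)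
    also have "\<dots> \<le> C * (1 + norm x) ^ k * (1 + \<bar>v i\<bar>) ^ m + C' * (1 + norm x) ^ k' * (1 + \<bar>v i\<bar>) ^ m'"
      using 1[OF that, of x] 2[OF that, of x] by linarith
    also have "\<dots> \<le> \<bar>C\<bar> * (1 + norm x) ^ (k + k') * (1 + \<bar>v i\<bar>) ^ (m + m')
        + \<bar>C'\<bar> * (1 + norm x) ^ (k + k') * (1 + \<bar>v i\<bar>) ^ (m + m')"
      by (intro add_mono mult_mono power_increasing) auto
    finally show ?thesis by (simp add: distrib_right)
  qed
  thus "slow I v (\<lambda>i x. \<Phi> i x + \<Psi> i x)" unfolding slow_def by blast
qed

lemma slow_mult:
  assumes "slow I v \<Phi>" "slow I v \<Psi>"
  shows "slow I v (\<lambda>i x. \<Phi> i x * \<Psi> i x)"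
proof -
  from assms obtain k C m k' C' m' where
    1: "\<And>i x. i \<in> I \<Longrightarrow> cmod (\<Phi> i x) \<le> C * (1 + norm x) ^ k * (1 + \<bar>v i\<bar>) ^ m" and
    2: "\<And>i x. i \<in> I \<Longrightarrow> cmod (\<Psi> i x) \<le> C' * (1 + norm x) ^ k' * (1 + \<bar>v i\<bar>) ^ m'"
    unfolding slow_def by metis
  have "cmod (\<Phi> i x * \<Psi> i x) \<le> (C * C') * (1 + norm x) ^ (k + k') * (1 + \<bar>v i\<bar>) ^ (m + m')"
    if "i \<in> I" for i x
  proof -
    have "cmod (\<Phi> i x * \<Psi> i x)
      \<le> (C * (1 + norm x) ^ k * (1 + \<bar>v i\<bar>) ^ m) * (C' * (1 + norm x) ^ k' * (1 + \<bar>v i\<bar>) ^ m')"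
      unfolding norm_mult using 1[OF that, of x] 2[OF that, of x]
      by (intro mult_mono) (auto intro: order_trans[OF norm_ge_zero])
    thus ?thesis by (simp add: power_add mult_ac)
  qed
  thus ?thesis unfolding slow_def by blast
qed

text \<open>Growth of order k in \<Phi> is absorbed by using the decay of \<Psi> with exponent
  \<open>k + l\<close> in place of \<open>l\<close>.\<close>

lemma slow_rapid_mult:
  assumes "slow I v \<Phi>" "rapid I v \<Psi>"
  shows "rapid I v (\<lambda>i x. \<Phi> i x * \<Psi> i x)"
  unfolding rapid_def
proof
  fix l
  from assms(1) obtain k C m where
    1: "\<And>i x. i \<in> I \<Longrightarrow> cmod (\<Phi> i x) \<le> C * (1 + norm x) ^ k * (1 + \<bar>v i\<bar>) ^ m"
    unfolding slow_def by metis
  from assms(2) obtain C' m' where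
    2: "\<And>i x. i \<in> I \<Longrightarrow> (1 + norm x) ^ (k + l) * cmod (\<Psi> i x) \<le> C' * (1 + \<bar>v i\<bar>) ^ m'"
    unfolding rapid_def by metis
  have "(1 + norm x) ^ l * cmod (\<Phi> i x * \<Psi> i x) \<le> (\<bar>C\<bar> * C') * (1 + \<bar>v i\<bar>) ^ (m + m')"
    if "i \<in> I" for i x
  proof -
    have "(1 + norm x) ^ l * cmod (\<Phi> i x * \<Psi> i x)
      \<le> (1 + norm x) ^ l * ((\<bar>C\<bar> * (1 + norm x) ^ k * (1 + \<bar>v i\<bar>) ^ m) * cmod (\<Psi> i x))"
      unfolding norm_mult
      by (intro mult_left_mono mult_right_mono order_trans[OF 1[OF that, of x]]) auto
    also have "\<dots> = \<bar>C\<bar> * (1 + \<bar>v i\<bar>) ^ m * ((1 + norm x) ^ (k + l) * cmod (\<Psi> i x))"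
      by (simp add: power_add mult_ac)
    also have "\<dots> \<le> \<bar>C\<bar> * (1 + \<bar>v i\<bar>) ^ m * (C' * (1 + \<bar>v i\<bar>) ^ m')"
      by (intro mult_left_mono 2[OF that, of x]) auto
    finally show ?thesis by (simp add: power_add mult_ac)
  qed
  thus "\<exists>C m. \<forall>i\<in>I. \<forall>x. (1 + norm x) ^ l * cmod (\<Phi> i x * \<Psi> i x) \<le> C * (1 + \<bar>v i\<bar>) ^ m" by blast
qed

lemma rapid_imp_slow: "rapid I v \<Phi> \<Longrightarrow> slow I v \<Phi>"
  unfolding rapid_def slow_def
  by (drule spec[of _ 0]) (metis mult.right_neutral mult_1 power_0)

lemma slow_const [simp]: "slow I v (\<lambda>i x. c)"
  unfolding slow_def by (intro exI[of _ 0] exI[of _ "cmod c"]) auto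

lemma smooth_family_const:
  assumes "Q (\<lambda>i x. c i)" "Q (\<lambda>i x. 0)" "plus_closed Q"
  shows "smooth_family Q (\<lambda>i x. c i)"
proof (rule smooth_family_coinduct[OF _ assms(3)])
  let ?S = "{\<lambda>i x. c i, \<lambda>i x. 0}"
  fix \<Phi> :: "'a \<Rightarrow> real ^ 'b \<Rightarrow> complex" and j
  assume "\<Phi> \<in> ?S"
  hence "(\<lambda>i. pd j (\<Phi> i)) \<in> ?S" by auto
  thus "(\<lambda>i. pd j (\<Phi> i)) \<in> sum_closure ?S" by (rule sum_closure.base)
qed (use assms in auto)

lemma differentiable_coord: "(\<lambda>x. complex_of_real (x $ j)) differentiable (at x)"
  by (rule differentiableI[OF bounded_linear_imp_has_derivative])
     (intro bounded_linear_compose[OF bounded_linear_of_real] bounded_linear_vec_nth)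

lemma smooth_family_coord: "smooth_family (slow I v) (\<lambda>i x. complex_of_real (x $ j))"
proof (rule smooth_family_coinduct[OF _ slow_plus_closed])
  let ?S = "{\<lambda>(i :: 'a) x. complex_of_real (x $ j), \<lambda>i x. 0, \<lambda>i x. 1}"
  show "(\<lambda>(i :: 'a) x. complex_of_real (x $ j)) \<in> ?S" by simp
  fix \<Phi> assume S: "\<Phi> \<in> ?S"
  show "\<Phi> i differentiable (at x)" for i x using S by (auto intro: differentiable_coord)
  have "slow I v (\<lambda>(i :: 'a) x. complex_of_real (x $ j))"
    unfolding slow_def
    by (intro exI[of _ 1] exI[of _ 1] exI[of _ 0]) (auto intro: order_trans[OF component_le_norm_cart])
  thus "slow I v \<Phi>" using S by auto
  have "(\<lambda>i. pd k (\<Phi> i)) \<in> ?S" for k using S by (auto simp: pd_coord)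
  thus "(\<lambda>i. pd k (\<Phi> i)) \<in> sum_closure ?S" for k by (rule sum_closure.base)
qed

lemma slow_family_mult:
  "smooth_family (slow I v) \<Phi> \<Longrightarrow> smooth_family (slow I v) \<Psi>
    \<Longrightarrow> smooth_family (slow I v) (\<lambda>i x. \<Phi> i x * \<Psi> i x)"
  by (rule smooth_family_mult[OF _ _ slow_plus_closed slow_mult])

lemma slow_rapid_family_mult:
  "smooth_family (slow I v) \<Phi> \<Longrightarrow> smooth_family (rapid I v) \<Psi>
    \<Longrightarrow> smooth_family (rapid I v) (\<lambda>i x. \<Phi> i x * \<Psi> i x)"
  by (rule smooth_family_mult[OF _ _ rapid_plus_closed slow_rapid_mult])

lemmas slow_family_add = smooth_family_add[OF _ _ slow_plus_closed]
lemmas rapid_family_add = smooth_family_add[OF _ _ rapid_plus_closed]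

lemma slow_family_const: "smooth_family (slow I v) (\<lambda>i x. c)"
  by (rule smooth_family_const) (auto simp: slow_plus_closed)

lemma slow_family_sum:
  assumes "\<And>j. j \<in> J \<Longrightarrow> smooth_family (slow I v) (\<Phi> j)"
  shows "smooth_family (slow I v) (\<lambda>i x. \<Sum>j\<in>J. \<Phi> j i x)"
  using assms
  by (induction J rule: infinite_finite_induct) (auto intro: slow_family_const slow_family_add)

lemma slow_family_norm2:
  fixes v :: "'i \<Rightarrow> real"
  shows "smooth_family (slow I v) (\<lambda>i x :: real ^ 'n. complex_of_real ((norm x)\<^sup>2))"
proof -
  have "(\<lambda>(i::'i) x :: real ^ 'n. complex_of_real ((norm x)\<^sup>2))
    = (\<lambda>i x. \<Sum>j\<in>UNIV. complex_of_real (x $ j) * complex_of_real (x $ j))"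
    by (simp add: norm_vec_def L2_set_def sum_nonneg power2_eq_square)
  thus ?thesis by (simp only:) (intro slow_family_sum slow_family_mult smooth_family_coord)
qed

text \<open>Pulls a family back along a projection, so that families with different parameters can
  be multiplied over a common index set, as in \<open>tempered_cutoff_heat_bound\<close>.\<close>

lemma smooth_family_reindex:
  assumes "smooth_family (slow I v) \<Phi>" "\<And>j. j \<in> J \<Longrightarrow> h j \<in> I" "\<And>j. j \<in> J \<Longrightarrow> \<bar>v (h j)\<bar> \<le> \<bar>w j\<bar>"
  shows "smooth_family (slow J w) (\<lambda>j. \<Phi> (h j))"
  unfolding smooth_family_def
proof (intro conjI allI)
  show "smooth (\<Phi> (h i))" for i using assms by (auto simp: smooth_family_def)
  fix "is"
  from assms(1) obtain k C m where
    C: "\<And>i x. i \<in> I \<Longrightarrow> cmod (partials is (\<Phi> i) x) \<le> C * (1 + norm x) ^ k * (1 + \<bar>v i\<bar>) ^ m"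
    unfolding slow_def smooth_family_def by metis
  have "cmod (partials is (\<Phi> (h j)) x) \<le> \<bar>C\<bar> * (1 + norm x) ^ k * (1 + \<bar>w j\<bar>) ^ m" if "j \<in> J" for j x
    by (rule order_trans[OF C]) (use that assms in \<open>auto intro!: mult_mono power_mono\<close>)
  thus "slow J w (\<lambda>i. partials is (\<Phi> (h i)))" unfolding slow_def by blast
qed

lemma rapid_family_reindex:
  assumes "smooth_family (rapid I v) \<Phi>" "\<And>j. j \<in> J \<Longrightarrow> h j \<in> I" "\<And>j. j \<in> J \<Longrightarrow> \<bar>v (h j)\<bar> \<le> \<bar>w j\<bar>"
  shows "smooth_family (rapid J w) (\<lambda>j. \<Phi> (h j))"
  unfolding smooth_family_def
proof (intro conjI allI)
  show "smooth (\<Phi> (h i))" for i using assms by (auto simp: smooth_family_def)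
  fix "is"
  show "rapid J w (\<lambda>i. partials is (\<Phi> (h i)))" unfolding rapid_def
  proof
    fix k
    from assms(1) obtain C m where
      C: "\<And>i x. i \<in> I \<Longrightarrow> (1 + norm x) ^ k * cmod (partials is (\<Phi> i) x) \<le> C * (1 + \<bar>v i\<bar>) ^ m"
      unfolding rapid_def smooth_family_def by metis
    have "(1 + norm x) ^ k * cmod (partials is (\<Phi> (h j)) x) \<le> \<bar>C\<bar> * (1 + \<bar>w j\<bar>) ^ m" if "j \<in> J" for j x
      by (rule order_trans[OF C]) (use that assms in \<open>auto intro!: mult_mono power_mono\<close>)
    thus "\<exists>C m. \<forall>i\<in>J. \<forall>x. (1 + norm x) ^ k * cmod (partials is (\<Phi> (h i)) x) \<le> C * (1 + \<bar>w i\<bar>) ^ m" by blast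
  qed
qed

subsection \<open>Schwartz functions\<close>

text \<open>The weight \<open>1 + norm x\<close> never vanishes, so it can be divided by, and it is
  submultiplicative under addition of arguments; it therefore replaces \<open>norm x\<close> from
  here on.\<close>

lemma schwartz_weighted_bound:
  assumes "schwartz \<phi>"
  obtains C where "C \<ge> 0" "\<And>x. (1 + norm x) ^ k * cmod (partials is \<phi> x) \<le> C"
proof -
  have "bounded (range (\<lambda>x. norm x ^ k * cmod (partials is \<phi> x)))"
    "bounded (range (\<lambda>x. norm x ^ 0 * cmod (partials is \<phi> x)))"
    using assms unfolding schwartz_def by blast+
  then obtain B C where B: "\<And>x. \<bar>norm x ^ k * cmod (partials is \<phi> x)\<bar> \<le> B"
    and C: "\<And>x. cmod (partials is \<phi> x) \<le> C"
    unfolding bounded_iff by (auto simp: abs_mult)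
  have "(1 + norm x) ^ k * cmod (partials is \<phi> x) \<le> 2 ^ k * (B + C)" for x
  proof -
    have "(1 + norm x) ^ k \<le> (2 * max 1 (norm x)) ^ k" by (intro power_mono) auto
    also have "\<dots> = 2 ^ k * (max 1 (norm x)) ^ k" by (rule power_mult_distrib)
    also have "\<dots> \<le> 2 ^ k * (1 + norm x ^ k)"
      by (intro mult_left_mono) (auto simp: max_def)
    finally have "(1 + norm x) ^ k * cmod (partials is \<phi> x) \<le> 2 ^ k * (1 + norm x ^ k) * cmod (partials is \<phi> x)"
      by (rule mult_right_mono) simp
    also have "\<dots> = 2 ^ k * (cmod (partials is \<phi> x) + norm x ^ k * cmod (partials is \<phi> x))"
      by (simp add: algebra_simps)
    also have "\<dots> \<le> 2 ^ k * (B + C)"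
      using B[of x] C[of x] by (intro mult_left_mono) auto
    finally show ?thesis .
  qed
  moreover have "0 \<le> 2 ^ k * (B + C)" using B[of 0] C[of 0]
    by (meson abs_ge_zero add_nonneg_nonneg mult_nonneg_nonneg norm_ge_zero order_trans zero_le_numeral zero_le_power)
  ultimately show ?thesis using that by blast
qed

lemma schwartz_rapid_family:
  assumes "schwartz \<phi>" shows "smooth_family (rapid I v) (\<lambda>i. \<phi>)"
  unfolding smooth_family_def
proof (intro conjI allI)
  show "smooth \<phi>" using assms by (simp add: schwartz_def)
  show "rapid I v (\<lambda>i. partials is \<phi>)" for "is"
    unfolding rapid_def
  proof
    fix k
    obtain C where "C \<ge> 0" "\<And>x. (1 + norm x) ^ k * cmod (partials is \<phi> x) \<le> C"
      using schwartz_weighted_bound[OF assms] by metis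
    thus "\<exists>C m. \<forall>i\<in>I. \<forall>x. (1 + norm x) ^ k * cmod (partials is \<phi> x) \<le> C * (1 + \<bar>v i\<bar>) ^ m"
      by (intro exI[of _ C] exI[of _ 0]) auto
  qed
qed

lemma rapid_family_schwartz:
  assumes "smooth_family (rapid I v) \<Phi>" "i \<in> I"
  shows "schwartz (\<Phi> i)"
  unfolding schwartz_def
proof (intro conjI allI)
  show "smooth (\<Phi> i)" using assms by (simp add: smooth_family_def)
  fix k "is"
  from assms obtain C m where
      C: "\<And>x. (1 + norm x) ^ k * cmod (partials is (\<Phi> i) x) \<le> C * (1 + \<bar>v i\<bar>) ^ m"
      unfolding rapid_def smooth_family_def by metis
  have "norm x ^ k * cmod (partials is (\<Phi> i) x) \<le> C * (1 + \<bar>v i\<bar>) ^ m" for x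
    by (rule order_trans[OF _ C[of x]]) (intro mult_right_mono power_mono, auto)
  thus "bounded (range (\<lambda>x. norm x ^ k * cmod (partials is (\<Phi> i) x)))"
    by (auto simp: bounded_iff intro!: exI[of _ "C * (1 + \<bar>v i\<bar>) ^ m"])
qed

lemma schwartz_iff_family: "schwartz \<phi> \<longleftrightarrow> smooth_family (rapid (UNIV :: unit set) (\<lambda>_. 0)) (\<lambda>_. \<phi>)"
  using schwartz_rapid_family rapid_family_schwartz by (metis UNIV_I)

text \<open>The multipliers of the Schwartz class, each derivative having its own polynomial bound.
  The one-element index set makes the closure rules for families apply directly.\<close>

definition slow_smooth :: "(real ^ 'n \<Rightarrow> complex) \<Rightarrow> bool" where
  "slow_smooth a \<longleftrightarrow> smooth_family (slow (UNIV :: unit set) (\<lambda>_. 0)) (\<lambda>_. a)"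

lemma slow_smooth_mult: "slow_smooth a \<Longrightarrow> slow_smooth b \<Longrightarrow> slow_smooth (\<lambda>x. a x * b x)"
  and slow_smooth_add: "slow_smooth a \<Longrightarrow> slow_smooth b \<Longrightarrow> slow_smooth (\<lambda>x. a x + b x)"
  and slow_smooth_const: "slow_smooth (\<lambda>x. c)"
  and slow_smooth_coord: "slow_smooth (\<lambda>x. complex_of_real (x $ j))"
  and slow_smooth_norm2: "slow_smooth (\<lambda>x. complex_of_real ((norm x)\<^sup>2))"
  and slow_smooth_pd: "slow_smooth a \<Longrightarrow> slow_smooth (pd i a)"
  and slow_smooth_smooth: "slow_smooth a \<Longrightarrow> smooth a"
  unfolding slow_smooth_def
        apply (erule (1) slow_family_mult)
       apply (erule (1) slow_family_add)
      apply (rule slow_family_const)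
     apply (rule smooth_family_coord)
    apply (rule slow_family_norm2)
   apply (erule smooth_familyD(3))
  apply (erule smooth_familyD(1))
  done

lemma slow_smooth_power: "slow_smooth a \<Longrightarrow> slow_smooth (\<lambda>x. a x ^ k)"
  by (induction k) (auto intro: slow_smooth_const slow_smooth_mult)

lemma schwartz_add: "schwartz f \<Longrightarrow> schwartz g \<Longrightarrow> schwartz (\<lambda>x. f x + g x)"
  and schwartz_slow_mult: "slow_smooth a \<Longrightarrow> schwartz f \<Longrightarrow> schwartz (\<lambda>x. a x * f x)"
  and schwartz_pd: "schwartz f \<Longrightarrow> schwartz (pd i f)"
  and schwartz_slow_smooth: "schwartz f \<Longrightarrow> slow_smooth f"
  unfolding schwartz_iff_family slow_smooth_def
     apply (erule (1) rapid_family_add)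
    apply (erule (1) slow_rapid_family_mult)
   apply (erule smooth_familyD(3))
  apply (erule smooth_family_mono, erule rapid_imp_slow)
  done

lemma schwartz_cmult: "schwartz f \<Longrightarrow> schwartz (\<lambda>x. c * f x)"
  by (intro schwartz_slow_mult slow_smooth_const)

lemma schwartz_partials: "schwartz f \<Longrightarrow> schwartz (partials is f)"
  by (induction "is" arbitrary: f rule: rev_induct) (auto simp: partials_snoc schwartz_pd)

lemma schwartz_smooth: "schwartz f \<Longrightarrow> smooth f" by (simp add: schwartz_def)
lemma schwartz_differentiable: "schwartz f \<Longrightarrow> f differentiable (at x)"
  by (simp add: schwartz_smooth smooth_differentiable)

lemma schwartz_zero: "schwartz (\<lambda>x. 0)"
  unfolding schwartz_iff_family
  by (rule smooth_family_const) (auto simp: rapid_def rapid_plus_closed intro: exI[of _ 0])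

lemma schwartz_diff: "schwartz f \<Longrightarrow> schwartz g \<Longrightarrow> schwartz (\<lambda>x. f x - g x)"
  using schwartz_add[of f "\<lambda>x. (-1) * g x"] schwartz_cmult[of g "-1"] by simp

lemma schwartz_sum:
  assumes "\<And>j. j \<in> J \<Longrightarrow> schwartz (f j)"
  shows "schwartz (\<lambda>x. \<Sum>j\<in>J. f j x)"
  using assms by (induction J rule: infinite_finite_induct) (auto intro: schwartz_zero schwartz_add)

lemma schwartz_seminorm_le:
  assumes "\<And>is x. length is \<le> N \<Longrightarrow> (1 + norm x) ^ N * cmod (partials is \<phi> x) \<le> C"
  shows "schwartz_seminorm N \<phi> \<le> C"
  unfolding schwartz_seminorm_def
  by (rule cSUP_least) (use assms in \<open>auto intro: exI[of _ "[]"]\<close>)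

lemma finite_lists_le: "finite {is :: 'n::finite list. length is \<le> N}"
  using finite_lists_length_le[of "UNIV :: 'n set" N] by simp

text \<open>A real \<open>SUP\<close> dominates its range only if the range is bounded above; here
  it is, since there are finitely many index lists of length at most N and each has a weighted
  bound.\<close>

lemma schwartz_seminorm_ge:
  fixes \<phi> :: "real ^ 'n \<Rightarrow> complex"
  assumes "schwartz \<phi>" "length is \<le> N"
  shows "(1 + norm x) ^ N * cmod (partials is \<phi> x) \<le> schwartz_seminorm N \<phi>"
proof -
  have "\<forall>is. \<exists>C\<ge>0. \<forall>x. (1 + norm x) ^ N * cmod (partials is \<phi> x) \<le> C"
    using schwartz_weighted_bound[OF assms(1)] by metis
  then obtain C where C: "\<And>is. C is \<ge> 0" "\<And>is x. (1 + norm x) ^ N * cmod (partials is \<phi> x) \<le> C is" by metis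
  define L where "L = {is :: 'n list. length is \<le> N}"
  have "finite L" unfolding L_def by (rule finite_lists_le)
  have "(1 + norm x) ^ N * cmod (partials is \<phi> x) \<le> (\<Sum>is\<in>L. C is)" if "is \<in> L" for "is" x
    using C(2) member_le_sum[OF that, of C] C(1) \<open>finite L\<close> by (meson order_trans)
  hence "bdd_above ((\<lambda>(is, x). (1 + norm x) ^ N * cmod (partials is \<phi> x)) ` (L \<times> UNIV))"
    by (intro bdd_aboveI2[of _ _ "\<Sum>is\<in>L. C is"]) auto
  from cSUP_upper[OF _ this, of "(is, x)"] show ?thesis
    using assms(2) by (auto simp: schwartz_seminorm_def L_def)
qed

lemma schwartz_seminorm_nonneg: "schwartz \<phi> \<Longrightarrow> 0 \<le> schwartz_seminorm N \<phi>"
  using schwartz_seminorm_ge[of \<phi> "[]" N 0] by (auto intro: order_trans[OF norm_ge_zero])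

lemma schwartz_seminorm_mono:
  assumes "schwartz \<phi>" "M \<le> N"
  shows "schwartz_seminorm M \<phi> \<le> schwartz_seminorm N \<phi>"
proof (rule schwartz_seminorm_le)
  fix "is" x assume "length (is :: 'a list) \<le> M"
  have "(1 + norm x) ^ M * cmod (partials is \<phi> x) \<le> (1 + norm x) ^ N * cmod (partials is \<phi> x)"
    by (intro mult_right_mono power_increasing assms) auto
  also have "\<dots> \<le> schwartz_seminorm N \<phi>"
    using \<open>length is \<le> M\<close> assms by (intro schwartz_seminorm_ge) auto
  finally show "(1 + norm x) ^ M * cmod (partials is \<phi> x) \<le> schwartz_seminorm N \<phi>" .
qed

section \<open>Linearity and continuity of tempered distributions\<close>

lemma tempered_add:
  "tempered_distribution T \<Longrightarrow> schwartz \<phi> \<Longrightarrow> schwartz \<psi> \<Longrightarrow> T (\<lambda>x. \<phi> x + \<psi> x) = T \<phi> + T \<psi>"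
  and tempered_cmult: "tempered_distribution T \<Longrightarrow> schwartz \<phi> \<Longrightarrow> T (\<lambda>x. c * \<phi> x) = c * T \<phi>"
  by (auto simp: tempered_distribution_def)

lemma tempered_diff:
  "tempered_distribution T \<Longrightarrow> schwartz \<phi> \<Longrightarrow> schwartz \<psi> \<Longrightarrow> T (\<lambda>x. \<phi> x - \<psi> x) = T \<phi> - T \<psi>"
  using tempered_add[of T \<phi> "\<lambda>x. (-1) * \<psi> x"] tempered_cmult[of T \<psi> "-1"] schwartz_cmult[of \<psi> "-1"]
  by simp

lemma tempered_zero: "tempered_distribution T \<Longrightarrow> T (\<lambda>x. 0) = 0"
  using tempered_cmult[of T "\<lambda>x. 0" 0] schwartz_zero by simp

lemma tempered_sum:
  assumes "tempered_distribution T" "\<And>j. j \<in> J \<Longrightarrow> schwartz (f j)"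
  shows "T (\<lambda>x. \<Sum>j\<in>J. f j x) = (\<Sum>j\<in>J. T (f j))"
  using assms(2)
  by (induction J rule: infinite_finite_induct)
     (auto simp: tempered_zero[OF assms(1)] tempered_add[OF assms(1)] schwartz_sum)

lemma tempered_bound:
  assumes "tempered_distribution T"
  obtains C N where "C \<ge> 0" "\<And>\<phi>. schwartz \<phi> \<Longrightarrow> cmod (T \<phi>) \<le> C * schwartz_seminorm N \<phi>"
proof -
  from assms obtain C N where CN: "\<And>\<phi>. schwartz \<phi> \<Longrightarrow> cmod (T \<phi>) \<le> C * schwartz_seminorm N \<phi>"
    unfolding tempered_distribution_def by blast
  have "cmod (T \<phi>) \<le> \<bar>C\<bar> * schwartz_seminorm N \<phi>" if "schwartz \<phi>" for \<phi>
    by (rule order_trans[OF CN[OF that]]) (intro mult_right_mono schwartz_seminorm_nonneg that, simp)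
  thus ?thesis by (intro that[of "\<bar>C\<bar>" N]) auto
qed

text \<open>A tempered functional sees finitely many derivatives, so the constants and the exponents
  belonging to the single index lists can simply be summed, giving \<open>K\<close> and
  \<open>M\<close>.\<close>

lemma tempered_family_bound:
  fixes \<Phi> :: "'i \<Rightarrow> real ^ 'n \<Rightarrow> complex"
  assumes T: "tempered_distribution T" and fam: "smooth_family (rapid I v) \<Phi>"
  obtains C m where "C \<ge> 0" "\<And>i. i \<in> I \<Longrightarrow> cmod (T (\<Phi> i)) \<le> C * (1 + \<bar>v i\<bar>) ^ m"
proof -
  obtain C0 N where C0: "C0 \<ge> 0" "\<And>\<phi>. schwartz \<phi> \<Longrightarrow> cmod (T \<phi>) \<le> C0 * schwartz_seminorm N \<phi>"
    using tempered_bound[OF T] by metis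
  have "\<forall>is. \<exists>C m. \<forall>i\<in>I. \<forall>x. (1 + norm x) ^ N * cmod (partials is (\<Phi> i) x) \<le> C * (1 + \<bar>v i\<bar>) ^ m"
    using fam unfolding smooth_family_def rapid_def by blast
  then obtain C m where
    C: "\<And>is i x. i \<in> I \<Longrightarrow> (1 + norm x) ^ N * cmod (partials is (\<Phi> i) x) \<le> C is * (1 + \<bar>v i\<bar>) ^ m is"
    by metis
  define L where "L = {is :: 'n list. length is \<le> N}"
  have "finite L" unfolding L_def by (rule finite_lists_le)
  define K where "K = (\<Sum>is\<in>L. \<bar>C is\<bar>)"
  define M where "M = (\<Sum>is\<in>L. m is)"
  have "cmod (T (\<Phi> i)) \<le> (C0 * K) * (1 + \<bar>v i\<bar>) ^ M" if i: "i \<in> I" for i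
  proof -
    have "schwartz_seminorm N (\<Phi> i) \<le> K * (1 + \<bar>v i\<bar>) ^ M"
    proof (rule schwartz_seminorm_le)
      fix "is" x assume "length (is :: 'n list) \<le> N"
      hence "is \<in> L" by (simp add: L_def)
      have "\<bar>C is\<bar> \<le> K" "m is \<le> M" unfolding K_def M_def
        using \<open>is \<in> L\<close> \<open>finite L\<close> by (auto intro: member_le_sum[where f = "\<lambda>is. \<bar>C is\<bar>"] member_le_sum[where f = m])
      hence "C is * (1 + \<bar>v i\<bar>) ^ m is \<le> K * (1 + \<bar>v i\<bar>) ^ M"
        by (intro mult_mono power_increasing) auto
      with C[OF i, of x "is"] show "(1 + norm x) ^ N * cmod (partials is (\<Phi> i) x) \<le> K * (1 + \<bar>v i\<bar>) ^ M"
        by linarith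
    qed
    hence "C0 * schwartz_seminorm N (\<Phi> i) \<le> C0 * (K * (1 + \<bar>v i\<bar>) ^ M)"
      using C0(1) by (rule mult_left_mono)
    with C0(2)[OF rapid_family_schwartz[OF fam i]] show ?thesis by simp
  qed
  moreover have "0 \<le> C0 * K" unfolding K_def using C0(1) by (simp add: sum_nonneg)
  ultimately show ?thesis using that by blast
qed

subsection \<open>Lebesgue integrals on Euclidean space\<close>

text \<open>The definitions integrate over the completed measure; for Borel integrands it is
  exchanged for \<open>lborel\<close>, where joint measurability and Fubini are handled.\<close>

lemma lebesgue_integral_lborel:
  fixes f :: "'a::euclidean_space \<Rightarrow> 'b::{banach, second_countable_topology}"
  assumes "f \<in> borel_measurable borel"
  shows "(LINT x|lebesgue. f x) = (LINT x|lborel. f x)"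
  using assms by (intro integral_completion) simp

lemma lborel_affine_sign:
  fixes a :: "'a::euclidean_space"
  assumes "\<bar>c\<bar> = 1"
  shows "distr lborel borel (\<lambda>x. a + c *\<^sub>R x) = lborel"
  using lborel_affine[of c a] assms by (auto simp: density_1)

lemma lborel_translate:
  fixes f :: "'a::euclidean_space \<Rightarrow> 'b::{banach, second_countable_topology}"
  assumes [measurable]: "f \<in> borel_measurable borel"
  shows "(LINT x|lborel. f (a + x)) = (LINT x|lborel. f x)"
    and "integrable lborel (\<lambda>x. f (a + x)) \<longleftrightarrow> integrable lborel f"
proof -
  have d: "distr lborel borel (\<lambda>x. a + x) = lborel" using lborel_affine_sign[of 1 a] by simp
  show "(LINT x|lborel. f (a + x)) = (LINT x|lborel. f x)"
    by (subst (2) d[symmetric]) (simp add: integral_distr)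
  show "integrable lborel (\<lambda>x. f (a + x)) \<longleftrightarrow> integrable lborel f"
    by (subst (2) d[symmetric]) (simp add: integrable_distr_eq)
qed

lemma lborel_reflect:
  fixes f :: "'a::euclidean_space \<Rightarrow> 'b::{banach, second_countable_topology}"
  assumes [measurable]: "f \<in> borel_measurable borel"
  shows "(LINT x|lborel. f (a - x)) = (LINT x|lborel. f x)"
    and "integrable lborel (\<lambda>x. f (a - x)) \<longleftrightarrow> integrable lborel f"
proof -
  have d: "distr lborel borel (\<lambda>x. a - x) = lborel" using lborel_affine_sign[of "-1" a] by simp
  show "(LINT x|lborel. f (a - x)) = (LINT x|lborel. f x)"
    by (subst (2) d[symmetric]) (simp add: integral_distr)
  show "integrable lborel (\<lambda>x. f (a - x)) \<longleftrightarrow> integrable lborel f"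
    by (subst (2) d[symmetric]) (simp add: integrable_distr_eq)
qed

lemma nn_lborel_reflect:
  fixes f :: "'a::euclidean_space \<Rightarrow> ennreal"
  assumes [measurable]: "f \<in> borel_measurable borel"
  shows "(\<integral>\<^sup>+x. f (a - x) \<partial>lborel) = (\<integral>\<^sup>+x. f x \<partial>lborel)"
proof -
  have d: "distr lborel borel (\<lambda>x. a - x) = lborel" using lborel_affine_sign[of "-1" a] by simp
  show ?thesis by (subst (2) d[symmetric]) (simp add: nn_integral_distr)
qed

lemma lborel_integral_prod:
  fixes f :: "'a::euclidean_space \<Rightarrow> real \<Rightarrow> 'b::{real_normed_field,banach,second_countable_topology}"
  assumes int: "\<And>b. b \<in> Basis \<Longrightarrow> integrable lborel (f b)"
  shows "integrable lborel (\<lambda>x::'a. \<Prod>b\<in>Basis. f b (x \<bullet> b))"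
    and "(LINT x|lborel. (\<Prod>b\<in>Basis. f b (x \<bullet> b))) = (\<Prod>b\<in>Basis. LINT x|lborel. f b x)"
proof -
  interpret product_sigma_finite "\<lambda>_::'a. lborel :: real measure" ..
  let ?S = "\<lambda>g::'a \<Rightarrow> real. \<Sum>b\<in>Basis. g b *\<^sub>R b"
  have [measurable]: "f b \<in> borel_measurable borel" if "b \<in> Basis" for b
    using int[OF that] by simp
  have S: "?S g \<bullet> b = g b" if "b \<in> Basis" for g b
    using that by simp
  have pm: "(\<lambda>x::'a. \<Prod>b\<in>Basis. f b (x \<bullet> b)) \<in> borel_measurable borel" by measurable
  have "integrable (\<Pi>\<^sub>M b\<in>Basis. lborel) (\<lambda>g. \<Prod>b\<in>Basis. f b (g b))"
    by (rule product_integrable_prod) (auto intro: int)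
  hence "integrable (\<Pi>\<^sub>M b\<in>Basis. lborel) (\<lambda>g. \<Prod>b\<in>Basis. f b (?S g \<bullet> b))"
    by (simp add: S)
  thus "integrable lborel (\<lambda>x::'a. \<Prod>b\<in>Basis. f b (x \<bullet> b))"
    by (subst lborel_eq) (simp add: integrable_distr_eq pm)
  have "(LINT x|lborel. (\<Prod>b\<in>Basis. f b (x \<bullet> b))) = (LINT g|(\<Pi>\<^sub>M b\<in>Basis. lborel). (\<Prod>b\<in>Basis. f b (?S g \<bullet> b)))"
    by (subst lborel_eq) (simp add: integral_distr pm)
  also have "\<dots> = (\<Prod>b\<in>Basis. LINT x|lborel. f b x)"
    by (simp add: S product_integral_prod int)
  finally show "(LINT x|lborel. (\<Prod>b\<in>Basis. f b (x \<bullet> b))) = (\<Prod>b\<in>Basis. LINT x|lborel. f b x)" .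
qed

lemma Basis_cart: "(Basis :: (real ^ 'n) set) = range (\<lambda>i. axis i 1)"
  by (auto simp: Basis_vec_def)

lemma prod_Basis_cart:
  fixes F :: "real ^ 'n \<Rightarrow> 'b::comm_monoid_mult"
  shows "(\<Prod>b\<in>Basis. F b) = (\<Prod>i\<in>UNIV. F (axis i 1))"
  unfolding Basis_cart by (subst prod.reindex) (auto simp: inj_on_def axis_eq_axis)

lemma cart_integral_prod:
  fixes f :: "'n::finite \<Rightarrow> real \<Rightarrow> 'b::{real_normed_field,banach,second_countable_topology}"
  assumes int: "\<And>i. integrable lborel (f i)"
  shows "integrable lborel (\<lambda>x::real^'n. \<Prod>i\<in>UNIV. f i (x $ i))"
    and "(LINT x|lborel. (\<Prod>i\<in>UNIV. f i ((x :: real^'n) $ i))) = (\<Prod>i\<in>UNIV. LINT x|lborel. f i x)"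
proof -
  \<comment> \<open>\<open>SOME\<close> inverts the injective map from indices to basis vectors,
    which turns a family over indices into one over \<open>Basis\<close>.\<close>
  let ?F = "\<lambda>b :: real^'n. f (SOME i. b = axis i 1)"
  have F: "?F (axis i 1) = f i" for i
  proof -
    have "(SOME j. (axis i 1 :: real^'n) = axis j 1) = i"
      by (rule some_equality) (auto simp: axis_eq_axis)
    thus ?thesis by simp
  qed
  show "integrable lborel (\<lambda>x::real^'n. \<Prod>i\<in>UNIV. f i (x $ i))"
    using lborel_integral_prod(1)[of ?F] int unfolding prod_Basis_cart F
    by (simp add: inner_axis)
  show "(LINT x|lborel. (\<Prod>i\<in>UNIV. f i ((x :: real^'n) $ i))) = (\<Prod>i\<in>UNIV. LINT x|lborel. f i x)"
    using lborel_integral_prod(2)[of ?F] int unfolding prod_Basis_cart F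
    by (simp add: inner_axis)
qed

lemma integrable_inverse_1_square: "integrable lborel (\<lambda>x::real. 1 / (1 + x\<^sup>2))"
proof -
  have "set_integrable lborel {0..} (\<lambda>x::real. 1 / (1 + x\<^sup>2))"
    using integrable_I0i_1_div_plus_square
    by (simp add: interval_lebesgue_integrable_def set_integrable_def einterval_def zero_ereal_def
        indicator_def cong: if_cong)
      (erule integrable_cong_AE_imp, auto intro!: AE_I[of _ _ "{0}"])
  hence 1: "integrable lborel (\<lambda>x::real. indicator {0..} x *\<^sub>R (1 / (1 + x\<^sup>2)))"
    by (simp add: set_integrable_def)
  have 2: "integrable lborel (\<lambda>x::real. indicator {0..} (-x) *\<^sub>R (1 / (1 + (-x)\<^sup>2)))"
    using lborel_integrable_real_affine[OF 1, of "-1" 0] by simp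
  show ?thesis
    by (rule Bochner_Integration.integrable_bound[OF Bochner_Integration.integrable_add[OF 1 2]])
       (auto simp: indicator_def)
qed

lemma prod_1_square_le:
  fixes x :: "real^'n"
  shows "(\<Prod>i\<in>UNIV. 1 + (x $ i)\<^sup>2) \<le> (1 + norm x) ^ (2 * CARD('n))"
proof -
  have "(\<Prod>i\<in>UNIV. 1 + (x $ i)\<^sup>2) \<le> (\<Prod>i\<in>(UNIV::'n set). (1 + norm x)\<^sup>2)"
  proof (rule prod_mono)
    fix i :: 'n
    have "\<bar>x $ i\<bar>\<^sup>2 \<le> (norm x)\<^sup>2" by (intro power_mono component_le_norm_cart) auto
    thus "0 \<le> 1 + (x $ i)\<^sup>2 \<and> 1 + (x $ i)\<^sup>2 \<le> (1 + norm x)\<^sup>2"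
      by (auto simp: power2_sum intro: add_increasing2)
  qed
  thus ?thesis by (simp add: power_mult)
qed

text \<open>The generous exponent makes the radial weight comparable with the product of the
  one-dimensional integrable functions \<open>1 / (1 + (x $ i)\<^sup>2)\<close>, so integrability
  follows coordinate by coordinate.\<close>

lemma decay_integrable: "integrable lborel (\<lambda>x :: real^'n. 1 / (1 + norm x) ^ (2 * CARD('n)))"
proof (rule Bochner_Integration.integrable_bound)
  show "integrable lborel (\<lambda>x :: real^'n. \<Prod>i\<in>UNIV. 1 / (1 + (x $ i)\<^sup>2))"
    by (rule cart_integral_prod(1)) (rule integrable_inverse_1_square)
  show "AE x::real^'n in lborel. norm (1 / (1 + norm x) ^ (2 * CARD('n))) \<le> norm (\<Prod>i\<in>UNIV. 1 / (1 + (x $ i)\<^sup>2))"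
  proof (rule AE_I2)
    fix x :: "real^'n"
    have "0 < (\<Prod>i\<in>UNIV. 1 + (x $ i)\<^sup>2)" by (rule prod_pos) (auto simp: add_pos_nonneg)
    hence "1 / (1 + norm x) ^ (2 * CARD('n)) \<le> 1 / (\<Prod>i\<in>UNIV. 1 + (x $ i)\<^sup>2)"
      by (intro divide_left_mono prod_1_square_le) (auto intro!: mult_pos_pos zero_less_power add_pos_nonneg)
    thus "norm (1 / (1 + norm x) ^ (2 * CARD('n))) \<le> norm (\<Prod>i\<in>UNIV. 1 / (1 + (x $ i)\<^sup>2))"
      by (simp add: prod_dividef abs_prod)
  qed
qed measurable

lemma smooth_borel [measurable]: "smooth \<phi> \<Longrightarrow> \<phi> \<in> borel_measurable borel"
  by (intro borel_measurable_continuous_onI differentiable_imp_continuous_on)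
     (auto simp: differentiable_on_def intro: smooth_differentiable differentiable_at_withinI)

lemma schwartz_borel: "schwartz \<phi> \<Longrightarrow> \<phi> \<in> borel_measurable borel"
  by (intro smooth_borel schwartz_smooth)

lemma schwartz_weight_integrable:
  fixes \<phi> :: "real^'n \<Rightarrow> complex"
  assumes "schwartz \<phi>"
  shows "integrable lborel (\<lambda>x. (1 + norm x) ^ k * cmod (\<phi> x))"
proof -
  obtain C where C: "C \<ge> 0" "\<And>x. (1 + norm x) ^ (k + 2 * CARD('n)) * cmod (partials [] \<phi> x) \<le> C"
    using schwartz_weighted_bound[OF assms] by metis
  have [measurable]: "\<phi> \<in> borel_measurable borel" by (rule schwartz_borel[OF assms])
  show ?thesis
  proof (rule Bochner_Integration.integrable_bound)
    show "integrable lborel (\<lambda>x :: real^'n. C * (1 / (1 + norm x) ^ (2 * CARD('n))))"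
      by (intro integrable_mult_right decay_integrable)
    show "AE x :: real^'n in lborel. norm ((1 + norm x) ^ k * cmod (\<phi> x)) \<le> norm (C * (1 / (1 + norm x) ^ (2 * CARD('n))))"
    proof (rule AE_I2)
      fix x :: "real^'n"
      have "0 < (1 + norm x) ^ (2 * CARD('n))" by (simp add: add_pos_nonneg)
      with C show "norm ((1 + norm x) ^ k * cmod (\<phi> x)) \<le> norm (C * (1 / (1 + norm x) ^ (2 * CARD('n))))"
        by (auto simp: abs_mult power_add field_simps)
    qed
  qed measurable
qed

lemma schwartz_integrable: "schwartz \<phi> \<Longrightarrow> integrable lborel \<phi>"
  using schwartz_weight_integrable[of \<phi> 0] schwartz_borel[of \<phi>] by (simp add: integrable_norm_iff)

lemma schwartz_L1_le:
  fixes \<phi> :: "real^'n \<Rightarrow> complex"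
  assumes "schwartz \<phi>"
  shows "(LINT x|lborel. cmod (\<phi> x))
    \<le> schwartz_seminorm (2 * CARD('n)) \<phi> * (LINT x|lborel. 1 / (1 + norm (x :: real^'n)) ^ (2 * CARD('n)))"
proof -
  have "(LINT x|lborel. cmod (\<phi> x))
    \<le> (LINT x|lborel. schwartz_seminorm (2 * CARD('n)) \<phi> * (1 / (1 + norm (x :: real^'n)) ^ (2 * CARD('n))))"
  proof (rule integral_mono)
    fix x :: "real^'n"
    have "0 < (1 + norm x) ^ (2 * CARD('n))" by (simp add: add_pos_nonneg)
    with schwartz_seminorm_ge[OF assms, of "[]" "2 * CARD('n)" x]
    show "cmod (\<phi> x) \<le> schwartz_seminorm (2 * CARD('n)) \<phi> * (1 / (1 + norm x) ^ (2 * CARD('n)))"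
      by (simp add: field_simps)
  qed (intro integrable_norm schwartz_integrable assms integrable_mult_right decay_integrable)+
  thus ?thesis by (subst (asm) integral_mult_right_zero)
qed

subsection \<open>Fubini\<close>

lemma fubini_dominated:
  fixes f :: "'a::euclidean_space \<Rightarrow> 'b::euclidean_space \<Rightarrow> 'c::{banach, second_countable_topology}"
  assumes [measurable]: "(\<lambda>(x, y). f x y) \<in> borel_measurable (borel \<Otimes>\<^sub>M borel)"
    and g: "integrable lborel g" and h: "integrable lborel h"
    and le: "\<And>x y. norm (f x y) \<le> g x * h y"
  shows "(LINT x|lborel. LINT y|lborel. f x y) = (LINT y|lborel. LINT x|lborel. f x y)"
    and "integrable (lborel \<Otimes>\<^sub>M lborel) (\<lambda>(x, y). f x y)"
proof -
  have [measurable]: "g \<in> borel_measurable borel" "h \<in> borel_measurable borel" using g h by auto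
  have "integrable (lborel \<Otimes>\<^sub>M lborel) (\<lambda>(x, y). g x * h y)"
  proof (rule lborel_pair.Fubini_integrable)
    show "integrable lborel (\<lambda>x. LINT y|lborel. norm (case (x, y) of (x, y) \<Rightarrow> g x * h y))"
      using g by (simp add: abs_mult)
  qed (use h in auto)
  thus *: "integrable (lborel \<Otimes>\<^sub>M lborel) (\<lambda>(x, y). f x y)"
  proof (rule Bochner_Integration.integrable_bound)
    show "AE z in lborel \<Otimes>\<^sub>M lborel. norm (case z of (x, y) \<Rightarrow> f x y) \<le> norm (case z of (x, y) \<Rightarrow> g x * h y)"
      using le by (auto intro!: AE_I2 intro: order_trans[OF _ abs_ge_self])
  qed measurable
  show "(LINT x|lborel. LINT y|lborel. f x y) = (LINT y|lborel. LINT x|lborel. f x y)"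
    using lborel_pair.Fubini_integral[OF *] by simp
qed

text \<open>First countability reduces the limit to sequences in S that avoid x, where the
  sequential dominated convergence theorem applies.\<close>

lemma tendsto_at_within_dominated_convergence:
  fixes f :: "'b::first_countable_topology \<Rightarrow> 'a \<Rightarrow> 'c::{banach, second_countable_topology}"
  assumes meas: "g \<in> borel_measurable M" "\<And>s. s \<in> S \<Longrightarrow> f s \<in> borel_measurable M"
    and w: "integrable M w"
    and lim: "AE a in M. ((\<lambda>s. f s a) \<longlongrightarrow> g a) (at x within S)"
    and le: "\<And>s. s \<in> S \<Longrightarrow> s \<noteq> x \<Longrightarrow> AE a in M. norm (f s a) \<le> w a"
  shows "((\<lambda>s. LINT a|M. f s a) \<longlongrightarrow> (LINT a|M. g a)) (at x within S)"
  unfolding tendsto_at_iff_sequentially comp_def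
proof (intro allI impI)
  fix X assume X: "\<forall>i. X i \<in> S - {x}" "X \<longlonglongrightarrow> x"
  show "(\<lambda>n. LINT a|M. f (X n) a) \<longlonglongrightarrow> (LINT a|M. g a)"
  proof (rule integral_dominated_convergence[OF _ _ w])
    show "AE a in M. (\<lambda>i. f (X i) a) \<longlonglongrightarrow> g a"
      using lim by eventually_elim (use X in \<open>auto simp: tendsto_at_iff_sequentially comp_def\<close>)
  qed (use X meas le in auto)
qed

lemma at_right_dominated_convergence:
  fixes f :: "real \<Rightarrow> 'a \<Rightarrow> 'c::{banach, second_countable_topology}"
  assumes "g \<in> borel_measurable M" "\<And>s. s > x \<Longrightarrow> f s \<in> borel_measurable M"
    and "integrable M w" and "d > 0"
    and "AE a in M. ((\<lambda>s. f s a) \<longlongrightarrow> g a) (at_right x)"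
    and "\<And>s. x < s \<Longrightarrow> s < x + d \<Longrightarrow> AE a in M. norm (f s a) \<le> w a"
  shows "((\<lambda>s. LINT a|M. f s a) \<longlongrightarrow> (LINT a|M. g a)) (at_right x)"
proof -
  have eq: "at_right x = at x within {x<..<x + d}"
    by (rule at_within_nhd[of _ "{..<x + d}"]) (use \<open>d > 0\<close> in auto)
  show ?thesis unfolding eq
    by (rule tendsto_at_within_dominated_convergence[OF assms(1) _ assms(3)])
       (use assms(2,5,6) in \<open>auto simp: eq\<close>)
qed

text \<open>The Lipschitz bound with integrable constant \<open>w\<close> dominates the difference
  quotients and passes to their limit \<open>f'\<close>; the remainder divided by
  \<open>norm h\<close> is then dominated by \<open>2 * w\<close>. Measurability of
  \<open>f'\<close> also comes from its being a limit of difference quotients.\<close>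

lemma has_derivative_lebesgue_integral:
  fixes f :: "'b::euclidean_space \<Rightarrow> 'a \<Rightarrow> complex"
  assumes int: "\<And>h. norm h \<le> 1 \<Longrightarrow> integrable M (f (x + h))"
    and deriv: "\<And>a. ((\<lambda>x. f x a) has_derivative f' a) (at x)"
    and w: "integrable M w"
    and lip: "\<And>h a. norm h \<le> 1 \<Longrightarrow> cmod (f (x + h) a - f x a) \<le> norm h * w a"
  shows "((\<lambda>x. LINT a|M. f x a) has_derivative (\<lambda>h. LINT a|M. f' a h)) (at x)"
    and "\<And>h. integrable M (\<lambda>a. f' a h)"
proof -
  have int0: "integrable M (f x)" using int[of 0] by simp
  have bl: "bounded_linear (f' a)" for a using deriv by (rule has_derivative_bounded_linear)
  define R where "R h a = f (x + h) a - f x a - f' a h" for h a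
  have Rlim: "((\<lambda>h. cmod (R h a) / norm h) \<longlongrightarrow> 0) (at 0)" for a
    using deriv[of a] by (simp add: has_derivative_at R_def)
  have dirlim: "(\<lambda>n. real (Suc n) *\<^sub>R (f (x + (1 / real (Suc n)) *\<^sub>R h) a - f x a)) \<longlonglongrightarrow> f' a h"
    if "h \<noteq> 0" for a h
  proof -
    have "filterlim (\<lambda>n. (1 / real (Suc n)) *\<^sub>R h) (at 0) sequentially"
      unfolding filterlim_at using that
      using tendsto_scaleR[OF LIMSEQ_Suc[OF lim_1_over_n] tendsto_const, of h] by (auto simp del: of_nat_Suc)
    from filterlim_compose[OF Rlim this, of a]
    have "(\<lambda>n. cmod (R ((1 / real (Suc n)) *\<^sub>R h) a) / norm ((1 / real (Suc n)) *\<^sub>R h) * norm h) \<longlonglongrightarrow> 0 * norm h"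
      by (rule tendsto_mult_right)
    also have "(\<lambda>n. cmod (R ((1 / real (Suc n)) *\<^sub>R h) a) / norm ((1 / real (Suc n)) *\<^sub>R h) * norm h)
      = (\<lambda>n. norm (real (Suc n) *\<^sub>R (f (x + (1 / real (Suc n)) *\<^sub>R h) a - f x a) - f' a h))"
    proof
      fix n
      have "f' a h = real (Suc n) *\<^sub>R f' a ((1 / real (Suc n)) *\<^sub>R h)"
        using linear_scale[OF bounded_linear.linear[OF bl], of a "1 / real (Suc n)" h] by simp
      hence "real (Suc n) *\<^sub>R (f (x + (1 / real (Suc n)) *\<^sub>R h) a - f x a) - f' a h
        = real (Suc n) *\<^sub>R R ((1 / real (Suc n)) *\<^sub>R h) a"
        unfolding R_def by (metis scaleR_diff_right)
      hence "norm (real (Suc n) *\<^sub>R (f (x + (1 / real (Suc n)) *\<^sub>R h) a - f x a) - f' a h)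
        = real (Suc n) * cmod (R ((1 / real (Suc n)) *\<^sub>R h) a)"
        by simp
      thus "cmod (R ((1 / real (Suc n)) *\<^sub>R h) a) / norm ((1 / real (Suc n)) *\<^sub>R h) * norm h
        = norm (real (Suc n) *\<^sub>R (f (x + (1 / real (Suc n)) *\<^sub>R h) a - f x a) - f' a h)"
        using that by simp
    qed
    finally show ?thesis by (simp add: tendsto_norm_zero_iff LIM_zero_iff)
  qed
  have f'_le: "cmod (f' a h) \<le> norm h * w a" if "norm h \<le> 1" for a h
  proof (cases "h = 0")
    case False
    have "cmod (real (Suc n) *\<^sub>R (f (x + (1 / real (Suc n)) *\<^sub>R h) a - f x a)) \<le> norm h * w a" for n
    proof -
      have "norm ((1 / real (Suc n)) *\<^sub>R h) \<le> 1" using that by (simp add: field_simps)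
      from mult_left_mono[OF lip[OF this, of a], of "real (Suc n)"] show ?thesis
        unfolding norm_scaleR by simp
    qed
    thus ?thesis by (intro LIMSEQ_le_const2[OF tendsto_norm[OF dirlim[OF False]]]) auto
  qed (simp add: linear_0[OF bounded_linear.linear[OF bl]])
  have meas0: "(\<lambda>a. f' a h) \<in> borel_measurable M" if "norm h \<le> 1" for h
  proof (cases "h = 0")
    case False
    show ?thesis
    proof (rule borel_measurable_LIMSEQ_metric)
      show "(\<lambda>n. real (Suc n) *\<^sub>R (f (x + (1 / real (Suc n)) *\<^sub>R h) a - f x a)) \<longlonglongrightarrow> f' a h" for a
        by (rule dirlim[OF False])
      fix n
      have "norm ((1 / real (Suc n)) *\<^sub>R h) \<le> 1" using that by (simp add: field_simps)
      from int[OF this] int0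
      show "(\<lambda>a. real (Suc n) *\<^sub>R (f (x + (1 / real (Suc n)) *\<^sub>R h) a - f x a)) \<in> borel_measurable M"
        by auto
    qed
  qed (simp add: linear_0[OF bounded_linear.linear[OF bl]])
  have int1: "integrable M (\<lambda>a. f' a h)" if "norm h \<le> 1" for h
    using meas0[OF that] f'_le[OF that]
    by (intro Bochner_Integration.integrable_bound[OF integrable_mult_right[OF w, of "norm h"]])
       (auto intro: order_trans[OF _ abs_ge_self])
  show int': "integrable M (\<lambda>a. f' a h)" for h
  proof (cases "h = 0")
    case False
    hence "f' a h = norm h *\<^sub>R f' a ((1 / norm h) *\<^sub>R h)" for a
      using linear_scale[OF bounded_linear.linear[OF bl], of a "1 / norm h" h] by simp
    moreover have "integrable M (\<lambda>a. norm h *\<^sub>R f' a ((1 / norm h) *\<^sub>R h))"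
      using False by (intro integrable_scaleR_right int1) auto
    ultimately show ?thesis by simp
  qed (use int1 in auto)
  show "((\<lambda>x. LINT a|M. f x a) has_derivative (\<lambda>h. LINT a|M. f' a h)) (at x)"
    unfolding has_derivative_at
  proof
    show "bounded_linear (\<lambda>h. LINT a|M. f' a h)"
    proof (rule bounded_linear_intro[where K = "LINT a|M. \<bar>w a\<bar>"])
      show "(LINT a|M. f' a (h + k)) = (LINT a|M. f' a h) + (LINT a|M. f' a k)" for h k
        by (simp add: linear_add[OF bounded_linear.linear[OF bl]] int')
      show s: "(LINT a|M. f' a (c *\<^sub>R h)) = c *\<^sub>R (LINT a|M. f' a h)" for c h
        by (simp add: linear_scale[OF bounded_linear.linear[OF bl]])
      have le1: "cmod (LINT a|M. f' a h) \<le> norm h * (LINT a|M. \<bar>w a\<bar>)" if "norm h \<le> 1" for h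
      proof -
        have "cmod (LINT a|M. f' a h) \<le> (LINT a|M. norm h * \<bar>w a\<bar>)"
          by (rule order_trans[OF integral_norm_bound integral_mono])
             (auto intro!: int' w order_trans[OF f'_le[OF that]] mult_left_mono)
        thus ?thesis by simp
      qed
      show "cmod (LINT a|M. f' a h) \<le> norm h * (LINT a|M. \<bar>w a\<bar>)" for h
      proof (cases "h = 0")
        case False
        have "norm ((1 / norm h) *\<^sub>R h) = 1" using False by simp
        with le1[of "(1 / norm h) *\<^sub>R h"] False show ?thesis
          unfolding s by (simp add: field_simps)
      qed (use le1[of 0] in simp)
    qed
    \<comment> \<open>The hypotheses cover only increments of norm at most 1, so the limit is taken
      within the unit ball, of which 0 is an interior point.\<close>
    have "((\<lambda>h. LINT a|M. (1 / norm h) *\<^sub>R R h a) \<longlongrightarrow> (LINT a|M. 0)) (at 0 within cball 0 1)"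
    proof (rule tendsto_at_within_dominated_convergence)
      show "(\<lambda>a. (1 / norm h) *\<^sub>R R h a) \<in> borel_measurable M" if "h \<in> cball 0 1" for h
        unfolding R_def using int[of h] int0 int'[of h] that by auto
      show "integrable M (\<lambda>a. 2 * w a)" using w by simp
      show "AE a in M. ((\<lambda>h. (1 / norm h) *\<^sub>R R h a) \<longlongrightarrow> 0) (at 0 within cball 0 1)"
      proof (rule AE_I2)
        fix a
        have "((\<lambda>h. norm ((1 / norm h) *\<^sub>R R h a)) \<longlongrightarrow> 0) (at 0)"
          using Rlim[of a] by simp
        hence "((\<lambda>h. (1 / norm h) *\<^sub>R R h a) \<longlongrightarrow> 0) (at 0)" by (rule tendsto_norm_zero_cancel)
        thus "((\<lambda>h. (1 / norm h) *\<^sub>R R h a) \<longlongrightarrow> 0) (at 0 within cball 0 1)"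
          by (rule tendsto_within_subset) auto
      qed
      show "AE a in M. norm ((1 / norm h) *\<^sub>R R h a) \<le> 2 * w a" if "h \<in> cball 0 1" "h \<noteq> 0" for h
      proof (rule AE_I2)
        fix a
        have h: "norm h \<le> 1" "norm h > 0" using that by auto
        have "cmod (R h a) \<le> cmod (f (x + h) a - f x a) + cmod (f' a h)"
          unfolding R_def by (rule norm_triangle_ineq4)
        also have "\<dots> \<le> norm h * (2 * w a)"
          using lip[OF h(1), of a] f'_le[OF h(1), of a] by (simp add: algebra_simps)
        finally show "norm ((1 / norm h) *\<^sub>R R h a) \<le> 2 * w a" using h by (simp add: field_simps)
      qed
    qed simp
    hence "((\<lambda>h. LINT a|M. (1 / norm h) *\<^sub>R R h a) \<longlongrightarrow> 0) (at 0)"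
      by (subst (asm) at_within_interior) auto
    hence "((\<lambda>h. norm (LINT a|M. (1 / norm h) *\<^sub>R R h a)) \<longlongrightarrow> 0) (at 0)" by (rule tendsto_norm_zero)
    thus "((\<lambda>h. cmod ((LINT a|M. f (x + h) a) - (LINT a|M. f x a) - (LINT a|M. f' a h)) / norm h) \<longlongrightarrow> 0) (at 0)"
    proof (rule Lim_transform_eventually)
      have "\<forall>\<^sub>F h::'b in at 0. norm h \<le> 1"
        unfolding eventually_at by (intro exI[of _ 1]) auto
      thus "\<forall>\<^sub>F h in at 0. norm (LINT a|M. (1 / norm h) *\<^sub>R R h a) =
          cmod ((LINT a|M. f (x + h) a) - (LINT a|M. f x a) - (LINT a|M. f' a h)) / norm h"
      proof eventually_elim
        case (elim h)
        have "(LINT a|M. (1 / norm h) *\<^sub>R R h a)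
          = (1 / norm h) *\<^sub>R ((LINT a|M. f (x + h) a) - (LINT a|M. f x a) - (LINT a|M. f' a h))"
          unfolding R_def using int[OF elim] int0 int' by simp
        thus ?case by auto
      qed
    qed
  qed
qed

subsection \<open>The heat kernel\<close>

lemma heat_kernel_nonneg: "0 \<le> heat_kernel t x"
  by (simp add: heat_kernel_def)

lemma heat_kernel_borel [measurable]:
  "(\<lambda>(t, x :: real^'n). heat_kernel t x) \<in> borel_measurable (borel \<Otimes>\<^sub>M borel)"
  unfolding heat_kernel_def by measurable

lemma heat_kernel_minus: "heat_kernel t (x - y) = heat_kernel t (y - x)"
  by (simp add: heat_kernel_def norm_minus_commute)

lemma cis_borel [measurable]: "cis \<in> borel_measurable borel"
  by (intro borel_measurable_continuous_onI continuous_intros)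

text \<open>The one-dimensional heat kernel is the normal density of variance \<open>2 * t\<close>;
  rescaling by \<sigma> leads to the characteristic function of the standard normal
  distribution.\<close>

lemma gauss_fourier_real:
  assumes t: "t > 0"
  shows "integrable lborel (\<lambda>x. complex_of_real ((4 * pi * t) powr (-1/2) * exp (- (x\<^sup>2 / (4 * t)))) * cis (x * \<xi>))"
    and "(LINT x|lborel. complex_of_real ((4 * pi * t) powr (-1/2) * exp (- (x\<^sup>2 / (4 * t)))) * cis (x * \<xi>))
      = complex_of_real (exp (- (t * \<xi>\<^sup>2)))"
proof -
  define \<sigma> where "\<sigma> = sqrt (2 * t)"
  have \<sigma>: "\<sigma> > 0" "\<sigma>\<^sup>2 = 2 * t" using t by (auto simp: \<sigma>_def)
  define F where "F y = complex_of_real (std_normal_density y) * cis (\<sigma> * \<xi> * y)" for y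
  have intF: "integrable lborel F"
    by (rule Bochner_Integration.integrable_bound[of _ std_normal_density])
       (auto simp: F_def[abs_def] norm_mult)
  have "char std_normal_distribution (\<sigma> * \<xi>) = (LINT y|lborel. F y)"
    unfolding char_def F_def
    by (subst integral_density) (auto simp: scaleR_conv_of_real cis_conv_exp mult_ac)
  hence intF_eq: "(LINT y|lborel. F y) = exp (- (t * \<xi>\<^sup>2))"
    using \<sigma> by (simp add: char_std_normal_distribution power_mult_distrib field_simps)
  have eq: "complex_of_real ((4 * pi * t) powr (-1/2) * exp (- (x\<^sup>2 / (4 * t)))) * cis (x * \<xi>)
    = complex_of_real (1 / \<sigma>) * F (0 + (1 / \<sigma>) * x)" for x
  proof -
    have "(4 * pi * t) powr (-1/2) = 1 / sqrt (4 * pi * t)"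
      using t by (simp add: powr_minus_divide powr_half_sqrt)
    also have "sqrt (4 * pi * t) = sqrt (2 * pi) * \<sigma>"
      unfolding \<sigma>_def by (simp add: mult_ac flip: real_sqrt_mult)
    finally have 1: "(4 * pi * t) powr (-1/2) = 1 / \<sigma> * (1 / sqrt (2 * pi))" by simp
    have 2: "(1 / \<sigma> * x)\<^sup>2 / 2 = x\<^sup>2 / (4 * t)" using \<sigma> by (simp add: power_divide)
    show ?thesis unfolding F_def std_normal_density_def 1 using \<sigma>(1) 2 by (simp add: mult_ac)
  qed
  show "integrable lborel (\<lambda>x. complex_of_real ((4 * pi * t) powr (-1/2) * exp (- (x\<^sup>2 / (4 * t)))) * cis (x * \<xi>))"
    unfolding eq using \<sigma> by (intro integrable_mult_right lborel_integrable_real_affine intF) auto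
  have "(LINT y|lborel. F y) = \<bar>1 / \<sigma>\<bar> *\<^sub>R (LINT x|lborel. F (0 + (1 / \<sigma>) * x))"
    using \<sigma> by (intro lborel_integral_real_affine) auto
  thus "(LINT x|lborel. complex_of_real ((4 * pi * t) powr (-1/2) * exp (- (x\<^sup>2 / (4 * t)))) * cis (x * \<xi>))
      = complex_of_real (exp (- (t * \<xi>\<^sup>2)))"
    unfolding eq integral_mult_right_zero using intF_eq \<sigma> by (simp add: scaleR_conv_of_real)
qed

lemma norm_cart_sum: "(norm (x :: real^'n))\<^sup>2 = (\<Sum>i\<in>UNIV. (x $ i)\<^sup>2)"
  by (simp add: norm_vec_def L2_set_def sum_nonneg)

lemma cis_sum: "finite I \<Longrightarrow> cis (\<Sum>i\<in>I. f i) = (\<Prod>i\<in>I. cis (f i))"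
  by (induction I rule: finite_induct) (auto simp: cis_mult[symmetric])

lemma heat_kernel_fourier:
  fixes \<xi> :: "real^'n"
  assumes t: "t > 0"
  shows "integrable lborel (\<lambda>z. complex_of_real (heat_kernel t z) * cis (z \<bullet> \<xi>))"
    and "(LINT z|lborel. complex_of_real (heat_kernel t z) * cis (z \<bullet> \<xi>))
      = complex_of_real (exp (- (t * (norm \<xi>)\<^sup>2)))"
proof -
  let ?f = "\<lambda>i x. complex_of_real ((4 * pi * t) powr (-1/2) * exp (- (x\<^sup>2 / (4 * t)))) * cis (x * \<xi> $ i)"
  have eq: "complex_of_real (heat_kernel t z) * cis (z \<bullet> \<xi>) = (\<Prod>i\<in>UNIV. ?f i (z $ i))" for z
  proof -
    have 1: "(4 * pi * t) powr (- (real CARD('n) / 2)) = (\<Prod>i\<in>(UNIV::'n set). (4 * pi * t) powr (-1/2))"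
      using t by (simp add: powr_powr flip: powr_realpow)
    have 2: "exp (- ((norm z)\<^sup>2 / (4 * t))) = (\<Prod>i\<in>UNIV. exp (- ((z $ i)\<^sup>2 / (4 * t))))"
      by (simp add: norm_cart_sum sum_divide_distrib sum_negf flip: exp_sum)
    have 3: "cis (z \<bullet> \<xi>) = (\<Prod>i\<in>UNIV. cis (z $ i * \<xi> $ i))"
      by (simp add: inner_vec_def cis_sum)
    show ?thesis unfolding heat_kernel_def 1 2 3 by (simp only: of_real_mult of_real_prod prod.distrib)
  qed
  show "integrable lborel (\<lambda>z. complex_of_real (heat_kernel t z) * cis (z \<bullet> \<xi>))"
    unfolding eq by (intro cart_integral_prod(1) gauss_fourier_real t)
  show "(LINT z|lborel. complex_of_real (heat_kernel t z) * cis (z \<bullet> \<xi>))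
      = complex_of_real (exp (- (t * (norm \<xi>)\<^sup>2)))"
    unfolding eq cart_integral_prod(2)[OF gauss_fourier_real(1)[OF t]] gauss_fourier_real(2)[OF t]
    by (simp add: norm_cart_sum sum_distrib_left sum_negf flip: exp_sum of_real_prod)
qed

lemma heat_kernel_integrable: "t > 0 \<Longrightarrow> integrable lborel (heat_kernel t :: real^'n \<Rightarrow> real)"
  using integrable_Re[OF heat_kernel_fourier(1)[of t 0]] by simp

lemma heat_kernel_integral: "t > 0 \<Longrightarrow> (LINT z|lborel. heat_kernel t (z :: real^'n)) = 1"
  using heat_kernel_fourier(2)[of t "0 :: real^'n"] by simp

text \<open>\<open>1 + w \<le> exp w\<close> turns the polynomial into an exponential, and
  completing the square in the exponent gives the constant.\<close>

lemma weight_gauss_le: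
  assumes "w \<ge> 0" "b > 0"
  shows "(1 + w) ^ M * exp (- (b * w\<^sup>2)) \<le> exp ((real M)\<^sup>2 / (4 * b))"
proof -
  have "(1 + w) ^ M \<le> exp w ^ M" using assms by (intro power_mono) auto
  also have "\<dots> = exp (real M * w)" by (simp add: exp_of_nat_mult)
  finally have "(1 + w) ^ M * exp (- (b * w\<^sup>2)) \<le> exp (real M * w) * exp (- (b * w\<^sup>2))"
    by (rule mult_right_mono) simp
  also have "\<dots> = exp (real M * w - b * w\<^sup>2)" by (simp flip: exp_add)
  also have "\<dots> \<le> exp ((real M)\<^sup>2 / (4 * b))"
  proof -
    have "0 \<le> b * (w - real M / (2 * b))\<^sup>2" using assms by simp
    also have "\<dots> = b * w\<^sup>2 - real M * w + (real M)\<^sup>2 / (4 * b)"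
      using assms by (simp add: power2_eq_square field_simps)
    finally show ?thesis by simp
  qed
  finally show ?thesis .
qed

text \<open>Half of the Gaussian exponent is kept as a kernel at doubled time, still of integral 1;
  the other half is free to absorb polynomial weights.\<close>

lemma heat_kernel_double:
  fixes z :: "real^'n"
  assumes "t > 0"
  shows "heat_kernel t z = 2 powr (real CARD('n) / 2) * heat_kernel (2 * t) z * exp (- ((norm z)\<^sup>2 / (8 * t)))"
proof -
  have "(4 * pi * (2 * t)) powr (- (real CARD('n) / 2)) = 2 powr (- (real CARD('n) / 2)) * (4 * pi * t) powr (- (real CARD('n) / 2))"
    using assms by (subst powr_mult[symmetric]) (auto simp: mult_ac)
  moreover have "exp (- ((norm z)\<^sup>2 / (4 * t))) = exp (- ((norm z)\<^sup>2 / (4 * (2 * t)))) * exp (- ((norm z)\<^sup>2 / (8 * t)))"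
    by (simp flip: exp_add)
  ultimately show ?thesis
    by (simp add: heat_kernel_def powr_minus_divide)
qed

text \<open>On the scale of the kernel each factor \<open>norm z\<close> is worth
  \<open>sqrt t\<close>. The restriction \<open>t \<le> 1\<close> gives
  \<open>norm z \<le> norm z / sqrt t\<close>, so the weight is a weight in the rescaled variable
  too.\<close>

lemma heat_kernel_weight_le:
  obtains C where "C > 0" "\<And>t (z :: real^'n). 0 < t \<Longrightarrow> t \<le> 1 \<Longrightarrow>
    norm z ^ l * (1 + norm z) ^ N * heat_kernel t z \<le> C * sqrt t ^ l * heat_kernel (2 * t) z"
proof -
  define E where "E = exp ((real (l + N))\<^sup>2 / (4 * (1 / 8)))"
  let ?D = "2 powr (real CARD('n) / 2)"
  have "norm z ^ l * (1 + norm z) ^ N * heat_kernel t z \<le> (E * ?D) * sqrt t ^ l * heat_kernel (2 * t) z"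
    if t: "0 < t" "t \<le> 1" for t and z :: "real^'n"
  proof -
    define w where "w = norm z / sqrt t"
    have w: "w \<ge> 0" "norm z = sqrt t * w" "(norm z)\<^sup>2 / (8 * t) = 1 / 8 * w\<^sup>2"
      using t by (auto simp: w_def power_divide)
    have "sqrt t * w \<le> 1 * w" using t w by (intro mult_right_mono) auto
    hence "norm z \<le> w" using w by simp
    have "norm z ^ l * (1 + norm z) ^ N \<le> (sqrt t ^ l * (1 + w) ^ l) * (1 + w) ^ N"
      using w t \<open>norm z \<le> w\<close> unfolding power_mult_distrib[symmetric]
      by (intro mult_mono power_mono) (auto intro!: mult_left_mono)
    hence "norm z ^ l * (1 + norm z) ^ N * exp (- ((norm z)\<^sup>2 / (8 * t)))
      \<le> sqrt t ^ l * ((1 + w) ^ (l + N) * exp (- (1 / 8 * w\<^sup>2)))"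
      unfolding w(3) by (simp add: power_add mult_right_mono)
    also have "\<dots> \<le> sqrt t ^ l * E" unfolding E_def using w t
      by (intro mult_left_mono weight_gauss_le) auto
    finally have "(norm z ^ l * (1 + norm z) ^ N * exp (- ((norm z)\<^sup>2 / (8 * t)))) * (?D * heat_kernel (2 * t) z)
      \<le> (sqrt t ^ l * E) * (?D * heat_kernel (2 * t) z)"
      by (rule mult_right_mono) (auto simp: heat_kernel_nonneg)
    thus ?thesis by (simp add: heat_kernel_double[OF t(1), of z] mult_ac)
  qed
  moreover have "E * ?D > 0" by (simp add: E_def)
  ultimately show ?thesis using that by blast
qed

subsection \<open>Smooth families built from exponentials\<close>

lemma gaussian_differentiable:
  fixes z :: "real^'n"
  shows "((\<lambda>z. complex_of_real (exp (- ((norm z)\<^sup>2 / (4 * t))))) has_derivative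
    (\<lambda>h. complex_of_real (exp (- ((norm z)\<^sup>2 / (4 * t))) * (- (z \<bullet> h) / (2 * t))))) (at z)"
proof -
  have "((\<lambda>z::real^'n. exp (- ((z \<bullet> z) / (4 * t)))) has_derivative
    (\<lambda>h. exp (- ((z \<bullet> z) / (4 * t))) * (- (z \<bullet> h) / (2 * t)))) (at z)"
    by (cases "t = 0") (auto intro!: derivative_eq_intros simp: inner_commute)
  thus ?thesis unfolding power2_norm_eq_inner by (rule has_derivative_of_real)
qed

text \<open>Each derivative of the Gaussian produces \<open>- z $ j / (2 * t)\<close>: the
  coordinate joins the coefficient a, and the power of \<open>1 / t\<close> stays outside, whence
  the exponents m. The class \<open>P\<close> of coefficients is left open because
  \<open>heat_kernel_away_family\<close> needs coefficients that vanish near 0.\<close>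

lemma gaussian_family:
  fixes P :: "(real^'n \<Rightarrow> complex) set" and c :: "real \<Rightarrow> real"
  assumes "a \<in> P" and Q: "plus_closed Q"
    and diff: "\<And>a. a \<in> P \<Longrightarrow> smooth a"
    and pd: "\<And>a j. a \<in> P \<Longrightarrow> pd j a \<in> P"
    and coord: "\<And>a j. a \<in> P \<Longrightarrow> (\<lambda>z. complex_of_real (- (z $ j) / 2) * a z) \<in> P"
    and bound: "\<And>a m. a \<in> P \<Longrightarrow>
      Q (\<lambda>t z. complex_of_real (c t * (1 / t) ^ m) * (complex_of_real (exp (- ((norm z)\<^sup>2 / (4 * t)))) * a z))"
  shows "smooth_family Q (\<lambda>t z. complex_of_real (c t) * (complex_of_real (exp (- ((norm z)\<^sup>2 / (4 * t)))) * a z))"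
proof (rule smooth_family_coinduct[OF _ Q])
  let ?F = "\<lambda>a m t z. complex_of_real (c t * (1 / t) ^ m) * (complex_of_real (exp (- ((norm z)\<^sup>2 / (4 * t)))) * a z)"
  let ?S = "{?F a m |a m. a \<in> P}"
  show "(\<lambda>t z. complex_of_real (c t) * (complex_of_real (exp (- ((norm z)\<^sup>2 / (4 * t)))) * a z)) \<in> ?S"
    using \<open>a \<in> P\<close> by (intro CollectI exI[of _ a] exI[of _ 0]) auto
  fix \<Phi> assume "\<Phi> \<in> ?S"
  then obtain a m where \<Phi>: "\<Phi> = ?F a m" and a: "a \<in> P" by blast
  have ad: "a differentiable (at z)" for z using diff[OF a] by (rule smooth_differentiable)
  have gd: "(\<lambda>z::real^'n. complex_of_real (exp (- ((norm z)\<^sup>2 / (4 * t))))) differentiable (at z)" for t z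
    using gaussian_differentiable by (rule differentiableI)
  show "\<Phi> t differentiable (at z)" for t z
    unfolding \<Phi> by (intro differentiable_mult ad gd differentiable_const)
  show "Q \<Phi>" unfolding \<Phi> using a by (rule bound)
  show "(\<lambda>t. pd j (\<Phi> t)) \<in> sum_closure ?S" for j
  proof -
    have "(\<lambda>t. pd j (\<Phi> t)) = (\<lambda>t z. ?F (pd j a) m t z + ?F (\<lambda>z. complex_of_real (- (z $ j) / 2) * a z) (Suc m) t z)"
    proof (intro ext)
      fix t z
      have "pd j (\<lambda>z::real^'n. complex_of_real (exp (- ((norm z)\<^sup>2 / (4 * t))))) z
        = complex_of_real (exp (- ((norm z)\<^sup>2 / (4 * t))) * (- (z $ j) / (2 * t)))"
        by (subst pd_eq[OF gaussian_differentiable]) (simp add: inner_axis)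
      thus "pd j (\<Phi> t) z = ?F (pd j a) m t z + ?F (\<lambda>z. complex_of_real (- (z $ j) / 2) * a z) (Suc m) t z"
        unfolding \<Phi> pd_cmult[OF differentiable_mult[OF gd ad]] pd_mult[OF gd ad]
        by (simp add: algebra_simps)
    qed
    moreover have "?F (pd j a) m \<in> ?S" using pd[OF a] by blast
    moreover have "?F (\<lambda>z. complex_of_real (- (z $ j) / 2) * a z) (Suc m) \<in> ?S"
      using coord[OF a, of j] by (intro CollectI exI[of _ "\<lambda>z. complex_of_real (- (z $ j) / 2) * a z"] exI[of _ "Suc m"] conjI refl)
    ultimately show ?thesis by (simp only:) (intro sum_closure.intros)
  qed
qed

lemma slow_smooth_bound:
  assumes "slow_smooth a"
  obtains C k where "C \<ge> 0" "\<And>x. cmod (a x) \<le> C * (1 + norm x) ^ k"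
proof -
  from smooth_familyD(2)[OF assms[unfolded slow_smooth_def]] obtain k C where
    C: "\<And>x. cmod (a x) \<le> C * (1 + norm x) ^ k" unfolding slow_def by auto
  have "cmod (a x) \<le> \<bar>C\<bar> * (1 + norm x) ^ k" for x
    by (rule order_trans[OF C mult_right_mono]) auto
  thus ?thesis by (intro that[of "\<bar>C\<bar>" k]) auto
qed

lemma schwartz_gaussian_mult:
  fixes a :: "real^'n \<Rightarrow> complex"
  assumes "slow_smooth a" "t > 0"
  shows "schwartz (\<lambda>z. complex_of_real (exp (- ((norm z)\<^sup>2 / (4 * t)))) * a z)"
proof -
  have "smooth_family (rapid {t} (\<lambda>_. 0))
    (\<lambda>t z. complex_of_real 1 * (complex_of_real (exp (- ((norm z)\<^sup>2 / (4 * t)))) * a z))"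
  proof (rule gaussian_family[where P = "Collect slow_smooth"])
    fix a :: "real^'n \<Rightarrow> complex" and m assume "a \<in> Collect slow_smooth"
    then obtain C l where C: "C \<ge> 0" "\<And>x. cmod (a x) \<le> C * (1 + norm x) ^ l"
      using slow_smooth_bound by blast
    show "rapid {t} (\<lambda>_. 0)
      (\<lambda>t z. complex_of_real (1 * (1 / t) ^ m) * (complex_of_real (exp (- ((norm z)\<^sup>2 / (4 * t)))) * a z))"
      unfolding rapid_def
    proof
      fix k
      define K where "K = (1 / t) ^ m * C * exp ((real (k + l))\<^sup>2 / (4 * (1 / (4 * t))))"
      have "(1 + norm z) ^ k * cmod (complex_of_real (1 * (1 / t) ^ m) *
          (complex_of_real (exp (- ((norm z)\<^sup>2 / (4 * t)))) * a z)) \<le> K" for z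
      proof -
        have "(1 + norm z) ^ k * cmod (complex_of_real (1 * (1 / t) ^ m) *
          (complex_of_real (exp (- ((norm z)\<^sup>2 / (4 * t)))) * a z))
          = (1 / t) ^ m * ((1 + norm z) ^ k * exp (- ((norm z)\<^sup>2 / (4 * t))) * cmod (a z))"
          using assms(2) by (simp add: norm_mult norm_divide norm_power mult_ac)
        also have "\<dots> \<le> (1 / t) ^ m * ((1 + norm z) ^ k * exp (- ((norm z)\<^sup>2 / (4 * t))) * (C * (1 + norm z) ^ l))"
          using assms(2) C by (intro mult_left_mono) auto
        also have "\<dots> = (1 / t) ^ m * C * ((1 + norm z) ^ (k + l) * exp (- (1 / (4 * t) * (norm z)\<^sup>2)))"
          by (simp add: power_add mult_ac)
        also have "\<dots> \<le> K" unfolding K_def using assms(2) C(1)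
          by (intro mult_left_mono weight_gauss_le) auto
        finally show ?thesis .
      qed
      thus "\<exists>C n. \<forall>i\<in>{t}. \<forall>x. (1 + norm x) ^ k * cmod (complex_of_real (1 * (1 / i) ^ m) *
          (complex_of_real (exp (- ((norm x)\<^sup>2 / (4 * i)))) * a x)) \<le> C * (1 + \<bar>0\<bar>) ^ n"
        by (intro exI[of _ K] exI[of _ 0]) auto
    qed
  next
    fix a :: "real^'n \<Rightarrow> complex" and j assume a: "a \<in> Collect slow_smooth"
    have "slow_smooth (\<lambda>z. (complex_of_real (-1/2) * complex_of_real (z $ j)) * a z)"
      using a by (intro slow_smooth_mult slow_smooth_coord slow_smooth_const) auto
    thus "(\<lambda>z. complex_of_real (- (z $ j) / 2) * a z) \<in> Collect slow_smooth" by simp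
  qed (use assms(1) in \<open>auto simp: rapid_plus_closed intro: slow_smooth_pd slow_smooth_smooth\<close>)
  from rapid_family_schwartz[OF this, of t] show ?thesis by simp
qed

lemma schwartz_exp_norm2:
  fixes a :: "real^'n \<Rightarrow> complex"
  assumes "slow_smooth a" "t > 0"
  shows "schwartz (\<lambda>z. complex_of_real (exp (- (t * (norm z)\<^sup>2))) * a z)"
  using schwartz_gaussian_mult[OF assms(1), of "1 / (4 * t)"] assms(2) by (simp add: mult.commute)

lemma slow_smooth_exp_norm2:
  assumes "t \<ge> 0" shows "slow_smooth (\<lambda>z :: real^'n. complex_of_real (exp (- (t * (norm z)\<^sup>2))))"
proof (cases "t = 0")
  case False
  thus ?thesis using schwartz_slow_smooth[OF schwartz_exp_norm2[OF slow_smooth_const[of 1], of t]] assms by simp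
qed (simp add: slow_smooth_const)

lemma schwartz_heat_kernel:
  assumes "t > 0" shows "schwartz (\<lambda>z :: real^'n. complex_of_real (heat_kernel t z))"
  using schwartz_cmult[OF schwartz_gaussian_mult[OF slow_smooth_const[of 1] assms],
    of "complex_of_real ((4 * pi * t) powr (- (real CARD('n) / 2)))"]
  by (simp add: heat_kernel_def)

lemma cis_lipschitz: "cmod (cis a - cis b) \<le> \<bar>a - b\<bar>"
proof -
  have "cis a - cis b = cis b * (iexp (a - b) - 1)"
    by (simp only: right_diff_distrib cis_conv_exp[symmetric] cis_mult) simp
  thus ?thesis using iexp_approx1[of "a - b" 0] by (simp add: norm_mult)
qed

lemma cis_inner_has_derivative:
  "((\<lambda>x. cis (x \<bullet> \<eta>)) has_derivative (\<lambda>h. \<i> * complex_of_real (h \<bullet> \<eta>) * cis (x \<bullet> \<eta>))) (at x)"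
proof -
  have "((\<lambda>x. cis (x \<bullet> \<eta>)) has_derivative (\<lambda>h. (h \<bullet> \<eta>) *\<^sub>R (\<i> * cis (x \<bullet> \<eta>)))) (at x)"
    by (rule has_derivative_compose[of "\<lambda>x. x \<bullet> \<eta>" "\<lambda>h. h \<bullet> \<eta>" x UNIV cis "\<lambda>s. s *\<^sub>R (\<i> * cis (x \<bullet> \<eta>))", unfolded o_def])
       (auto intro!: derivative_eq_intros simp: cis_conv_exp scaleR_conv_of_real)
  thus ?thesis by (simp add: scaleR_conv_of_real mult_ac)
qed

lemma slow_smooth_cis: "slow_smooth (\<lambda>x :: real^'n. cis (x \<bullet> \<eta>))"
proof -
  have "smooth_family (slow (UNIV :: unit set) (\<lambda>_. 0)) (\<lambda>_ (x :: real^'n). cis (x \<bullet> \<eta>))"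
  proof (rule smooth_family_coinduct[OF _ slow_plus_closed])
    let ?S = "{\<lambda>(_::unit) (x :: real^'n). c * cis (x \<bullet> \<eta>) |c. True}"
    show "(\<lambda>(_::unit) x. cis (x \<bullet> \<eta>)) \<in> ?S" by (intro CollectI exI[of _ 1]) auto
    fix \<Phi> assume "\<Phi> \<in> ?S"
    then obtain c where \<Phi>: "\<Phi> = (\<lambda>_ x. c * cis (x \<bullet> \<eta>))" by blast
    have d: "(\<lambda>x. cis (x \<bullet> \<eta>)) differentiable (at x)" for x :: "real^'n"
      using cis_inner_has_derivative by (rule differentiableI)
    show "\<Phi> i differentiable (at x)" for i x unfolding \<Phi> by (intro differentiable_mult d differentiable_const)
    show "slow UNIV (\<lambda>_. 0) \<Phi>" unfolding \<Phi> slow_def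
      by (intro exI[of _ 0] exI[of _ "cmod c"]) (auto simp: norm_mult)
    show "(\<lambda>i. pd j (\<Phi> i)) \<in> sum_closure ?S" for j
    proof (rule sum_closure.base, intro CollectI exI conjI TrueI)
      show "(\<lambda>i. pd j (\<Phi> i)) = (\<lambda>_ x. (c * (\<i> * complex_of_real (\<eta> $ j))) * cis (x \<bullet> \<eta>))"
        unfolding \<Phi> by (intro ext) (simp add: pd_cmult[OF d] pd_eq[OF cis_inner_has_derivative] inner_axis')
    qed
  qed
  thus ?thesis by (simp add: slow_smooth_def)
qed

section \<open>Affine substitutions, weighted Lipschitz bounds and integrals of derivatives\<close>

lemma pd_affine:
  fixes f :: "real^'n \<Rightarrow> complex"
  assumes "f differentiable (at (a + c *\<^sub>R x))"
  shows "(\<lambda>x. f (a + c *\<^sub>R x)) differentiable (at x)"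
    and "pd j (\<lambda>x. f (a + c *\<^sub>R x)) x = complex_of_real c * pd j f (a + c *\<^sub>R x)"
proof -
  let ?D = "frechet_derivative f (at (a + c *\<^sub>R x))"
  have D: "(f has_derivative ?D) (at (a + c *\<^sub>R x))" using assms by (simp add: frechet_derivative_works)
  have "((\<lambda>x. f (a + c *\<^sub>R x)) has_derivative (\<lambda>h. ?D (c *\<^sub>R h))) (at x)"
    by (rule has_derivative_compose[of "\<lambda>x. a + c *\<^sub>R x" "\<lambda>h. c *\<^sub>R h" x UNIV f ?D, unfolded o_def])
       (auto intro!: derivative_eq_intros D)
  note * = this
  show "(\<lambda>x. f (a + c *\<^sub>R x)) differentiable (at x)" using * by (rule differentiableI)
  show "pd j (\<lambda>x. f (a + c *\<^sub>R x)) x = complex_of_real c * pd j f (a + c *\<^sub>R x)"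
    using linear_scale[OF linear_frechet_derivative[OF assms], of c "axis j 1"]
    by (subst pd_eq[OF *]) (simp add: pd_def scaleR_conv_of_real)
qed

lemma partials_affine:
  fixes f :: "real^'n \<Rightarrow> complex"
  assumes "smooth f"
  shows "smooth (\<lambda>x. f (a + c *\<^sub>R x))"
    and "partials is (\<lambda>x. f (a + c *\<^sub>R x)) = (\<lambda>x. complex_of_real (c ^ length is) * partials is f (a + c *\<^sub>R x))"
proof -
  have D: "partials is f differentiable (at x)" for "is" x using assms by (simp add: smooth_def)
  have *: "partials is (\<lambda>x. f (a + c *\<^sub>R x)) = (\<lambda>x. complex_of_real (c ^ length is) * partials is f (a + c *\<^sub>R x))" for "is"
  proof (induction "is")
    case (Cons i "is")
    show ?case
    proof
      fix x
      have "partials (i # is) (\<lambda>x. f (a + c *\<^sub>R x)) x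
        = pd i (\<lambda>x. complex_of_real (c ^ length is) * partials is f (a + c *\<^sub>R x)) x"
        unfolding partials_Cons Cons.IH ..
      also have "\<dots> = complex_of_real (c ^ length is) * pd i (\<lambda>x. partials is f (a + c *\<^sub>R x)) x"
        by (rule pd_cmult) (rule pd_affine(1)[OF D])
      also have "pd i (\<lambda>x. partials is f (a + c *\<^sub>R x)) x = complex_of_real c * partials (i # is) f (a + c *\<^sub>R x)"
        unfolding partials_Cons by (rule pd_affine(2)[OF D])
      finally show "partials (i # is) (\<lambda>x. f (a + c *\<^sub>R x)) x
        = complex_of_real (c ^ length (i # is)) * partials (i # is) f (a + c *\<^sub>R x)" by simp
    qed
  qed simp
  thus "partials is (\<lambda>x. f (a + c *\<^sub>R x)) = (\<lambda>x. complex_of_real (c ^ length is) * partials is f (a + c *\<^sub>R x))" .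
  show "smooth (\<lambda>x. f (a + c *\<^sub>R x))"
    unfolding smooth_def
  proof (intro allI)
    fix "is" x
    have "(\<lambda>x. partials is f (a + c *\<^sub>R x)) differentiable (at x)" by (rule pd_affine(1)[OF D])
    thus "partials is (\<lambda>x. f (a + c *\<^sub>R x)) differentiable (at x)"
      unfolding * by (rule differentiable_mult[OF differentiable_const])
  qed
qed

lemma schwartz_affine:
  fixes f :: "real^'n \<Rightarrow> complex"
  assumes f: "schwartz f" and c: "c \<noteq> 0"
  shows "schwartz (\<lambda>x. f (a + c *\<^sub>R x))"
  unfolding schwartz_def partials_affine(2)[OF schwartz_smooth[OF f]]
proof (intro conjI allI)
  show "smooth (\<lambda>x. f (a + c *\<^sub>R x))" by (rule partials_affine(1)[OF schwartz_smooth[OF f]])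
  fix k "is"
  obtain C where C: "C \<ge> 0" "\<And>x. (1 + norm x) ^ k * cmod (partials is f x) \<le> C"
    using schwartz_weighted_bound[OF f] by metis
  define K where "K = (1 + norm a) / \<bar>c\<bar>"
  have K: "norm x \<le> K * (1 + norm (a + c *\<^sub>R x))" for x
  proof -
    have "\<bar>c\<bar> * norm x \<le> norm (a + c *\<^sub>R x) + norm a"
      using norm_triangle_ineq4[of "a + c *\<^sub>R x" a] by simp
    also have "\<dots> \<le> (1 + norm a) * (1 + norm (a + c *\<^sub>R x))" by (simp add: algebra_simps)
    finally show ?thesis using c by (simp add: K_def field_simps)
  qed
  have "norm x ^ k * cmod (complex_of_real (c ^ length is) * partials is f (a + c *\<^sub>R x))
    \<le> \<bar>c\<bar> ^ length is * K ^ k * C" for x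
  proof -
    have "norm x ^ k \<le> (K * (1 + norm (a + c *\<^sub>R x))) ^ k" by (intro power_mono K) auto
    hence "norm x ^ k * cmod (partials is f (a + c *\<^sub>R x))
      \<le> (K * (1 + norm (a + c *\<^sub>R x))) ^ k * cmod (partials is f (a + c *\<^sub>R x))"
      by (rule mult_right_mono) simp
    also have "\<dots> = K ^ k * ((1 + norm (a + c *\<^sub>R x)) ^ k * cmod (partials is f (a + c *\<^sub>R x)))"
      by (simp add: power_mult_distrib)
    also have "\<dots> \<le> K ^ k * C" by (intro mult_left_mono C) (auto simp: K_def)
    finally have "\<bar>c\<bar> ^ length is * (norm x ^ k * cmod (partials is f (a + c *\<^sub>R x))) \<le> \<bar>c\<bar> ^ length is * (K ^ k * C)"
      by (intro mult_left_mono) auto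
    thus ?thesis by (simp add: norm_mult norm_power mult_ac)
  qed
  thus "bounded (range (\<lambda>x. norm x ^ k * cmod (complex_of_real (c ^ length is) * partials is f (a + c *\<^sub>R x))))"
    by (auto simp: bounded_iff intro!: exI[of _ "\<bar>c\<bar> ^ length is * K ^ k * C"])
qed

lemma schwartz_reflect: "schwartz f \<Longrightarrow> schwartz (\<lambda>x. f (a - x))"
  using schwartz_affine[of f "-1" a] by simp

lemma partials_reflect:
  "smooth f \<Longrightarrow> partials is (\<lambda>x. f (a - x)) = (\<lambda>x. (-1) ^ length is * partials is f (a - x))"
  using partials_affine(2)[of f "is" a "-1"] by simp

text \<open>Moves a weight from one point to another at the price of the weight of their difference;
  this is behind all weighted estimates for translates and convolutions.\<close>

lemma weight_submult: "(1 + norm (x + y)) ^ N \<le> (1 + norm x) ^ N * (1 + norm y) ^ N"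
proof -
  have "1 + norm (x + y) \<le> (1 + norm x) * (1 + norm y)"
    using norm_triangle_ineq[of x y] mult_nonneg_nonneg[of "norm x" "norm y"]
    by (simp add: algebra_simps del: mult_nonneg_nonneg)
  hence "(1 + norm (x + y)) ^ N \<le> ((1 + norm x) * (1 + norm y)) ^ N" by (rule power_mono) auto
  thus ?thesis by (simp add: power_mult_distrib)
qed

text \<open>Mean value inequality along the segment from x to \<open>x + h\<close>; comparing the
  weight at a point of the segment with that at x costs the factor
  \<open>(1 + norm h) ^ N\<close>.\<close>

lemma schwartz_lipschitz:
  fixes \<psi> :: "real^'n \<Rightarrow> complex"
  assumes "schwartz \<psi>"
  obtains C where "C \<ge> 0" "\<And>x h. (1 + norm x) ^ N * cmod (\<psi> (x + h) - \<psi> x) \<le> C * norm h * (1 + norm h) ^ N"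
proof -
  have "\<forall>i. \<exists>C\<ge>0. \<forall>x. (1 + norm x) ^ N * cmod (partials [i] \<psi> x) \<le> C"
    using schwartz_weighted_bound[OF assms] by metis
  then obtain C where C: "\<And>i. C i \<ge> 0" "\<And>i x. (1 + norm x) ^ N * cmod (pd i \<psi> x) \<le> C i"
    by (auto simp: partials_Cons) metis
  define K where "K = (\<Sum>i\<in>UNIV. C i)"
  have bound: "(1 + norm x) ^ N * cmod (\<psi> (x + h) - \<psi> x) \<le> K * norm h * (1 + norm h) ^ N" for x h
  proof -
    let ?B = "K * (1 + norm h) ^ N / (1 + norm x) ^ N"
    have pos: "0 < (1 + norm y) ^ N" for y :: "real^'n"
      by (rule zero_less_power, rule add_pos_nonneg) auto
    have "cmod (\<psi> (x + h) - \<psi> x) \<le> ?B * norm (x + h - x)"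
    proof (rule differentiable_bound[of "closed_segment x (x + h)" \<psi> "\<lambda>y. frechet_derivative \<psi> (at y)" ?B "x + h" x])
      fix y assume y: "y \<in> closed_segment x (x + h)"
      show "(\<psi> has_derivative frechet_derivative \<psi> (at y)) (at y within closed_segment x (x + h))"
        by (rule has_derivative_at_withinI, rule frechet_derivative_works[THEN iffD1], rule schwartz_differentiable[OF assms])
      have "norm (x - y) \<le> norm h"
        using segment_bound1[OF y] by (simp add: norm_minus_commute)
      hence "(1 + norm x) ^ N \<le> (1 + norm h) ^ N * (1 + norm y) ^ N"
        using weight_submult[of "x - y" y N]
          mult_right_mono[OF power_mono[of "1 + norm (x - y)" "1 + norm h" N], of "(1 + norm y) ^ N"]
        by simp
      hence w: "1 / (1 + norm y) ^ N \<le> (1 + norm h) ^ N / (1 + norm x) ^ N"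
        using pos[of x] pos[of y] by (simp add: field_simps)
      show "onorm (frechet_derivative \<psi> (at y)) \<le> ?B"
      proof (rule onorm_le)
        fix k
        have "cmod (frechet_derivative \<psi> (at y) k) \<le> norm k * (\<Sum>i\<in>UNIV. cmod (pd i \<psi> y))"
          by (rule norm_frechet_le_sum_pd[OF schwartz_differentiable[OF assms]])
        also have "\<dots> \<le> norm k * (\<Sum>i\<in>UNIV. C i * (1 / (1 + norm y) ^ N))"
          using C(2)[of y] pos[of y] by (intro mult_left_mono sum_mono) (auto simp: field_simps)
        also have "\<dots> = norm k * (K * (1 / (1 + norm y) ^ N))" by (simp only: K_def sum_distrib_right)
        also have "\<dots> \<le> norm k * (K * ((1 + norm h) ^ N / (1 + norm x) ^ N))"
          using w C(1) by (intro mult_left_mono) (auto simp: K_def sum_nonneg)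
        finally show "cmod (frechet_derivative \<psi> (at y) k) \<le> ?B * norm k" by (simp add: mult_ac)
      qed
    qed auto
    thus ?thesis using pos[of x] by (simp add: field_simps)
  qed
  show ?thesis by (rule that[of K, OF _ bound]) (auto simp: K_def C sum_nonneg)
qed

text \<open>By translation invariance the integral of \<open>\<psi> (h + y)\<close> over y does not
  depend on h, so its derivative at \<open>h = 0\<close>, taken under the integral sign, vanishes.
  This supplies integration by parts.\<close>

lemma schwartz_integral_pd:
  fixes \<psi> :: "real^'n \<Rightarrow> complex"
  assumes "schwartz \<psi>"
  shows "(LINT x|lborel. pd j \<psi> x) = 0"
proof -
  let ?N = "2 * CARD('n)"
  have [measurable]: "\<psi> \<in> borel_measurable borel" by (rule schwartz_borel[OF assms])
  obtain C where C: "C \<ge> 0"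
    "\<And>x h. (1 + norm x) ^ ?N * cmod (\<psi> (x + h) - \<psi> x) \<le> C * norm h * (1 + norm h) ^ ?N"
    using schwartz_lipschitz[OF assms] by metis
  have "((\<lambda>h. LINT y|lborel. \<psi> (h + y)) has_derivative
      (\<lambda>h. LINT y|lborel. frechet_derivative \<psi> (at y) h)) (at 0)"
  proof (rule has_derivative_lebesgue_integral(1))
    show "integrable lborel (\<lambda>y. \<psi> (0 + h + y))" for h
      using lborel_translate(2)[of \<psi> h] schwartz_integrable[OF assms] by simp
    show "((\<lambda>h. \<psi> (h + y)) has_derivative frechet_derivative \<psi> (at y)) (at 0)" for y
    proof -
      have "(\<psi> has_derivative frechet_derivative \<psi> (at y)) (at (0 + y))"
        using frechet_derivative_works[THEN iffD1, OF schwartz_differentiable[OF assms, of y]] by simp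
      from has_derivative_compose[of "\<lambda>h. h + y" "\<lambda>h. h" 0 UNIV, OF _ this]
      show ?thesis by (rule meta_mp) (auto intro!: derivative_eq_intros)
    qed
    show "integrable lborel (\<lambda>y :: real^'n. (C * 2 ^ ?N) * (1 / (1 + norm y) ^ ?N))"
      by (intro integrable_mult_right decay_integrable)
    show "cmod (\<psi> (0 + h + y) - \<psi> (0 + y)) \<le> norm h * ((C * 2 ^ ?N) * (1 / (1 + norm y) ^ ?N))"
      if "norm h \<le> 1" for h y
    proof -
      have pos: "0 < (1 + norm y) ^ ?N" by (simp add: add_pos_nonneg)
      have "(1 + norm y) ^ ?N * cmod (\<psi> (y + h) - \<psi> y) \<le> C * norm h * (1 + norm h) ^ ?N" by (rule C)
      also have "\<dots> \<le> C * norm h * 2 ^ ?N"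
        using that C(1) by (intro mult_left_mono power_mono) auto
      finally show ?thesis using pos by (simp add: field_simps add.commute)
    qed
  qed
  moreover have "(\<lambda>h. LINT y|lborel. \<psi> (h + y)) = (\<lambda>h. LINT y|lborel. \<psi> y)"
    by (intro ext lborel_translate(1)) measurable
  ultimately have "((\<lambda>h::real^'n. LINT y|lborel. \<psi> y) has_derivative
      (\<lambda>h. LINT y|lborel. frechet_derivative \<psi> (at y) h)) (at 0)" by simp
  from has_derivative_unique[OF this has_derivative_const]
  have "(LINT y|lborel. frechet_derivative \<psi> (at y) (axis j 1)) = 0" by metis
  thus ?thesis by (simp add: pd_def)
qed

subsection \<open>The Fourier transform\<close>

lemma fourier_lborel:
  assumes [measurable]: "\<phi> \<in> borel_measurable borel"
  shows "fourier \<phi> \<xi> = (LINT x|lborel. cis (- (x \<bullet> \<xi>)) * \<phi> x)"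
  unfolding fourier_def by (rule lebesgue_integral_lborel) measurable

lemma slow_smooth_cis_minus: "slow_smooth (\<lambda>x :: real^'n. cis (- (x \<bullet> \<xi>)))"
  using slow_smooth_cis[of "- \<xi>"] by simp

lemma schwartz_cis_mult: "schwartz \<phi> \<Longrightarrow> schwartz (\<lambda>x. cis (- (x \<bullet> \<xi>)) * \<phi> x)"
  by (rule schwartz_slow_mult[OF slow_smooth_cis_minus])

lemma fourier_add:
  assumes "schwartz \<phi>" "schwartz \<psi>"
  shows "fourier (\<lambda>x. \<phi> x + \<psi> x) \<xi> = fourier \<phi> \<xi> + fourier \<psi> \<xi>"
  using assms schwartz_add[OF assms]
  by (simp add: fourier_lborel schwartz_borel distrib_left schwartz_integrable schwartz_cis_mult)

lemma fourier_cmult: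
  assumes "schwartz \<phi>"
  shows "fourier (\<lambda>x. c * \<phi> x) \<xi> = c * fourier \<phi> \<xi>"
  using schwartz_borel[OF assms] schwartz_borel[OF schwartz_cmult[OF assms]]
  by (simp add: fourier_lborel mult.left_commute)

lemma fourier_sum:
  assumes "\<And>j. j \<in> J \<Longrightarrow> schwartz (f j)"
  shows "fourier (\<lambda>x. \<Sum>j\<in>J. f j x) \<xi> = (\<Sum>j\<in>J. fourier (f j) \<xi>)"
  using assms
proof (induction J rule: infinite_finite_induct)
  case (insert j J)
  thus ?case by (simp add: fourier_add schwartz_sum)
qed (auto simp: fourier_def)

lemma fourier_norm_le:
  assumes "schwartz \<phi>" shows "cmod (fourier \<phi> \<xi>) \<le> (LINT x|lborel. cmod (\<phi> x))"
  unfolding fourier_lborel[OF schwartz_borel[OF assms]]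
  by (rule order_trans[OF integral_norm_bound]) (simp add: norm_mult)

lemma fourier_has_derivative:
  fixes \<phi> :: "real^'n \<Rightarrow> complex"
  assumes "schwartz \<phi>"
  shows "(fourier \<phi> has_derivative
    (\<lambda>h. LINT x|lborel. - \<i> * complex_of_real (x \<bullet> h) * cis (- (x \<bullet> \<xi>)) * \<phi> x)) (at \<xi>)"
  unfolding fourier_lborel[OF schwartz_borel[OF assms], abs_def]
proof (rule has_derivative_lebesgue_integral(1))
  show "integrable lborel (\<lambda>x. cis (- (x \<bullet> (\<xi> + h))) * \<phi> x)" for h
    by (intro schwartz_integrable schwartz_cis_mult assms)
  show "((\<lambda>\<xi>. cis (- (x \<bullet> \<xi>)) * \<phi> x) has_derivative (\<lambda>h. - \<i> * complex_of_real (x \<bullet> h) * cis (- (x \<bullet> \<xi>)) * \<phi> x)) (at \<xi>)"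
    for x
    using has_derivative_mult_left[OF cis_inner_has_derivative[of "-x" \<xi>], of "\<phi> x"]
    by (simp add: inner_commute mult_ac)
  show "integrable lborel (\<lambda>x. (1 + norm x) ^ 1 * cmod (\<phi> x))"
    by (rule schwartz_weight_integrable[OF assms])
  fix h x :: "real^'n"
  have "cmod (cis (- (x \<bullet> (\<xi> + h))) - cis (- (x \<bullet> \<xi>))) \<le> \<bar>x \<bullet> h\<bar>"
    by (rule order_trans[OF cis_lipschitz]) (simp add: inner_add_right)
  also have "\<dots> \<le> norm x * norm h" by (rule Cauchy_Schwarz_ineq2)
  also have "\<dots> \<le> norm h * (1 + norm x)" by (simp add: algebra_simps)
  finally have "cmod (cis (- (x \<bullet> (\<xi> + h))) - cis (- (x \<bullet> \<xi>))) * cmod (\<phi> x) \<le> norm h * (1 + norm x) * cmod (\<phi> x)"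
    by (rule mult_right_mono) simp
  thus "cmod (cis (- (x \<bullet> (\<xi> + h))) * \<phi> x - cis (- (x \<bullet> \<xi>)) * \<phi> x) \<le> norm h * ((1 + norm x) ^ 1 * cmod (\<phi> x))"
    by (simp add: mult_ac norm_mult left_diff_distrib[symmetric] del: left_diff_distrib)
       (simp add: mult_ac norm_mult flip: right_diff_distrib)
qed

lemma pd_fourier:
  assumes "schwartz \<phi>"
  shows "pd j (fourier \<phi>) = fourier (\<lambda>x. - \<i> * complex_of_real (x $ j) * \<phi> x)"
proof
  fix \<xi>
  have [measurable]: "\<phi> \<in> borel_measurable borel" by (rule schwartz_borel[OF assms])
  show "pd j (fourier \<phi>) \<xi> = fourier (\<lambda>x. - \<i> * complex_of_real (x $ j) * \<phi> x) \<xi>"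
    by (subst pd_eq[OF fourier_has_derivative[OF assms]], subst fourier_lborel)
       (auto simp: inner_axis mult_ac)
qed

lemma schwartz_coord_mult: "schwartz \<phi> \<Longrightarrow> schwartz (\<lambda>x. complex_of_real (x $ j) * \<phi> x)"
  by (rule schwartz_slow_mult[OF slow_smooth_coord])

text \<open>Integration by parts: the derivative of
  \<open>cis (- (x \<bullet> \<xi>)) * \<phi> x\<close> has integral 0, and the product rule
  separates the two terms.\<close>

lemma fourier_pd:
  assumes "schwartz \<phi>"
  shows "fourier (pd j \<phi>) \<xi> = \<i> * complex_of_real (\<xi> $ j) * fourier \<phi> \<xi>"
proof -
  have "pd j (\<lambda>x. cis (- (x \<bullet> \<xi>)) * \<phi> x) x
    = cis (- (x \<bullet> \<xi>)) * pd j \<phi> x - (\<i> * complex_of_real (\<xi> $ j)) * (cis (- (x \<bullet> \<xi>)) * \<phi> x)" for x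
  proof -
    have "pd j (\<lambda>x. cis (- (x \<bullet> \<xi>))) x = - \<i> * complex_of_real (\<xi> $ j) * cis (- (x \<bullet> \<xi>))"
      using pd_eq[OF cis_inner_has_derivative[of "-\<xi>" x], of j] by (simp add: inner_axis')
    thus ?thesis
      using pd_mult[OF smooth_differentiable[OF slow_smooth_smooth[OF slow_smooth_cis_minus]]
          schwartz_differentiable[OF assms]]
      by (simp add: algebra_simps)
  qed
  hence "0 = (LINT x|lborel. cis (- (x \<bullet> \<xi>)) * pd j \<phi> x - (\<i> * complex_of_real (\<xi> $ j)) * (cis (- (x \<bullet> \<xi>)) * \<phi> x))"
    using schwartz_integral_pd[OF schwartz_cis_mult[OF assms], of j \<xi>] by simp
  also have "\<dots> = (LINT x|lborel. cis (- (x \<bullet> \<xi>)) * pd j \<phi> x)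
      - (LINT x|lborel. (\<i> * complex_of_real (\<xi> $ j)) * (cis (- (x \<bullet> \<xi>)) * \<phi> x))"
    by (intro Bochner_Integration.integral_diff integrable_mult_right schwartz_integrable schwartz_cis_mult schwartz_pd assms)
  also have "\<dots> = fourier (pd j \<phi>) \<xi> - (\<i> * complex_of_real (\<xi> $ j)) * fourier \<phi> \<xi>"
    unfolding fourier_lborel[OF schwartz_borel[OF assms]] fourier_lborel[OF schwartz_borel[OF schwartz_pd[OF assms]]]
    by (subst integral_mult_right_zero) simp
  finally show ?thesis by simp
qed

lemma fourier_laplacian:
  assumes "schwartz \<phi>"
  shows "schwartz (\<lambda>x. \<Sum>j\<in>UNIV. pd j (pd j \<phi>) x)"
    and "fourier (\<lambda>x. \<Sum>j\<in>UNIV. pd j (pd j \<phi>) x) \<xi> = - complex_of_real ((norm \<xi>)\<^sup>2) * fourier \<phi> \<xi>"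
proof -
  show "schwartz (\<lambda>x. \<Sum>j\<in>UNIV. pd j (pd j \<phi>) x)" by (intro schwartz_sum schwartz_pd assms)
  show "fourier (\<lambda>x. \<Sum>j\<in>UNIV. pd j (pd j \<phi>) x) \<xi> = - complex_of_real ((norm \<xi>)\<^sup>2) * fourier \<phi> \<xi>"
  proof -
    have "fourier (pd j (pd j \<phi>)) \<xi> = - complex_of_real ((\<xi> $ j)\<^sup>2) * fourier \<phi> \<xi>" for j
      unfolding fourier_pd[OF schwartz_pd[OF assms]] fourier_pd[OF assms]
      by (simp add: complex_eq_iff power2_eq_square algebra_simps)
    thus ?thesis
      unfolding fourier_sum[OF schwartz_pd[OF schwartz_pd[OF assms]]]
      by (simp add: norm_cart_sum sum_distrib_right sum_negf)
  qed
qed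

text \<open>A factor \<open>1 + (norm \<xi>)\<^sup>2\<close> on the Fourier side amounts to
  replacing \<phi> by \<phi> - \<Delta>\<phi>, again a Schwartz function; decay is gained one factor
  at a time from the trivial L1 bound.\<close>

lemma fourier_weight_bound:
  assumes "schwartz \<phi>"
  shows "\<exists>C. \<forall>\<xi>. (1 + (norm \<xi>)\<^sup>2) ^ k * cmod (fourier \<phi> \<xi>) \<le> C"
  using assms
proof (induction k arbitrary: \<phi>)
  case 0
  thus ?case using fourier_norm_le by auto
next
  case (Suc k)
  define \<psi> where "\<psi> = (\<lambda>x. \<phi> x + (-1) * (\<Sum>j\<in>UNIV. pd j (pd j \<phi>) x))"
  have "schwartz \<psi>" unfolding \<psi>_def by (intro schwartz_add schwartz_cmult fourier_laplacian Suc.prems)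
  then obtain C where C: "\<And>\<xi>. (1 + (norm \<xi>)\<^sup>2) ^ k * cmod (fourier \<psi> \<xi>) \<le> C" using Suc.IH by blast
  have "fourier \<psi> \<xi> = complex_of_real (1 + (norm \<xi>)\<^sup>2) * fourier \<phi> \<xi>" for \<xi>
    unfolding \<psi>_def
    by (subst fourier_add, (intro schwartz_cmult fourier_laplacian Suc.prems)+,
        subst fourier_cmult, (intro fourier_laplacian Suc.prems)+, subst fourier_laplacian(2), rule Suc.prems)
       (simp add: algebra_simps)
  hence "cmod (fourier \<psi> \<xi>) = (1 + (norm \<xi>)\<^sup>2) * cmod (fourier \<phi> \<xi>)" for \<xi>
    by (simp only: norm_mult norm_of_real) simp
  thus ?case using C by (intro exI[of _ C]) (auto simp: mult_ac)
qed

text \<open>A derivative of a transform is the transform of a coordinate multiple, so the transforms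
  of Schwartz functions are closed under \<open>pd\<close>, and coinduction reduces the claim to the
  decay of an undifferentiated transform.\<close>

lemma schwartz_fourier:
  fixes \<phi> :: "real^'n \<Rightarrow> complex"
  assumes "schwartz \<phi>"
  shows "schwartz (fourier \<phi>)"
proof -
  have "smooth_family (rapid (UNIV :: unit set) (\<lambda>_. 0)) (\<lambda>_. fourier \<phi>)"
  proof (rule smooth_family_coinduct[OF _ rapid_plus_closed])
    let ?S = "{(\<lambda>_::unit. fourier \<phi>) |\<phi> :: real^'n \<Rightarrow> complex. schwartz \<phi>}"
    show "(\<lambda>_. fourier \<phi>) \<in> ?S" using assms by blast
    fix \<Phi> assume "\<Phi> \<in> ?S"
    then obtain \<phi> where \<Phi>: "\<Phi> = (\<lambda>_. fourier \<phi>)" and \<phi>: "schwartz \<phi>" by blast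
    show "\<Phi> i differentiable (at x)" for i x
      unfolding \<Phi> using fourier_has_derivative[OF \<phi>] by (rule differentiableI)
    show "rapid UNIV (\<lambda>_. 0) \<Phi>" unfolding rapid_def
    proof
      fix k
      obtain C where C: "\<And>\<xi>. (1 + (norm \<xi>)\<^sup>2) ^ k * cmod (fourier \<phi> \<xi>) \<le> C"
        using fourier_weight_bound[OF \<phi>] by blast
      have "(1 + norm \<xi>) ^ k * cmod (fourier \<phi> \<xi>) \<le> 2 ^ k * C" for \<xi>
      proof -
        have "1 + norm \<xi> \<le> 2 * (1 + (norm \<xi>)\<^sup>2)"
        proof -
          have "0 \<le> (norm \<xi> - 1/2)\<^sup>2 + (norm \<xi>)\<^sup>2 + 3/4" by simp
          also have "\<dots> = 2 * (1 + (norm \<xi>)\<^sup>2) - (1 + norm \<xi>)"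
            by (simp add: power2_eq_square algebra_simps)
          finally show ?thesis by simp
        qed
        hence "(1 + norm \<xi>) ^ k \<le> (2 * (1 + (norm \<xi>)\<^sup>2)) ^ k" by (intro power_mono) auto
        hence "(1 + norm \<xi>) ^ k * cmod (fourier \<phi> \<xi>) \<le> 2 ^ k * ((1 + (norm \<xi>)\<^sup>2) ^ k * cmod (fourier \<phi> \<xi>))"
          unfolding power_mult_distrib mult.assoc[symmetric] by (rule mult_right_mono) simp
        also have "\<dots> \<le> 2 ^ k * C" by (intro mult_left_mono C) auto
        finally show ?thesis .
      qed
      thus "\<exists>C m. \<forall>i\<in>UNIV. \<forall>x. (1 + norm x) ^ k * cmod (\<Phi> i x) \<le> C * (1 + \<bar>0\<bar>) ^ m"
        unfolding \<Phi> by auto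
    qed
    show "(\<lambda>i. pd j (\<Phi> i)) \<in> sum_closure ?S" for j
    proof (rule sum_closure.base, intro CollectI exI conjI)
      show "(\<lambda>i. pd j (\<Phi> i)) = (\<lambda>_. fourier (\<lambda>x. - \<i> * (complex_of_real (x $ j) * \<phi> x)))"
        unfolding \<Phi> pd_fourier[OF \<phi>] by (simp add: mult.assoc)
      show "schwartz (\<lambda>x. - \<i> * (complex_of_real (x $ j) * \<phi> x))"
        by (intro schwartz_cmult schwartz_coord_mult \<phi>)
    qed
  qed
  thus ?thesis by (simp add: schwartz_iff_family)
qed

definition conv :: "(real^'n \<Rightarrow> real) \<Rightarrow> (real^'n \<Rightarrow> complex) \<Rightarrow> real^'n \<Rightarrow> complex" where
  "conv k \<psi> x = (LINT z|lborel. complex_of_real (k z) * \<psi> (x - z))"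

text \<open>After Fubini the kernel meets only the character \<open>cis (z \<bullet> \<xi>)\<close>,
  so \<open>K\<close> is its transform with the sign opposite to that of \<open>fourier\<close>; the
  heat and Laplace kernels to which this is applied are even.\<close>

lemma conv_fourier:
  fixes \<phi> :: "real^'n \<Rightarrow> complex"
  assumes k: "integrable lborel k" and \<phi>: "schwartz \<phi>"
    and K: "\<And>\<xi>. (LINT z|lborel. complex_of_real (k z) * cis (z \<bullet> \<xi>)) = K \<xi>"
    and K\<phi>: "(\<lambda>\<xi>. K \<xi> * \<phi> \<xi>) \<in> borel_measurable borel"
  shows "conv k (fourier \<phi>) = fourier (\<lambda>\<xi>. K \<xi> * \<phi> \<xi>)"
proof
  fix x
  have [measurable]: "\<phi> \<in> borel_measurable borel" "k \<in> borel_measurable borel"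
    using schwartz_borel[OF \<phi>] k by auto
  have "conv k (fourier \<phi>) x
    = (LINT z|lborel. LINT \<xi>|lborel. complex_of_real (k z) * (cis (- (\<xi> \<bullet> (x - z))) * \<phi> \<xi>))"
    by (simp add: conv_def fourier_lborel)
  also have "\<dots> = (LINT \<xi>|lborel. LINT z|lborel. complex_of_real (k z) * (cis (- (\<xi> \<bullet> (x - z))) * \<phi> \<xi>))"
  proof (rule fubini_dominated(1))
    show "integrable lborel (\<lambda>z. \<bar>k z\<bar>)" "integrable lborel (\<lambda>\<xi>. cmod (\<phi> \<xi>))"
      using k schwartz_integrable[OF \<phi>] by auto
  qed (auto simp: norm_mult)
  also have "\<dots> = (LINT \<xi>|lborel. cis (- (\<xi> \<bullet> x)) * (K \<xi> * \<phi> \<xi>))"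
  proof (rule Bochner_Integration.integral_cong[OF refl])
    fix \<xi>
    have "(LINT z|lborel. complex_of_real (k z) * (cis (- (\<xi> \<bullet> (x - z))) * \<phi> \<xi>))
      = (LINT z|lborel. (cis (- (\<xi> \<bullet> x)) * \<phi> \<xi>) * (complex_of_real (k z) * cis (z \<bullet> \<xi>)))"
    proof (rule Bochner_Integration.integral_cong[OF refl])
      fix z
      have "cis (- (\<xi> \<bullet> (x - z))) = cis (- (\<xi> \<bullet> x)) * cis (z \<bullet> \<xi>)"
        by (simp add: cis_mult inner_diff_right inner_commute)
      thus "complex_of_real (k z) * (cis (- (\<xi> \<bullet> (x - z))) * \<phi> \<xi>)
        = (cis (- (\<xi> \<bullet> x)) * \<phi> \<xi>) * (complex_of_real (k z) * cis (z \<bullet> \<xi>))" by (simp add: mult_ac)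
    qed
    also have "\<dots> = (cis (- (\<xi> \<bullet> x)) * \<phi> \<xi>) * K \<xi>"
      by (subst integral_mult_right_zero) (simp only: K)
    finally show "(LINT z|lborel. complex_of_real (k z) * (cis (- (\<xi> \<bullet> (x - z))) * \<phi> \<xi>)) = cis (- (\<xi> \<bullet> x)) * (K \<xi> * \<phi> \<xi>)"
      by (simp only: mult_ac)
  qed
  also have "\<dots> = fourier (\<lambda>\<xi>. K \<xi> * \<phi> \<xi>) x" using fourier_lborel[OF K\<phi>] by simp
  finally show "conv k (fourier \<phi>) x = fourier (\<lambda>\<xi>. K \<xi> * \<phi> \<xi>) x" .
qed

lemma conv_L1_le:
  fixes \<psi> :: "real^'n \<Rightarrow> complex"
  assumes k: "integrable lborel k" and \<psi>: "integrable lborel \<psi>"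
  shows "(LINT x|lborel. cmod (conv k \<psi> x)) \<le> (LINT z|lborel. \<bar>k z\<bar>) * (LINT x|lborel. cmod (\<psi> x))"
proof -
  have [measurable]: "\<psi> \<in> borel_measurable borel" "k \<in> borel_measurable borel" using k \<psi> by auto
  have "ennreal (LINT x|lborel. cmod (conv k \<psi> x)) \<le> (\<integral>\<^sup>+x. cmod (conv k \<psi> x) \<partial>lborel)"
    by (rule order_trans[OF _ order_refl], subst integral_eq_nn_integral)
       (auto simp: conv_def[abs_def] ennreal_enn2real_if)
  also have "\<dots> \<le> (\<integral>\<^sup>+x. (\<integral>\<^sup>+z. ennreal \<bar>k z\<bar> * ennreal (cmod (\<psi> (x - z))) \<partial>lborel) \<partial>lborel)"
  proof (rule nn_integral_mono)
    fix x :: "real^'n"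
    show "ennreal (cmod (conv k \<psi> x)) \<le> (\<integral>\<^sup>+z. ennreal \<bar>k z\<bar> * ennreal (cmod (\<psi> (x - z))) \<partial>lborel)"
    \<comment> \<open>Where the product is not integrable the Bochner integral is 0 by convention,
      and the estimate is trivial.\<close>
    proof (cases "integrable lborel (\<lambda>z. complex_of_real (k z) * \<psi> (x - z))")
      case True
      have "ennreal (cmod (conv k \<psi> x)) \<le> (\<integral>\<^sup>+z. norm (complex_of_real (k z) * \<psi> (x - z)) \<partial>lborel)"
        unfolding conv_def using integral_norm_bound_ennreal[OF True] by simp
      thus ?thesis by (simp add: norm_mult ennreal_mult)
    qed (simp add: conv_def not_integrable_integral_eq)
  qed
  also have "\<dots> = (\<integral>\<^sup>+z. (\<integral>\<^sup>+x. ennreal \<bar>k z\<bar> * ennreal (cmod (\<psi> (x - z))) \<partial>lborel) \<partial>lborel)"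
    by (rule lborel_pair.Fubini'[symmetric]) measurable
  also have "\<dots> = (\<integral>\<^sup>+z. ennreal \<bar>k z\<bar> * (\<integral>\<^sup>+x. ennreal (cmod (\<psi> x)) \<partial>lborel) \<partial>lborel)"
  proof (rule nn_integral_cong)
    fix z :: "real^'n"
    have d: "distr lborel borel (\<lambda>x. (-z) + x) = lborel" using lborel_affine_sign[of 1 "-z"] by simp
    have "(\<integral>\<^sup>+x. ennreal (cmod (\<psi> x)) \<partial>lborel) = (\<integral>\<^sup>+x. ennreal (cmod (\<psi> (x - z))) \<partial>lborel)"
      by (subst d[symmetric], subst nn_integral_distr) auto
    thus "(\<integral>\<^sup>+x. ennreal \<bar>k z\<bar> * ennreal (cmod (\<psi> (x - z))) \<partial>lborel)
      = ennreal \<bar>k z\<bar> * (\<integral>\<^sup>+x. ennreal (cmod (\<psi> x)) \<partial>lborel)" by (simp add: nn_integral_cmult)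
  qed
  also have "\<dots> = ennreal ((LINT z|lborel. \<bar>k z\<bar>) * (LINT x|lborel. cmod (\<psi> x)))"
    using k \<psi> by (simp add: nn_integral_multc nn_integral_eq_integral ennreal_mult)
  finally show ?thesis by (subst (asm) ennreal_le_iff) auto
qed

lemma heat_conv_fourier:
  assumes "t > 0" "schwartz \<phi>"
  shows "conv (heat_kernel t) (fourier \<phi>) = fourier (\<lambda>\<xi>. complex_of_real (exp (- (t * (norm \<xi>)\<^sup>2))) * \<phi> \<xi>)"
  by (rule conv_fourier[OF heat_kernel_integrable[OF assms(1)] assms(2) heat_kernel_fourier(2)[OF assms(1)]
      schwartz_borel[OF schwartz_slow_mult[OF slow_smooth_exp_norm2 assms(2)]]])
     (use assms(1) in auto)

subsection \<open>Convolution of Schwartz functions with the heat kernel\<close>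

lemma schwartz_bounded:
  assumes "schwartz \<psi>"
  obtains C where "C \<ge> 0" "\<And>x. cmod (\<psi> x) \<le> C"
  using schwartz_weighted_bound[OF assms, of 0 "[]"] by auto

lemma conv_integrable:
  fixes \<psi> :: "real^'n \<Rightarrow> complex"
  assumes k: "integrable lborel k" and \<psi>: "schwartz \<psi>"
  shows "integrable lborel (\<lambda>z. complex_of_real (k z) * \<psi> (x - z))"
proof -
  obtain C where C: "C \<ge> 0" "\<And>x. cmod (\<psi> x) \<le> C" using schwartz_bounded[OF \<psi>] by metis
  have [measurable]: "\<psi> \<in> borel_measurable borel" "k \<in> borel_measurable borel"
    using schwartz_borel[OF \<psi>] k by auto
  show ?thesis
  proof (rule Bochner_Integration.integrable_bound[of _ "\<lambda>z. \<bar>k z\<bar> * C"])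
    show "integrable lborel (\<lambda>z. \<bar>k z\<bar> * C)" using k by auto
  qed (auto simp: norm_mult abs_mult C intro!: mult_left_mono)
qed

lemma conv_has_derivative:
  fixes \<psi> :: "real^'n \<Rightarrow> complex"
  assumes k: "integrable lborel k" and \<psi>: "schwartz \<psi>"
  shows "(conv k \<psi> has_derivative
    (\<lambda>h. LINT z|lborel. complex_of_real (k z) * frechet_derivative \<psi> (at (x - z)) h)) (at x)"
proof -
  obtain C where C: "C \<ge> 0" "\<And>x h. (1 + norm x) ^ 0 * cmod (\<psi> (x + h) - \<psi> x) \<le> C * norm h * (1 + norm h) ^ 0"
    using schwartz_lipschitz[OF \<psi>] by metis
  show ?thesis unfolding conv_def[abs_def]
  proof (rule has_derivative_lebesgue_integral(1))
  show "integrable lborel (\<lambda>z. complex_of_real (k z) * \<psi> (x + h - z))" for h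
    by (rule conv_integrable[OF k \<psi>])
  show "((\<lambda>x. complex_of_real (k z) * \<psi> (x - z)) has_derivative
      (\<lambda>h. complex_of_real (k z) * frechet_derivative \<psi> (at (x - z)) h)) (at x)" for z
  proof (rule has_derivative_mult_right)
    have "(\<psi> has_derivative frechet_derivative \<psi> (at (x - z))) (at (x - z))"
      by (rule frechet_derivative_works[THEN iffD1], rule schwartz_differentiable[OF \<psi>])
    from has_derivative_compose[of "\<lambda>x. x - z" "\<lambda>h. h" x UNIV, OF _ this]
    show "((\<lambda>x. \<psi> (x - z)) has_derivative frechet_derivative \<psi> (at (x - z))) (at x)"
      by (rule meta_mp) (auto intro!: derivative_eq_intros)
  qed
  show "integrable lborel (\<lambda>z. C * \<bar>k z\<bar>)" using k by auto
  fix h z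
  have "cmod (\<psi> (x - z + h) - \<psi> (x - z)) \<le> C * norm h" using C(2)[of "x - z" h] by simp
  hence "\<bar>k z\<bar> * cmod (\<psi> (x - z + h) - \<psi> (x - z)) \<le> \<bar>k z\<bar> * (C * norm h)" by (rule mult_left_mono) simp
  moreover have "complex_of_real (k z) * \<psi> (x + h - z) - complex_of_real (k z) * \<psi> (x - z)
    = complex_of_real (k z) * (\<psi> (x - z + h) - \<psi> (x - z))"
    by (simp add: right_diff_distrib algebra_simps)
  ultimately show "cmod (complex_of_real (k z) * \<psi> (x + h - z) - complex_of_real (k z) * \<psi> (x - z)) \<le> norm h * (C * \<bar>k z\<bar>)"
    by (simp add: norm_mult mult_ac)
  qed
qed

lemma pd_conv:
  assumes k: "integrable lborel k" and \<psi>: "schwartz \<psi>"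
  shows "pd j (conv k \<psi>) = conv k (pd j \<psi>)"
proof
  fix x
  show "pd j (conv k \<psi>) x = conv k (pd j \<psi>) x"
    by (subst pd_eq[OF conv_has_derivative[OF k \<psi>]]) (simp add: conv_def pd_def)
qed

lemma partials_conv:
  assumes k: "integrable lborel k" and \<psi>: "schwartz \<psi>"
  shows "partials is (conv k \<psi>) = conv k (partials is \<psi>)"
  using \<psi>
proof (induction "is" arbitrary: \<psi> rule: rev_induct)
  case (snoc i "is")
  show ?case unfolding partials_snoc pd_conv[OF k snoc.prems] by (rule snoc.IH[OF schwartz_pd[OF snoc.prems]])
qed simp

lemma heat_weight_integral:
  obtains C where "C > 0" "\<And>t. 0 < t \<Longrightarrow> t \<le> 1 \<Longrightarrow>
      integrable lborel (\<lambda>z :: real^'n. norm z ^ l * (1 + norm z) ^ N * heat_kernel t z)"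
    "\<And>t. 0 < t \<Longrightarrow> t \<le> 1 \<Longrightarrow>
      (LINT z|lborel. norm (z :: real^'n) ^ l * (1 + norm z) ^ N * heat_kernel t z) \<le> C * sqrt t ^ l"
proof -
  obtain C where C: "C > 0" "\<And>t (z :: real^'n). 0 < t \<Longrightarrow> t \<le> 1 \<Longrightarrow>
    norm z ^ l * (1 + norm z) ^ N * heat_kernel t z \<le> C * sqrt t ^ l * heat_kernel (2 * t) z"
    using heat_kernel_weight_le by metis
  have int: "integrable lborel (\<lambda>z :: real^'n. norm z ^ l * (1 + norm z) ^ N * heat_kernel t z)"
    if t: "0 < t" "t \<le> 1" for t
  proof (rule Bochner_Integration.integrable_bound)
    show "integrable lborel (\<lambda>z :: real^'n. C * sqrt t ^ l * heat_kernel (2 * t) z)"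
      using t by (intro integrable_mult_right heat_kernel_integrable) auto
    show "AE z::real^'n in lborel. norm (norm z ^ l * (1 + norm z) ^ N * heat_kernel t z)
      \<le> norm (C * sqrt t ^ l * heat_kernel (2 * t) z)"
    proof (rule AE_I2)
      fix z :: "real^'n"
      have "C * sqrt t ^ l * heat_kernel (2 * t) z \<ge> 0" using C(1) t by (simp add: heat_kernel_nonneg)
      with C(2)[OF t, of z] show "norm (norm z ^ l * (1 + norm z) ^ N * heat_kernel t z)
        \<le> norm (C * sqrt t ^ l * heat_kernel (2 * t) z)"
        by (simp add: heat_kernel_nonneg)
    qed
  qed measurable
  moreover have "(LINT z|lborel. norm (z :: real^'n) ^ l * (1 + norm z) ^ N * heat_kernel t z) \<le> C * sqrt t ^ l"
    if t: "0 < t" "t \<le> 1" for t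
  proof -
    have "(LINT z|lborel. norm (z :: real^'n) ^ l * (1 + norm z) ^ N * heat_kernel t z)
      \<le> (LINT z :: real^'n|lborel. C * sqrt t ^ l * heat_kernel (2 * t) z)"
      by (intro integral_mono int integrable_mult_right heat_kernel_integrable C t) (use t in auto)
    thus ?thesis using t by (simp add: heat_kernel_integral)
  qed
  ultimately show ?thesis using that C(1) by blast
qed

text \<open>The hypothesis is a bound \<open>B\<close> for a single function instead of a seminorm,
  so that it can be applied to each partial derivative separately; these commute with the
  convolution.\<close>

lemma heat_conv_weighted_bound:
  obtains C where "C > 0" "\<And>t \<phi> (x :: real^'n) B. 0 < t \<Longrightarrow> t \<le> 1 \<Longrightarrow> schwartz \<phi> \<Longrightarrow>
    (\<And>y. (1 + norm y) ^ N * cmod (\<phi> y) \<le> B) \<Longrightarrow> (1 + norm x) ^ N * cmod (conv (heat_kernel t) \<phi> x) \<le> C * B"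
proof -
  obtain C where C: "C > 0" "\<And>t. 0 < t \<Longrightarrow> t \<le> 1 \<Longrightarrow>
      integrable lborel (\<lambda>z :: real^'n. norm z ^ 0 * (1 + norm z) ^ N * heat_kernel t z)"
    "\<And>t. 0 < t \<Longrightarrow> t \<le> 1 \<Longrightarrow>
      (LINT z|lborel. norm (z :: real^'n) ^ 0 * (1 + norm z) ^ N * heat_kernel t z) \<le> C * sqrt t ^ 0"
    by (rule heat_weight_integral[of 0 N]) (rule that)
  have "(1 + norm x) ^ N * cmod (conv (heat_kernel t) \<phi> x) \<le> C * B"
    if t: "0 < t" "t \<le> 1" and \<phi>: "schwartz \<phi>" and B: "\<And>y. (1 + norm y) ^ N * cmod (\<phi> y) \<le> B"
    for t \<phi> and x :: "real^'n" and B
  proof -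
    have B0: "B \<ge> 0" using B[of 0] by (auto intro: order_trans[OF norm_ge_zero])
    note int = conv_integrable[OF heat_kernel_integrable[OF t(1)] \<phi>, of x]
    have "(1 + norm x) ^ N * cmod (conv (heat_kernel t) \<phi> x)
      \<le> (1 + norm x) ^ N * (LINT z|lborel. cmod (complex_of_real (heat_kernel t z) * \<phi> (x - z)))"
      unfolding conv_def by (intro mult_left_mono integral_norm_bound) auto
    also have "\<dots> = (LINT z|lborel. (1 + norm x) ^ N * cmod (complex_of_real (heat_kernel t z) * \<phi> (x - z)))"
      by (rule integral_mult_right_zero[symmetric])
    also have "\<dots> \<le> (LINT z|lborel. B * (norm (z :: real^'n) ^ 0 * (1 + norm z) ^ N * heat_kernel t z))"
    proof (rule integral_mono)
      fix z
      have "(1 + norm x) ^ N * cmod (\<phi> (x - z)) \<le> (1 + norm z) ^ N * (1 + norm (x - z)) ^ N * cmod (\<phi> (x - z))"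
        using weight_submult[of z "x - z" N] by (intro mult_right_mono) auto
      also have "\<dots> \<le> (1 + norm z) ^ N * B"
        unfolding mult.assoc by (intro mult_left_mono B) auto
      finally have "heat_kernel t z * ((1 + norm x) ^ N * cmod (\<phi> (x - z))) \<le> heat_kernel t z * ((1 + norm z) ^ N * B)"
        by (intro mult_left_mono heat_kernel_nonneg)
      thus "(1 + norm x) ^ N * cmod (complex_of_real (heat_kernel t z) * \<phi> (x - z))
        \<le> B * (norm z ^ 0 * (1 + norm z) ^ N * heat_kernel t z)"
        by (simp add: norm_mult heat_kernel_nonneg mult_ac)
    qed (intro integrable_mult_right integrable_norm int C t)+
    also have "\<dots> = B * (LINT z|lborel. norm (z :: real^'n) ^ 0 * (1 + norm z) ^ N * heat_kernel t z)"
      by (rule integral_mult_right_zero)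
    also have "\<dots> \<le> B * C" using C(3)[OF t] B0 by (intro mult_left_mono) auto
    finally show ?thesis by (simp add: mult_ac)
  qed
  thus ?thesis using that C(1) by blast
qed

text \<open>As the kernel has integral 1, the difference is a Gaussian mean of
  \<open>\<phi> (x - z) - \<phi> x\<close>, which is of size \<open>norm z\<close> up to weights,
  and the first moment of the kernel is of size \<open>sqrt t\<close>.\<close>

lemma heat_conv_approx:
  fixes \<phi> :: "real^'n \<Rightarrow> complex"
  assumes \<phi>: "schwartz \<phi>"
  obtains C where "C \<ge> 0" "\<And>t x. 0 < t \<Longrightarrow> t \<le> 1 \<Longrightarrow>
    (1 + norm x) ^ N * cmod (conv (heat_kernel t) \<phi> x - \<phi> x) \<le> C * sqrt t"
proof -
  obtain C where C: "C > 0" "\<And>t. 0 < t \<Longrightarrow> t \<le> 1 \<Longrightarrow>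
      integrable lborel (\<lambda>z :: real^'n. norm z ^ 1 * (1 + norm z) ^ N * heat_kernel t z)"
    "\<And>t. 0 < t \<Longrightarrow> t \<le> 1 \<Longrightarrow>
      (LINT z|lborel. norm (z :: real^'n) ^ 1 * (1 + norm z) ^ N * heat_kernel t z) \<le> C * sqrt t ^ 1"
    by (rule heat_weight_integral[of 1 N]) (rule that)
  obtain D where D: "D \<ge> 0" "\<And>x h. (1 + norm x) ^ N * cmod (\<phi> (x + h) - \<phi> x) \<le> D * norm h * (1 + norm h) ^ N"
    using schwartz_lipschitz[OF \<phi>] by metis
  have "(1 + norm x) ^ N * cmod (conv (heat_kernel t) \<phi> x - \<phi> x) \<le> (D * C) * sqrt t"
    if t: "0 < t" "t \<le> 1" for t x
  proof -
    note int = conv_integrable[OF heat_kernel_integrable[OF t(1)] \<phi>, of x]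
    have int2: "integrable lborel (\<lambda>z::real^'n. complex_of_real (heat_kernel t z) * \<phi> x)"
      using heat_kernel_integrable[OF t(1)] by (intro integrable_mult_left integrable_of_real)
    have "(LINT z::real^'n|lborel. complex_of_real (heat_kernel t z) * \<phi> x) = \<phi> x"
      using heat_kernel_integral[OF t(1), where 'n = 'n] by (simp add: integral_complex_of_real)
    hence "conv (heat_kernel t) \<phi> x - \<phi> x
      = (LINT z|lborel. complex_of_real (heat_kernel t z) * \<phi> (x - z)) - (LINT z::real^'n|lborel. complex_of_real (heat_kernel t z) * \<phi> x)"
      by (simp add: conv_def)
    also have "\<dots> = (LINT z|lborel. complex_of_real (heat_kernel t z) * \<phi> (x - z) - complex_of_real (heat_kernel t z) * \<phi> x)"
      by (rule Bochner_Integration.integral_diff[symmetric, OF int int2])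
    finally have eq: "conv (heat_kernel t) \<phi> x - \<phi> x = \<dots>" .
    have "(1 + norm x) ^ N * cmod (conv (heat_kernel t) \<phi> x - \<phi> x)
      \<le> (1 + norm x) ^ N * (LINT z|lborel. cmod (complex_of_real (heat_kernel t z) * \<phi> (x - z) - complex_of_real (heat_kernel t z) * \<phi> x))"
      unfolding eq by (intro mult_left_mono integral_norm_bound) auto
    also have "\<dots> = (LINT z|lborel. (1 + norm x) ^ N * cmod (complex_of_real (heat_kernel t z) * \<phi> (x - z) - complex_of_real (heat_kernel t z) * \<phi> x))"
      by (rule integral_mult_right_zero[symmetric])
    also have "\<dots> \<le> (LINT z|lborel. D * (norm (z :: real^'n) ^ 1 * (1 + norm z) ^ N * heat_kernel t z))"
    proof (rule integral_mono)
      fix z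
      have "(1 + norm x) ^ N * cmod (\<phi> (x - z) - \<phi> x) \<le> D * norm z * (1 + norm z) ^ N"
        using D(2)[of x "-z"] by simp
      hence "heat_kernel t z * ((1 + norm x) ^ N * cmod (\<phi> (x - z) - \<phi> x)) \<le> heat_kernel t z * (D * norm z * (1 + norm z) ^ N)"
        by (intro mult_left_mono heat_kernel_nonneg)
      thus "(1 + norm x) ^ N * cmod (complex_of_real (heat_kernel t z) * \<phi> (x - z) - complex_of_real (heat_kernel t z) * \<phi> x)
        \<le> D * (norm z ^ 1 * (1 + norm z) ^ N * heat_kernel t z)"
        unfolding right_diff_distrib[symmetric] norm_mult by (simp add: heat_kernel_nonneg mult_ac)
    qed (intro integrable_mult_right integrable_norm Bochner_Integration.integrable_diff int int2 C t)+
    also have "\<dots> = D * (LINT z|lborel. norm (z :: real^'n) ^ 1 * (1 + norm z) ^ N * heat_kernel t z)"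
      by (rule integral_mult_right_zero)
    also have "\<dots> \<le> D * (C * sqrt t)" using C(3)[OF t] D(1) by (intro mult_left_mono) auto
    finally show ?thesis by (simp add: mult_ac)
  qed
  thus ?thesis using that[of "D * C"] C(1) D(1) by simp
qed

lemma heat_conv_tendsto:
  fixes \<phi> :: "real^'n \<Rightarrow> complex"
  assumes \<phi>: "schwartz \<phi>"
  shows "((\<lambda>t. conv (heat_kernel t) \<phi> x) \<longlongrightarrow> \<phi> x) (at_right 0)"
proof -
  obtain C where C: "C \<ge> 0" "\<And>t x. 0 < t \<Longrightarrow> t \<le> 1 \<Longrightarrow>
    (1 + norm x) ^ 0 * cmod (conv (heat_kernel t) \<phi> x - \<phi> x) \<le> C * sqrt t"
    using heat_conv_approx[OF \<phi>] by metis
  have "((\<lambda>t. conv (heat_kernel t) \<phi> x - \<phi> x) \<longlongrightarrow> 0) (at_right 0)"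
  proof (rule Lim_null_comparison)
    show "\<forall>\<^sub>F t in at_right 0. cmod (conv (heat_kernel t) \<phi> x - \<phi> x) \<le> C * sqrt t"
      using C(2)[of _ x] unfolding eventually_at_right_field by (intro exI[of _ 1]) auto
    show "((\<lambda>t. C * sqrt t) \<longlongrightarrow> 0) (at_right 0)" by (auto intro!: tendsto_eq_intros)
  qed
  thus ?thesis by (rule LIM_zero_cancel)
qed

subsection \<open>Fourier inversion\<close>

lemma exp_norm2_fourier:
  fixes w :: "real^'n"
  assumes "\<epsilon> > 0"
  shows "(LINT \<xi>|lborel. complex_of_real (exp (- (\<epsilon> * (norm \<xi>)\<^sup>2))) * cis (- (\<xi> \<bullet> w)))
    = complex_of_real ((2 * pi) ^ CARD('n) * heat_kernel \<epsilon> w)"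
proof -
  \<comment> \<open>The dual time: a Gaussian in frequency is a multiple of the heat kernel at this
    time, so its transform is already known.\<close>
  define t where "t = 1 / (4 * \<epsilon>)"
  have t: "t > 0" using assms by (simp add: t_def)
  let ?n = "real CARD('n)"
  have eq: "exp (- (\<epsilon> * (norm \<xi>)\<^sup>2)) = (4 * pi * t) powr (?n / 2) * heat_kernel t \<xi>" for \<xi> :: "real^'n"
    using t assms unfolding heat_kernel_def by (simp add: powr_minus_divide t_def mult.commute)
  have "(LINT \<xi>|lborel. complex_of_real (exp (- (\<epsilon> * (norm \<xi>)\<^sup>2))) * cis (- (\<xi> \<bullet> w)))
    = (LINT \<xi>|lborel. complex_of_real ((4 * pi * t) powr (?n / 2)) * (complex_of_real (heat_kernel t \<xi>) * cis (\<xi> \<bullet> (-w))))"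
    unfolding eq by (simp add: mult_ac)
  also have "\<dots> = complex_of_real ((4 * pi * t) powr (?n / 2) * exp (- (t * (norm w)\<^sup>2)))"
    by (subst integral_mult_right_zero) (simp add: heat_kernel_fourier(2)[OF t] del: inner_minus_right)
  also have "(4 * pi * t) powr (?n / 2) * exp (- (t * (norm w)\<^sup>2)) = (2 * pi) ^ CARD('n) * heat_kernel \<epsilon> w"
  proof -
    have "(2 * pi) ^ CARD('n) = (2 * pi) powr ?n" by (simp add: powr_realpow)
    also have "\<dots> = ((2 * pi) powr 2) powr (?n / 2)" by (simp only: powr_powr) simp
    also have "(2 * pi) powr 2 = (4 * pi * t) * (4 * pi * \<epsilon>)"
      using assms by (simp add: t_def power2_eq_square)
    also have "\<dots> powr (?n / 2) = (4 * pi * t) powr (?n / 2) * (4 * pi * \<epsilon>) powr (?n / 2)"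
      by (rule powr_mult)
    finally show ?thesis using assms unfolding heat_kernel_def by (simp add: powr_minus_divide t_def)
  qed
  finally show ?thesis .
qed

text \<open>The double transform need not converge absolutely as a double integral. A Gaussian
  factor in \<xi> makes Fubini available and turns it into a heat convolution at time \<epsilon>,
  which tends to \<psi>; on the other side the factor is removed by dominated convergence.\<close>

lemma fourier_inversion:
  fixes \<psi> :: "real^'n \<Rightarrow> complex"
  assumes \<psi>: "schwartz \<psi>"
  shows "fourier (fourier \<psi>) x = complex_of_real ((2 * pi) ^ CARD('n)) * \<psi> (- x)"
proof -
  note sf = schwartz_fourier[OF \<psi>]
  have [measurable]: "\<psi> \<in> borel_measurable borel" "fourier \<psi> \<in> borel_measurable borel"
    using schwartz_borel \<psi> sf by auto
  let ?c = "complex_of_real ((2 * pi) ^ CARD('n))"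
  define F where "F \<epsilon> = (LINT \<xi>|lborel. complex_of_real (exp (- (\<epsilon> * (norm \<xi>)\<^sup>2))) * (cis (- (\<xi> \<bullet> x)) * fourier \<psi> \<xi>))" for \<epsilon>
  have F_eq: "F \<epsilon> = ?c * conv (heat_kernel \<epsilon>) \<psi> (- x)" if "\<epsilon> > 0" for \<epsilon>
  proof -
    have "F \<epsilon> = (LINT \<xi>|lborel. LINT y|lborel. complex_of_real (exp (- (\<epsilon> * (norm \<xi>)\<^sup>2))) * (cis (- (\<xi> \<bullet> x)) * (cis (- (y \<bullet> \<xi>)) * \<psi> y)))"
      unfolding F_def by (simp add: fourier_lborel)
    also have "\<dots> = (LINT y|lborel. LINT \<xi>|lborel. complex_of_real (exp (- (\<epsilon> * (norm \<xi>)\<^sup>2))) * (cis (- (\<xi> \<bullet> x)) * (cis (- (y \<bullet> \<xi>)) * \<psi> y)))"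
    proof (rule fubini_dominated(1))
      show "integrable lborel (\<lambda>\<xi>::real^'n. cmod (complex_of_real (exp (- (\<epsilon> * (norm \<xi>)\<^sup>2))) * 1))"
        by (intro integrable_norm schwartz_integrable schwartz_exp_norm2 slow_smooth_const that)
      show "integrable lborel (\<lambda>y. cmod (\<psi> y))" by (intro integrable_norm schwartz_integrable \<psi>)
    qed (auto simp: norm_mult)
    also have "\<dots> = (LINT y|lborel. ?c * (complex_of_real (heat_kernel \<epsilon> (- x - y)) * \<psi> y))"
    proof (rule Bochner_Integration.integral_cong[OF refl])
      fix y
      have "(LINT \<xi>|lborel. complex_of_real (exp (- (\<epsilon> * (norm \<xi>)\<^sup>2))) * (cis (- (\<xi> \<bullet> x)) * (cis (- (y \<bullet> \<xi>)) * \<psi> y)))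
        = (LINT \<xi>|lborel. \<psi> y * (complex_of_real (exp (- (\<epsilon> * (norm \<xi>)\<^sup>2))) * cis (- (\<xi> \<bullet> (x + y)))))"
      proof (rule Bochner_Integration.integral_cong[OF refl])
        fix \<xi>
        have "cis (- (\<xi> \<bullet> (x + y))) = cis (- (\<xi> \<bullet> x)) * cis (- (y \<bullet> \<xi>))"
          by (simp add: cis_mult inner_add_right inner_commute)
        thus "complex_of_real (exp (- (\<epsilon> * (norm \<xi>)\<^sup>2))) * (cis (- (\<xi> \<bullet> x)) * (cis (- (y \<bullet> \<xi>)) * \<psi> y))
          = \<psi> y * (complex_of_real (exp (- (\<epsilon> * (norm \<xi>)\<^sup>2))) * cis (- (\<xi> \<bullet> (x + y))))" by (simp only: mult_ac)
      qed
      also have "\<dots> = \<psi> y * complex_of_real ((2 * pi) ^ CARD('n) * heat_kernel \<epsilon> (x + y))"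
        by (subst integral_mult_right_zero) (simp only: exp_norm2_fourier[OF that])
      also have "heat_kernel \<epsilon> (x + y) = heat_kernel \<epsilon> (- x - y)"
        using heat_kernel_minus[of \<epsilon> x "-y"] by (metis diff_minus_eq_add minus_diff_commute)
      finally show "(LINT \<xi>|lborel. complex_of_real (exp (- (\<epsilon> * (norm \<xi>)\<^sup>2))) * (cis (- (\<xi> \<bullet> x)) * (cis (- (y \<bullet> \<xi>)) * \<psi> y)))
        = ?c * (complex_of_real (heat_kernel \<epsilon> (- x - y)) * \<psi> y)" by (simp only: of_real_mult mult_ac)
    qed
    also have "\<dots> = ?c * (LINT y|lborel. complex_of_real (heat_kernel \<epsilon> (- x - y)) * \<psi> y)"
      by (rule integral_mult_right_zero)
    also have "(LINT y|lborel. complex_of_real (heat_kernel \<epsilon> (- x - y)) * \<psi> y) = conv (heat_kernel \<epsilon>) \<psi> (- x)"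
      unfolding conv_def
      using lborel_reflect(1)[of "\<lambda>y. complex_of_real (heat_kernel \<epsilon> (- x - y)) * \<psi> y" "-x"] by simp
    finally show ?thesis .
  qed
  have "(F \<longlongrightarrow> (LINT \<xi>|lborel. cis (- (\<xi> \<bullet> x)) * fourier \<psi> \<xi>)) (at_right 0)"
    unfolding F_def
  proof (rule at_right_dominated_convergence[where d = 1])
    show "integrable lborel (\<lambda>\<xi>. cmod (fourier \<psi> \<xi>))" by (intro integrable_norm schwartz_integrable sf)
    show "AE \<xi> in lborel. ((\<lambda>\<epsilon>. complex_of_real (exp (- (\<epsilon> * (norm \<xi>)\<^sup>2))) * (cis (- (\<xi> \<bullet> x)) * fourier \<psi> \<xi>))
      \<longlongrightarrow> cis (- (\<xi> \<bullet> x)) * fourier \<psi> \<xi>) (at_right 0)"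
      by (intro AE_I2) (auto intro!: tendsto_eq_intros)
    show "AE \<xi> in lborel. cmod (complex_of_real (exp (- (\<epsilon> * (norm \<xi>)\<^sup>2))) * (cis (- (\<xi> \<bullet> x)) * fourier \<psi> \<xi>)) \<le> cmod (fourier \<psi> \<xi>)"
      if "0 < \<epsilon>" for \<epsilon>
      using that by (intro AE_I2) (auto simp: norm_mult intro!: mult_left_le_one_le)
  qed auto
  moreover have "(F \<longlongrightarrow> ?c * \<psi> (- x)) (at_right 0)"
  proof (rule Lim_transform_eventually)
    show "((\<lambda>\<epsilon>. ?c * conv (heat_kernel \<epsilon>) \<psi> (- x)) \<longlongrightarrow> ?c * \<psi> (- x)) (at_right 0)"
      by (intro tendsto_mult_left heat_conv_tendsto \<psi>)
    show "\<forall>\<^sub>F \<epsilon> in at_right 0. ?c * conv (heat_kernel \<epsilon>) \<psi> (- x) = F \<epsilon>"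
      using F_eq by (auto simp: eventually_at_right_field intro!: exI[of _ 1])
  qed
  ultimately have "(LINT \<xi>|lborel. cis (- (\<xi> \<bullet> x)) * fourier \<psi> \<xi>) = ?c * \<psi> (- x)"
    by (intro tendsto_unique[of "at_right (0::real)"]) auto
  thus ?thesis by (simp add: fourier_lborel)
qed

text \<open>Every Schwartz function can be taken to be a transform, so convolutions with it become
  products. The witness is the reflected transform, by inversion.\<close>

lemma fourier_surj:
  fixes \<psi> :: "real^'n \<Rightarrow> complex"
  assumes \<psi>: "schwartz \<psi>"
  obtains \<phi> where "schwartz \<phi>" "fourier \<phi> = \<psi>"
proof
  let ?c = "complex_of_real ((2 * pi) ^ CARD('n))"
  let ?\<phi> = "\<lambda>\<xi>. (1 / ?c) * fourier \<psi> (0 - \<xi>)"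
  have s: "schwartz (\<lambda>\<xi>. fourier \<psi> (0 - \<xi>))" by (intro schwartz_reflect schwartz_fourier \<psi>)
  thus "schwartz ?\<phi>" by (rule schwartz_cmult)
  show "fourier ?\<phi> = \<psi>"
  proof
    fix x
    have [measurable]: "fourier \<psi> \<in> borel_measurable borel" by (intro schwartz_borel schwartz_fourier \<psi>)
    have "fourier (\<lambda>\<xi>. fourier \<psi> (0 - \<xi>)) x = (LINT \<xi>|lborel. cis (- (\<xi> \<bullet> x)) * fourier \<psi> (0 - \<xi>))"
      by (rule fourier_lborel) measurable
    also have "\<dots> = (LINT \<xi>|lborel. cis (- (\<xi> \<bullet> - x)) * fourier \<psi> \<xi>)"
      using lborel_reflect(1)[of "\<lambda>\<xi>. cis (- (\<xi> \<bullet> - x)) * fourier \<psi> \<xi>" 0] by simp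
    also have "\<dots> = fourier (fourier \<psi>) (- x)" by (rule fourier_lborel[symmetric]) measurable
    also have "\<dots> = ?c * \<psi> x" using fourier_inversion[OF \<psi>, of "-x"] by simp
    finally show "fourier ?\<phi> x = \<psi> x" unfolding fourier_cmult[OF s] by simp
  qed
qed

lemma heat_conv_schwartz:
  assumes "t > 0" and \<psi>: "schwartz \<psi>"
  shows "schwartz (conv (heat_kernel t) \<psi>)"
proof -
  obtain \<phi> where \<phi>: "schwartz \<phi>" "fourier \<phi> = \<psi>" using fourier_surj[OF \<psi>] .
  show ?thesis unfolding \<phi>(2)[symmetric] heat_conv_fourier[OF assms(1) \<phi>(1)]
    by (intro schwartz_fourier schwartz_slow_mult slow_smooth_exp_norm2 \<phi>) (use assms in auto)
qed

lemma heat_conv_seminorm_le: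
  obtains C where "C > 0" "\<And>t (\<phi> :: real^'n \<Rightarrow> complex). 0 < t \<Longrightarrow> t \<le> 1 \<Longrightarrow> schwartz \<phi> \<Longrightarrow>
    schwartz_seminorm N (conv (heat_kernel t) \<phi>) \<le> C * schwartz_seminorm N \<phi>"
proof -
  obtain C where C: "C > 0" "\<And>t \<phi> (x :: real^'n) B. 0 < t \<Longrightarrow> t \<le> 1 \<Longrightarrow> schwartz \<phi> \<Longrightarrow>
    (\<And>y. (1 + norm y) ^ N * cmod (\<phi> y) \<le> B) \<Longrightarrow> (1 + norm x) ^ N * cmod (conv (heat_kernel t) \<phi> x) \<le> C * B"
    using heat_conv_weighted_bound by metis
  have "schwartz_seminorm N (conv (heat_kernel t) \<phi>) \<le> C * schwartz_seminorm N \<phi>"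
    if t: "0 < t" "t \<le> 1" and \<phi>: "schwartz \<phi>" for t and \<phi> :: "real^'n \<Rightarrow> complex"
  proof (rule schwartz_seminorm_le)
    fix "is" x assume l: "length (is :: 'n list) \<le> N"
    show "(1 + norm x) ^ N * cmod (partials is (conv (heat_kernel t) \<phi>) x) \<le> C * schwartz_seminorm N \<phi>"
      unfolding partials_conv[OF heat_kernel_integrable[OF t(1)] \<phi>]
      by (intro C(2) t schwartz_partials \<phi> schwartz_seminorm_ge l)
  qed
  thus ?thesis using that C(1) by blast
qed

lemma partials_diff:
  assumes "smooth f" "smooth g"
  shows "partials is (\<lambda>x. f x - g x) = (\<lambda>x. partials is f x - partials is g x)"
proof (induction "is")
  case (Cons i "is")
  have d: "partials is f differentiable (at x)" "partials is g differentiable (at x)" for x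
    using assms by (auto simp: smooth_def)
  show ?case
  proof
    fix x
    have "pd i (\<lambda>x. partials is f x - partials is g x) x = pd i (\<lambda>x. partials is f x + (-1) * partials is g x) x" by simp
    also have "\<dots> = pd i (partials is f) x + pd i (\<lambda>x. (-1) * partials is g x) x"
      by (intro pd_add d differentiable_mult differentiable_const)
    also have "\<dots> = pd i (partials is f) x - pd i (partials is g) x"
      using pd_cmult[OF d(2), of i "-1"] by simp
    finally show "partials (i # is) (\<lambda>x. f x - g x) x = partials (i # is) f x - partials (i # is) g x"
      unfolding partials_Cons Cons.IH .
  qed
qed simp

text \<open>Convolution commutes with partial derivatives, so \<open>heat_conv_approx\<close>
  applied to each of the finitely many derivatives in a seminorm gives convergence at rate
  \<open>sqrt t\<close> in that seminorm.\<close>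

lemma tempered_heat_conv_tendsto:
  fixes \<psi> :: "real^'n \<Rightarrow> complex"
  assumes T: "tempered_distribution T" and \<psi>: "schwartz \<psi>"
  shows "((\<lambda>t. T (conv (heat_kernel t) \<psi>)) \<longlongrightarrow> T \<psi>) (at_right 0)"
proof -
  obtain C0 N where C0: "C0 \<ge> 0" "\<And>\<phi>. schwartz \<phi> \<Longrightarrow> cmod (T \<phi>) \<le> C0 * schwartz_seminorm N \<phi>"
    using tempered_bound[OF T] by metis
  have "\<forall>is. \<exists>C\<ge>0. \<forall>t x. 0 < t \<longrightarrow> t \<le> 1 \<longrightarrow>
    (1 + norm x) ^ N * cmod (conv (heat_kernel t) (partials is \<psi>) x - partials is \<psi> x) \<le> C * sqrt t"
    using heat_conv_approx[OF schwartz_partials[OF \<psi>]] by metis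
  then obtain C where C: "\<And>is. C is \<ge> 0" "\<And>is t x. 0 < t \<Longrightarrow> t \<le> 1 \<Longrightarrow>
    (1 + norm x) ^ N * cmod (conv (heat_kernel t) (partials is \<psi>) x - partials is \<psi> x) \<le> C is * sqrt t" by metis
  define K where "K = (\<Sum>is\<in>{is :: 'n list. length is \<le> N}. C is)"
  have "((\<lambda>t. T (conv (heat_kernel t) \<psi>) - T \<psi>) \<longlongrightarrow> 0) (at_right 0)"
  proof (rule Lim_null_comparison)
    have "cmod (T (conv (heat_kernel t) \<psi>) - T \<psi>) \<le> C0 * (K * sqrt t)" if t: "0 < t" "t < 1" for t
    proof -
      note s = heat_conv_schwartz[OF t(1) \<psi>]
      have "cmod (T (conv (heat_kernel t) \<psi>) - T \<psi>) = cmod (T (\<lambda>x. conv (heat_kernel t) \<psi> x - \<psi> x))"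
        by (simp add: tempered_diff[OF T s \<psi>])
      also have "\<dots> \<le> C0 * schwartz_seminorm N (\<lambda>x. conv (heat_kernel t) \<psi> x - \<psi> x)"
        by (intro C0 schwartz_diff s \<psi>)
      also have "\<dots> \<le> C0 * (K * sqrt t)"
      proof (intro mult_left_mono schwartz_seminorm_le C0)
        fix "is" x assume l: "length (is :: 'n list) \<le> N"
        have "C is \<le> K" unfolding K_def
          using l C(1) finite_lists_le by (intro member_le_sum) auto
        have "partials is (\<lambda>x. conv (heat_kernel t) \<psi> x - \<psi> x)
          = (\<lambda>x. conv (heat_kernel t) (partials is \<psi>) x - partials is \<psi> x)"
          using partials_diff[OF schwartz_smooth[OF s] schwartz_smooth[OF \<psi>]]
            partials_conv[OF heat_kernel_integrable[OF t(1)] \<psi>] by simp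
        hence "(1 + norm x) ^ N * cmod (partials is (\<lambda>x. conv (heat_kernel t) \<psi> x - \<psi> x) x) \<le> C is * sqrt t"
          using C(2)[of t x "is"] t by simp
        also have "\<dots> \<le> K * sqrt t" using \<open>C is \<le> K\<close> t by (intro mult_right_mono) auto
        finally show "(1 + norm x) ^ N * cmod (partials is (\<lambda>x. conv (heat_kernel t) \<psi> x - \<psi> x) x) \<le> K * sqrt t" .
      qed
      finally show ?thesis .
    qed
    thus "\<forall>\<^sub>F t in at_right 0. cmod (T (conv (heat_kernel t) \<psi>) - T \<psi>) \<le> C0 * (K * sqrt t)"
      unfolding eventually_at_right_field by (intro exI[of _ 1]) auto
    show "((\<lambda>t. C0 * (K * sqrt t)) \<longlongrightarrow> 0) (at_right 0)" by (auto intro!: tendsto_eq_intros)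
  qed
  thus ?thesis by (rule LIM_zero_cancel)
qed

subsection \<open>Cutoff functions\<close>

text \<open>The classical flat function \<open>exp (- 1 / w)\<close>, together with its quotients by
  powers of w: the derivative of one of these is a combination of two others, so the whole class is
  handled at once.\<close>

definition flat_exp :: "nat \<Rightarrow> real \<Rightarrow> real" where
  "flat_exp k w = (if w > 0 then exp (- (1 / w)) / w ^ k else 0)"

lemma flat_exp_nonneg: "0 \<le> flat_exp k w"
  by (simp add: flat_exp_def)

text \<open>The term of degree \<open>k + 2\<close> of the exponential series at
  \<open>1 / w\<close> beats the denominator and leaves a factor \<open>w\<^sup>2\<close>, which
  gives derivative 0 at the origin.\<close>

lemma flat_exp_le: "flat_exp k w \<le> fact (k + 2) * w\<^sup>2"
proof (cases "w > 0")
  case True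
  define F :: real where "F = fact (k + 2)"
  have F: "F > 0" by (simp add: F_def)
  define q where "q = (1 / w) ^ (k + 2)"
  have "(\<Sum>n\<in>{k + 2}. inverse (fact n) * (1 / w) ^ n) \<le> (\<Sum>n. inverse (fact n) * (1 / w) ^ n)"
    by (rule sum_le_suminf[OF summable_exp]) (use True in auto)
  hence "inverse F * q \<le> exp (1 / w)" by (simp add: exp_def F_def q_def)
  hence "q / exp (1 / w) \<le> F" using F by (simp add: field_simps)
  hence "w\<^sup>2 * (q / exp (1 / w)) \<le> w\<^sup>2 * F" by (rule mult_left_mono) simp
  moreover have "w\<^sup>2 * (q / exp (1 / w)) = exp (- (1 / w)) / w ^ k"
    using True by (simp add: q_def exp_minus field_simps power_add power2_eq_square)
  ultimately show ?thesis using True by (simp add: flat_exp_def F_def mult.commute)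
qed (simp add: flat_exp_def)

lemma flat_exp_derivative: "(flat_exp k has_real_derivative flat_exp (k + 2) w - real k * flat_exp (k + 1) w) (at w)"
proof -
  consider "w > 0" | "w < 0" | "w = 0" by linarith
  thus ?thesis
  proof cases
    case 1
    have "((\<lambda>w. exp (- (1 / w)) / w ^ k) has_real_derivative flat_exp (k + 2) w - real k * flat_exp (k + 1) w) (at w)"
      using 1 by (auto intro!: derivative_eq_intros simp: flat_exp_def)
        (cases k; simp add: field_simps power2_eq_square)
    thus ?thesis
      by (rule has_field_derivative_transform_within_open[of _ _ _ "{0<..}"]) (use 1 in \<open>auto simp: flat_exp_def\<close>)
  next
    case 2
    have "((\<lambda>w. 0) has_real_derivative flat_exp (k + 2) w - real k * flat_exp (k + 1) w) (at w)"
      using 2 by (simp add: flat_exp_def)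
    thus ?thesis
      by (rule has_field_derivative_transform_within_open[of _ _ _ "{..<0}"]) (use 2 in \<open>auto simp: flat_exp_def\<close>)
  next
    case 3
    have "((\<lambda>h. (flat_exp k (0 + h) - flat_exp k 0) / h) \<longlongrightarrow> 0) (at 0)"
    proof (rule Lim_null_comparison)
      show "\<forall>\<^sub>F h in at 0. norm ((flat_exp k (0 + h) - flat_exp k 0) / h) \<le> fact (k + 2) * \<bar>h\<bar>"
      proof (rule always_eventually, rule allI)
        fix h :: real
        show "norm ((flat_exp k (0 + h) - flat_exp k 0) / h) \<le> fact (k + 2) * \<bar>h\<bar>"
        proof (cases "h = 0")
          case False
          have "\<bar>flat_exp k h\<bar> \<le> fact (k + 2) * \<bar>h\<bar> * \<bar>h\<bar>"
            using flat_exp_le[of k h] flat_exp_nonneg[of k h] by (simp add: power2_eq_square)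
          thus ?thesis using False by (simp add: flat_exp_def[of _ 0] field_simps)
        qed simp
      qed
      show "((\<lambda>h::real. fact (k + 2) * \<bar>h\<bar>) \<longlongrightarrow> 0) (at 0)" by (auto intro!: tendsto_eq_intros)
    qed
    thus ?thesis using 3 by (simp add: DERIV_def flat_exp_def)
  qed
qed

lemma smooth_mult: "smooth f \<Longrightarrow> smooth g \<Longrightarrow> smooth (\<lambda>x. f x * g x)"
  using smooth_family_mult[of "\<lambda>_. True" "\<lambda>_::unit. f" "\<lambda>_. True" "\<lambda>_. g" "\<lambda>_. True"]
  by (auto simp: smooth_family_True plus_closed_def)

lemma smooth_add: "smooth f \<Longrightarrow> smooth g \<Longrightarrow> smooth (\<lambda>x. f x + g x)"
  using smooth_family_add[of "\<lambda>_. True" "\<lambda>_::unit. f" "\<lambda>_. g"]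
  by (auto simp: smooth_family_True plus_closed_def)

text \<open>Smoothness is asked of the derivative of w, which may itself contain
  \<open>flat_exp\<close>; this allows the two nested applications in
  \<open>cutoff_smooth\<close>.\<close>

lemma smooth_flat_exp_compose:
  fixes w :: "real^'n \<Rightarrow> real"
  assumes w: "\<And>x. (w has_derivative w' x) (at x)"
    and w': "\<And>j. smooth (\<lambda>x. complex_of_real (w' x (axis j 1)))"
    and a: "smooth a"
  shows "smooth (\<lambda>x. a x * complex_of_real (flat_exp k (w x)))"
proof -
  have d: "((\<lambda>x. complex_of_real (flat_exp k (w x))) has_derivative
    (\<lambda>h. complex_of_real ((flat_exp (k + 2) (w x) - real k * flat_exp (k + 1) (w x)) * w' x h))) (at x)" for k x
    by (rule has_derivative_of_real)
       (use has_derivative_compose[OF w[of x] flat_exp_derivative[of k "w x", unfolded has_field_derivative_def]] in simp)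
  have "smooth_family (\<lambda>_. True) (\<lambda>_::unit. \<lambda>x. a x * complex_of_real (flat_exp k (w x)))"
  proof (rule smooth_family_coinduct)
    let ?S = "{\<lambda>_::unit. \<lambda>x. a x * complex_of_real (flat_exp k (w x)) |a k. smooth a}"
    show "(\<lambda>_::unit. \<lambda>x. a x * complex_of_real (flat_exp k (w x))) \<in> ?S" using a by blast
    fix \<Phi> assume "\<Phi> \<in> ?S"
    then obtain a k where \<Phi>: "\<Phi> = (\<lambda>_::unit. \<lambda>x. a x * complex_of_real (flat_exp k (w x)))" and a: "smooth a" by blast
    have d': "(\<lambda>x. complex_of_real (flat_exp k (w x))) differentiable (at x)" for x
      using d by (rule differentiableI)
    show "\<Phi> i differentiable (at x)" for i x
      unfolding \<Phi> by (intro differentiable_mult smooth_differentiable a d')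
    show "(\<lambda>i. pd j (\<Phi> i)) \<in> sum_closure ?S" for j
    proof -
      let ?w = "\<lambda>x. complex_of_real (w' x (axis j 1))"
      have "(\<lambda>i. pd j (\<Phi> i)) = (\<lambda>_ x. pd j a x * complex_of_real (flat_exp k (w x))
        + ((a x * ?w x) * complex_of_real (flat_exp (k + 2) (w x))
          + ((- of_nat k) * (a x * ?w x)) * complex_of_real (flat_exp (k + 1) (w x))))"
        unfolding \<Phi>
        by (intro ext) (simp add: pd_mult[OF smooth_differentiable[OF a] d'] pd_eq[OF d] algebra_simps)
      moreover have "(\<lambda>_ x. pd j a x * complex_of_real (flat_exp k (w x))) \<in> ?S"
        using smooth_pd[OF a] by blast
      moreover have aw: "smooth (\<lambda>x. a x * ?w x)" by (intro smooth_mult a w')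
      hence "(\<lambda>_ x. (a x * ?w x) * complex_of_real (flat_exp (k + 2) (w x))) \<in> ?S"
        by (intro CollectI exI[of _ "\<lambda>x. a x * ?w x"] exI[of _ "k + 2"] conjI refl)
      moreover have "(\<lambda>_ x. ((- of_nat k) * (a x * ?w x)) * complex_of_real (flat_exp (k + 1) (w x))) \<in> ?S"
        by (intro CollectI exI[of _ "\<lambda>x. (- of_nat k) * (a x * ?w x)"] exI[of _ "k + 1"] conjI refl
            smooth_mult slow_smooth_smooth[OF slow_smooth_const] a w')
      ultimately show ?thesis by (simp only:) (intro sum_closure.intros)
    qed
  qed (auto simp: plus_closed_def)
  thus ?thesis by (simp add: smooth_family_True)
qed

text \<open>Equal to 1 on the unit ball and to 0 outside the ball of radius 2.\<close>

definition cutoff :: "real^'n \<Rightarrow> real" where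
  "cutoff x = exp 1 * flat_exp 0 (1 - 2 * flat_exp 0 ((norm x)\<^sup>2 - 1))"

lemma cutoff_smooth: "smooth (\<lambda>x :: real^'n. complex_of_real (cutoff x))"
proof -
  let ?w1 = "\<lambda>x :: real^'n. (norm x)\<^sup>2 - 1"
  have w1: "(?w1 has_derivative (\<lambda>h. 2 * (x \<bullet> h))) (at x)" for x
    unfolding power2_norm_eq_inner by (auto intro!: derivative_eq_intros simp: inner_commute)
  have "smooth (\<lambda>x :: real^'n. 2 * complex_of_real (x $ j))" for j
    by (intro slow_smooth_smooth slow_smooth_mult slow_smooth_const slow_smooth_coord)
  hence w1': "smooth (\<lambda>x :: real^'n. complex_of_real (2 * (x \<bullet> axis j 1)))" for j
    by (simp add: inner_axis)
  have w2: "((\<lambda>x. 1 - 2 * flat_exp 0 (?w1 x)) has_derivative (\<lambda>h. - 2 * (flat_exp 2 (?w1 x) * (2 * (x \<bullet> h))))) (at x)" for x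
    using has_derivative_compose[OF w1[of x] flat_exp_derivative[of 0 "?w1 x", unfolded has_field_derivative_def]]
    by (auto intro!: derivative_eq_intros simp: numeral_2_eq_2)
  have w2': "smooth (\<lambda>x :: real^'n. complex_of_real (- 2 * (flat_exp 2 (?w1 x) * (2 * (x \<bullet> axis j 1)))))" for j
  proof -
    have "smooth (\<lambda>x :: real^'n. ((-2) * complex_of_real (2 * (x \<bullet> axis j 1))) * complex_of_real (flat_exp 2 (?w1 x)))"
      by (rule smooth_flat_exp_compose[OF w1 w1']) (intro smooth_mult w1' slow_smooth_smooth slow_smooth_const)
    thus ?thesis by (simp add: mult_ac)
  qed
  have "smooth (\<lambda>x :: real^'n. complex_of_real (exp 1) * complex_of_real (flat_exp 0 (1 - 2 * flat_exp 0 (?w1 x))))"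
    by (rule smooth_flat_exp_compose[OF w2 w2']) (intro slow_smooth_smooth slow_smooth_const)
  thus ?thesis by (simp add: cutoff_def)
qed

lemma cutoff_nonneg: "0 \<le> cutoff x"
  by (simp add: cutoff_def flat_exp_nonneg)

lemma cutoff_le_1: "cutoff x \<le> 1"
proof -
  define w where "w = 1 - 2 * flat_exp 0 ((norm x)\<^sup>2 - 1)"
  have "w \<le> 1" by (simp add: w_def flat_exp_nonneg)
  have "exp 1 * flat_exp 0 w \<le> 1"
  proof (cases "w > 0")
    case True
    hence "1 \<le> 1 / w" using \<open>w \<le> 1\<close> by (simp add: field_simps)
    hence "exp 1 * exp (- (1 / w)) \<le> exp 1 * exp (-1)" by (intro mult_left_mono) auto
    thus ?thesis using True by (simp add: flat_exp_def exp_minus)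
  qed (simp add: flat_exp_def)
  thus ?thesis by (simp add: cutoff_def w_def)
qed

lemma cutoff_eq_1: "norm x \<le> 1 \<Longrightarrow> cutoff x = 1"
proof -
  assume "norm x \<le> 1"
  hence "(norm x)\<^sup>2 \<le> 1" by (simp add: power_le_one)
  thus ?thesis by (simp add: cutoff_def flat_exp_def exp_minus)
qed

lemma cutoff_eq_0: "norm x \<ge> 2 \<Longrightarrow> cutoff x = 0"
proof -
  assume "norm x \<ge> 2"
  hence "(norm x)\<^sup>2 \<ge> 2\<^sup>2" by (intro power_mono) auto
  hence r: "(norm x)\<^sup>2 - 1 \<ge> 3" by simp
  \<comment> \<open>Outside radius 2 the inner argument is at least 3. Then
    \<open>exp (- (1 / 3)) \<ge> 1 / 2\<close>, and the factor 2 in \<open>cutoff\<close> pushes the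
    outer argument to 0 or below.\<close>
  have "exp (1 / 3 :: real) \<le> 2"
  proof (rule power_le_imp_le_base[of _ 2])
    have "exp (1 / 3 :: real) ^ Suc 2 = exp 1" by (simp flip: exp_of_nat_mult)
    also have "\<dots> \<le> 2 ^ Suc 2" using exp_le by simp
    finally show "exp (1 / 3 :: real) ^ Suc 2 \<le> 2 ^ Suc 2" .
  qed simp
  hence "1 / 2 \<le> exp (- (1 / 3 :: real))" by (simp add: exp_minus field_simps)
  also have "\<dots> \<le> exp (- (1 / ((norm x)\<^sup>2 - 1)))" using r by (simp add: field_simps)
  finally have "1 - 2 * flat_exp 0 ((norm x)\<^sup>2 - 1) \<le> 0" using r by (simp add: flat_exp_def)
  thus ?thesis by (simp add: cutoff_def flat_exp_def)
qed

lemma pd_eq_0: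
  assumes "open S" "x \<in> S" "\<And>y. y \<in> S \<Longrightarrow> f y = 0"
  shows "pd j f x = 0"
proof -
  have "((\<lambda>x. 0) has_derivative (\<lambda>h. 0)) (at x)" by simp
  hence "(f has_derivative (\<lambda>h. 0)) (at x)"
    by (rule has_derivative_transform_within_open[OF _ assms(1,2)]) (use assms(3) in simp)
  thus ?thesis by (rule pd_eq)
qed

lemma partials_eq_0:
  assumes "open S" "x \<in> S" "\<And>y. y \<in> S \<Longrightarrow> f y = 0"
  shows "partials is f x = 0"
  using assms(2)
proof (induction "is" arbitrary: x)
  case (Cons i "is")
  show ?case unfolding partials_Cons by (rule pd_eq_0[OF assms(1) Cons.prems Cons.IH])
qed (use assms in simp)

lemma test_function_schwartz:
  fixes \<psi> :: "real^'n \<Rightarrow> complex"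
  assumes "test_function \<psi>" shows "schwartz \<psi>"
  unfolding schwartz_def
proof (intro conjI allI)
  show s: "smooth \<psi>" using assms by (simp add: test_function_def)
  fix k "is"
  define K where "K = closure {x. \<psi> x \<noteq> 0}"
  have K: "compact K" using assms by (simp add: test_function_def K_def)
  have zero: "partials is \<psi> x = 0" if "x \<notin> K" for x
    by (rule partials_eq_0[of "- K"]) (use that closure_subset[of "{x. \<psi> x \<noteq> 0}"] in \<open>auto simp: K_def\<close>)
  have "continuous_on K (partials is \<psi>)"
    using s by (intro differentiable_imp_continuous_on) (auto simp: smooth_def differentiable_on_def intro: differentiable_at_withinI)
  hence "continuous_on K (\<lambda>x. norm x ^ k * cmod (partials is \<psi> x))" by (intro continuous_intros)
  hence "bounded ((\<lambda>x. norm x ^ k * cmod (partials is \<psi> x)) ` K)"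
    by (intro compact_imp_bounded compact_continuous_image K)
  hence "bounded (insert 0 ((\<lambda>x. norm x ^ k * cmod (partials is \<psi> x)) ` K))" by simp
  thus "bounded (range (\<lambda>x. norm x ^ k * cmod (partials is \<psi> x)))"
    by (rule bounded_subset) (use zero in force)
qed

lemma test_functionI:
  assumes "smooth \<psi>" "\<And>x. norm x > R \<Longrightarrow> \<psi> x = 0"
  shows "test_function \<psi>"
  unfolding test_function_def
proof
  have "{x. \<psi> x \<noteq> 0} \<subseteq> cball 0 R" using assms(2) by (auto simp: not_less[symmetric])
  thus "compact (closure {x. \<psi> x \<noteq> 0})" by (metis bounded_cball bounded_subset compact_closure)
qed (rule assms)

lemma cutoff_test_function: "test_function (\<lambda>x :: real^'n. complex_of_real (cutoff x))"
  by (rule test_functionI[OF cutoff_smooth, of 2]) (simp add: cutoff_eq_0)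

lemma cutoff_schwartz: "schwartz (\<lambda>x :: real^'n. complex_of_real (cutoff x))"
  by (rule test_function_schwartz[OF cutoff_test_function])

section \<open>Truncation by dilated cutoffs\<close>

definition scaled_cutoff :: "real \<Rightarrow> real^'n \<Rightarrow> real" where
  "scaled_cutoff R x = cutoff ((1 / R) *\<^sub>R x)"

lemma partials_scaled_cutoff:
  fixes R :: real
  shows "smooth (\<lambda>x :: real^'n. complex_of_real (scaled_cutoff R x))"
    and "partials is (\<lambda>x :: real^'n. complex_of_real (scaled_cutoff R x))
      = (\<lambda>x. complex_of_real ((1 / R) ^ length is) * partials is (\<lambda>x. complex_of_real (cutoff x)) ((1 / R) *\<^sub>R x))"
  using partials_affine(1)[OF cutoff_smooth, of 0 "1 / R"] partials_affine(2)[OF cutoff_smooth, of _ 0 "1 / R"] by (auto simp: scaled_cutoff_def)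

lemma scaled_cutoff_family:
  "smooth_family (slow {1..} (\<lambda>_. 0)) (\<lambda>R (x :: real^'n). complex_of_real (scaled_cutoff R x))"
  unfolding smooth_family_def partials_scaled_cutoff(2)
proof (intro conjI allI partials_scaled_cutoff(1))
  fix "is" :: "'n list"
  obtain C where C: "C \<ge> 0" "\<And>x. cmod (partials is (\<lambda>x. complex_of_real (cutoff x)) x) \<le> C"
    using schwartz_bounded[OF schwartz_partials[OF cutoff_schwartz]] by metis
  have "cmod (complex_of_real ((1 / R) ^ length is) * partials is (\<lambda>x. complex_of_real (cutoff x)) ((1 / R) *\<^sub>R x)) \<le> 1 * C"
    if "R \<in> {1..}" for R and x :: "real^'n"
    unfolding norm_mult by (intro mult_mono C) (use that in \<open>auto simp: norm_power norm_divide power_le_one\<close>)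
  thus "slow {1..} (\<lambda>_. 0) (\<lambda>R x. complex_of_real ((1 / R) ^ length is) * partials is (\<lambda>x. complex_of_real (cutoff x)) ((1 / R) *\<^sub>R x))"
    unfolding slow_def by (intro exI[of _ 0] exI[of _ "1 * C"]) auto
qed

lemma partials_const: "partials is (\<lambda>x. c) = (if is = [] then (\<lambda>x. c) else (\<lambda>x. 0))"
  by (induction "is") (auto simp: partials_Cons)

lemma partials_cmult:
  assumes "smooth f"
  shows "partials is (\<lambda>x. c * f x) = (\<lambda>x. c * partials is f x)"
proof (induction "is")
  case (Cons i "is")
  have d: "partials is f differentiable (at x)" for x using assms by (auto simp: smooth_def)
  show ?case unfolding partials_Cons Cons.IH by (rule ext) (rule pd_cmult[OF d])
qed simp

text \<open>The factor R is affordable: the cutoff is Lipschitz and equals 1 at 0, so its dilate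
  differs from 1 by a multiple of \<open>norm x / R\<close>, and each derivative brings at least one
  factor \<open>1 / R\<close>. Truncation errors are therefore of order \<open>1 / R\<close> in
  every seminorm.\<close>

lemma scaled_cutoff_deviation_family:
  "smooth_family (slow {1..} (\<lambda>_. 0)) (\<lambda>R (x :: real^'n). complex_of_real R * (complex_of_real (scaled_cutoff R x) - 1))"
proof -
  let ?\<chi> = "\<lambda>x :: real^'n. complex_of_real (cutoff x)"
  have s: "smooth (\<lambda>x :: real^'n. complex_of_real (scaled_cutoff R x) - 1)" for R
    using smooth_add[OF partials_scaled_cutoff(1) slow_smooth_smooth[OF slow_smooth_const[of "-1"]]] by simp
  have p: "partials is (\<lambda>x :: real^'n. complex_of_real R * (complex_of_real (scaled_cutoff R x) - 1))
    = (\<lambda>x. complex_of_real R * (complex_of_real ((1 / R) ^ length is) * partials is ?\<chi> ((1 / R) *\<^sub>R x)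
        - (if is = [] then 1 else 0)))" for "is" R
    unfolding partials_cmult[OF s] partials_diff[OF partials_scaled_cutoff(1) slow_smooth_smooth[OF slow_smooth_const]]
      partials_const partials_scaled_cutoff(2) by auto
  have "slow {1..} (\<lambda>_. 0) (\<lambda>R x. complex_of_real R * (complex_of_real ((1 / R) ^ length is) * partials is ?\<chi> ((1 / R) *\<^sub>R x)
        - (if is = [] then 1 else 0)))" for "is"
  proof (cases "is")
    case Nil
    obtain C where C: "C \<ge> 0" "\<And>x h. (1 + norm x) ^ 0 * cmod (?\<chi> (x + h) - ?\<chi> x) \<le> C * norm h * (1 + norm h) ^ 0"
      using schwartz_lipschitz[OF cutoff_schwartz] by metis
    have "cmod (complex_of_real R * (?\<chi> ((1 / R) *\<^sub>R x) - 1)) \<le> C * (1 + norm x) ^ 1" if "R \<ge> 1" for R and x :: "real^'n"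
    proof -
      have "cmod (?\<chi> ((1 / R) *\<^sub>R x) - 1) \<le> C * norm ((1 / R) *\<^sub>R x)"
        using C(2)[of 0 "(1 / R) *\<^sub>R x"] by (simp add: cutoff_eq_1)
      hence "R * cmod (?\<chi> ((1 / R) *\<^sub>R x) - 1) \<le> R * (C * norm ((1 / R) *\<^sub>R x))"
        using that by (intro mult_left_mono) auto
      also have "\<dots> = C * norm x" using that by simp
      also have "\<dots> \<le> C * (1 + norm x) ^ 1" using C(1) by (intro mult_left_mono) auto
      finally show ?thesis using that by (simp only: norm_mult norm_of_real)
    qed
    thus ?thesis using Nil unfolding slow_def by (intro exI[of _ 1] exI[of _ C] exI[of _ 0]) auto
  next
    case (Cons i js)
    obtain C where C: "C \<ge> 0" "\<And>x. cmod (partials is ?\<chi> x) \<le> C"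
      using schwartz_bounded[OF schwartz_partials[OF cutoff_schwartz]] by metis
    have "cmod (complex_of_real R * (complex_of_real ((1 / R) ^ length is) * partials is ?\<chi> ((1 / R) *\<^sub>R x))) \<le> 1 * C"
      if "R \<ge> 1" for R and x :: "real^'n"
    proof -
      have "R * (1 / R) ^ length is = (1 / R) ^ length js" using that Cons by simp
      also have "\<dots> \<le> 1" using that by (intro power_le_one) auto
      finally have "R * (1 / R) ^ length is \<le> 1" .
      hence "(R * (1 / R) ^ length is) * cmod (partials is ?\<chi> ((1 / R) *\<^sub>R x)) \<le> 1 * C"
        by (intro mult_mono C) auto
      thus ?thesis using that by (simp add: norm_mult norm_power norm_divide)
    qed
    thus ?thesis using Cons unfolding slow_def by (intro exI[of _ 0] exI[of _ "1 * C"] exI[of _ 0]) auto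
  qed
  thus ?thesis unfolding smooth_family_def p
    by (auto intro!: smooth_mult s slow_smooth_smooth[OF slow_smooth_const])
qed

text \<open>The weight at y is at most the weight at x times that at \<open>x - y\<close>, so
  translation costs only a power of \<open>1 + norm x\<close>; the centre x becomes part of the
  parameter.\<close>

lemma translation_family:
  fixes \<Phi> :: "'i \<Rightarrow> real^'n \<Rightarrow> complex"
  assumes fam: "smooth_family (rapid I v) \<Phi>"
  shows "smooth_family (rapid (I \<times> UNIV) (\<lambda>(i, x). \<bar>v i\<bar> + norm x)) (\<lambda>(i, x) y. \<Phi> i (x - y))"
proof -
  have s: "smooth (\<Phi> i)" for i using fam by (simp add: smooth_family_def)
  have "rapid (I \<times> UNIV) (\<lambda>(i, x). \<bar>v i\<bar> + norm x) (\<lambda>(i, x) y. (-1) ^ length is * partials is (\<Phi> i) (x - y))" for "is"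
    unfolding rapid_def
  proof
    fix k
    from fam obtain C m where
      C: "\<And>i x. i \<in> I \<Longrightarrow> (1 + norm x) ^ k * cmod (partials is (\<Phi> i) x) \<le> C * (1 + \<bar>v i\<bar>) ^ m"
      unfolding rapid_def smooth_family_def by metis
    have "(1 + norm y) ^ k * cmod ((-1) ^ length is * partials is (\<Phi> i) (x - y)) \<le> \<bar>C\<bar> * (1 + (\<bar>v i\<bar> + norm x)) ^ (k + m)"
      if "i \<in> I" for i x y
    proof -
      have "(1 + norm y) ^ k \<le> (1 + norm x) ^ k * (1 + norm (x - y)) ^ k"
        using weight_submult[of x "y - x" k] by (simp add: norm_minus_commute)
      hence "(1 + norm y) ^ k * cmod (partials is (\<Phi> i) (x - y))
        \<le> (1 + norm x) ^ k * (1 + norm (x - y)) ^ k * cmod (partials is (\<Phi> i) (x - y))"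
        by (rule mult_right_mono) simp
      also have "\<dots> \<le> (1 + norm x) ^ k * (C * (1 + \<bar>v i\<bar>) ^ m)"
        unfolding mult.assoc by (intro mult_left_mono C that) auto
      also have "\<dots> \<le> (1 + (\<bar>v i\<bar> + norm x)) ^ k * (\<bar>C\<bar> * (1 + (\<bar>v i\<bar> + norm x)) ^ m)"
        by (intro mult_mono' mult_mono power_mono) (auto intro: order_trans[OF _ C[OF that, of 0]])
      finally show ?thesis by (simp add: norm_mult norm_power power_add mult_ac)
    qed
    thus "\<exists>C m. \<forall>i\<in>I \<times> UNIV. \<forall>x. (1 + norm x) ^ k * cmod ((case i of (i, x) \<Rightarrow> \<lambda>y. (-1) ^ length is * partials is (\<Phi> i) (x - y)) x)
      \<le> C * (1 + \<bar>case i of (i, x) \<Rightarrow> \<bar>v i\<bar> + norm x\<bar>) ^ m"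
      by (intro exI[of _ "\<bar>C\<bar>"] exI[of _ "k + m"]) auto
  qed
  moreover have "partials is ((\<lambda>(i, x) y. \<Phi> i (x - y)) p) = (\<lambda>(i, x) y. (-1) ^ length is * partials is (\<Phi> i) (x - y)) p" for "is" p
    using partials_reflect[OF s] by (cases p) auto
  moreover have "smooth ((\<lambda>(i, x) y. \<Phi> i (x - y)) p)" for p
    using partials_affine(1)[OF s, of _ _ "-1"] by (cases p) auto
  ultimately show ?thesis unfolding smooth_family_def by presburger
qed

lemma scaled_cutoff_mult_test_function:
  assumes "R > 0" "smooth \<theta>"
  shows "test_function (\<lambda>x :: real^'n. complex_of_real (scaled_cutoff R x) * \<theta> x)"
proof (rule test_functionI[of _ "2 * R"])
  show "smooth (\<lambda>x. complex_of_real (scaled_cutoff R x) * \<theta> x)"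
    by (intro smooth_mult partials_scaled_cutoff assms)
  fix x :: "real^'n" assume "norm x > 2 * R"
  hence "norm ((1 / R) *\<^sub>R x) \<ge> 2" using assms(1) by (simp add: field_simps)
  thus "complex_of_real (scaled_cutoff R x) * \<theta> x = 0" by (simp add: scaled_cutoff_def cutoff_eq_0)
qed

text \<open>Carries what is known on test functions over to Schwartz functions. R times the error is
  T tested on a family bounded uniformly in R.\<close>

lemma tempered_cutoff_tendsto:
  fixes \<theta> :: "real^'n \<Rightarrow> complex"
  assumes T: "tempered_distribution T" and \<theta>: "schwartz \<theta>"
  shows "(\<lambda>n. T (\<lambda>x. complex_of_real (scaled_cutoff (real (Suc n)) x) * \<theta> x)) \<longlonglongrightarrow> T \<theta>"
proof -
  let ?\<Phi> = "\<lambda>R x. complex_of_real R * (complex_of_real (scaled_cutoff R x) - 1) * \<theta> x"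
  have fam: "smooth_family (rapid {1..} (\<lambda>_. 0)) ?\<Phi>"
    by (rule slow_rapid_family_mult[OF scaled_cutoff_deviation_family schwartz_rapid_family[OF \<theta>]])
  obtain C m where C: "C \<ge> 0" "\<And>R. R \<in> {1..} \<Longrightarrow> cmod (T (?\<Phi> R)) \<le> C * (1 + \<bar>0::real\<bar>) ^ m"
    by (rule tempered_family_bound[OF T fam]) (rule that)
  have "cmod (T (\<lambda>x. complex_of_real (scaled_cutoff R x) * \<theta> x) - T \<theta>) \<le> C * (1 / R)" if "R \<ge> 1" for R
  proof -
    have s: "schwartz (\<lambda>x. complex_of_real (scaled_cutoff R x) * \<theta> x)"
      by (intro test_function_schwartz scaled_cutoff_mult_test_function schwartz_smooth \<theta>) (use that in simp)
    have "complex_of_real R * (T (\<lambda>x. complex_of_real (scaled_cutoff R x) * \<theta> x) - T \<theta>)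
      = T (\<lambda>x. complex_of_real R * (complex_of_real (scaled_cutoff R x) * \<theta> x - \<theta> x))"
      using tempered_cmult[OF T schwartz_diff[OF s \<theta>]] tempered_diff[OF T s \<theta>] by simp
    also have "\<dots> = T (?\<Phi> R)" by (simp add: algebra_simps)
    finally have "cmod (complex_of_real R * (T (\<lambda>x. complex_of_real (scaled_cutoff R x) * \<theta> x) - T \<theta>)) \<le> C"
      using C(2)[of R] that by simp
    hence "R * cmod (T (\<lambda>x. complex_of_real (scaled_cutoff R x) * \<theta> x) - T \<theta>) \<le> C"
      using that by (simp add: norm_mult)
    thus ?thesis using that by (simp add: field_simps)
  qed
  hence le: "cmod (T (\<lambda>x. complex_of_real (scaled_cutoff (real (Suc n)) x) * \<theta> x) - T \<theta>) \<le> C * (1 / real (Suc n))" for n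
    by simp
  have "(\<lambda>n. T (\<lambda>x. complex_of_real (scaled_cutoff (real (Suc n)) x) * \<theta> x) - T \<theta>) \<longlonglongrightarrow> 0"
    by (rule Lim_null_comparison[OF always_eventually[OF allI[OF le]]])
       (use tendsto_mult_right_zero[OF LIMSEQ_Suc[OF lim_1_over_n]] in simp)
  thus ?thesis by (rule LIM_zero_cancel)
qed

lemma heat_kernel_translates:
  fixes t :: real
  assumes "t > 0"
  shows "smooth_family (rapid UNIV norm) (\<lambda>(x :: real^'n) y. complex_of_real (heat_kernel t (x - y)))"
proof -
  have "smooth_family (rapid (UNIV \<times> UNIV) (\<lambda>(i, x). \<bar>0\<bar> + norm x)) (\<lambda>(i :: unit, x) y. complex_of_real (heat_kernel t (x - y)))"
    using translation_family[OF schwartz_rapid_family[OF schwartz_heat_kernel[OF assms], of UNIV "\<lambda>_::unit. 0"]] .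
  from rapid_family_reindex[OF this, of UNIV "\<lambda>x. ((), x)" norm] show ?thesis by simp
qed

lemma schwartz_heat_translate: "t > 0 \<Longrightarrow> schwartz (\<lambda>y :: real^'n. complex_of_real (heat_kernel t (x - y)))"
  using rapid_family_schwartz[OF heat_kernel_translates] by blast

text \<open>Uniformity in R makes the truncated heat extensions a sequence dominated by one
  polynomial in x, as required in \<open>heat_pairing\<close>.\<close>

lemma tempered_cutoff_heat_bound:
  fixes T :: "(real^'n \<Rightarrow> complex) \<Rightarrow> complex"
  assumes T: "tempered_distribution T" and t: "t > 0"
  obtains C m where "C \<ge> 0" "\<And>R x. R \<ge> 1 \<Longrightarrow>
    cmod (T (\<lambda>y. complex_of_real (scaled_cutoff R y) * complex_of_real (heat_kernel t (x - y)))) \<le> C * (1 + norm x) ^ m"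
proof -
  let ?I = "{1::real..} \<times> (UNIV :: (real^'n) set)"
  have 1: "smooth_family (slow ?I (\<lambda>p. norm (snd p))) (\<lambda>p y. complex_of_real (scaled_cutoff (fst p) y))"
    by (rule smooth_family_reindex[OF scaled_cutoff_family]) auto
  have 2: "smooth_family (rapid ?I (\<lambda>p. norm (snd p))) (\<lambda>p y. complex_of_real (heat_kernel t (snd p - y)))"
    by (rule rapid_family_reindex[OF heat_kernel_translates[OF t]]) auto
  obtain C m where C: "C \<ge> 0" "\<And>p. p \<in> ?I \<Longrightarrow>
    cmod (T (\<lambda>y. complex_of_real (scaled_cutoff (fst p) y) * complex_of_real (heat_kernel t (snd p - y)))) \<le> C * (1 + \<bar>norm (snd p)\<bar>) ^ m"
    by (rule tempered_family_bound[OF T slow_rapid_family_mult[OF 1 2]]) (rule that)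
  show ?thesis
  proof (rule that[OF C(1)])
    fix R :: real and x :: "real^'n" assume "R \<ge> 1"
    thus "cmod (T (\<lambda>y. complex_of_real (scaled_cutoff R y) * complex_of_real (heat_kernel t (x - y)))) \<le> C * (1 + norm x) ^ m"
      using C(2)[of "(R, x)"] by simp
  qed
qed

text \<open>Where the coefficient does not vanish, \<open>norm z \<ge> 1\<close> and hence
  \<open>1 / t \<le> (norm z / sqrt t)\<^sup>2\<close>; the Gaussian absorbs all negative powers of
  t. Thus the tail of the kernel stays bounded in the Schwartz class as t tends to 0.\<close>

lemma heat_kernel_away_family:
  "smooth_family (rapid {0<..1} (\<lambda>_. 0))
    (\<lambda>t (z :: real^'n). complex_of_real (heat_kernel t z) * (1 - complex_of_real (cutoff z)))"
proof -
  define c where "c t = (4 * pi * t) powr (- (real CARD('n) / 2))" for t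
  define P where "P = {a :: real^'n \<Rightarrow> complex. slow_smooth a \<and> (\<forall>z. norm z < 1 \<longrightarrow> a z = 0)}"
  have "smooth_family (rapid {0<..1} (\<lambda>_. 0))
    (\<lambda>t (z :: real^'n). complex_of_real (c t) * (complex_of_real (exp (- ((norm z)\<^sup>2 / (4 * t)))) * (1 - complex_of_real (cutoff z))))"
  proof (rule gaussian_family[where P = P])
    have "slow_smooth (\<lambda>z :: real^'n. 1 + (-1) * complex_of_real (cutoff z))"
      by (intro slow_smooth_add slow_smooth_mult slow_smooth_const schwartz_slow_smooth cutoff_schwartz)
    thus "(\<lambda>z :: real^'n. 1 - complex_of_real (cutoff z)) \<in> P"
      by (auto simp: P_def cutoff_eq_1)
  next
    fix a j assume a: "a \<in> P"
    have "pd j a z = 0" if "norm z < 1" for z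
      by (rule pd_eq_0[of "ball 0 1"]) (use a that in \<open>auto simp: P_def\<close>)
    thus "pd j a \<in> P" using a by (auto simp: P_def intro: slow_smooth_pd)
    have "slow_smooth (\<lambda>z. (complex_of_real (-1/2) * complex_of_real (z $ j)) * a z)"
      using a by (intro slow_smooth_mult slow_smooth_coord slow_smooth_const) (auto simp: P_def)
    thus "(\<lambda>z. complex_of_real (- (z $ j) / 2) * a z) \<in> P" using a by (auto simp: P_def)
  next
    fix a m assume a: "a \<in> P"
    then obtain C l where C: "C \<ge> 0" "\<And>z. cmod (a z) \<le> C * (1 + norm z) ^ l"
      using slow_smooth_bound unfolding P_def by blast
    have a0: "a z = 0" if "norm z < 1" for z using a that by (simp add: P_def)
    \<comment> \<open>Counts the powers of \<open>1 / t\<close>: m from derivatives, and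
      \<open>CARD('n)\<close> as a generous bound for the normalising factor of order n / 2.\<close>
    define M where "M = m + CARD('n)"
    show "rapid {0<..1} (\<lambda>_. 0)
      (\<lambda>t z. complex_of_real (c t * (1 / t) ^ m) * (complex_of_real (exp (- ((norm z)\<^sup>2 / (4 * t)))) * a z))"
      unfolding rapid_def
    proof
      fix k
      define K where "K = C * exp ((real (k + l + 2 * M))\<^sup>2 / (4 * (1 / 4)))"
      have "(1 + norm z) ^ k * cmod (complex_of_real (c t * (1 / t) ^ m) *
          (complex_of_real (exp (- ((norm z)\<^sup>2 / (4 * t)))) * a z)) \<le> K" if t: "0 < t" "t \<le> 1" for t and z :: "real^'n"
      proof (cases "norm z < 1")
        case True
        thus ?thesis using C(1) by (simp add: a0 K_def)
      next
        case False
        define w where "w = norm z / sqrt t"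
        have "sqrt t \<le> 1" "sqrt t > 0" using t by auto
        hence w: "norm z \<le> w" "(norm z)\<^sup>2 / (4 * t) = 1 / 4 * w\<^sup>2" "w \<ge> 0"
          using t by (auto simp: w_def power_divide field_simps mult_left_le_one_le)
        have "1 \<le> (norm z)\<^sup>2" using False by (simp add: power2_eq_square) (metis less_eq_real_def linorder_not_less mult_mono' mult_1 zero_le_one)
        hence "1 / t \<le> w\<^sup>2" using t by (simp add: w_def power_divide divide_right_mono)
        also have "\<dots> \<le> (1 + w)\<^sup>2" using w by (intro power_mono) auto
        finally have "(1 / t) ^ M \<le> ((1 + w)\<^sup>2) ^ M" using t by (intro power_mono) auto
        hence tM: "(1 / t) ^ M \<le> (1 + w) ^ (2 * M)" by (simp add: power_mult)
        have "c t \<le> (1 / t) ^ CARD('n)"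
        proof -
          have "t * 1 \<le> t * (4 * pi)" using t pi_gt3 by (intro mult_left_mono) auto
          hence "c t \<le> t powr (- (real CARD('n) / 2))" unfolding c_def
            using t by (intro powr_mono2') (auto simp: mult_ac)
          also have "\<dots> = (1 / t) powr (real CARD('n) / 2)" using t by (simp add: powr_minus_divide powr_divide)
          also have "\<dots> \<le> (1 / t) powr (real CARD('n))" using t by (intro powr_mono) auto
          also have "\<dots> = (1 / t) ^ CARD('n)" using t by (intro powr_realpow) auto
          finally show ?thesis .
        qed
        hence "c t * (1 / t) ^ m \<le> (1 / t) ^ CARD('n) * (1 / t) ^ m" using t by (intro mult_right_mono) auto
        also have "\<dots> = (1 / t) ^ M" by (simp add: M_def power_add mult.commute)
        finally have ct: "c t * (1 / t) ^ m \<le> (1 + w) ^ (2 * M)" using tM by simp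
        have c0: "c t \<ge> 0" by (simp add: c_def)
        have "(1 + norm z) ^ k * cmod (complex_of_real (c t * (1 / t) ^ m) *
          (complex_of_real (exp (- ((norm z)\<^sup>2 / (4 * t)))) * a z))
          = (1 + norm z) ^ k * ((c t * (1 / t) ^ m) * (exp (- (1 / 4 * w\<^sup>2)) * cmod (a z)))"
          using t c0 by (simp add: norm_mult norm_power norm_divide w(2))
        also have "\<dots> \<le> (1 + w) ^ k * ((1 + w) ^ (2 * M) * (exp (- (1 / 4 * w\<^sup>2)) * (C * (1 + w) ^ l)))"
        proof (intro mult_mono ct power_mono)
          have "C * (1 + norm z) ^ l \<le> C * (1 + w) ^ l" using C(1) w by (intro mult_left_mono power_mono) auto
          thus "cmod (a z) \<le> C * (1 + w) ^ l" using C(2)[of z] by linarith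
        qed (use w t c0 C(1) in auto)
        also have "\<dots> = C * ((1 + w) ^ (k + l + 2 * M) * exp (- (1 / 4 * w\<^sup>2)))" by (simp add: power_add mult_ac)
        also have "\<dots> \<le> K" unfolding K_def by (intro mult_left_mono weight_gauss_le w C(1)) auto
        finally show ?thesis .
      qed
      thus "\<exists>C n. \<forall>i\<in>{0<..1}. \<forall>x. (1 + norm x) ^ k * cmod (complex_of_real (c i * (1 / i) ^ m) *
          (complex_of_real (exp (- ((norm x)\<^sup>2 / (4 * i)))) * a x)) \<le> C * (1 + \<bar>0\<bar>) ^ n"
        by (intro exI[of _ K] exI[of _ 0]) auto
    qed
  qed (auto simp: rapid_plus_closed P_def intro: slow_smooth_smooth)
  thus ?thesis by (simp add: heat_kernel_def c_def mult_ac)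
qed

subsection \<open>Distributions given by locally integrable functions\<close>

text \<open>A Borel version of \<open>given_by\<close>: measurability with respect to \<open>borel\<close> is needed for Fubini's
  theorem.\<close>

definition represents :: "((real^'n \<Rightarrow> complex) \<Rightarrow> complex) \<Rightarrow> (real^'n \<Rightarrow> real) \<Rightarrow> bool" where
  "represents T f \<longleftrightarrow> f \<in> borel_measurable borel \<and>
     (\<forall>K. compact K \<longrightarrow> set_integrable lborel K f) \<and>
     (\<forall>\<phi>. test_function \<phi> \<longrightarrow> T \<phi> = (LINT x|lborel. complex_of_real (f x) * \<phi> x))"

lemma test_function_borel: "test_function \<phi> \<Longrightarrow> \<phi> \<in> borel_measurable borel"
  by (intro smooth_borel) (simp add: test_function_def)

lemma given_by_represents:
  fixes f :: "real^'n \<Rightarrow> real"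
  assumes g: "given_by T f"
  obtains f0 where "represents T f0" "AE x in lborel. f x = f0 x"
proof -
  have si: "set_integrable lebesgue K f" if "compact K" for K using g that by (simp add: given_by_def)
  \<comment> \<open>Measurability is recovered from integrability on the balls of integer radius,
    which exhaust the space.\<close>
  have "f \<in> borel_measurable lebesgue"
  proof (rule borel_measurable_LIMSEQ_metric)
    show "(\<lambda>x. indicator (cball 0 (real n)) x *\<^sub>R f x) \<in> borel_measurable lebesgue" for n
      using si[OF compact_cball] unfolding set_integrable_def by (rule borel_measurable_integrable)
    show "(\<lambda>n. indicator (cball 0 (real n)) x *\<^sub>R f x) \<longlonglongrightarrow> f x" for x
    proof (rule tendsto_eventually)
      obtain N where "norm x \<le> real N" using real_arch_simple by blast
      thus "\<forall>\<^sub>F n in sequentially. indicator (cball 0 (real n)) x *\<^sub>R f x = f x"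
        unfolding eventually_sequentially by (intro exI[of _ N]) (auto simp: indicator_def)
    qed
  qed
  then obtain f0 where f0: "f0 \<in> borel_measurable lborel" "AE x in lborel. f x = f0 x"
    using completion_ex_borel_measurable_real by blast
  have [measurable]: "f0 \<in> borel_measurable borel" using f0 by simp
  have ae: "AE x in lebesgue. f x = f0 x" using f0(2) by (rule AE_completion)
  have "represents T f0" unfolding represents_def
  proof (intro conjI allI impI)
    fix K :: "(real^'n) set" assume K: "compact K"
    have [measurable]: "K \<in> sets borel" using K by (intro borel_closed compact_imp_closed)
    have "integrable lebesgue (\<lambda>x. indicator K x *\<^sub>R f0 x)"
      by (rule integrable_cong_AE_imp[OF si[OF K, unfolded set_integrable_def]])
         (use ae in \<open>auto intro!: measurable_completion\<close>)
    thus "set_integrable lborel K f0" unfolding set_integrable_def by (subst (asm) integrable_completion) auto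
  next
    fix \<phi> :: "real^'n \<Rightarrow> complex" assume \<phi>: "test_function \<phi>"
    have [measurable]: "\<phi> \<in> borel_measurable borel" by (rule test_function_borel[OF \<phi>])
    have "T \<phi> = (LINT x|lebesgue. complex_of_real (f x) * \<phi> x)" using g \<phi> by (simp add: given_by_def)
    also have "\<dots> = (LINT x|lebesgue. complex_of_real (f0 x) * \<phi> x)"
    proof (rule integral_cong_AE)
      show "(\<lambda>x. complex_of_real (f0 x) * \<phi> x) \<in> borel_measurable lebesgue" by (rule measurable_completion) measurable
      have "\<phi> \<in> borel_measurable lebesgue" by (rule measurable_completion) measurable
      thus "(\<lambda>x. complex_of_real (f x) * \<phi> x) \<in> borel_measurable lebesgue"
        using \<open>f \<in> borel_measurable lebesgue\<close> by measurable
    qed (use ae in auto)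
    also have "\<dots> = (LINT x|lborel. complex_of_real (f0 x) * \<phi> x)" by (rule lebesgue_integral_lborel) measurable
    finally show "T \<phi> = (LINT x|lborel. complex_of_real (f0 x) * \<phi> x)" .
  qed measurable
  thus ?thesis using that f0(2) by blast
qed

lemma scaled_cutoff_borel [measurable]: "(scaled_cutoff R :: real^'n \<Rightarrow> real) \<in> borel_measurable borel"
proof -
  have "(\<lambda>x :: real^'n. Re (complex_of_real (scaled_cutoff R x))) \<in> borel_measurable borel"
    using smooth_borel[OF partials_scaled_cutoff(1)] by measurable
  thus ?thesis by simp
qed

lemma scaled_cutoff_bounds: "0 \<le> scaled_cutoff R x" "scaled_cutoff R x \<le> 1"
  by (auto simp: scaled_cutoff_def cutoff_nonneg cutoff_le_1)

locale represented_distribution =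
  fixes T :: "(real^'n \<Rightarrow> complex) \<Rightarrow> complex" and f :: "real^'n \<Rightarrow> real"
  assumes tempered: "tempered_distribution T" and repr: "represents T f"
begin

lemma f_borel [measurable]: "f \<in> borel_measurable borel"
  using repr by (simp add: represents_def)

lemma f_ball_integrable: "integrable lborel (\<lambda>x. indicator (cball 0 R) x * f x)"
  using repr compact_cball[of 0 R] unfolding represents_def set_integrable_def by auto

lemma cutoff_integrable:
  assumes "R > 0"
  shows "integrable lborel (\<lambda>y. f y * scaled_cutoff R y)"
proof (rule Bochner_Integration.integrable_bound[OF f_ball_integrable[of "2 * R"]])
  show "AE x in lborel. norm (f x * scaled_cutoff R x) \<le> norm (indicator (cball 0 (2 * R)) x * f x)"
  proof (rule AE_I2)
    fix x
    show "norm (f x * scaled_cutoff R x) \<le> norm (indicator (cball 0 (2 * R)) x * f x)"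
    proof (cases "norm x \<le> 2 * R")
      case True
      thus ?thesis using scaled_cutoff_bounds[of R x] by (auto simp: abs_mult mult_right_le_one_le)
    next
      case False
      hence "norm ((1 / R) *\<^sub>R x) \<ge> 2" using assms(1) by (simp add: field_simps)
      thus ?thesis by (simp add: scaled_cutoff_def cutoff_eq_0)
    qed
  qed
qed measurable

text \<open>The heat kernel has no compact support, so \<open>heat_conv t T\<close> is reached as the limit of integrals
  against truncated kernels.\<close>

definition trunc_heat :: "nat \<Rightarrow> real \<Rightarrow> real^'n \<Rightarrow> real" where
  "trunc_heat n t x = (LINT y|lborel. f y * (scaled_cutoff (real (Suc n)) y * heat_kernel t (x - y)))"

text \<open>Nothing is lost by the real part, see \<open>heat_conv_eq\<close>: T is given by a real
  function. The value 0 at nonpositive times makes joint measurability hold over all of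
  \<open>real\<close>.\<close>

definition heat :: "real \<Rightarrow> real^'n \<Rightarrow> real" where
  "heat t x = (if t > 0 then Re (heat_conv t T x) else 0)"

lemma cutoff_eq:
  assumes "R > 0" "smooth \<theta>"
  shows "T (\<lambda>y. complex_of_real (scaled_cutoff R y) * \<theta> y)
    = (LINT y|lborel. complex_of_real (f y) * (complex_of_real (scaled_cutoff R y) * \<theta> y))"
  using repr scaled_cutoff_mult_test_function[OF assms] by (simp add: represents_def)

lemma trunc_heat_eq:
  assumes "t > 0"
  shows "T (\<lambda>y. complex_of_real (scaled_cutoff (real (Suc n)) y) * complex_of_real (heat_kernel t (x - y)))
    = complex_of_real (trunc_heat n t x)"
  unfolding trunc_heat_def
  by (subst cutoff_eq[OF _ schwartz_smooth[OF schwartz_heat_translate[OF assms]]])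
     (simp_all flip: integral_complex_of_real)

lemma trunc_heat_tendsto_complex:
  assumes "t > 0"
  shows "(\<lambda>n. complex_of_real (trunc_heat n t x)) \<longlonglongrightarrow> heat_conv t T x"
  using tempered_cutoff_tendsto[OF tempered schwartz_heat_translate[OF assms], of x]
  unfolding trunc_heat_eq[OF assms] heat_conv_def .

lemma trunc_heat_tendsto:
  assumes "t > 0" shows "(\<lambda>n. trunc_heat n t x) \<longlonglongrightarrow> heat t x"
  using tendsto_Re[OF trunc_heat_tendsto_complex[OF assms, of x]] assms by (simp add: heat_def)

lemma heat_conv_eq:
  assumes "t > 0" shows "heat_conv t T x = complex_of_real (heat t x)"
  using LIMSEQ_unique[OF trunc_heat_tendsto_complex[OF assms] tendsto_of_real[OF trunc_heat_tendsto[OF assms]]] .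

lemma heat_borel [measurable]: "(\<lambda>(t, x). heat t x) \<in> borel_measurable (borel \<Otimes>\<^sub>M borel)"
proof (rule borel_measurable_LIMSEQ_metric)
  have "(\<lambda>p. LINT y|lborel. f y * (scaled_cutoff (real (Suc n)) y * heat_kernel (fst p) (snd p - y)))
      \<in> borel_measurable (borel \<Otimes>\<^sub>M borel)" for n
    by (rule lborel.borel_measurable_lebesgue_integral) measurable
  thus "(\<lambda>(t, x). if t > 0 then trunc_heat n t x else 0) \<in> borel_measurable (borel \<Otimes>\<^sub>M borel)" for n
    unfolding trunc_heat_def split_beta' by measurable
  show "(\<lambda>n. (\<lambda>(t, x). if t > 0 then trunc_heat n t x else 0) p) \<longlonglongrightarrow> (\<lambda>(t, x). heat t x) p" for p
    using trunc_heat_tendsto[of "fst p" "snd p"] by (cases "fst p > 0") (auto simp: split_beta' heat_def)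
qed

lemma heat_bound:
  assumes "t > 0"
  obtains C m where "C \<ge> 0" "\<And>n x. \<bar>trunc_heat n t x\<bar> \<le> C * (1 + norm x) ^ m" "\<And>x. \<bar>heat t x\<bar> \<le> C * (1 + norm x) ^ m"
proof -
  obtain C m where C: "C \<ge> 0" "\<And>R x. R \<ge> 1 \<Longrightarrow>
    cmod (T (\<lambda>y. complex_of_real (scaled_cutoff R y) * complex_of_real (heat_kernel t (x - y)))) \<le> C * (1 + norm x) ^ m"
    by (rule tempered_cutoff_heat_bound[OF tempered assms]) (rule that)
  have 1: "\<bar>trunc_heat n t x\<bar> \<le> C * (1 + norm x) ^ m" for n x
    using C(2)[of "real (Suc n)" x] unfolding trunc_heat_eq[OF assms] by simp
  have "\<bar>heat t x\<bar> \<le> C * (1 + norm x) ^ m" for x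
    using tendsto_rabs[OF trunc_heat_tendsto[OF assms, of x]] 1 by (intro LIMSEQ_le_const2) auto
  thus ?thesis using that C(1) 1 by blast
qed

lemma heat_kernel_bounded: "heat_kernel t (x :: real^'n) \<le> (4 * pi * t) powr (- (real CARD('n) / 2))" if "t > 0"
  using that by (simp add: heat_kernel_def mult_left_le)

text \<open>Fubini is applied to the truncations, where f times a cutoff is integrable. Then the
  functional side converges by \<open>tempered_cutoff_tendsto\<close>, and the integral side by
  domination with the polynomial bound, which is uniform in n.\<close>

lemma heat_pairing:
  assumes t: "t > 0" and \<psi>: "schwartz \<psi>"
  shows "integrable lborel (\<lambda>x. complex_of_real (heat t x) * \<psi> x)"
    and "T (conv (heat_kernel t) \<psi>) = (LINT x|lborel. complex_of_real (heat t x) * \<psi> x)"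
proof -
  have [measurable]: "\<psi> \<in> borel_measurable borel" by (rule schwartz_borel[OF \<psi>])
  obtain C m where C: "C \<ge> 0" "\<And>n x. \<bar>trunc_heat n t x\<bar> \<le> C * (1 + norm x) ^ m" "\<And>x. \<bar>heat t x\<bar> \<le> C * (1 + norm x) ^ m"
    using heat_bound[OF t] by blast
  have w: "integrable lborel (\<lambda>x. C * ((1 + norm x) ^ m * cmod (\<psi> x)))"
    by (intro integrable_mult_right schwartz_weight_integrable \<psi>)
  show int: "integrable lborel (\<lambda>x. complex_of_real (heat t x) * \<psi> x)"
    by (rule Bochner_Integration.integrable_bound[OF w])
       (use C in \<open>auto simp: norm_mult abs_mult mult.assoc[symmetric] intro!: mult_right_mono\<close>)
  let ?M = "(4 * pi * t) powr (- (real CARD('n) / 2))"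
  have conv_eq: "conv (heat_kernel t) \<psi> y = (LINT x|lborel. complex_of_real (heat_kernel t (x - y)) * \<psi> x)" for y
    unfolding conv_def
    using lborel_reflect(1)[of "\<lambda>x. complex_of_real (heat_kernel t (x - y)) * \<psi> x" y]
    by (simp add: heat_kernel_minus[of t _ y] heat_kernel_def)
  have trunc: "T (\<lambda>y. complex_of_real (scaled_cutoff (real (Suc n)) y) * conv (heat_kernel t) \<psi> y)
    = (LINT x|lborel. complex_of_real (trunc_heat n t x) * \<psi> x)" for n
  proof -
    let ?\<chi> = "scaled_cutoff (real (Suc n))"
    have "T (\<lambda>y. complex_of_real (?\<chi> y) * conv (heat_kernel t) \<psi> y)
      = (LINT y|lborel. complex_of_real (f y) * (complex_of_real (?\<chi> y) * conv (heat_kernel t) \<psi> y))"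
      by (intro cutoff_eq schwartz_smooth heat_conv_schwartz t \<psi>) simp
    also have "\<dots> = (LINT y|lborel. LINT x|lborel. complex_of_real (f y * ?\<chi> y) * (complex_of_real (heat_kernel t (x - y)) * \<psi> x))"
      unfolding conv_eq by (simp add: mult.assoc)
    also have "\<dots> = (LINT x|lborel. LINT y|lborel. complex_of_real (f y * ?\<chi> y) * (complex_of_real (heat_kernel t (x - y)) * \<psi> x))"
    proof (rule fubini_dominated(1))
      show "integrable lborel (\<lambda>y. \<bar>f y * ?\<chi> y\<bar>)" by (intro integrable_abs cutoff_integrable) simp
      show "integrable lborel (\<lambda>x. ?M * cmod (\<psi> x))"
        by (intro integrable_mult_right integrable_norm schwartz_integrable \<psi>)
      show "cmod (complex_of_real (f y * ?\<chi> y) * (complex_of_real (heat_kernel t (x - y)) * \<psi> x))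
        \<le> \<bar>f y * ?\<chi> y\<bar> * (?M * cmod (\<psi> x))" for x y
        unfolding norm_mult norm_of_real abs_mult
        by (intro mult_left_mono mult_right_mono)
           (use heat_kernel_bounded[OF t, of "x - y"] in \<open>auto simp: heat_kernel_nonneg\<close>)
    qed measurable
    also have "\<dots> = (LINT x|lborel. complex_of_real (trunc_heat n t x) * \<psi> x)"
    proof (rule Bochner_Integration.integral_cong[OF refl])
      fix x
      have "(LINT y|lborel. complex_of_real (f y * ?\<chi> y) * (complex_of_real (heat_kernel t (x - y)) * \<psi> x))
        = (LINT y|lborel. complex_of_real (f y * (?\<chi> y * heat_kernel t (x - y))) * \<psi> x)"
        by (simp add: mult_ac)
      also have "\<dots> = complex_of_real (trunc_heat n t x) * \<psi> x"
        by (simp only: integral_mult_left_zero integral_complex_of_real trunc_heat_def)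
      finally show "(LINT y|lborel. complex_of_real (f y * ?\<chi> y) * (complex_of_real (heat_kernel t (x - y)) * \<psi> x))
        = complex_of_real (trunc_heat n t x) * \<psi> x" .
    qed
    finally show ?thesis .
  qed
  have [measurable]: "trunc_heat n t \<in> borel_measurable borel" for n
    unfolding trunc_heat_def[abs_def] by measurable
  have "(\<lambda>n. LINT x|lborel. complex_of_real (trunc_heat n t x) * \<psi> x) \<longlonglongrightarrow> (LINT x|lborel. complex_of_real (heat t x) * \<psi> x)"
  proof (rule integral_dominated_convergence[OF _ _ w])
    show "AE x in lborel. (\<lambda>n. complex_of_real (trunc_heat n t x) * \<psi> x) \<longlonglongrightarrow> complex_of_real (heat t x) * \<psi> x"
      by (intro AE_I2 tendsto_mult_right tendsto_of_real trunc_heat_tendsto t)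
    show "AE x in lborel. cmod (complex_of_real (trunc_heat n t x) * \<psi> x) \<le> C * ((1 + norm x) ^ m * cmod (\<psi> x))" for n
      using C by (auto simp: norm_mult mult.assoc[symmetric] intro!: mult_right_mono)
  qed measurable
  moreover have "(\<lambda>n. LINT x|lborel. complex_of_real (trunc_heat n t x) * \<psi> x) \<longlonglongrightarrow> T (conv (heat_kernel t) \<psi>)"
    using tempered_cutoff_tendsto[OF tempered heat_conv_schwartz[OF t \<psi>]] unfolding trunc .
  ultimately show "T (conv (heat_kernel t) \<psi>) = (LINT x|lborel. complex_of_real (heat t x) * \<psi> x)"
    by (intro LIMSEQ_unique)
qed

text \<open>The truncations obey the bound because the cutoff lies between 0 and 1, and the limit
  preserves it. The right side may be infinite, since f is only locally integrable.\<close>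

lemma heat_le_nn_integral:
  assumes t: "t > 0"
  shows "ennreal \<bar>heat t x\<bar> \<le> (\<integral>\<^sup>+y. ennreal (\<bar>f y\<bar> * heat_kernel t (x - y)) \<partial>lborel)" (is "_ \<le> ?R")
proof (cases "?R = \<infinity>")
  case False
  then obtain r where r: "?R = ennreal r" "r \<ge> 0" by (cases ?R) auto
  have "\<bar>trunc_heat n t x\<bar> \<le> r" for n
  proof -
    let ?F = "\<lambda>y. f y * (scaled_cutoff (real (Suc n)) y * heat_kernel t (x - y))"
    have "ennreal \<bar>trunc_heat n t x\<bar> \<le> (\<integral>\<^sup>+y. ennreal (norm (?F y)) \<partial>lborel)"
    proof (cases "integrable lborel ?F")
      case True
      thus ?thesis unfolding trunc_heat_def using integral_norm_bound_ennreal[OF True] by simp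
    qed (simp add: trunc_heat_def not_integrable_integral_eq)
    also have "\<dots> \<le> ?R"
    proof (rule nn_integral_mono)
      fix y
      have "\<bar>f y\<bar> * (scaled_cutoff (real (Suc n)) y * heat_kernel t (x - y)) \<le> \<bar>f y\<bar> * (1 * heat_kernel t (x - y))"
        by (intro mult_left_mono mult_right_mono scaled_cutoff_bounds heat_kernel_nonneg) auto
      thus "ennreal (norm (?F y)) \<le> ennreal (\<bar>f y\<bar> * heat_kernel t (x - y))"
        by (intro ennreal_leI) (simp add: abs_mult scaled_cutoff_bounds heat_kernel_nonneg)
    qed
    finally show ?thesis using r by simp
  qed
  hence "\<bar>heat t x\<bar> \<le> r"
    using tendsto_rabs[OF trunc_heat_tendsto[OF t, of x]] by (intro LIMSEQ_le_const2) auto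
  thus ?thesis using r by (simp add: ennreal_leI)
qed simp

text \<open>A cutoff centred at x splits the kernel: the near part is a test function, on which T
  integrates against f over a fixed ball; the far part is bounded, uniformly for small times,
  through \<open>heat_kernel_away_family\<close>.\<close>

lemma heat_split_bound:
  fixes \<rho> :: real
  obtains D where "D \<ge> 0" "\<And>t x. 0 < t \<Longrightarrow> t \<le> 1 \<Longrightarrow> norm x \<le> \<rho> \<Longrightarrow>
    ennreal \<bar>heat t x\<bar> \<le> (\<integral>\<^sup>+y. ennreal (\<bar>indicator (cball 0 (\<rho> + 2)) y * f y\<bar> * heat_kernel t (x - y)) \<partial>lborel) + ennreal D"
proof -
  let ?\<Phi> = "\<lambda>t z :: real^'n. complex_of_real (heat_kernel t z) * (1 - complex_of_real (cutoff z))"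
  obtain C m where C: "C \<ge> 0" "\<And>p. p \<in> {0<..1} \<times> UNIV \<Longrightarrow>
      cmod (T ((\<lambda>(i, x) y. ?\<Phi> i (x - y)) p)) \<le> C * (1 + \<bar>(\<lambda>(i, x). \<bar>0::real\<bar> + norm x) p\<bar>) ^ m"
    by (rule tempered_family_bound[OF tempered translation_family[OF heat_kernel_away_family]]) (rule that)
  define D where "D = C * (1 + \<bar>\<rho>\<bar>) ^ m"
  have "ennreal \<bar>heat t x\<bar> \<le> (\<integral>\<^sup>+y. ennreal (\<bar>indicator (cball 0 (\<rho> + 2)) y * f y\<bar> * heat_kernel t (x - y)) \<partial>lborel) + ennreal D"
    if t: "0 < t" "t \<le> 1" and x: "norm x \<le> \<rho>" for t x
  proof -
    let ?near = "\<lambda>y. complex_of_real (cutoff (x - y)) * complex_of_real (heat_kernel t (x - y))"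
    have sm: "smooth ?near"
      using smooth_mult[OF partials_affine(1)[OF cutoff_smooth, of x "-1"] schwartz_smooth[OF schwartz_heat_translate[OF t(1), of x]]] by simp
    have tf: "test_function ?near"
    proof (rule test_functionI[OF sm])
      fix y :: "real^'n" assume "norm y > norm x + 2"
      hence "norm (x - y) \<ge> 2" using norm_triangle_ineq2[of y x] by (simp add: norm_minus_commute)
      thus "?near y = 0" by (simp add: cutoff_eq_0)
    qed
    have far: "schwartz (\<lambda>y. ?\<Phi> t (x - y))"
      by (rule schwartz_reflect) (rule rapid_family_schwartz[OF heat_kernel_away_family], use t in simp)
    have "heat_conv t T x = T (\<lambda>y. ?near y + ?\<Phi> t (x - y))"
      unfolding heat_conv_def by (simp add: algebra_simps)
    also have "\<dots> = T ?near + T (\<lambda>y. ?\<Phi> t (x - y))"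
      by (rule tempered_add[OF tempered test_function_schwartz[OF tf] far])
    finally have "cmod (heat_conv t T x) \<le> cmod (T ?near) + cmod (T (\<lambda>y. ?\<Phi> t (x - y)))"
      by (simp add: norm_triangle_ineq)
    moreover have "cmod (T (\<lambda>y. ?\<Phi> t (x - y))) \<le> D"
    proof -
      have "cmod (T (\<lambda>y. ?\<Phi> t (x - y))) \<le> C * (1 + norm x) ^ m" using C(2)[of "(t, x)"] t by simp
      also have "\<dots> \<le> D" unfolding D_def using C(1) x by (intro mult_left_mono power_mono) auto
      finally show ?thesis .
    qed
    ultimately have "\<bar>heat t x\<bar> \<le> cmod (T ?near) + D" using heat_conv_eq[OF t(1)] by simp
    hence "ennreal \<bar>heat t x\<bar> \<le> ennreal (cmod (T ?near) + D)" by (rule ennreal_leI)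
    also have "\<dots> = ennreal (cmod (T ?near)) + ennreal D"
      by (rule ennreal_plus) (use C(1) in \<open>auto simp: D_def\<close>)
    finally have "ennreal \<bar>heat t x\<bar> \<le> ennreal (cmod (T ?near)) + ennreal D" .
    moreover have "ennreal (cmod (T ?near)) \<le> (\<integral>\<^sup>+y. ennreal (\<bar>indicator (cball 0 (\<rho> + 2)) y * f y\<bar> * heat_kernel t (x - y)) \<partial>lborel)"
    proof -
      let ?F = "\<lambda>y. complex_of_real (f y) * ?near y"
      have "T ?near = (LINT y|lborel. ?F y)" using repr tf by (simp add: represents_def)
      hence "ennreal (cmod (T ?near)) \<le> (\<integral>\<^sup>+y. ennreal (cmod (?F y)) \<partial>lborel)"
        using integral_norm_bound_ennreal[of lborel ?F] by (cases "integrable lborel ?F") (auto simp: not_integrable_integral_eq)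
      also have "\<dots> \<le> (\<integral>\<^sup>+y. ennreal (\<bar>indicator (cball 0 (\<rho> + 2)) y * f y\<bar> * heat_kernel t (x - y)) \<partial>lborel)"
      proof (intro nn_integral_mono ennreal_leI)
        fix y :: "real^'n"
        show "cmod (?F y) \<le> \<bar>indicator (cball 0 (\<rho> + 2)) y * f y\<bar> * heat_kernel t (x - y)"
        proof (cases "norm y \<le> \<rho> + 2")
          case True
          have "\<bar>f y\<bar> * (cutoff (x - y) * heat_kernel t (x - y)) \<le> \<bar>f y\<bar> * (1 * heat_kernel t (x - y))"
            by (intro mult_left_mono mult_right_mono cutoff_le_1 heat_kernel_nonneg) auto
          thus ?thesis using True by (simp add: norm_mult heat_kernel_nonneg cutoff_nonneg)
        next
          case False
          hence "norm (x - y) \<ge> 2" using norm_triangle_ineq2[of y x] x by (simp add: norm_minus_commute)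
          thus ?thesis by (simp add: cutoff_eq_0 heat_kernel_nonneg)
        qed
      qed
      finally show ?thesis .
    qed
    ultimately show ?thesis by (meson add_right_mono order_trans)
  qed
  moreover have "D \<ge> 0" using C(1) by (simp add: D_def)
  ultimately show ?thesis using that by blast
qed

text \<open>The near part of \<open>heat_split_bound\<close> is integrated by Tonelli, the kernel
  having mass 1. This is the estimate that makes the time integral defining \<open>u\<close>
  converge locally in L1 near time 0.\<close>

lemma heat_local_bound:
  obtains C where "C \<ge> 0" "\<And>t. 0 < t \<Longrightarrow> t \<le> 1 \<Longrightarrow> (\<integral>\<^sup>+x. ennreal \<bar>heat t x\<bar> * indicator (cball 0 \<rho>) x \<partial>lborel) \<le> ennreal C"
proof -
  obtain D where D: "D \<ge> 0" "\<And>t x. 0 < t \<Longrightarrow> t \<le> 1 \<Longrightarrow> norm x \<le> \<rho> \<Longrightarrow>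
    ennreal \<bar>heat t x\<bar> \<le> (\<integral>\<^sup>+y. ennreal (\<bar>indicator (cball 0 (\<rho> + 2)) y * f y\<bar> * heat_kernel t (x - y)) \<partial>lborel) + ennreal D"
    using heat_split_bound by blast
  define g where "g y = \<bar>indicator (cball 0 (\<rho> + 2)) y * f y\<bar>" for y
  have gi: "integrable lborel g" unfolding g_def by (intro integrable_abs f_ball_integrable)
  have [measurable]: "g \<in> borel_measurable borel" using gi by simp
  have [measurable]: "(cball 0 r :: (real^'n) set) \<in> sets borel" for r by simp
  have g0: "g y \<ge> 0" for y by (simp add: g_def)
  have fin: "emeasure lborel (cball 0 \<rho> :: (real^'n) set) < \<infinity>" by (intro emeasure_bounded_finite bounded_cball)
  define V where "V = measure lborel (cball 0 \<rho> :: (real^'n) set)"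
  have "(\<integral>\<^sup>+x. ennreal \<bar>heat t x\<bar> * indicator (cball 0 \<rho>) x \<partial>lborel) \<le> ennreal ((LINT y|lborel. g y) + D * V)"
    if t: "0 < t" "t \<le> 1" for t
  proof -
    have "(\<integral>\<^sup>+x. ennreal \<bar>heat t x\<bar> * indicator (cball 0 \<rho>) x \<partial>lborel)
      \<le> (\<integral>\<^sup>+x. (\<integral>\<^sup>+y. ennreal (g y * heat_kernel t (x - y)) \<partial>lborel) + ennreal D * indicator (cball 0 \<rho>) x \<partial>lborel)"
    proof (rule nn_integral_mono)
      fix x :: "real^'n"
      show "ennreal \<bar>heat t x\<bar> * indicator (cball 0 \<rho>) x
        \<le> (\<integral>\<^sup>+y. ennreal (g y * heat_kernel t (x - y)) \<partial>lborel) + ennreal D * indicator (cball 0 \<rho>) x"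
        using D(2)[OF t, of x] unfolding g_def by (auto simp: indicator_def)
    qed
    also have "\<dots> = (\<integral>\<^sup>+x. (\<integral>\<^sup>+y. ennreal (g y * heat_kernel t (x - y)) \<partial>lborel) \<partial>lborel) + (\<integral>\<^sup>+x. ennreal D * indicator (cball 0 \<rho> :: (real^'n) set) x \<partial>lborel)"
      by (rule nn_integral_add) measurable
    also have "(\<integral>\<^sup>+x. (\<integral>\<^sup>+y. ennreal (g y * heat_kernel t (x - y)) \<partial>lborel) \<partial>lborel)
      = (\<integral>\<^sup>+y. (\<integral>\<^sup>+x. ennreal (g y * heat_kernel t (x - y)) \<partial>lborel) \<partial>lborel)"
      by (rule lborel_pair.Fubini') measurable
    also have "\<dots> = (\<integral>\<^sup>+y. ennreal (g y) \<partial>lborel)"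
    proof (rule nn_integral_cong)
      fix y :: "real^'n"
      have "(\<integral>\<^sup>+x. ennreal (g y * heat_kernel t (x - y)) \<partial>lborel) = ennreal (g y) * (\<integral>\<^sup>+x. ennreal (heat_kernel t (y - x)) \<partial>lborel)"
        by (simp add: ennreal_mult heat_kernel_nonneg nn_integral_cmult heat_kernel_minus[of t _ y] g0)
      also have "(\<integral>\<^sup>+x. ennreal (heat_kernel t (y - x)) \<partial>lborel) = (\<integral>\<^sup>+x. ennreal (heat_kernel t (x :: real^'n)) \<partial>lborel)"
        by (rule nn_lborel_reflect) measurable
      also have "\<dots> = 1"
        using heat_kernel_integral[OF t(1), where 'n = 'n] heat_kernel_integrable[OF t(1), where 'n = 'n]
        by (subst nn_integral_eq_integral) (auto simp: heat_kernel_nonneg)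
      finally show "(\<integral>\<^sup>+x. ennreal (g y * heat_kernel t (x - y)) \<partial>lborel) = ennreal (g y)" by simp
    qed
    also have "\<dots> = ennreal (LINT y|lborel. g y)" using gi g0 by (subst nn_integral_eq_integral) auto
    also have "(\<integral>\<^sup>+x. ennreal D * indicator (cball 0 \<rho> :: (real^'n) set) x \<partial>lborel) = ennreal (D * V)"
      using D(1) fin by (simp add: nn_integral_cmult_indicator V_def ennreal_mult emeasure_eq_ennreal_measure)
    finally show ?thesis using D(1) g0 by (simp add: V_def ennreal_plus)
  qed
  thus ?thesis using that[of "(LINT y|lborel. g y) + D * V"] D(1) g0 by (simp add: V_def)
qed

end

subsection \<open>Power weights on the half line\<close>

text \<open>Turns evaluated gauge integrals of nonnegative functions into Lebesgue integrals;
  \<open>S'\<close> allows endpoints to be added or dropped.\<close>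

lemma nonneg_has_integral_lborel:
  fixes f :: "real \<Rightarrow> real"
  assumes [measurable]: "f \<in> borel_measurable borel" "S \<in> sets borel"
    and nonneg: "\<And>x. x \<in> S \<Longrightarrow> 0 \<le> f x" and int: "(f has_integral I) S" and S': "S' \<in> sets borel" "AE x in lborel. x \<in> S \<longleftrightarrow> x \<in> S'"
  shows "integrable lborel (\<lambda>x. indicator S' x * f x)" "(LINT x|lborel. indicator S' x * f x) = I"
proof -
  have [measurable]: "S' \<in> sets borel" by (rule S')
  have hb: "has_bochner_integral lborel (\<lambda>x. indicator S x * f x) I"
  proof (rule has_bochner_integral_nn_integral)
    have "((\<lambda>x. indicator S x * f x) has_integral I) UNIV"
    proof -
      have "(\<lambda>x. indicator S x * f x) = (\<lambda>x. if x \<in> S then f x else 0)" by (auto simp: indicator_def)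
      thus ?thesis using int by (simp only: has_integral_restrict_UNIV)
    qed
    hence "(\<integral>\<^sup>+x. ennreal (indicator S x * f x) \<partial>lborel) = ennreal I"
      by (intro nn_integral_has_integral_lborel) (auto simp: indicator_def nonneg)
    thus "(\<integral>\<^sup>+x. ennreal (indicator S x * f x) \<partial>lborel) = ennreal I" .
    show "0 \<le> I" using has_integral_nonneg[OF int] nonneg by blast
  qed (auto simp: indicator_def nonneg)
  have ae: "AE x in lborel. indicator S x * f x = indicator S' x * f x"
    using S'(2) by eventually_elim (auto simp: indicator_def)
  have "has_bochner_integral lborel (\<lambda>x. indicator S' x * f x) I"
    by (rule has_bochner_integral_cong_AE[THEN iffD1, OF _ _ ae hb]) measurable
  thus "integrable lborel (\<lambda>x. indicator S' x * f x)" "(LINT x|lborel. indicator S' x * f x) = I"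
    by (auto simp: has_bochner_integral_iff)
qed

lemma AE_lborel_neq: "AE x in lborel. x \<noteq> (c::real)"
  by (rule AE_lborel_singleton)

lemma powr_weight_0:
  assumes "\<gamma> > 0" "c > 0"
  shows "integrable lborel (\<lambda>\<tau>::real. indicator {0<..c} \<tau> * \<tau> powr (\<gamma> - 1))"
    and "(LINT \<tau>|lborel. indicator {0<..c} \<tau> * \<tau> powr (\<gamma> - 1)) = c powr \<gamma> / \<gamma>"
proof -
  have "((\<lambda>x. x powr (\<gamma> - 1)) has_integral (c powr (\<gamma> - 1 + 1) / (\<gamma> - 1 + 1))) {0..c}"
    by (rule has_integral_powr_from_0) (use assms in auto)
  hence h: "((\<lambda>x. x powr (\<gamma> - 1)) has_integral (c powr \<gamma> / \<gamma>)) {0..c}" by simp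
  have ae: "AE x in lborel. x \<in> {0..c} \<longleftrightarrow> x \<in> {0<..c}" using AE_lborel_neq[of 0] by eventually_elim auto
  show "integrable lborel (\<lambda>\<tau>::real. indicator {0<..c} \<tau> * \<tau> powr (\<gamma> - 1))"
    by (rule nonneg_has_integral_lborel(1)[OF _ _ _ h _ ae]) auto
  show "(LINT \<tau>|lborel. indicator {0<..c} \<tau> * \<tau> powr (\<gamma> - 1)) = c powr \<gamma> / \<gamma>"
    by (rule nonneg_has_integral_lborel(2)[OF _ _ _ h _ ae]) auto
qed

lemma powr_weight_inf:
  assumes "\<delta> > 0" "c > 0"
  shows "integrable lborel (\<lambda>\<tau>::real. indicator {c<..} \<tau> * \<tau> powr (- 1 - \<delta>))"
    and "(LINT \<tau>|lborel. indicator {c<..} \<tau> * \<tau> powr (- 1 - \<delta>)) = c powr (- \<delta>) / \<delta>"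
proof -
  have "((\<lambda>x. x powr (- 1 - \<delta>)) has_integral (- (c powr (- 1 - \<delta> + 1)) / (- 1 - \<delta> + 1))) {c..}"
    by (rule has_integral_powr_to_inf) (use assms in auto)
  hence h: "((\<lambda>x. x powr (- 1 - \<delta>)) has_integral (c powr (- \<delta>) / \<delta>)) {c..}" by simp
  have ae: "AE x in lborel. x \<in> {c..} \<longleftrightarrow> x \<in> {c<..}" using AE_lborel_neq[of c] by eventually_elim auto
  show "integrable lborel (\<lambda>\<tau>::real. indicator {c<..} \<tau> * \<tau> powr (- 1 - \<delta>))"
    by (rule nonneg_has_integral_lborel(1)[OF _ _ _ h _ ae]) auto
  show "(LINT \<tau>|lborel. indicator {c<..} \<tau> * \<tau> powr (- 1 - \<delta>)) = c powr (- \<delta>) / \<delta>"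
    by (rule nonneg_has_integral_lborel(2)[OF _ _ _ h _ ae]) auto
qed

text \<open>The kernel of fractional integration of order \<gamma> without the factor
  \<open>1 / Gamma \<gamma>\<close>; the indicator lets all time integrals run over the whole
  line.\<close>

definition weight :: "real \<Rightarrow> real \<Rightarrow> real" where
  "weight \<gamma> \<tau> = indicator {0<..} \<tau> * \<tau> powr (\<gamma> - 1)"

lemma weight_nonneg: "0 \<le> weight \<gamma> \<tau>"
  by (simp add: weight_def)

lemma weight_borel [measurable]: "weight \<gamma> \<in> borel_measurable borel"
  unfolding weight_def[abs_def] by measurable

lemma weight_pos: "\<tau> > 0 \<Longrightarrow> weight \<gamma> \<tau> = \<tau> powr (\<gamma> - 1)"
  and weight_0: "\<tau> \<le> 0 \<Longrightarrow> weight \<gamma> \<tau> = 0"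
  by (auto simp: weight_def)

lemma Gamma_weight:
  assumes "\<gamma> > 0" "a > 0"
  shows "integrable lborel (\<lambda>\<tau>. weight \<gamma> \<tau> * exp (- (a * \<tau>)))"
    and "(LINT \<tau>|lborel. weight \<gamma> \<tau> * exp (- (a * \<tau>))) = Gamma \<gamma> * a powr (- \<gamma>)"
proof -
  let ?f = "\<lambda>t::real. t powr (\<gamma> - 1) / exp t"
  have ae: "AE x in lborel. x \<in> {0::real..} \<longleftrightarrow> x \<in> {0<..}" using AE_lborel_neq[of 0] by eventually_elim auto
  let ?g = "\<lambda>t::real. indicator {0<..} t * ?f t"
  have int: "integrable lborel ?g" and val: "(LINT t|lborel. ?g t) = Gamma \<gamma>"
    using nonneg_has_integral_lborel[OF _ _ _ Gamma_integral_real[OF assms(1)] _ ae] by auto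
  have eq: "weight \<gamma> \<tau> * exp (- (a * \<tau>)) = a powr (1 - \<gamma>) * ?g (0 + a * \<tau>)" for \<tau>
  proof (cases "\<tau> > 0")
    case True
    have "a powr (1 - \<gamma>) * (a * \<tau>) powr (\<gamma> - 1) = \<tau> powr (\<gamma> - 1)"
      using True assms by (simp add: powr_mult flip: powr_add mult.assoc)
    thus ?thesis using True assms by (simp add: weight_def exp_minus divide_inverse flip: mult.assoc)
  next
    case False
    thus ?thesis using assms by (simp add: weight_0 indicator_def zero_less_mult_iff)
  qed
  show "integrable lborel (\<lambda>\<tau>. weight \<gamma> \<tau> * exp (- (a * \<tau>)))"
    unfolding eq using assms by (intro integrable_mult_right lborel_integrable_real_affine int) auto
  have "Gamma \<gamma> = a * (LINT \<tau>|lborel. ?g (0 + a * \<tau>))"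
    using lborel_integral_real_affine[of a ?g 0] val assms by simp
  hence "(LINT \<tau>|lborel. ?g (0 + a * \<tau>)) = Gamma \<gamma> / a" using assms by simp
  moreover have "a powr (1 - \<gamma>) = a * a powr (- \<gamma>)"
    using assms powr_add[of a 1 "- \<gamma>"] by simp
  ultimately show "(LINT \<tau>|lborel. weight \<gamma> \<tau> * exp (- (a * \<tau>))) = Gamma \<gamma> * a powr (- \<gamma>)"
    unfolding eq integral_mult_right_zero using assms by simp
qed

lemma Beta_weight:
  assumes "a > 0" "b > 0" "r > 0"
  shows "integrable lborel (\<lambda>t. weight a t * weight b (r - t))"
    and "(LINT t|lborel. weight a t * weight b (r - t)) = Beta a b * r powr (a + b - 1)"
proof -
  let ?f = "\<lambda>t::real. t powr (a - 1) * (1 - t) powr (b - 1)"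
  have ae: "AE x in lborel. x \<in> {0::real..1} \<longleftrightarrow> x \<in> {0<..<1}"
    using AE_lborel_neq[of 0] AE_lborel_neq[of 1] by eventually_elim auto
  let ?g = "\<lambda>t::real. indicator {0<..<1} t * ?f t"
  have int: "integrable lborel ?g" and val: "(LINT t|lborel. ?g t) = Beta a b"
    using nonneg_has_integral_lborel[OF _ _ _ has_integral_Beta_real[OF assms(1,2)] _ ae] by auto
  have eq: "weight a t * weight b (r - t) = r powr (a + b - 2) * ?g (0 + (1 / r) * t)" for t
  proof (cases "0 < t \<and> t < r")
    case True
    have "(r - t) powr (b - 1) = (r * (1 - t / r)) powr (b - 1)" using assms by (simp add: right_diff_distrib)
    also have "\<dots> = r powr (b - 1) * (1 - t / r) powr (b - 1)" by (rule powr_mult)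
    finally have 1: "(r - t) powr (b - 1) = r powr (b - 1) * (1 - t / r) powr (b - 1)" .
    have "t powr (a - 1) = (r * (t / r)) powr (a - 1)" using assms by simp
    also have "\<dots> = r powr (a - 1) * (t / r) powr (a - 1)" by (rule powr_mult)
    finally have 2: "t powr (a - 1) = r powr (a - 1) * (t / r) powr (a - 1)" .
    have 3: "r powr (a + b - 2) = r powr (a - 1) * r powr (b - 1)" by (simp flip: powr_add)
    have "indicator {0<..<1} (0 + 1 / r * t) = (1::real)" using True assms by simp
    thus ?thesis using True by (simp add: weight_pos 1 2 3)
  next
    case False
    hence "weight a t * weight b (r - t) = 0" by (auto simp: weight_0 not_less)
    moreover have "0 + (1 / r) * t \<notin> {0<..<1}" using False assms by (auto simp: field_simps)
    ultimately show ?thesis by simp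
  qed
  show "integrable lborel (\<lambda>t. weight a t * weight b (r - t))"
    unfolding eq using assms by (intro integrable_mult_right lborel_integrable_real_affine int) auto
  have "Beta a b = (1 / r) * (LINT t|lborel. ?g (0 + (1 / r) * t))"
    using lborel_integral_real_affine[of "1 / r" ?g 0] val assms by simp
  hence "(LINT t|lborel. ?g (0 + (1 / r) * t)) = Beta a b * r" using assms by (simp add: field_simps)
  moreover have "r powr (a + b - 2) * r = r powr (a + b - 1)"
    using assms powr_add[of r "a + b - 2" 1] by simp
  ultimately show "(LINT t|lborel. weight a t * weight b (r - t)) = Beta a b * r powr (a + b - 1)"
    unfolding eq integral_mult_right_zero by (simp add: mult_ac)
qed

text \<open>The semigroup law of Weyl fractional integrals; the Beta integral appears after exchanging the
  order of integration.\<close>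

lemma weyl_composition:
  fixes p :: "real \<Rightarrow> complex"
  assumes \<alpha>: "\<alpha> > 0" and \<kappa>: "\<kappa> > 0"
    and p [measurable]: "p \<in> borel_measurable borel"
    and int: "integrable lborel (\<lambda>r. weight (\<alpha> + \<kappa>) r * cmod (p r))"
  shows "(LINT t|lborel. complex_of_real (weight \<alpha> t) * (LINT \<tau>|lborel. complex_of_real (weight \<kappa> \<tau>) * p (t + \<tau>)))
      = complex_of_real (Beta \<alpha> \<kappa>) * (LINT r|lborel. complex_of_real (weight (\<alpha> + \<kappa>) r) * p r)"
proof -
  define F where "F t r = complex_of_real (weight \<alpha> t * weight \<kappa> (r - t)) * p r" for t r
  have [measurable]: "(\<lambda>(t, r). F t r) \<in> borel_measurable (borel \<Otimes>\<^sub>M borel)"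
    unfolding F_def by measurable
  have 1: "complex_of_real (weight \<alpha> t) * (LINT \<tau>|lborel. complex_of_real (weight \<kappa> \<tau>) * p (t + \<tau>)) = (LINT r|lborel. F t r)" for t
  proof -
    have "(LINT \<tau>|lborel. complex_of_real (weight \<kappa> \<tau>) * p (t + \<tau>)) = (LINT r|lborel. complex_of_real (weight \<kappa> (r - t)) * p r)"
      using lborel_translate(1)[of "\<lambda>r. complex_of_real (weight \<kappa> (r - t)) * p r" t] by simp
    thus ?thesis by (simp add: F_def mult.assoc flip: integral_mult_right_zero)
  qed
  \<comment> \<open>Carrying out the t-integral of the modulus by \<open>Beta_weight\<close> reduces
    joint integrability to the hypothesis on p.\<close>
  have inner_nn: "(\<integral>\<^sup>+t. ennreal (cmod (F t r)) \<partial>lborel) = ennreal (Beta \<alpha> \<kappa> * (weight (\<alpha> + \<kappa>) r * cmod (p r)))" for r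
  proof (cases "r > 0")
    case True
    have "(\<integral>\<^sup>+t. ennreal (cmod (F t r)) \<partial>lborel) = (\<integral>\<^sup>+t. ennreal (cmod (p r) * (weight \<alpha> t * weight \<kappa> (r - t))) \<partial>lborel)"
      by (simp add: F_def norm_mult weight_nonneg abs_mult mult_ac)
    also have "\<dots> = ennreal (LINT t|lborel. cmod (p r) * (weight \<alpha> t * weight \<kappa> (r - t)))"
      by (rule nn_integral_eq_integral)
         (use Beta_weight(1)[OF \<alpha> \<kappa> True] in \<open>auto simp: weight_nonneg\<close>)
    also have "\<dots> = ennreal (Beta \<alpha> \<kappa> * (weight (\<alpha> + \<kappa>) r * cmod (p r)))"
      using Beta_weight(2)[OF \<alpha> \<kappa> True] True
      by (subst integral_mult_right_zero) (simp add: weight_pos mult_ac)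
    finally show ?thesis .
  next
    case False
    have z: "F t r = 0" for t
      using False by (cases "t > 0") (auto simp: F_def weight_0)
    show ?thesis using False by (simp add: z weight_0)
  qed
  have Fint: "integrable (lborel \<Otimes>\<^sub>M lborel) (\<lambda>(t, r). F t r)"
    unfolding integrable_iff_bounded
  proof
    have "(\<integral>\<^sup>+z. ennreal (norm (case z of (t, r) \<Rightarrow> F t r)) \<partial>(lborel \<Otimes>\<^sub>M lborel))
      = (\<integral>\<^sup>+r. (\<integral>\<^sup>+t. ennreal (cmod (F t r)) \<partial>lborel) \<partial>lborel)"
      by (subst lborel_pair.nn_integral_snd[symmetric]) auto
    also have "\<dots> = (\<integral>\<^sup>+r. ennreal (Beta \<alpha> \<kappa> * (weight (\<alpha> + \<kappa>) r * cmod (p r))) \<partial>lborel)"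
      by (simp add: inner_nn)
    also have "\<dots> = ennreal (LINT r|lborel. Beta \<alpha> \<kappa> * (weight (\<alpha> + \<kappa>) r * cmod (p r)))"
      by (rule nn_integral_eq_integral)
         (use int \<alpha> \<kappa> in \<open>auto simp: weight_nonneg Beta_def intro!: mult_nonneg_nonneg divide_nonneg_nonneg\<close>)
    finally show "(\<integral>\<^sup>+z. ennreal (norm (case z of (t, r) \<Rightarrow> F t r)) \<partial>(lborel \<Otimes>\<^sub>M lborel)) < \<infinity>" by simp
  qed measurable
  have 2: "(LINT t|lborel. F t r) = complex_of_real (Beta \<alpha> \<kappa>) * (complex_of_real (weight (\<alpha> + \<kappa>) r) * p r)" for r
  proof (cases "r > 0")
    case True
    have "(LINT t|lborel. F t r) = complex_of_real (LINT t|lborel. weight \<alpha> t * weight \<kappa> (r - t)) * p r"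
      unfolding F_def by (simp only: integral_mult_left_zero integral_complex_of_real)
    thus ?thesis using Beta_weight(2)[OF \<alpha> \<kappa> True] True by (simp add: weight_pos)
  next
    case False
    have z: "F t r = 0" for t
      using False by (cases "t > 0") (auto simp: F_def weight_0)
    show ?thesis using False by (simp add: z weight_0)
  qed
  have "(LINT t|lborel. LINT r|lborel. F t r) = (LINT r|lborel. LINT t|lborel. F t r)"
    using lborel_pair.Fubini_integral[OF Fint] by simp
  thus ?thesis unfolding 1 2 by simp
qed

subsection \<open>Smoothing and powers of the Laplacian on the Fourier side\<close>

text \<open>The Fourier multiplier of \<open>(-\<Delta>) ^ k\<close> composed with the heat
  semigroup at time r, applied on the frequency side; times and orders add in
  \<open>smoothed_smoothed\<close>.\<close>

definition smoothed :: "real \<Rightarrow> nat \<Rightarrow> (real^'n \<Rightarrow> complex) \<Rightarrow> real^'n \<Rightarrow> complex" where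
  "smoothed r k \<phi> \<xi> = complex_of_real (exp (- (r * (norm \<xi>)\<^sup>2))) * (complex_of_real ((norm \<xi>)\<^sup>2) ^ k * \<phi> \<xi>)"

lemma schwartz_smoothed: "r \<ge> 0 \<Longrightarrow> schwartz \<phi> \<Longrightarrow> schwartz (smoothed r k \<phi>)"
  unfolding smoothed_def[abs_def]
  by (intro schwartz_slow_mult slow_smooth_exp_norm2 slow_smooth_power slow_smooth_norm2)

lemma smoothed_smoothed:
  fixes \<phi> :: "real^'n \<Rightarrow> complex"
  shows "smoothed a j (smoothed b k \<phi>) = smoothed (a + b) (j + k) \<phi>"
proof
  fix \<xi> :: "real^'n"
  have "exp (- ((a + b) * (norm \<xi>)\<^sup>2)) = exp (- (a * (norm \<xi>)\<^sup>2)) * exp (- (b * (norm \<xi>)\<^sup>2))"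
    by (simp add: algebra_simps flip: exp_add)
  thus "smoothed a j (smoothed b k \<phi>) \<xi> = smoothed (a + b) (j + k) \<phi> \<xi>"
    by (simp only: smoothed_def power_add of_real_mult mult_ac)
qed

lemma smoothed_0 [simp]: "smoothed 0 0 \<phi> = \<phi>"
  by (rule ext) (simp add: smoothed_def)

lemma conv_heat_fourier_smoothed:
  assumes "t > 0" "r \<ge> 0" "schwartz \<phi>"
  shows "conv (heat_kernel t) (fourier (smoothed r k \<phi>)) = fourier (smoothed (t + r) k \<phi>)"
  using heat_conv_fourier[OF assms(1) schwartz_smoothed[OF assms(2,3), of k]] smoothed_smoothed[of t 0 r k \<phi>]
  by (simp add: smoothed_def[of t 0, abs_def])

definition L1 :: "(real^'n \<Rightarrow> complex) \<Rightarrow> real" where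
  "L1 \<psi> = (LINT x|lborel. cmod (\<psi> x))"

lemma L1_nonneg: "0 \<le> L1 \<psi>"
  by (simp add: L1_def)

text \<open>The kernel of \<open>-\<Delta> exp (a \<Delta>)\<close>, with Fourier transform \<open>|\<xi>|\<^sup>2 exp (-a |\<xi>|\<^sup>2)\<close>; \<open>laplace_const / a\<close>
  bounds its integral.\<close>

definition laplace_kernel :: "real \<Rightarrow> real^'n \<Rightarrow> real" where
  "laplace_kernel a z = (real CARD('n) / (2 * a) - (norm z)\<^sup>2 / (4 * a\<^sup>2)) * heat_kernel a z"

definition laplace_const :: "'n itself \<Rightarrow> real" where
  "laplace_const _ = real CARD('n) / 2 + 2 * 2 powr (real CARD('n) / 2)"

lemma heat_kernel_complex:
  "complex_of_real (heat_kernel a (z :: real^'n))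
    = complex_of_real ((4 * pi * a) powr (- (real CARD('n) / 2))) * complex_of_real (exp (- ((norm z)\<^sup>2 / (4 * a))))"
  by (simp add: heat_kernel_def)

lemma pd_heat_kernel:
  fixes z :: "real^'n"
  shows "pd j (\<lambda>z. complex_of_real (heat_kernel a z)) z
    = (- 1 / (2 * complex_of_real a) * complex_of_real (z $ j)) * complex_of_real (heat_kernel a z)"
proof -
  have d: "(\<lambda>z::real^'n. complex_of_real (exp (- ((norm z)\<^sup>2 / (4 * a))))) differentiable (at z)"
    using gaussian_differentiable by (rule differentiableI)
  show ?thesis unfolding heat_kernel_complex pd_cmult[OF d] pd_eq[OF gaussian_differentiable]
    by (simp add: inner_axis)
qed

lemma laplace_kernel_eq:
  fixes z :: "real^'n"
  assumes "a > 0"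
  shows "complex_of_real (laplace_kernel a z) = - (\<Sum>j\<in>UNIV. pd j (pd j (\<lambda>z. complex_of_real (heat_kernel a z))) z)"
proof -
  let ?h = "\<lambda>z :: real^'n. complex_of_real (heat_kernel a z)"
  let ?c = "- 1 / (2 * complex_of_real a)"
  have dh: "?h differentiable (at z)" for z by (rule schwartz_differentiable[OF schwartz_heat_kernel[OF assms]])
  have dc: "(\<lambda>z::real^'n. ?c * complex_of_real (z $ j)) differentiable (at z)" for z j
    by (intro differentiable_mult differentiable_const differentiable_coord)
  have "pd j (pd j ?h) z = ?c * ?h z + complex_of_real ((z $ j)\<^sup>2) * (?c\<^sup>2 * ?h z)" for j
  proof -
    have "pd j (pd j ?h) z = pd j (\<lambda>z. (?c * complex_of_real (z $ j)) * ?h z) z"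
      by (simp only: pd_heat_kernel[abs_def])
    also have "\<dots> = (?c * complex_of_real (z $ j)) * pd j ?h z + pd j (\<lambda>z. ?c * complex_of_real (z $ j)) z * ?h z"
      by (rule pd_mult[OF dc dh])
    also have "pd j (\<lambda>z. ?c * complex_of_real (z $ j)) z = ?c"
      by (subst pd_cmult[OF differentiable_coord]) (simp add: pd_coord)
    finally show ?thesis unfolding pd_heat_kernel by (simp add: power2_eq_square field_simps)
  qed
  hence "(\<Sum>j\<in>UNIV. pd j (pd j ?h) z) = (\<Sum>j\<in>(UNIV::'n set). ?c * ?h z) + (\<Sum>j\<in>UNIV. complex_of_real ((z $ j)\<^sup>2)) * (?c\<^sup>2 * ?h z)"
    by (simp only: sum.distrib sum_distrib_right)
  also have "(\<Sum>j\<in>UNIV. complex_of_real ((z $ j)\<^sup>2)) = complex_of_real ((norm z)\<^sup>2)"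
    by (simp only: norm_cart_sum of_real_sum)
  finally show ?thesis using assms
    by (simp add: laplace_kernel_def power2_eq_square field_simps)
qed

lemma laplace_kernel_borel [measurable]: "laplace_kernel a \<in> borel_measurable borel"
  unfolding laplace_kernel_def[abs_def] by measurable

text \<open>The quadratic term is absorbed by half of the Gaussian exponent through
  \<open>v * exp (- v) \<le> 1\<close>; passing to doubled time costs the factor
  \<open>2 powr (n / 2)\<close>.\<close>

lemma laplace_kernel_bound:
  fixes z :: "real^'n"
  assumes a: "a > 0"
  shows "\<bar>laplace_kernel a z\<bar> \<le> real CARD('n) / (2 * a) * heat_kernel a z + 2 * 2 powr (real CARD('n) / 2) / a * heat_kernel (2 * a) z"
proof -
  let ?D = "2 powr (real CARD('n) / 2)"
  define v where "v = (norm z)\<^sup>2 / (8 * a)"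
  have v: "v \<ge> 0" "(norm z)\<^sup>2 = 8 * a * v" using a by (auto simp: v_def)
  have "v * exp (- v) \<le> 1"
  proof -
    have "v \<le> exp v" using exp_ge_add_one_self[of v] by linarith
    thus ?thesis by (simp add: exp_minus field_simps)
  qed
  have "(norm z)\<^sup>2 / (4 * a\<^sup>2) * heat_kernel a z = (2 / a) * ?D * heat_kernel (2 * a) z * (v * exp (- v))"
    using a unfolding heat_kernel_double[OF a, of z] v(2) by (simp add: power2_eq_square field_simps)
  also have "\<dots> \<le> (2 / a) * ?D * heat_kernel (2 * a) z * 1"
    using a \<open>v * exp (- v) \<le> 1\<close> by (intro mult_left_mono) (auto simp: heat_kernel_nonneg)
  finally have 1: "(norm z)\<^sup>2 / (4 * a\<^sup>2) * heat_kernel a z \<le> 2 * ?D / a * heat_kernel (2 * a) z" by simp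
  have "\<bar>laplace_kernel a z\<bar> \<le> (real CARD('n) / (2 * a) + (norm z)\<^sup>2 / (4 * a\<^sup>2)) * heat_kernel a z"
    unfolding laplace_kernel_def abs_mult using a
    by (intro mult_mono) (auto simp: heat_kernel_nonneg intro!: order_trans[OF abs_triangle_ineq4])
  with 1 show ?thesis by (simp add: distrib_right)
qed

lemma laplace_kernel_integrable:
  fixes a :: real
  assumes a: "a > 0"
  shows "integrable lborel (laplace_kernel a :: real^'n \<Rightarrow> real)"
    and "(LINT z|lborel. \<bar>laplace_kernel a (z :: real^'n)\<bar>) \<le> laplace_const TYPE('n) / a"
proof -
  let ?G = "\<lambda>z :: real^'n. real CARD('n) / (2 * a) * heat_kernel a z + 2 * 2 powr (real CARD('n) / 2) / a * heat_kernel (2 * a) z"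
  have G: "integrable lborel ?G"
    using a by (intro Bochner_Integration.integrable_add integrable_mult_right heat_kernel_integrable) auto
  show int: "integrable lborel (laplace_kernel a :: real^'n \<Rightarrow> real)"
    by (rule Bochner_Integration.integrable_bound[OF G])
       (use laplace_kernel_bound[OF a] in \<open>auto intro: order_trans[OF _ abs_ge_self]\<close>)
  have "(LINT z|lborel. \<bar>laplace_kernel a (z :: real^'n)\<bar>) \<le> (LINT z|lborel. ?G z)"
    by (intro integral_mono integrable_abs int G laplace_kernel_bound a)
  also have "\<dots> = real CARD('n) / (2 * a) + 2 * 2 powr (real CARD('n) / 2) / a"
    using a heat_kernel_integral[OF a, where 'n = 'n] heat_kernel_integral[of "2 * a", where 'n = 'n]
    by (subst Bochner_Integration.integral_add) (auto intro!: integrable_mult_right heat_kernel_integrable)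
  finally show "(LINT z|lborel. \<bar>laplace_kernel a (z :: real^'n)\<bar>) \<le> laplace_const TYPE('n) / a"
    using a by (simp add: laplace_const_def field_simps)
qed

lemma laplace_kernel_fourier:
  fixes \<xi> :: "real^'n"
  assumes a: "a > 0"
  shows "(LINT z|lborel. complex_of_real (laplace_kernel a z) * cis (z \<bullet> \<xi>))
    = complex_of_real (exp (- (a * (norm \<xi>)\<^sup>2))) * complex_of_real ((norm \<xi>)\<^sup>2) ^ 1"
proof -
  let ?h = "\<lambda>z :: real^'n. complex_of_real (heat_kernel a z)"
  let ?L = "\<lambda>z. \<Sum>j\<in>UNIV. pd j (pd j ?h) z"
  have s: "schwartz ?h" by (rule schwartz_heat_kernel[OF a])
  have "(LINT z|lborel. complex_of_real (laplace_kernel a z) * cis (z \<bullet> \<xi>))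
    = (LINT z|lborel. (-1) * (cis (- (z \<bullet> - \<xi>)) * ?L z))"
    unfolding laplace_kernel_eq[OF a] by (simp add: mult.commute)
  also have "\<dots> = (-1) * fourier ?L (- \<xi>)"
    unfolding fourier_lborel[OF schwartz_borel[OF fourier_laplacian(1)[OF s]]] by (rule integral_mult_right_zero)
  also have "\<dots> = complex_of_real ((norm \<xi>)\<^sup>2) * fourier ?h (- \<xi>)"
    unfolding fourier_laplacian(2)[OF s] by simp
  also have "fourier ?h (- \<xi>) = complex_of_real (exp (- (a * (norm \<xi>)\<^sup>2)))"
    unfolding fourier_lborel[OF schwartz_borel[OF s]] using heat_kernel_fourier(2)[OF a, of \<xi>] by (simp add: mult.commute)
  finally show ?thesis by (simp add: mult.commute)
qed

lemma fourier_smoothed_1: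
  fixes \<phi> :: "real^'n \<Rightarrow> complex"
  assumes a: "a > 0" and \<phi>: "schwartz \<phi>"
  shows "conv (laplace_kernel a) (fourier \<phi>) = fourier (smoothed a 1 \<phi>)"
proof -
  have eq: "(\<lambda>\<xi>. complex_of_real (exp (- (a * (norm \<xi>)\<^sup>2))) * complex_of_real ((norm \<xi>)\<^sup>2) ^ 1 * \<phi> \<xi>) = smoothed a 1 \<phi>"
    by (rule ext) (simp add: smoothed_def)
  show ?thesis
    using conv_fourier[OF laplace_kernel_integrable(1)[OF a] \<phi> laplace_kernel_fourier[OF a]]
      schwartz_borel[OF schwartz_smoothed[OF _ \<phi>, of a 1]] a unfolding eq by auto
qed

lemma L1_fourier_smoothed_1:
  fixes \<phi> :: "real^'n \<Rightarrow> complex"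
  assumes a: "a > 0" and \<phi>: "schwartz \<phi>"
  shows "L1 (fourier (smoothed a 1 \<phi>)) \<le> laplace_const TYPE('n) / a * L1 (fourier \<phi>)"
proof -
  have "L1 (fourier (smoothed a 1 \<phi>)) \<le> (LINT z|lborel. \<bar>laplace_kernel a (z :: real^'n)\<bar>) * L1 (fourier \<phi>)"
    unfolding fourier_smoothed_1[OF assms, symmetric] L1_def
    by (rule conv_L1_le[OF laplace_kernel_integrable(1)[OF a] schwartz_integrable[OF schwartz_fourier[OF \<phi>]]])
  also have "\<dots> \<le> laplace_const TYPE('n) / a * L1 (fourier \<phi>)"
    by (intro mult_right_mono laplace_kernel_integrable a L1_nonneg)
  finally show ?thesis .
qed

lemma L1_fourier_smoothed_0:
  fixes \<phi> :: "real^'n \<Rightarrow> complex"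
  assumes r: "r \<ge> 0" and \<phi>: "schwartz \<phi>"
  shows "L1 (fourier (smoothed r 0 \<phi>)) \<le> L1 (fourier \<phi>)"
proof (cases "r = 0")
  case False
  hence r: "r > 0" using r by simp
  have "L1 (conv (heat_kernel r) (fourier \<phi>)) \<le> (LINT z|lborel. \<bar>heat_kernel r (z :: real^'n)\<bar>) * L1 (fourier \<phi>)"
    unfolding L1_def by (intro conv_L1_le heat_kernel_integrable schwartz_integrable schwartz_fourier \<phi> r)
  thus ?thesis using conv_heat_fourier_smoothed[OF r _ \<phi>, of 0 0] heat_kernel_integral[OF r, where 'n = 'n]
    by (simp add: heat_kernel_nonneg)
qed simp

lemma laplace_const_nonneg: "0 \<le> laplace_const TYPE('n::finite)"
  by (simp add: laplace_const_def)

text \<open>The time r is cut into k + 1 equal slices: one for each of the k Laplacians, each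
  costing \<open>laplace_const / a\<close>, and a spare one without Laplacian, so that the slices
  make sense for \<open>k = 0\<close> as well.\<close>

lemma L1_fourier_smoothed:
  fixes \<phi> :: "real^'n \<Rightarrow> complex"
  assumes r: "r > 0" and \<phi>: "schwartz \<phi>"
  shows "L1 (fourier (smoothed r k \<phi>)) \<le> (laplace_const TYPE('n) * real (Suc k) / r) ^ k * L1 (fourier \<phi>)"
proof -
  define a where "a = r / real (Suc k)"
  have a: "a > 0" using r by (simp add: a_def)
  let ?c = "laplace_const TYPE('n) / a"
  have *: "L1 (fourier (smoothed (real j * a) j \<psi>)) \<le> ?c ^ j * L1 (fourier \<psi>)" if "schwartz \<psi>" for j and \<psi> :: "real^'n \<Rightarrow> complex"
  proof (induction j)
    case (Suc j)
    have "smoothed (real (Suc j) * a) (Suc j) \<psi> = smoothed a 1 (smoothed (real j * a) j \<psi>)"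
      unfolding smoothed_smoothed by (simp add: algebra_simps)
    hence "L1 (fourier (smoothed (real (Suc j) * a) (Suc j) \<psi>)) \<le> ?c * L1 (fourier (smoothed (real j * a) j \<psi>))"
      using L1_fourier_smoothed_1[OF a schwartz_smoothed[OF _ that, of "real j * a" j]] a by simp
    also have "\<dots> \<le> ?c * (?c ^ j * L1 (fourier \<psi>))"
      using a laplace_const_nonneg[where 'n = 'n] by (intro mult_left_mono Suc.IH) auto
    finally show ?case by (simp add: mult.assoc)
  qed simp
  have "smoothed r k \<phi> = smoothed (real k * a) k (smoothed a 0 \<phi>)"
  proof -
    have "real k * a + a = a * real (Suc k)" by (simp add: algebra_simps)
    also have "\<dots> = r" by (simp add: a_def)
    finally show ?thesis unfolding smoothed_smoothed by simp
  qed
  hence "L1 (fourier (smoothed r k \<phi>)) \<le> ?c ^ k * L1 (fourier (smoothed a 0 \<phi>))"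
    using *[OF schwartz_smoothed[OF _ \<phi>, of a 0], of k] a by simp
  also have "\<dots> \<le> ?c ^ k * L1 (fourier \<phi>)"
    using a \<phi> laplace_const_nonneg[where 'n = 'n] by (intro mult_left_mono L1_fourier_smoothed_0) auto
  finally show ?thesis by (simp add: a_def)
qed

lemma fourier_smoothed_borel:
  assumes \<eta>: "schwartz \<eta>"
  shows "(\<lambda>(\<tau>, x). fourier (smoothed \<tau> k \<eta>) x) \<in> borel_measurable (borel \<Otimes>\<^sub>M borel)"
proof -
  have [measurable]: "\<eta> \<in> borel_measurable borel" by (rule schwartz_borel[OF \<eta>])
  have m: "smoothed \<tau> k \<eta> \<in> borel_measurable borel" for \<tau> unfolding smoothed_def[abs_def] by measurable
  have "(\<lambda>p. LINT \<xi>|lborel. cis (- (\<xi> \<bullet> snd p)) * smoothed (fst p) k \<eta> \<xi>) \<in> borel_measurable (borel \<Otimes>\<^sub>M borel)"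
    unfolding smoothed_def by (rule lborel.borel_measurable_lebesgue_integral) measurable
  thus ?thesis by (simp add: fourier_lborel[OF m] split_beta')
qed

text \<open>The base stays above \<open>\<epsilon>\<^sup>2\<close>, so differentiation only lowers
  the exponent by 1 and adds a polynomial factor. Negative exponents are bounded by the value at
  \<xi> = 0, positive ones by an integer power.\<close>

lemma slow_smooth_symbol:
  fixes \<epsilon> q :: real
  assumes \<epsilon>: "\<epsilon> > 0"
  shows "slow_smooth (\<lambda>\<xi> :: real^'n. complex_of_real ((\<epsilon>\<^sup>2 + (norm \<xi>)\<^sup>2) powr q))"
proof -
  have pos: "0 < \<epsilon>\<^sup>2 + (norm \<xi>)\<^sup>2" for \<xi> :: "real^'n" using \<epsilon> by (simp add: add_pos_nonneg)
  have d: "((\<lambda>\<xi> :: real^'n. complex_of_real ((\<epsilon>\<^sup>2 + (norm \<xi>)\<^sup>2) powr q)) has_derivative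
    (\<lambda>h. complex_of_real (q * (\<epsilon>\<^sup>2 + (norm \<xi>)\<^sup>2) powr (q - 1) * (2 * (\<xi> \<bullet> h))))) (at \<xi>)" for q \<xi>
  proof (rule has_derivative_of_real)
    have 1: "((\<lambda>\<xi> :: real^'n. \<epsilon>\<^sup>2 + \<xi> \<bullet> \<xi>) has_derivative (\<lambda>h. 2 * (\<xi> \<bullet> h))) (at \<xi>)"
      by (auto intro!: derivative_eq_intros simp: inner_commute)
    have 2: "((\<lambda>x. x powr q) has_derivative (\<lambda>h. q * (\<epsilon>\<^sup>2 + \<xi> \<bullet> \<xi>) powr (q - 1) * h)) (at (\<epsilon>\<^sup>2 + \<xi> \<bullet> \<xi>))"
      using has_real_derivative_powr[of "\<epsilon>\<^sup>2 + \<xi> \<bullet> \<xi>" q] pos[of \<xi>]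
      by (simp add: has_field_derivative_def power2_norm_eq_inner)
    show "((\<lambda>\<xi> :: real^'n. (\<epsilon>\<^sup>2 + (norm \<xi>)\<^sup>2) powr q) has_derivative
        (\<lambda>h. q * (\<epsilon>\<^sup>2 + (norm \<xi>)\<^sup>2) powr (q - 1) * (2 * (\<xi> \<bullet> h)))) (at \<xi>)"
      using has_derivative_compose[OF 1 2] by (simp add: power2_norm_eq_inner)
  qed
  have bound: "\<exists>K N. K \<ge> 0 \<and> (\<forall>\<xi> :: real^'n. (\<epsilon>\<^sup>2 + (norm \<xi>)\<^sup>2) powr q \<le> K * (1 + norm \<xi>) ^ N)" for q
  proof -
    obtain N :: nat where N: "q \<le> real N" using real_arch_simple by blast
    define K where "K = (1 + (\<epsilon>\<^sup>2) powr q) + (1 + \<epsilon>\<^sup>2) ^ N"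
    have "(\<epsilon>\<^sup>2 + (norm \<xi>)\<^sup>2) powr q \<le> K * (1 + norm \<xi>) ^ (2 * N)" for \<xi> :: "real^'n"
    proof -
      let ?X = "\<epsilon>\<^sup>2 + (norm \<xi>)\<^sup>2"
      have one: "1 \<le> (1 + norm \<xi>) ^ (2 * N)" by (intro one_le_power) auto
      show ?thesis
      proof (cases "?X \<ge> 1")
        case True
        have "?X powr q \<le> ?X powr real N" using N True by (intro powr_mono) auto
        also have "\<dots> = ?X ^ N" using pos by (intro powr_realpow)
        also have "?X ^ N \<le> ((1 + \<epsilon>\<^sup>2) * (1 + norm \<xi>)\<^sup>2) ^ N"
        proof (rule power_mono)
          have "?X \<le> \<epsilon>\<^sup>2 * 1 + 1 * (1 + norm \<xi>)\<^sup>2" by (auto intro: power_mono)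
          also have "\<dots> \<le> \<epsilon>\<^sup>2 * (1 + norm \<xi>)\<^sup>2 + 1 * (1 + norm \<xi>)\<^sup>2"
            by (intro add_mono mult_left_mono one_le_power) auto
          finally show "?X \<le> (1 + \<epsilon>\<^sup>2) * (1 + norm \<xi>)\<^sup>2" by (simp add: algebra_simps)
        qed (use pos less_imp_le in blast)
        also have "\<dots> = (1 + \<epsilon>\<^sup>2) ^ N * (1 + norm \<xi>) ^ (2 * N)" by (simp add: power_mult_distrib power_mult)
        also have "\<dots> \<le> K * (1 + norm \<xi>) ^ (2 * N)" by (intro mult_right_mono) (auto simp: K_def)
        finally show ?thesis .
      next
        case False
        have "?X powr q \<le> 1 + (\<epsilon>\<^sup>2) powr q"
        proof (cases "q \<ge> 0")
          case True
          have "?X powr q \<le> 1 powr q" using False pos[of \<xi>] True by (intro powr_mono2) auto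
          thus ?thesis by (simp add: add_increasing2)
        next
          case False
          have "?X powr q \<le> (\<epsilon>\<^sup>2) powr q" using False \<epsilon> by (intro powr_mono2') auto
          thus ?thesis by simp
        qed
        also have "\<dots> \<le> K * 1" by (simp add: K_def)
        also have "\<dots> \<le> K * (1 + norm \<xi>) ^ (2 * N)" using one by (intro mult_left_mono) (auto simp: K_def)
        finally show ?thesis .
      qed
    qed
    moreover have "K \<ge> 0" by (simp add: K_def)
    ultimately show ?thesis by blast
  qed
  have "smooth_family (slow (UNIV :: unit set) (\<lambda>_. 0)) (\<lambda>_ (\<xi> :: real^'n). 1 * complex_of_real ((\<epsilon>\<^sup>2 + (norm \<xi>)\<^sup>2) powr q))"
  proof (rule smooth_family_coinduct[OF _ slow_plus_closed])
    let ?S = "{\<lambda>_ :: unit. \<lambda>\<xi> :: real^'n. a \<xi> * complex_of_real ((\<epsilon>\<^sup>2 + (norm \<xi>)\<^sup>2) powr q) |a q. slow_smooth a}"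
    show "(\<lambda>_ :: unit. \<lambda>\<xi> :: real^'n. 1 * complex_of_real ((\<epsilon>\<^sup>2 + (norm \<xi>)\<^sup>2) powr q)) \<in> ?S"
      by (intro CollectI exI[of _ "\<lambda>_. 1"] exI[of _ q] conjI refl slow_smooth_const)
    fix \<Phi> assume "\<Phi> \<in> ?S"
    then obtain a q where \<Phi>: "\<Phi> = (\<lambda>_ :: unit. \<lambda>\<xi>. a \<xi> * complex_of_real ((\<epsilon>\<^sup>2 + (norm \<xi>)\<^sup>2) powr q))"
      and a: "slow_smooth a" by blast
    have ad: "a differentiable (at \<xi>)" for \<xi> by (rule smooth_differentiable[OF slow_smooth_smooth[OF a]])
    have d': "(\<lambda>\<xi> :: real^'n. complex_of_real ((\<epsilon>\<^sup>2 + (norm \<xi>)\<^sup>2) powr q)) differentiable (at \<xi>)" for \<xi>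
      using d by (rule differentiableI)
    show "\<Phi> i differentiable (at x)" for i x unfolding \<Phi> by (intro differentiable_mult ad d')
    show "slow UNIV (\<lambda>_. 0) \<Phi>"
    proof -
      obtain K N where K: "K \<ge> 0" "\<And>\<xi> :: real^'n. (\<epsilon>\<^sup>2 + (norm \<xi>)\<^sup>2) powr q \<le> K * (1 + norm \<xi>) ^ N"
        using bound[of q] by blast
      have "slow UNIV (\<lambda>_::unit. 0) (\<lambda>_ \<xi> :: real^'n. complex_of_real ((\<epsilon>\<^sup>2 + (norm \<xi>)\<^sup>2) powr q))"
        unfolding slow_def using K by (intro exI[of _ N] exI[of _ K] exI[of _ 0]) auto
      thus ?thesis unfolding \<Phi>
        by (intro slow_mult smooth_familyD(2)[OF a[unfolded slow_smooth_def]])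
    qed
    show "(\<lambda>i. pd j (\<Phi> i)) \<in> sum_closure ?S" for j
    proof -
      have "(\<lambda>i. pd j (\<Phi> i)) = (\<lambda>_ \<xi>. pd j a \<xi> * complex_of_real ((\<epsilon>\<^sup>2 + (norm \<xi>)\<^sup>2) powr q)
        + (complex_of_real (2 * q) * (complex_of_real (\<xi> $ j) * a \<xi>)) * complex_of_real ((\<epsilon>\<^sup>2 + (norm \<xi>)\<^sup>2) powr (q - 1)))"
        unfolding \<Phi> by (intro ext) (simp add: pd_mult[OF ad d'] pd_eq[OF d] inner_axis algebra_simps)
      moreover have "(\<lambda>_ \<xi>. pd j a \<xi> * complex_of_real ((\<epsilon>\<^sup>2 + (norm \<xi>)\<^sup>2) powr q)) \<in> ?S"
        using slow_smooth_pd[OF a] by blast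
      moreover have "(\<lambda>_ \<xi>. (complex_of_real (2 * q) * (complex_of_real (\<xi> $ j) * a \<xi>)) * complex_of_real ((\<epsilon>\<^sup>2 + (norm \<xi>)\<^sup>2) powr (q - 1))) \<in> ?S"
        by (intro CollectI exI[of _ "\<lambda>\<xi>. complex_of_real (2 * q) * (complex_of_real (\<xi> $ j) * a \<xi>)"] exI[of _ "q - 1"]
            conjI refl slow_smooth_mult slow_smooth_const slow_smooth_coord a)
      ultimately show ?thesis by (simp only:) (intro sum_closure.intros)
    qed
  qed
  thus ?thesis by (simp add: slow_smooth_def)
qed

subsection \<open>Distributions of negative Besov regularity\<close>

text \<open>The shape of all integrable majorants in time used below: the singularity of
  \<open>weight \<gamma>\<close> up to time 1, and decay faster than \<open>1 / \<tau>\<close>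
  afterwards.\<close>

definition envelope :: "real \<Rightarrow> real \<Rightarrow> real \<Rightarrow> real" where
  "envelope \<gamma> \<delta> \<tau> = indicator {0<..1} \<tau> * \<tau> powr (\<gamma> - 1) + indicator {1<..} \<tau> * \<tau> powr (- 1 - \<delta>)"

lemma envelope_integrable: "\<gamma> > 0 \<Longrightarrow> \<delta> > 0 \<Longrightarrow> integrable lborel (envelope \<gamma> \<delta>)"
  unfolding envelope_def[abs_def]
  by (intro Bochner_Integration.integrable_add powr_weight_0 powr_weight_inf) auto

lemma weight_le_envelope:
  assumes "C \<ge> 0" "\<tau> \<le> 1 \<Longrightarrow> a \<le> C" "\<tau> > 1 \<Longrightarrow> a \<le> C * \<tau> powr (- \<mu>)"
  shows "weight \<gamma> \<tau> * a \<le> C * envelope \<gamma> (\<mu> - \<gamma>) \<tau>"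
proof -
  consider "\<tau> \<le> 0" | "0 < \<tau>" "\<tau> \<le> 1" | "\<tau> > 1" by linarith
  thus ?thesis
  proof cases
    case 1 thus ?thesis using assms(1) by (simp add: weight_0 envelope_def)
  next
    case 2 thus ?thesis using assms(2) by (simp add: weight_pos envelope_def mult.commute mult_left_mono)
  next
    case 3
    have "weight \<gamma> \<tau> * a \<le> \<tau> powr (\<gamma> - 1) * (C * \<tau> powr (- \<mu>))"
      using 3 assms(3) by (simp add: weight_pos mult_left_mono)
    also have "\<dots> = C * (\<tau> powr (\<gamma> - 1) * \<tau> powr (- \<mu>))" by simp
    also have "\<tau> powr (\<gamma> - 1) * \<tau> powr (- \<mu>) = \<tau> powr (- 1 - (\<mu> - \<gamma>))"
      unfolding powr_add[symmetric] by (rule arg_cong[of _ _ "(powr) \<tau>"]) simp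
    finally show ?thesis using 3 by (simp add: envelope_def)
  qed
qed

text \<open>Read off from \<open>decay\<close>: the power of 2 comes from giving each purpose half
  of the time r, the rest from \<open>L1_fourier_smoothed\<close>.\<close>

definition decay_const :: "'n::finite itself \<Rightarrow> real \<Rightarrow> nat \<Rightarrow> real" where
  "decay_const _ \<beta> k = 2 powr (\<beta> / 2 + real k) * (laplace_const TYPE('n) * real (Suc k)) ^ k"

lemma decay_const_nonneg: "0 \<le> decay_const TYPE('n::finite) \<beta> k"
  using laplace_const_nonneg[where 'n = 'n] by (simp add: decay_const_def)

text \<open>The Besov norm acts only through this bound on the heat extension; it holds almost
  everywhere because the norm is built from essential suprema.\<close>

locale besov_distribution = represented_distribution T f
  for T :: "(real^'n \<Rightarrow> complex) \<Rightarrow> complex" and f :: "real^'n \<Rightarrow> real" +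
  fixes \<beta> B :: real
  assumes \<beta>: "\<beta> > 0" and B: "B \<ge> 0"
    and heat_AE: "\<And>t. t > 0 \<Longrightarrow> AE x in lborel. \<bar>heat t x\<bar> \<le> t powr (- (\<beta> / 2)) * B"
begin

text \<open>For \<open>\<tau> > 0\<close> this is the Fourier transform of \<open>T\<close> tested with
  \<open>exp (-\<tau> |\<xi>|\<^sup>2) |\<xi>|\<^bsup>2k\<^esup> \<phi>\<close>.\<close>

definition profile :: "nat \<Rightarrow> (real^'n \<Rightarrow> complex) \<Rightarrow> real \<Rightarrow> complex" where
  "profile k \<phi> \<tau> = (LINT x|lborel. complex_of_real (heat \<tau> x) * fourier (smoothed 0 k \<phi>) x)"

lemma profile_eq:
  assumes "\<tau> > 0" "schwartz \<phi>"
  shows "T (fourier (smoothed \<tau> k \<phi>)) = profile k \<phi> \<tau>"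
  using heat_pairing(2)[OF assms(1) schwartz_fourier[OF schwartz_smoothed[OF _ assms(2), of 0 k]]]
    conv_heat_fourier_smoothed[OF assms(1) _ assms(2), of 0 k]
  by (simp add: profile_def)

lemma profile_nonpos: "\<tau> \<le> 0 \<Longrightarrow> profile k \<phi> \<tau> = 0"
  by (simp add: profile_def heat_def)

lemma profile_borel:
  assumes "schwartz \<phi>" shows "profile k \<phi> \<in> borel_measurable borel"
proof -
  have [measurable]: "fourier (smoothed 0 k \<phi>) \<in> borel_measurable borel"
    by (intro schwartz_borel schwartz_fourier schwartz_smoothed assms) simp
  show ?thesis unfolding profile_def[abs_def] by measurable
qed

lemma pairing_bound:
  assumes r: "r > 0" and \<phi>: "schwartz \<phi>"
  shows "cmod (T (fourier (smoothed r 0 \<phi>))) \<le> r powr (- (\<beta> / 2)) * B * L1 (fourier \<phi>)"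
proof -
  note int = heat_pairing(1)[OF r schwartz_fourier[OF \<phi>]]
  have "cmod (T (fourier (smoothed r 0 \<phi>))) = cmod (LINT x|lborel. complex_of_real (heat r x) * fourier \<phi> x)"
    unfolding profile_eq[OF r \<phi>] profile_def by simp
  also have "\<dots> \<le> (LINT x|lborel. cmod (complex_of_real (heat r x) * fourier \<phi> x))"
    by (rule integral_norm_bound)
  also have "\<dots> \<le> (LINT x|lborel. (r powr (- (\<beta> / 2)) * B) * cmod (fourier \<phi> x))"
  proof (rule integral_mono_AE)
    show "AE x in lborel. cmod (complex_of_real (heat r x) * fourier \<phi> x) \<le> (r powr (- (\<beta> / 2)) * B) * cmod (fourier \<phi> x)"
      using heat_AE[OF r] by eventually_elim (auto simp: norm_mult intro!: mult_right_mono)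
  qed (intro integrable_norm int integrable_mult_right schwartz_integrable schwartz_fourier \<phi>)+
  also have "\<dots> = (r powr (- (\<beta> / 2)) * B) * L1 (fourier \<phi>)"
    unfolding L1_def by (rule integral_mult_right_zero)
  finally show ?thesis .
qed

text \<open>Half of the smoothing is spent on the Besov norm, the other half on the \<open>k\<close> Laplacians.\<close>

lemma decay:
  assumes r: "r > 0" and \<phi>: "schwartz \<phi>"
  shows "cmod (T (fourier (smoothed r k \<phi>))) \<le> decay_const TYPE('n) \<beta> k * r powr (- (\<beta> / 2) - real k) * B * L1 (fourier \<phi>)"
proof -
  have r2: "r / 2 > 0" using r by simp
  have "smoothed r k \<phi> = smoothed (r / 2) 0 (smoothed (r / 2) k \<phi>)"
    unfolding smoothed_smoothed by simp
  hence "cmod (T (fourier (smoothed r k \<phi>))) \<le> (r / 2) powr (- (\<beta> / 2)) * B * L1 (fourier (smoothed (r / 2) k \<phi>))"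
    using pairing_bound[OF r2 schwartz_smoothed[OF _ \<phi>, of "r / 2" k]] r by simp
  also have "\<dots> \<le> (r / 2) powr (- (\<beta> / 2)) * B * ((laplace_const TYPE('n) * real (Suc k) / (r / 2)) ^ k * L1 (fourier \<phi>))"
    using B by (intro mult_left_mono L1_fourier_smoothed r2 \<phi>) auto
  also have "(laplace_const TYPE('n) * real (Suc k) / (r / 2)) ^ k = (laplace_const TYPE('n) * real (Suc k)) ^ k * (r / 2) powr (- real k)"
  proof -
    have "(X / y) ^ k = X ^ k * y powr (- real k)" if "y > 0" for X y :: real
      unfolding power_divide using that by (simp add: powr_minus powr_realpow divide_inverse)
    from this[OF r2] show ?thesis .
  qed
  also have "(r / 2) powr (- (\<beta> / 2)) * B * ((laplace_const TYPE('n) * real (Suc k)) ^ k * (r / 2) powr (- real k) * L1 (fourier \<phi>))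
    = decay_const TYPE('n) \<beta> k * r powr (- (\<beta> / 2) - real k) * B * L1 (fourier \<phi>)"
  proof -
    define a where "a = \<beta> / 2 + real k"
    have "(r / 2) powr (- (\<beta> / 2)) * (r / 2) powr (- real k) = (r / 2) powr (- a)"
      unfolding powr_add[symmetric] by (rule arg_cong[of _ _ "(powr) (r / 2)"]) (simp add: a_def)
    also have "\<dots> = r powr (- a) * 2 powr a"
      unfolding powr_divide by (simp add: powr_minus field_simps)
    also have "- a = - (\<beta> / 2) - real k" by (simp add: a_def)
    finally have eq: "(r / 2) powr (- (\<beta> / 2)) * (r / 2) powr (- real k) = r powr (- (\<beta> / 2) - real k) * 2 powr a" .
    have "(r / 2) powr (- (\<beta> / 2)) * B * ((laplace_const TYPE('n) * real (Suc k)) ^ k * (r / 2) powr (- real k) * L1 (fourier \<phi>))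
      = ((r / 2) powr (- (\<beta> / 2)) * (r / 2) powr (- real k)) * ((laplace_const TYPE('n) * real (Suc k)) ^ k * B * L1 (fourier \<phi>))"
      by (simp only: mult_ac)
    thus ?thesis unfolding eq decay_const_def a_def by (simp only: mult_ac)
  qed
  finally show ?thesis .
qed

text \<open>Right continuity in time, including \<open>r = 0\<close>. It bounds profiles near time 0
  and removes the auxiliary smoothing in \<open>symbol_mult_eq\<close>.\<close>

lemma smoothing_tendsto:
  assumes r: "r \<ge> 0" and \<phi>: "schwartz \<phi>"
  shows "((\<lambda>t. T (fourier (smoothed (t + r) k \<phi>))) \<longlongrightarrow> T (fourier (smoothed r k \<phi>))) (at_right 0)"
proof (rule Lim_transform_eventually)
  show "((\<lambda>t. T (conv (heat_kernel t) (fourier (smoothed r k \<phi>)))) \<longlongrightarrow> T (fourier (smoothed r k \<phi>))) (at_right 0)"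
    by (intro tempered_heat_conv_tendsto tempered schwartz_fourier schwartz_smoothed r \<phi>)
  show "\<forall>\<^sub>F t in at_right 0. T (conv (heat_kernel t) (fourier (smoothed r k \<phi>))) = T (fourier (smoothed (t + r) k \<phi>))"
    unfolding eventually_at_right_field
    by (intro exI[of _ 1]) (auto simp: conv_heat_fourier_smoothed r \<phi>)
qed

text \<open>The decay estimate is useless near time 0; there the bound comes from convergence to the
  pairing without smoothing. \<open>C\<close> depends on \<phi> and serves only as a majorant;
  explicit constants come from \<open>decay\<close>.\<close>

lemma profile_bound:
  assumes \<phi>: "schwartz \<phi>"
  obtains C where "C \<ge> 0" "\<And>\<tau>. cmod (profile k \<phi> \<tau>) \<le> C"
    "\<And>\<tau>. \<tau> > 0 \<Longrightarrow> cmod (profile k \<phi> \<tau>) \<le> C * \<tau> powr (- (\<beta> / 2) - real k)"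
proof -
  define K where "K = decay_const TYPE('n) \<beta> k * B * L1 (fourier \<phi>)"
  have K: "K \<ge> 0" unfolding K_def by (intro mult_nonneg_nonneg decay_const_nonneg B L1_nonneg)
  have dec: "cmod (profile k \<phi> \<tau>) \<le> K * \<tau> powr (- (\<beta> / 2) - real k)" if "\<tau> > 0" for \<tau>
    using decay[OF that \<phi>, of k] unfolding profile_eq[OF that \<phi>] by (simp add: K_def mult_ac)
  have "((\<lambda>t. T (fourier (smoothed (t + 0) k \<phi>))) \<longlongrightarrow> T (fourier (smoothed 0 k \<phi>))) (at_right 0)"
    by (rule smoothing_tendsto[OF _ \<phi>]) simp
  from tendstoD[OF this, of 1] obtain d where d: "d > 0"
    "\<And>t. 0 < t \<Longrightarrow> t < d \<Longrightarrow> dist (T (fourier (smoothed t k \<phi>))) (T (fourier (smoothed 0 k \<phi>))) < 1"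
    unfolding eventually_at_right_field by auto
  define M where "M = cmod (T (fourier (smoothed 0 k \<phi>))) + 1"
  define C where "C = K + M + K * d powr (- (\<beta> / 2) - real k)"
  have M: "M \<ge> 0" by (simp add: M_def)
  have C: "C \<ge> 0" using K M by (simp add: C_def)
  have "cmod (profile k \<phi> \<tau>) \<le> C" for \<tau>
  proof -
    consider "\<tau> \<le> 0" | "0 < \<tau>" "\<tau> < d" | "\<tau> \<ge> d" by linarith
    thus ?thesis
    proof cases
      case 1 thus ?thesis using C by (simp add: profile_nonpos)
    next
      case 2
      have "cmod (profile k \<phi> \<tau>) \<le> M"
        using d(2)[OF 2] norm_triangle_sub[of "profile k \<phi> \<tau>" "T (fourier (smoothed 0 k \<phi>))"]
        unfolding profile_eq[OF 2(1) \<phi>] by (simp add: M_def dist_norm)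
      thus ?thesis using K by (simp add: C_def add_increasing add_increasing2)
    next
      case 3
      hence "\<tau> > 0" using d(1) by simp
      have "cmod (profile k \<phi> \<tau>) \<le> K * \<tau> powr (- (\<beta> / 2) - real k)" by (rule dec[OF \<open>\<tau> > 0\<close>])
      also have "\<dots> \<le> K * d powr (- (\<beta> / 2) - real k)"
        using 3 d(1) \<beta> K by (intro mult_left_mono powr_mono2') auto
      finally show ?thesis using K M by (simp add: C_def)
    qed
  qed
  moreover have "cmod (profile k \<phi> \<tau>) \<le> C * \<tau> powr (- (\<beta> / 2) - real k)" if "\<tau> > 0" for \<tau>
    by (rule order_trans[OF dec[OF that]]) (use K M in \<open>auto simp: C_def intro!: mult_right_mono\<close>)
  ultimately show ?thesis using that C by blast
qed

lemma weight_profile_le: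
  assumes "C \<ge> 0" "a \<le> C" "\<tau> > 1 \<Longrightarrow> a \<le> C * \<tau> powr (- (\<beta> / 2) - real k)"
    and \<gamma>: "\<gamma> = real k - \<sigma> / 2"
  shows "weight \<gamma> \<tau> * a \<le> C * envelope \<gamma> ((\<sigma> + \<beta>) / 2) \<tau>"
proof -
  have 1: "- (\<beta> / 2 + real k) = - (\<beta> / 2) - real k" and 2: "\<beta> / 2 + real k - \<gamma> = (\<sigma> + \<beta>) / 2"
    by (auto simp: \<gamma> field_simps)
  show ?thesis
    using weight_le_envelope[of C \<tau> a "\<beta> / 2 + real k" \<gamma>, unfolded 1 2] assms(1-3) by blast
qed

lemma weight_profile_integrable:
  assumes \<phi>: "schwartz \<phi>" and \<gamma>: "\<gamma> = real k - \<sigma> / 2" "\<gamma> > 0" and \<sigma>: "\<sigma> \<ge> 0"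
  shows "integrable lborel (\<lambda>\<tau>. weight \<gamma> \<tau> * cmod (profile k \<phi> \<tau>))"
proof -
  have [measurable]: "profile k \<phi> \<in> borel_measurable borel" by (rule profile_borel[OF \<phi>])
  obtain C where C: "C \<ge> 0" "\<And>\<tau>. cmod (profile k \<phi> \<tau>) \<le> C"
    "\<And>\<tau>. \<tau> > 0 \<Longrightarrow> cmod (profile k \<phi> \<tau>) \<le> C * \<tau> powr (- (\<beta> / 2) - real k)"
    by (rule profile_bound[OF \<phi>, of k]) (rule that)
  have "integrable lborel (\<lambda>\<tau>. C * envelope \<gamma> ((\<sigma> + \<beta>) / 2) \<tau>)"
    using \<gamma> \<sigma> \<beta> by (intro integrable_mult_right envelope_integrable) auto
  thus ?thesis
  proof (rule Bochner_Integration.integrable_bound)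
    show "AE \<tau> in lborel. norm (weight \<gamma> \<tau> * cmod (profile k \<phi> \<tau>)) \<le> norm (C * envelope \<gamma> ((\<sigma> + \<beta>) / 2) \<tau>)"
    proof (rule AE_I2)
      fix \<tau>
      have "weight \<gamma> \<tau> * cmod (profile k \<phi> \<tau>) \<le> C * envelope \<gamma> ((\<sigma> + \<beta>) / 2) \<tau>"
        by (rule weight_profile_le[OF C(1) C(2) C(3) \<gamma>(1)]) auto
      thus "norm (weight \<gamma> \<tau> * cmod (profile k \<phi> \<tau>)) \<le> norm (C * envelope \<gamma> ((\<sigma> + \<beta>) / 2) \<tau>)"
        by (simp add: weight_nonneg)
    qed
  qed measurable
qed

section \<open>Regularised fractional symbols as time integrals of the heat flow\<close>

definition shifted_power :: "real \<Rightarrow> nat \<Rightarrow> (real^'n \<Rightarrow> complex) \<Rightarrow> real^'n \<Rightarrow> complex" where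
  "shifted_power \<epsilon> k \<phi> \<xi> = complex_of_real (\<epsilon>\<^sup>2 + (norm \<xi>)\<^sup>2) ^ k * \<phi> \<xi>"

definition symbol_mult :: "real \<Rightarrow> real \<Rightarrow> (real^'n \<Rightarrow> complex) \<Rightarrow> real^'n \<Rightarrow> complex" where
  "symbol_mult \<epsilon> \<sigma> \<phi> \<xi> = complex_of_real ((\<epsilon>\<^sup>2 + (norm \<xi>)\<^sup>2) powr (\<sigma> / 2)) * \<phi> \<xi>"

lemma schwartz_shifted_power: "schwartz \<phi> \<Longrightarrow> schwartz (shifted_power \<epsilon> k \<phi>)"
  unfolding shifted_power_def[abs_def] of_real_add
  by (intro schwartz_slow_mult slow_smooth_power slow_smooth_add slow_smooth_const slow_smooth_norm2)

lemma schwartz_symbol_mult: "\<epsilon> > 0 \<Longrightarrow> schwartz \<phi> \<Longrightarrow> schwartz (symbol_mult \<epsilon> \<sigma> \<phi>)"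
  unfolding symbol_mult_def[abs_def] by (intro schwartz_slow_mult slow_smooth_symbol)

text \<open>Binomial expansion in powers of \<open>\<epsilon>\<^sup>2\<close>; only the term with j
  = k survives as \<epsilon> tends to 0.\<close>

lemma smoothed_shifted_power:
  "smoothed \<tau> 0 (shifted_power \<epsilon> k \<phi>)
    = (\<lambda>\<xi>. \<Sum>j\<le>k. complex_of_real (real (k choose j) * (\<epsilon>\<^sup>2) ^ (k - j)) * smoothed \<tau> j \<phi> \<xi>)"
proof
  fix \<xi> :: "real^'n"
  have "complex_of_real (\<epsilon>\<^sup>2 + (norm \<xi>)\<^sup>2) ^ k = (complex_of_real ((norm \<xi>)\<^sup>2) + complex_of_real (\<epsilon>\<^sup>2)) ^ k"
    by (simp only: of_real_add add.commute)
  also have "\<dots> = (\<Sum>j\<le>k. of_nat (k choose j) * complex_of_real ((norm \<xi>)\<^sup>2) ^ j * complex_of_real (\<epsilon>\<^sup>2) ^ (k - j))"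
    by (rule binomial_ring)
  finally show "smoothed \<tau> 0 (shifted_power \<epsilon> k \<phi>) \<xi>
    = (\<Sum>j\<le>k. complex_of_real (real (k choose j) * (\<epsilon>\<^sup>2) ^ (k - j)) * smoothed \<tau> j \<phi> \<xi>)"
    unfolding smoothed_def shifted_power_def by (simp add: sum_distrib_left sum_distrib_right mult_ac)
qed

lemma profile_shifted_power:
  assumes \<phi>: "schwartz \<phi>"
  shows "profile 0 (shifted_power \<epsilon> k \<phi>) \<tau>
    = (\<Sum>j\<le>k. complex_of_real (real (k choose j) * (\<epsilon>\<^sup>2) ^ (k - j)) * profile j \<phi> \<tau>)"
proof (cases "\<tau> > 0")
  case True
  have s: "schwartz (smoothed \<tau> j \<phi>)" for j using True by (intro schwartz_smoothed \<phi>) auto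
  have "fourier (smoothed \<tau> 0 (shifted_power \<epsilon> k \<phi>))
    = (\<lambda>x. \<Sum>j\<le>k. complex_of_real (real (k choose j) * (\<epsilon>\<^sup>2) ^ (k - j)) * fourier (smoothed \<tau> j \<phi>) x)"
    unfolding smoothed_shifted_power
    by (rule ext) (simp only: fourier_sum[OF schwartz_cmult[OF s]] fourier_cmult[OF s])
  hence "profile 0 (shifted_power \<epsilon> k \<phi>) \<tau>
    = T (\<lambda>x. \<Sum>j\<le>k. complex_of_real (real (k choose j) * (\<epsilon>\<^sup>2) ^ (k - j)) * fourier (smoothed \<tau> j \<phi>) x)"
    using profile_eq[OF True schwartz_shifted_power[OF \<phi>], of 0 \<epsilon> k] by simp
  also have "\<dots> = (\<Sum>j\<le>k. complex_of_real (real (k choose j) * (\<epsilon>\<^sup>2) ^ (k - j)) * T (fourier (smoothed \<tau> j \<phi>)))"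
    using s by (subst tempered_sum[OF tempered]) (auto intro!: schwartz_cmult schwartz_fourier simp: tempered_cmult[OF tempered] schwartz_fourier)
  finally show ?thesis by (simp only: profile_eq[OF True \<phi>])
qed (simp add: profile_nonpos)

text \<open>The power \<sigma> / 2 of the regularised symbol is its integer power k times the
  negative power - \<gamma>. The latter is a Gamma integral at each frequency, exchanged with the
  Fourier integral; \<open>exp (- (\<epsilon>\<^sup>2 * \<tau>))\<close> provides integrability in
  \<tau>.\<close>

lemma fourier_symbol_mult:
  assumes \<epsilon>: "\<epsilon> > 0" and \<phi>: "schwartz \<phi>" and \<gamma>: "\<gamma> = real k - \<sigma> / 2" "\<gamma> > 0"
  shows "(LINT \<tau>|lborel. complex_of_real (weight \<gamma> \<tau> * exp (- (\<epsilon>\<^sup>2 * \<tau>))) * fourier (smoothed \<tau> 0 (shifted_power \<epsilon> k \<phi>)) x)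
    = complex_of_real (Gamma \<gamma>) * fourier (symbol_mult \<epsilon> \<sigma> \<phi>) x"
proof -
  let ?\<eta> = "shifted_power \<epsilon> k \<phi>"
  note \<eta> = schwartz_shifted_power[OF \<phi>, of \<epsilon> k]
  have [measurable]: "?\<eta> \<in> borel_measurable borel" by (rule schwartz_borel[OF \<eta>])
  have m [measurable]: "smoothed \<tau> 0 ?\<eta> \<in> borel_measurable borel" for \<tau> unfolding smoothed_def[abs_def] by measurable
  let ?w = "\<lambda>\<tau>. weight \<gamma> \<tau> * exp (- (\<epsilon>\<^sup>2 * \<tau>))"
  have "(LINT \<tau>|lborel. complex_of_real (?w \<tau>) * fourier (smoothed \<tau> 0 ?\<eta>) x)
    = (LINT \<tau>|lborel. LINT \<xi>|lborel. complex_of_real (?w \<tau>) * (cis (- (\<xi> \<bullet> x)) * smoothed \<tau> 0 ?\<eta> \<xi>))"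
    by (simp add: fourier_lborel[OF m])
  also have "\<dots> = (LINT \<xi>|lborel. LINT \<tau>|lborel. complex_of_real (?w \<tau>) * (cis (- (\<xi> \<bullet> x)) * smoothed \<tau> 0 ?\<eta> \<xi>))"
  proof (rule fubini_dominated(1))
    show "(\<lambda>(\<tau>, \<xi>). complex_of_real (?w \<tau>) * (cis (- (\<xi> \<bullet> x)) * smoothed \<tau> 0 ?\<eta> \<xi>)) \<in> borel_measurable (borel \<Otimes>\<^sub>M borel)"
      unfolding smoothed_def by measurable
    show "integrable lborel ?w" using Gamma_weight(1)[OF \<gamma>(2), of "\<epsilon>\<^sup>2"] \<epsilon> by simp
    show "integrable lborel (\<lambda>\<xi>. cmod (?\<eta> \<xi>))" by (intro integrable_norm schwartz_integrable \<eta>)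
    fix \<tau> :: real and \<xi> :: "real^'n"
    show "cmod (complex_of_real (?w \<tau>) * (cis (- (\<xi> \<bullet> x)) * smoothed \<tau> 0 ?\<eta> \<xi>)) \<le> ?w \<tau> * cmod (?\<eta> \<xi>)"
    proof (cases "\<tau> > 0")
      case True
      thus ?thesis by (simp add: norm_mult weight_nonneg smoothed_def mult_left_le_one_le mult_left_mono)
    qed (simp add: weight_0)
  qed
  also have "\<dots> = (LINT \<xi>|lborel. complex_of_real (Gamma \<gamma>) * (cis (- (\<xi> \<bullet> x)) * symbol_mult \<epsilon> \<sigma> \<phi> \<xi>))"
  proof (rule Bochner_Integration.integral_cong[OF refl])
    fix \<xi> :: "real^'n"
    let ?X = "\<epsilon>\<^sup>2 + (norm \<xi>)\<^sup>2"
    have X: "?X > 0" using \<epsilon> by (simp add: add_pos_nonneg)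
    have "complex_of_real (?w \<tau>) * (cis (- (\<xi> \<bullet> x)) * smoothed \<tau> 0 ?\<eta> \<xi>)
      = complex_of_real (weight \<gamma> \<tau> * exp (- (?X * \<tau>))) * (cis (- (\<xi> \<bullet> x)) * ?\<eta> \<xi>)" for \<tau>
    proof -
      have "exp (- (?X * \<tau>)) = exp (- (\<epsilon>\<^sup>2 * \<tau>)) * exp (- (\<tau> * (norm \<xi>)\<^sup>2))"
        by (simp add: algebra_simps flip: exp_add)
      thus ?thesis by (simp only: smoothed_def of_real_mult mult_ac power_0 mult_1 mult_1_right)
    qed
    hence "(LINT \<tau>|lborel. complex_of_real (?w \<tau>) * (cis (- (\<xi> \<bullet> x)) * smoothed \<tau> 0 ?\<eta> \<xi>))
      = complex_of_real (Gamma \<gamma> * ?X powr (- \<gamma>)) * (cis (- (\<xi> \<bullet> x)) * ?\<eta> \<xi>)"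
      by (simp only: integral_mult_left_zero integral_complex_of_real Gamma_weight(2)[OF \<gamma>(2) X])
    also have "complex_of_real (Gamma \<gamma> * ?X powr (- \<gamma>)) * (cis (- (\<xi> \<bullet> x)) * ?\<eta> \<xi>)
      = complex_of_real (Gamma \<gamma>) * (cis (- (\<xi> \<bullet> x)) * symbol_mult \<epsilon> \<sigma> \<phi> \<xi>)"
    proof -
      have "?X powr (- \<gamma>) * ?X ^ k = ?X powr (\<sigma> / 2)"
        using X by (simp add: \<gamma>(1) flip: powr_realpow powr_add)
      hence "complex_of_real (?X powr (\<sigma> / 2)) = complex_of_real (?X powr (- \<gamma>)) * complex_of_real ?X ^ k"
        by (metis of_real_mult of_real_power)
      thus ?thesis by (simp only: symbol_mult_def shifted_power_def of_real_mult mult_ac)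
    qed
    finally show "(LINT \<tau>|lborel. complex_of_real (?w \<tau>) * (cis (- (\<xi> \<bullet> x)) * smoothed \<tau> 0 ?\<eta> \<xi>))
      = complex_of_real (Gamma \<gamma>) * (cis (- (\<xi> \<bullet> x)) * symbol_mult \<epsilon> \<sigma> \<phi> \<xi>)" .
  qed
  also have "\<dots> = complex_of_real (Gamma \<gamma>) * fourier (symbol_mult \<epsilon> \<sigma> \<phi>) x"
    unfolding fourier_lborel[OF schwartz_borel[OF schwartz_symbol_mult[OF \<epsilon> \<phi>]]] by (rule integral_mult_right_zero)
  finally show ?thesis .
qed

text \<open>An abstract functional cannot simply be moved inside the \<tau>-integral. After
  smoothing by \<open>r > 0\<close> it is integration against \<open>heat r\<close>, which is
  bounded almost everywhere, so Fubini does it.\<close>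

lemma smoothed_symbol_mult:
  assumes \<epsilon>: "\<epsilon> > 0" and \<phi>: "schwartz \<phi>" and \<gamma>: "\<gamma> = real k - \<sigma> / 2" "\<gamma> > 0" and r: "r > 0"
  shows "complex_of_real (Gamma \<gamma>) * T (fourier (smoothed r 0 (symbol_mult \<epsilon> \<sigma> \<phi>)))
    = (LINT \<tau>|lborel. complex_of_real (weight \<gamma> \<tau> * exp (- (\<epsilon>\<^sup>2 * \<tau>))) * profile 0 (shifted_power \<epsilon> k \<phi>) (r + \<tau>))"
proof -
  let ?\<eta> = "shifted_power \<epsilon> k \<phi>"
  note \<eta> = schwartz_shifted_power[OF \<phi>, of \<epsilon> k]
  let ?w = "\<lambda>\<tau>. weight \<gamma> \<tau> * exp (- (\<epsilon>\<^sup>2 * \<tau>))"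
  note [measurable] = fourier_smoothed_borel[OF \<eta>, of 0]
  define F where "F \<tau> x = complex_of_real (?w \<tau>) * (complex_of_real (heat r x) * fourier (smoothed \<tau> 0 ?\<eta>) x)" for \<tau> x
  have [measurable]: "(\<lambda>(\<tau>, x). F \<tau> x) \<in> borel_measurable (borel \<Otimes>\<^sub>M borel)"
    unfolding F_def by measurable
  define M where "M = r powr (- (\<beta> / 2)) * B"
  have M: "M \<ge> 0" using B by (simp add: M_def)
  have wint: "integrable lborel ?w" using Gamma_weight(1)[OF \<gamma>(2), of "\<epsilon>\<^sup>2"] \<epsilon> by simp
  have inner: "(\<integral>\<^sup>+x. ennreal (cmod (F \<tau> x)) \<partial>lborel) \<le> ennreal (?w \<tau> * (M * L1 (fourier ?\<eta>)))" for \<tau>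
  proof (cases "\<tau> > 0")
    case True
    have s: "schwartz (fourier (smoothed \<tau> 0 ?\<eta>))" using True by (intro schwartz_fourier schwartz_smoothed \<eta>) auto
    have "(\<integral>\<^sup>+x. ennreal (cmod (F \<tau> x)) \<partial>lborel) \<le> (\<integral>\<^sup>+x. ennreal (?w \<tau> * (M * cmod (fourier (smoothed \<tau> 0 ?\<eta>) x))) \<partial>lborel)"
    proof (rule nn_integral_mono_AE)
      show "AE x in lborel. ennreal (cmod (F \<tau> x)) \<le> ennreal (?w \<tau> * (M * cmod (fourier (smoothed \<tau> 0 ?\<eta>) x)))"
        using heat_AE[OF r] by eventually_elim
          (auto simp: F_def norm_mult weight_nonneg M_def[symmetric] intro!: ennreal_leI mult_left_mono mult_right_mono)
    qed
    also have "\<dots> = ennreal (LINT x|lborel. ?w \<tau> * (M * cmod (fourier (smoothed \<tau> 0 ?\<eta>) x)))"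
      by (intro nn_integral_eq_integral integrable_mult_right integrable_norm schwartz_integrable s)
         (auto simp: weight_nonneg M)
    also have "(LINT x|lborel. ?w \<tau> * (M * cmod (fourier (smoothed \<tau> 0 ?\<eta>) x))) = ?w \<tau> * (M * L1 (fourier (smoothed \<tau> 0 ?\<eta>)))"
      by (simp only: integral_mult_right_zero L1_def)
    also have "ennreal \<dots> \<le> ennreal (?w \<tau> * (M * L1 (fourier ?\<eta>)))"
      using True M by (intro ennreal_leI mult_left_mono L1_fourier_smoothed_0 \<eta>) (auto simp: weight_nonneg)
    finally show ?thesis .
  qed (simp add: F_def weight_0)
  have Fint: "integrable (lborel \<Otimes>\<^sub>M lborel) (\<lambda>(\<tau>, x). F \<tau> x)"
    unfolding integrable_iff_bounded
  proof
    have "(\<integral>\<^sup>+z. ennreal (norm (case z of (\<tau>, x) \<Rightarrow> F \<tau> x)) \<partial>(lborel \<Otimes>\<^sub>M lborel))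
      = (\<integral>\<^sup>+\<tau>. (\<integral>\<^sup>+x. ennreal (cmod (F \<tau> x)) \<partial>lborel) \<partial>lborel)"
      by (subst lborel.nn_integral_fst[symmetric]) auto
    also have "\<dots> \<le> (\<integral>\<^sup>+\<tau>. ennreal (?w \<tau> * (M * L1 (fourier ?\<eta>))) \<partial>lborel)"
      by (intro nn_integral_mono inner)
    also have "\<dots> = ennreal (LINT \<tau>|lborel. ?w \<tau> * (M * L1 (fourier ?\<eta>)))"
      by (intro nn_integral_eq_integral integrable_mult_left wint) (auto simp: weight_nonneg M L1_nonneg)
    finally show "(\<integral>\<^sup>+z. ennreal (norm (case z of (\<tau>, x) \<Rightarrow> F \<tau> x)) \<partial>(lborel \<Otimes>\<^sub>M lborel)) < \<infinity>"
      by (auto intro: order.strict_trans1)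
  qed measurable
  have "complex_of_real (Gamma \<gamma>) * T (fourier (smoothed r 0 (symbol_mult \<epsilon> \<sigma> \<phi>)))
    = (LINT x|lborel. complex_of_real (Gamma \<gamma>) * (complex_of_real (heat r x) * fourier (symbol_mult \<epsilon> \<sigma> \<phi>) x))"
    unfolding profile_eq[OF r schwartz_symbol_mult[OF \<epsilon> \<phi>]] profile_def by simp
  also have "\<dots> = (LINT x|lborel. LINT \<tau>|lborel. F \<tau> x)"
  proof (rule Bochner_Integration.integral_cong[OF refl])
    fix x
    have "(LINT \<tau>|lborel. F \<tau> x) = (LINT \<tau>|lborel. complex_of_real (heat r x) * (complex_of_real (?w \<tau>) * fourier (smoothed \<tau> 0 ?\<eta>) x))"
      by (simp only: F_def mult_ac)
    also have "\<dots> = complex_of_real (heat r x) * (complex_of_real (Gamma \<gamma>) * fourier (symbol_mult \<epsilon> \<sigma> \<phi>) x)"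
      by (simp only: integral_mult_right_zero fourier_symbol_mult[OF \<epsilon> \<phi> \<gamma>])
    finally show "complex_of_real (Gamma \<gamma>) * (complex_of_real (heat r x) * fourier (symbol_mult \<epsilon> \<sigma> \<phi>) x) = (LINT \<tau>|lborel. F \<tau> x)"
      by (simp only: mult_ac)
  qed
  also have "\<dots> = (LINT \<tau>|lborel. LINT x|lborel. F \<tau> x)"
    by (rule lborel_pair.Fubini_integral[OF Fint])
  also have "\<dots> = (LINT \<tau>|lborel. complex_of_real (?w \<tau>) * profile 0 ?\<eta> (r + \<tau>))"
  proof (rule Bochner_Integration.integral_cong[OF refl])
    fix \<tau>
    show "(LINT x|lborel. F \<tau> x) = complex_of_real (?w \<tau>) * profile 0 ?\<eta> (r + \<tau>)"
    proof (cases "\<tau> > 0")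
      case True
      have s: "schwartz (smoothed \<tau> 0 ?\<eta>)" using True by (intro schwartz_smoothed \<eta>) auto
      have "(LINT x|lborel. complex_of_real (heat r x) * fourier (smoothed \<tau> 0 ?\<eta>) x) = profile 0 (smoothed \<tau> 0 ?\<eta>) r"
        by (simp add: profile_def)
      also have "\<dots> = T (fourier (smoothed r 0 (smoothed \<tau> 0 ?\<eta>)))" by (rule profile_eq[OF r s, symmetric])
      also have "\<dots> = profile 0 ?\<eta> (r + \<tau>)"
        unfolding smoothed_smoothed using profile_eq[OF _ \<eta>, of "r + \<tau>" 0] r True by simp
      finally show ?thesis by (simp only: F_def integral_mult_right_zero)
    qed (simp add: F_def weight_0)
  qed
  finally show ?thesis .
qed

text \<open>Lets the auxiliary time r tend to 0: \<open>smoothing_tendsto\<close> on the left,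
  dominated convergence with the uniform bound of the profile on the right.\<close>

lemma symbol_mult_eq:
  assumes \<epsilon>: "\<epsilon> > 0" and \<phi>: "schwartz \<phi>" and \<gamma>: "\<gamma> = real k - \<sigma> / 2" "\<gamma> > 0"
  shows "complex_of_real (Gamma \<gamma>) * T (fourier (symbol_mult \<epsilon> \<sigma> \<phi>))
    = (LINT \<tau>|lborel. complex_of_real (weight \<gamma> \<tau> * exp (- (\<epsilon>\<^sup>2 * \<tau>))) * profile 0 (shifted_power \<epsilon> k \<phi>) \<tau>)"
proof -
  let ?\<eta> = "shifted_power \<epsilon> k \<phi>"
  note \<eta> = schwartz_shifted_power[OF \<phi>, of \<epsilon> k]
  have [measurable]: "profile 0 ?\<eta> \<in> borel_measurable borel" by (rule profile_borel[OF \<eta>])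
  let ?w = "\<lambda>\<tau>. weight \<gamma> \<tau> * exp (- (\<epsilon>\<^sup>2 * \<tau>))"
  have wint: "integrable lborel ?w" using Gamma_weight(1)[OF \<gamma>(2), of "\<epsilon>\<^sup>2"] \<epsilon> by simp
  obtain C where C: "C \<ge> 0" "\<And>\<tau>. cmod (profile 0 ?\<eta> \<tau>) \<le> C"
      "\<And>\<tau>. \<tau> > 0 \<Longrightarrow> cmod (profile 0 ?\<eta> \<tau>) \<le> C * \<tau> powr (- (\<beta> / 2) - real 0)"
    by (rule profile_bound[OF \<eta>, of 0]) (rule that)
  have "((\<lambda>r. LINT \<tau>|lborel. complex_of_real (?w \<tau>) * profile 0 ?\<eta> (r + \<tau>))
    \<longlongrightarrow> (LINT \<tau>|lborel. complex_of_real (?w \<tau>) * profile 0 ?\<eta> \<tau>)) (at_right 0)"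
  proof (rule at_right_dominated_convergence[where d = 1])
    show "integrable lborel (\<lambda>\<tau>. ?w \<tau> * C)" by (intro integrable_mult_left wint)
    show "AE \<tau> in lborel. ((\<lambda>r. complex_of_real (?w \<tau>) * profile 0 ?\<eta> (r + \<tau>))
      \<longlongrightarrow> complex_of_real (?w \<tau>) * profile 0 ?\<eta> \<tau>) (at_right 0)"
    proof (rule AE_I2)
      fix \<tau> :: real
      show "((\<lambda>r. complex_of_real (?w \<tau>) * profile 0 ?\<eta> (r + \<tau>))
        \<longlongrightarrow> complex_of_real (?w \<tau>) * profile 0 ?\<eta> \<tau>) (at_right 0)"
      proof (cases "\<tau> > 0")
        case True
        have "((\<lambda>r. T (fourier (smoothed (r + \<tau>) 0 ?\<eta>))) \<longlongrightarrow> T (fourier (smoothed \<tau> 0 ?\<eta>))) (at_right 0)"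
          using True by (intro smoothing_tendsto \<eta>) auto
        hence "((\<lambda>r. T (fourier (smoothed (r + \<tau>) 0 ?\<eta>))) \<longlongrightarrow> profile 0 ?\<eta> \<tau>) (at_right 0)"
          unfolding profile_eq[OF True \<eta>] .
        hence "((\<lambda>r. profile 0 ?\<eta> (r + \<tau>)) \<longlongrightarrow> profile 0 ?\<eta> \<tau>) (at_right 0)"
        proof (rule Lim_transform_eventually)
          show "\<forall>\<^sub>F r in at_right 0. T (fourier (smoothed (r + \<tau>) 0 ?\<eta>)) = profile 0 ?\<eta> (r + \<tau>)"
            unfolding eventually_at_right_field by (intro exI[of _ 1]) (use True in \<open>auto intro!: profile_eq \<eta>\<close>)
        qed
        thus ?thesis by (rule tendsto_mult_left)
      qed (simp add: weight_0)
    qed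
    show "AE \<tau> in lborel. cmod (complex_of_real (?w \<tau>) * profile 0 ?\<eta> (r + \<tau>)) \<le> ?w \<tau> * C" for r
      using C(2) by (intro AE_I2) (auto simp: norm_mult weight_nonneg intro!: mult_left_mono)
  qed measurable
  moreover have "((\<lambda>r. LINT \<tau>|lborel. complex_of_real (?w \<tau>) * profile 0 ?\<eta> (r + \<tau>))
    \<longlongrightarrow> complex_of_real (Gamma \<gamma>) * T (fourier (symbol_mult \<epsilon> \<sigma> \<phi>))) (at_right 0)"
  proof (rule Lim_transform_eventually)
    have "((\<lambda>r. T (fourier (smoothed (r + 0) 0 (symbol_mult \<epsilon> \<sigma> \<phi>))))
      \<longlongrightarrow> T (fourier (smoothed 0 0 (symbol_mult \<epsilon> \<sigma> \<phi>)))) (at_right 0)"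
      by (intro smoothing_tendsto schwartz_symbol_mult \<epsilon> \<phi>) simp
    thus "((\<lambda>r. complex_of_real (Gamma \<gamma>) * T (fourier (smoothed r 0 (symbol_mult \<epsilon> \<sigma> \<phi>))))
      \<longlongrightarrow> complex_of_real (Gamma \<gamma>) * T (fourier (symbol_mult \<epsilon> \<sigma> \<phi>))) (at_right 0)"
      by (intro tendsto_mult_left) simp
    show "\<forall>\<^sub>F r in at_right 0. complex_of_real (Gamma \<gamma>) * T (fourier (smoothed r 0 (symbol_mult \<epsilon> \<sigma> \<phi>)))
      = (LINT \<tau>|lborel. complex_of_real (?w \<tau>) * profile 0 ?\<eta> (r + \<tau>))"
      unfolding eventually_at_right_field
      by (intro exI[of _ 1] conjI allI impI smoothed_symbol_mult[OF \<epsilon> \<phi> \<gamma>]) auto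
  qed
  ultimately show ?thesis by (intro tendsto_unique[of "at_right (0::real)"]) auto
qed

text \<open>Trades powers of a = \<open>\<epsilon>\<^sup>2\<close> for decay in \<tau>, by a single
  term of the exponential series.\<close>

lemma exp_power_le:
  fixes a \<tau> :: real
  assumes "a > 0" "\<tau> > 0"
  shows "a ^ m * exp (- (a * \<tau>)) \<le> fact m * (1 / \<tau>) ^ m"
proof -
  have "(\<Sum>n\<in>{m}. inverse (fact n) * (a * \<tau>) ^ n) \<le> (\<Sum>n. inverse (fact n) * (a * \<tau>) ^ n)"
    by (rule sum_le_suminf[OF summable_exp]) (use assms in auto)
  hence "inverse (fact m) * (a * \<tau>) ^ m \<le> exp (a * \<tau>)" by (simp add: exp_def)
  thus ?thesis using assms by (simp add: exp_minus field_simps power_mult_distrib power_divide)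
qed

text \<open>Dominated convergence as \<epsilon> tends to 0. Profiles with j < k decay too slowly,
  but they come with \<open>(\<epsilon>\<^sup>2) ^ (k - j) * exp (- (\<epsilon>\<^sup>2 *
  \<tau>))\<close>, which is at most a constant times \<open>(1 / \<tau>) ^ (k - j)\<close>: the
  missing decay is restored uniformly in \<epsilon>, and every term has the decay of the profile of
  order k.\<close>

theorem weyl_formula:
  assumes \<phi>: "schwartz \<phi>" and \<gamma>: "\<gamma> = real k - \<sigma> / 2" "\<gamma> > 0" and \<sigma>: "\<sigma> \<ge> 0"
  shows "((\<lambda>\<epsilon>. T (fourier (symbol_mult \<epsilon> \<sigma> \<phi>)))
    \<longlongrightarrow> complex_of_real (1 / Gamma \<gamma>) * (LINT \<tau>|lborel. complex_of_real (weight \<gamma> \<tau>) * profile k \<phi> \<tau>)) (at_right 0)"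
proof -
  have [measurable]: "profile j \<phi> \<in> borel_measurable borel" for j by (rule profile_borel[OF \<phi>])
  define F where "F \<epsilon> \<tau> = complex_of_real (weight \<gamma> \<tau> * exp (- (\<epsilon>\<^sup>2 * \<tau>))) * profile 0 (shifted_power \<epsilon> k \<phi>) \<tau>" for \<epsilon> \<tau>
  have F_sum: "F \<epsilon> \<tau> = complex_of_real (weight \<gamma> \<tau>) * (\<Sum>j\<le>k. complex_of_real (exp (- (\<epsilon>\<^sup>2 * \<tau>)) * (real (k choose j) * (\<epsilon>\<^sup>2) ^ (k - j))) * profile j \<phi> \<tau>)" for \<epsilon> \<tau>
    unfolding F_def profile_shifted_power[OF \<phi>] by (simp add: sum_distrib_left mult_ac)
  have "\<forall>j. \<exists>C\<ge>0. (\<forall>\<tau>. cmod (profile j \<phi> \<tau>) \<le> C) \<and> (\<forall>\<tau>>0. cmod (profile j \<phi> \<tau>) \<le> C * \<tau> powr (- (\<beta> / 2) - real j))"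
    using profile_bound[OF \<phi>] by metis
  then obtain C where C: "\<And>j. C j \<ge> 0" "\<And>j \<tau>. cmod (profile j \<phi> \<tau>) \<le> C j"
    "\<And>j \<tau>. \<tau> > 0 \<Longrightarrow> cmod (profile j \<phi> \<tau>) \<le> C j * \<tau> powr (- (\<beta> / 2) - real j)" by metis
  define K where "K = (\<Sum>j\<le>k. real (k choose j) * fact (k - j) * C j)"
  have K: "K \<ge> 0" unfolding K_def by (intro sum_nonneg mult_nonneg_nonneg C) auto
  have F_le: "cmod (F \<epsilon> \<tau>) \<le> K * envelope \<gamma> ((\<sigma> + \<beta>) / 2) \<tau>" if \<epsilon>: "0 < \<epsilon>" "\<epsilon> < 1" for \<epsilon> \<tau>
  proof -
    define S where "S = (\<Sum>j\<le>k. complex_of_real (exp (- (\<epsilon>\<^sup>2 * \<tau>)) * (real (k choose j) * (\<epsilon>\<^sup>2) ^ (k - j))) * profile j \<phi> \<tau>)"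
    have \<epsilon>2: "0 < \<epsilon>\<^sup>2" "\<epsilon>\<^sup>2 \<le> 1" using \<epsilon> by (auto simp: power_le_one)
    have Sle: "cmod S \<le> (\<Sum>j\<le>k. real (k choose j) * ((\<epsilon>\<^sup>2) ^ (k - j) * exp (- (\<epsilon>\<^sup>2 * \<tau>)) * cmod (profile j \<phi> \<tau>)))"
      unfolding S_def by (rule order_trans[OF norm_sum]) (simp add: norm_mult norm_power mult_ac)
    have 1: "cmod S \<le> K"
    proof (cases "\<tau> > 0")
      case True
      have "(\<Sum>j\<le>k. real (k choose j) * ((\<epsilon>\<^sup>2) ^ (k - j) * exp (- (\<epsilon>\<^sup>2 * \<tau>)) * cmod (profile j \<phi> \<tau>))) \<le> K"
        unfolding K_def mult.assoc
      proof (intro sum_mono mult_left_mono)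
        fix j
        have "(\<epsilon>\<^sup>2) ^ (k - j) * (exp (- (\<epsilon>\<^sup>2 * \<tau>)) * cmod (profile j \<phi> \<tau>)) \<le> 1 * (1 * C j)"
          using \<epsilon> \<epsilon>2 True C(1,2)[of j] by (intro mult_mono power_le_one) auto
        also have "\<dots> \<le> fact (k - j) * C j" using C(1)[of j] by (simp add: mult_right_mono[of 1 "fact (k - j)" "C j", simplified])
        finally show "(\<epsilon>\<^sup>2) ^ (k - j) * (exp (- (\<epsilon>\<^sup>2 * \<tau>)) * cmod (profile j \<phi> \<tau>)) \<le> fact (k - j) * C j" .
      qed auto
      with Sle show ?thesis by linarith
    qed (use K in \<open>simp add: S_def profile_nonpos\<close>)
    have 2: "cmod S \<le> K * \<tau> powr (- (\<beta> / 2) - real k)" if "\<tau> > 1"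
    proof -
      have \<tau>: "\<tau> > 0" using that by simp
      have "(\<Sum>j\<le>k. real (k choose j) * ((\<epsilon>\<^sup>2) ^ (k - j) * exp (- (\<epsilon>\<^sup>2 * \<tau>)) * cmod (profile j \<phi> \<tau>))) \<le> K * \<tau> powr (- (\<beta> / 2) - real k)"
        unfolding K_def sum_distrib_right
      proof (rule sum_mono)
        fix j assume "j \<in> {..k}"
        hence "real k = real j + real (k - j)" by simp
        have "(\<epsilon>\<^sup>2) ^ (k - j) * exp (- (\<epsilon>\<^sup>2 * \<tau>)) * cmod (profile j \<phi> \<tau>)
          \<le> (fact (k - j) * (1 / \<tau>) ^ (k - j)) * (C j * \<tau> powr (- (\<beta> / 2) - real j))"
          using \<tau> C(1)[of j] by (intro mult_mono exp_power_le \<epsilon>2 C(3)) auto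
        also have "(1 / \<tau>) ^ (k - j) = \<tau> powr (- real (k - j))"
          using \<tau> by (simp add: powr_minus powr_realpow power_divide divide_inverse power_inverse)
        also have "(fact (k - j) * \<tau> powr (- real (k - j))) * (C j * \<tau> powr (- (\<beta> / 2) - real j))
          = fact (k - j) * C j * (\<tau> powr (- real (k - j)) * \<tau> powr (- (\<beta> / 2) - real j))" by simp
        also have "\<tau> powr (- real (k - j)) * \<tau> powr (- (\<beta> / 2) - real j) = \<tau> powr (- (\<beta> / 2) - real k)"
          unfolding powr_add[symmetric] by (rule arg_cong[of _ _ "(powr) \<tau>"]) (use \<open>real k = real j + real (k - j)\<close> in linarith)
        finally have "real (k choose j) * ((\<epsilon>\<^sup>2) ^ (k - j) * exp (- (\<epsilon>\<^sup>2 * \<tau>)) * cmod (profile j \<phi> \<tau>))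
          \<le> real (k choose j) * (fact (k - j) * C j * \<tau> powr (- (\<beta> / 2) - real k))" by (rule mult_left_mono) simp
        thus "real (k choose j) * ((\<epsilon>\<^sup>2) ^ (k - j) * exp (- (\<epsilon>\<^sup>2 * \<tau>)) * cmod (profile j \<phi> \<tau>))
          \<le> real (k choose j) * fact (k - j) * C j * \<tau> powr (- (\<beta> / 2) - real k)" by (simp only: mult.assoc)
      qed
      with Sle show ?thesis by linarith
    qed
    have "cmod (F \<epsilon> \<tau>) = weight \<gamma> \<tau> * cmod S"
      unfolding F_sum S_def[symmetric] by (simp add: norm_mult weight_nonneg)
    also have "\<dots> \<le> K * envelope \<gamma> ((\<sigma> + \<beta>) / 2) \<tau>"
      by (rule weight_profile_le[OF K 1 2 \<gamma>(1)]) auto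
    finally show ?thesis .
  qed
  have "((\<lambda>\<epsilon>. LINT \<tau>|lborel. F \<epsilon> \<tau>) \<longlongrightarrow> (LINT \<tau>|lborel. complex_of_real (weight \<gamma> \<tau>) * profile k \<phi> \<tau>)) (at_right 0)"
  proof (rule at_right_dominated_convergence[where d = 1])
    show "F \<epsilon> \<in> borel_measurable lborel" for \<epsilon> unfolding F_sum[abs_def] by measurable
    show "integrable lborel (\<lambda>\<tau>. K * envelope \<gamma> ((\<sigma> + \<beta>) / 2) \<tau>)"
      using \<gamma> \<sigma> \<beta> by (intro integrable_mult_right envelope_integrable) auto
    show "AE \<tau> in lborel. ((\<lambda>\<epsilon>. F \<epsilon> \<tau>) \<longlongrightarrow> complex_of_real (weight \<gamma> \<tau>) * profile k \<phi> \<tau>) (at_right 0)"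
    proof (rule AE_I2)
      fix \<tau> :: real
      have "((\<lambda>\<epsilon>. \<Sum>j\<le>k. complex_of_real (exp (- (\<epsilon>\<^sup>2 * \<tau>)) * (real (k choose j) * (\<epsilon>\<^sup>2) ^ (k - j))) * profile j \<phi> \<tau>)
        \<longlongrightarrow> (\<Sum>j\<le>k. complex_of_real (exp (- (0\<^sup>2 * \<tau>)) * (real (k choose j) * (0\<^sup>2) ^ (k - j))) * profile j \<phi> \<tau>)) (at_right 0)"
        by (intro tendsto_intros)
      also have "(\<Sum>j\<le>k. complex_of_real (exp (- (0\<^sup>2 * \<tau>)) * (real (k choose j) * (0\<^sup>2) ^ (k - j))) * profile j \<phi> \<tau>)
        = (\<Sum>j\<le>k. if j = k then profile k \<phi> \<tau> else 0)"
        by (intro sum.cong refl) (auto simp: power_0_left)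
      also have "\<dots> = profile k \<phi> \<tau>" by simp
      finally show "((\<lambda>\<epsilon>. F \<epsilon> \<tau>) \<longlongrightarrow> complex_of_real (weight \<gamma> \<tau>) * profile k \<phi> \<tau>) (at_right 0)"
        unfolding F_sum by (rule tendsto_mult_left)
    qed
    show "AE \<tau> in lborel. cmod (F \<epsilon> \<tau>) \<le> K * envelope \<gamma> ((\<sigma> + \<beta>) / 2) \<tau>" if "0 < \<epsilon>" "\<epsilon> < 0 + 1" for \<epsilon>
      using F_le[of \<epsilon>] that by (intro AE_I2) auto
  qed auto
  hence "((\<lambda>\<epsilon>. complex_of_real (1 / Gamma \<gamma>) * (LINT \<tau>|lborel. F \<epsilon> \<tau>))
    \<longlongrightarrow> complex_of_real (1 / Gamma \<gamma>) * (LINT \<tau>|lborel. complex_of_real (weight \<gamma> \<tau>) * profile k \<phi> \<tau>)) (at_right 0)"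
    by (rule tendsto_mult_left)
  thus ?thesis
  proof (rule Lim_transform_eventually)
    have "Gamma \<gamma> \<noteq> 0" using Gamma_real_pos[OF \<gamma>(2)] by simp
    thus "\<forall>\<^sub>F \<epsilon> in at_right 0. complex_of_real (1 / Gamma \<gamma>) * (LINT \<tau>|lborel. F \<epsilon> \<tau>) = T (fourier (symbol_mult \<epsilon> \<sigma> \<phi>))"
      unfolding eventually_at_right_field F_def
      using symbol_mult_eq[OF _ \<phi> \<gamma>, symmetric] by (intro exI[of _ 1]) (simp del: of_real_divide add: of_real_divide)
  qed
qed

end

subsection \<open>The intermediate fractional Laplacian\<close>

text \<open>The inverse Fourier transform of the heat kernel centred at \<open>x\<close>.\<close>

definition gaussian_wave :: "real \<Rightarrow> real^'n \<Rightarrow> real^'n \<Rightarrow> complex" where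
  "gaussian_wave t x \<xi> = complex_of_real (1 / (2 * pi) ^ CARD('n))
     * (complex_of_real (exp (- (t * (norm \<xi>)\<^sup>2))) * cis (\<xi> \<bullet> x))"

lemma schwartz_gaussian_wave: "t > 0 \<Longrightarrow> schwartz (gaussian_wave t x)"
  unfolding gaussian_wave_def[abs_def] by (intro schwartz_cmult schwartz_exp_norm2 slow_smooth_cis)

lemma fourier_gaussian_wave:
  fixes x :: "real^'n"
  assumes t: "t > 0"
  shows "fourier (gaussian_wave t x) = (\<lambda>y. complex_of_real (heat_kernel t (x - y)))"
proof
  fix y
  let ?c = "complex_of_real (1 / (2 * pi) ^ CARD('n))"
  have "fourier (gaussian_wave t x) y = (LINT \<xi>|lborel. ?c * (complex_of_real (exp (- (t * (norm \<xi>)\<^sup>2))) * cis (- (\<xi> \<bullet> (y - x)))))"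
    unfolding fourier_lborel[OF schwartz_borel[OF schwartz_gaussian_wave[OF t]]]
  proof (rule Bochner_Integration.integral_cong[OF refl])
    fix \<xi>
    have "cis (- (\<xi> \<bullet> (y - x))) = cis (- (\<xi> \<bullet> y)) * cis (\<xi> \<bullet> x)"
      by (simp add: cis_mult inner_diff_right)
    thus "cis (- (\<xi> \<bullet> y)) * gaussian_wave t x \<xi> = ?c * (complex_of_real (exp (- (t * (norm \<xi>)\<^sup>2))) * cis (- (\<xi> \<bullet> (y - x))))"
      by (simp only: gaussian_wave_def mult_ac)
  qed
  also have "\<dots> = ?c * complex_of_real ((2 * pi) ^ CARD('n) * heat_kernel t (y - x))"
    by (simp only: integral_mult_right_zero exp_norm2_fourier[OF t])
  also have "\<dots> = complex_of_real (heat_kernel t (x - y))" by (simp add: heat_kernel_minus[of t x])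
  finally show "fourier (gaussian_wave t x) y = complex_of_real (heat_kernel t (x - y))" .
qed

lemma smoothed_gaussian_wave:
  fixes x :: "real^'n"
  shows "smoothed a 0 (gaussian_wave b x) = gaussian_wave (a + b) x"
proof
  fix \<xi> :: "real^'n"
  have "exp (- ((a + b) * (norm \<xi>)\<^sup>2)) = exp (- (a * (norm \<xi>)\<^sup>2)) * exp (- (b * (norm \<xi>)\<^sup>2))"
    by (simp add: algebra_simps flip: exp_add)
  thus "smoothed a 0 (gaussian_wave b x) \<xi> = gaussian_wave (a + b) x \<xi>"
    by (simp only: smoothed_def gaussian_wave_def power_0 mult_1 of_real_mult mult_ac)
qed

lemma L1_heat_translate:
  fixes x :: "real^'n"
  assumes t: "t > 0"
  shows "L1 (\<lambda>y. complex_of_real (heat_kernel t (x - y))) = 1"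
  using lborel_reflect(1)[of "heat_kernel t" x] heat_kernel_integral[OF t, where 'n = 'n]
  by (simp add: L1_def heat_kernel_nonneg)

text \<open>The added 1 keeps the inequality in \<open>order_nat\<close> strict when s / 2 is an
  integer, so that \<kappa> > 0.\<close>

definition order_nat :: "real \<Rightarrow> nat" where
  "order_nat s = nat \<lceil>s / 2\<rceil> + 1"

lemma order_nat: "s / 2 < real (order_nat s)"
  unfolding order_nat_def by linarith

text \<open>The constant of \<open>heat_sup_bound\<close>. The power of 2 comes from
  \<open>\<tau> + t / 2 \<ge> max \<tau> t / 2\<close>; the terms \<open>1 / \<kappa>\<close> and
  \<open>2 / (s + \<beta>)\<close>, that is 1 / \<nu>, are the integrals over \<tau> \<le> t and
  \<tau> > t.\<close>

definition sup_const :: "'n::finite itself \<Rightarrow> real \<Rightarrow> real \<Rightarrow> real" where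
  "sup_const _ \<beta> s = (let k = order_nat s; \<kappa> = real k - s / 2 in
     decay_const TYPE('n) \<beta> k * 2 powr (\<beta> / 2 + real k) / Gamma \<kappa> * (1 / \<kappa> + 2 / (s + \<beta>)))"

text \<open>The constant of \<open>u_bound\<close>: \<open>2 / (s - s1)\<close> is 1 / \<alpha> and
  \<open>2 / (s1 + \<beta>)\<close> is 1 / (\<nu> - \<alpha>), one from each side of the splitting
  time. Being defined outside the locale it cannot depend on f.\<close>

definition pointwise_const :: "'n::finite itself \<Rightarrow> real \<Rightarrow> real \<Rightarrow> real \<Rightarrow> real" where
  "pointwise_const _ \<beta> s s1 = (1 / Gamma ((s - s1) / 2)) * (2 / (s - s1) + sup_const TYPE('n) \<beta> s * (2 / (s1 + \<beta>)))"

locale fractional_pair = besov_distribution T f \<beta> B + lap: represented_distribution U g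
  for T :: "(real^'n \<Rightarrow> complex) \<Rightarrow> complex" and f \<beta> B and U :: "(real^'n \<Rightarrow> complex) \<Rightarrow> complex" and g +
  fixes s s1 :: real
  assumes s1: "0 \<le> s1" "s1 < s"
    and laplacian: "frac_laplacian s T U"
begin

definition k where "k = order_nat s"
definition \<kappa> where "\<kappa> = real k - s / 2"
definition \<alpha> where "\<alpha> = (s - s1) / 2"
definition \<nu> where "\<nu> = (s + \<beta>) / 2"

lemma \<kappa>: "\<kappa> > 0" using order_nat[of s] by (simp add: \<kappa>_def k_def)
lemma \<alpha>: "\<alpha> > 0" using s1 by (simp add: \<alpha>_def)
lemma \<nu>: "\<nu> > \<alpha>" using s1 \<beta> by (simp add: \<nu>_def \<alpha>_def)
lemma \<nu>_pos: "\<nu> > 0" using \<alpha> \<nu> by simp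

text \<open>The definition of the fractional Laplacian and \<open>weyl_formula\<close> describe the
  same limit; its uniqueness leaves a formula for U free of \<epsilon>.\<close>

lemma laplacian_profile:
  assumes \<phi>: "schwartz \<phi>"
  shows "U (fourier \<phi>) = complex_of_real (1 / Gamma \<kappa>) * (LINT \<tau>|lborel. complex_of_real (weight \<kappa> \<tau>) * profile k \<phi> \<tau>)"
proof -
  have "((\<lambda>\<epsilon>. T (fourier (symbol_mult \<epsilon> s \<phi>))) \<longlongrightarrow> U (fourier \<phi>)) (at_right 0)"
    using laplacian \<phi> s1 by (auto simp: frac_laplacian_def fourier_distr_def symbol_mult_def[abs_def])
  moreover have "((\<lambda>\<epsilon>. T (fourier (symbol_mult \<epsilon> s \<phi>)))
    \<longlongrightarrow> complex_of_real (1 / Gamma \<kappa>) * (LINT \<tau>|lborel. complex_of_real (weight \<kappa> \<tau>) * profile k \<phi> \<tau>)) (at_right 0)"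
    by (rule weyl_formula[OF \<phi> \<kappa>_def \<kappa>]) (use s1 in simp)
  ultimately show ?thesis by (intro tendsto_unique[of "at_right (0::real)"]) auto
qed

definition S where "S = sup_const TYPE('n) \<beta> s"

lemma S_nonneg: "S \<ge> 0"
  using decay_const_nonneg[where 'n = 'n, of \<beta> k] \<kappa> s1 \<beta> Gamma_real_pos[OF \<kappa>]
  by (simp add: S_def sup_const_def Let_def k_def[symmetric] \<kappa>_def[symmetric])

text \<open>The heat extension of g at (t, x) is U tested on a Gaussian, hence by
  \<open>laplacian_profile\<close> a weighted integral of heat flows of T. Splitting at \<tau> = t
  gives the power - \<nu>, for every x and not just almost everywhere.\<close>

lemma heat_sup_bound:
  assumes t: "t > 0"
  shows "\<bar>lap.heat t x\<bar> \<le> S * B * t powr (- \<nu>)"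
proof -
  let ?\<phi> = "gaussian_wave t x"
  have \<phi>: "schwartz ?\<phi>" by (rule schwartz_gaussian_wave[OF t])
  let ?\<psi> = "gaussian_wave (t / 2) x"
  have t2: "t / 2 > 0" using t by simp
  have \<psi>: "schwartz ?\<psi>" by (rule schwartz_gaussian_wave[OF t2])
  define D where "D = decay_const TYPE('n) \<beta> k * B * 2 powr (\<beta> / 2 + real k)"
  define \<mu> where "\<mu> = \<beta> / 2 + real k"
  have D: "D \<ge> 0" unfolding D_def using decay_const_nonneg[where 'n = 'n, of \<beta> k] B by simp
  have \<mu>: "\<mu> > 0" using \<beta> by (simp add: \<mu>_def add_pos_nonneg)
  \<comment> \<open>The Gaussian at time t is the one at time t / 2 smoothed for another t / 2. One
    half joins \<tau> in \<open>decay\<close>, the other keeps a test function of L1 norm 1.\<close>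
  have prof: "cmod (profile k ?\<phi> \<tau>) \<le> D * (max \<tau> t) powr (- \<mu>)" if \<tau>: "\<tau> > 0" for \<tau>
  proof -
    have "profile k ?\<phi> \<tau> = T (fourier (smoothed (\<tau> + t / 2) k ?\<psi>))"
    proof -
      have "?\<phi> = smoothed (t / 2) 0 ?\<psi>" unfolding smoothed_gaussian_wave by simp
      thus ?thesis using profile_eq[OF \<tau> \<phi>, of k] smoothed_smoothed[of \<tau> k "t / 2" 0 ?\<psi>] by simp
    qed
    hence "cmod (profile k ?\<phi> \<tau>) \<le> decay_const TYPE('n) \<beta> k * (\<tau> + t / 2) powr (- (\<beta> / 2) - real k) * B * L1 (fourier ?\<psi>)"
      using decay[of "\<tau> + t / 2" ?\<psi> k] \<tau> t \<psi> by simp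
    also have "L1 (fourier ?\<psi>) = 1" unfolding fourier_gaussian_wave[OF t2] by (rule L1_heat_translate[OF t2])
    also have "(\<tau> + t / 2) powr (- (\<beta> / 2) - real k) = (\<tau> + t / 2) powr (- \<mu>)"
      by (simp add: \<mu>_def)
    also have "decay_const TYPE('n) \<beta> k * (\<tau> + t / 2) powr (- \<mu>) * B * 1
      \<le> decay_const TYPE('n) \<beta> k * (max \<tau> t / 2) powr (- \<mu>) * B * 1"
      using \<tau> t \<mu> B decay_const_nonneg[where 'n = 'n, of \<beta> k]
      by (intro mult_right_mono mult_left_mono powr_mono2') auto
    also have "(max \<tau> t / 2) powr (- \<mu>) = (max \<tau> t) powr (- \<mu>) * 2 powr \<mu>"
      unfolding powr_divide by (simp add: powr_minus field_simps)
    finally show ?thesis by (simp add: D_def \<mu>_def mult_ac)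
  qed
  let ?h = "\<lambda>\<tau>. t powr (- \<mu>) * (indicator {0<..t} \<tau> * \<tau> powr (\<kappa> - 1)) + indicator {t<..} \<tau> * \<tau> powr (- 1 - \<nu>)"
  have hint: "integrable lborel ?h"
    by (intro Bochner_Integration.integrable_add integrable_mult_right powr_weight_0 powr_weight_inf \<kappa> \<nu>_pos t)
  have hval: "(LINT \<tau>|lborel. ?h \<tau>) = t powr (- \<nu>) * (1 / \<kappa> + 1 / \<nu>)"
  proof -
    have "(LINT \<tau>|lborel. ?h \<tau>) = t powr (- \<mu>) * (t powr \<kappa> / \<kappa>) + t powr (- \<nu>) / \<nu>"
      by (subst Bochner_Integration.integral_add)
         (auto intro!: integrable_mult_right powr_weight_0(1) powr_weight_inf(1) simp: powr_weight_0(2) powr_weight_inf(2) \<kappa> \<nu>_pos t)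
    also have "t powr (- \<mu>) * (t powr \<kappa> / \<kappa>) = t powr (- \<nu>) / \<kappa>"
    proof -
      have "t powr (- \<mu>) * t powr \<kappa> = t powr (- \<nu>)"
        unfolding powr_add[symmetric]
        by (rule arg_cong[of _ _ "(powr) t"]) (simp add: \<mu>_def \<kappa>_def \<nu>_def field_simps)
      thus ?thesis by simp
    qed
    finally show ?thesis by (simp add: distrib_left)
  qed
  have le: "weight \<kappa> \<tau> * cmod (profile k ?\<phi> \<tau>) \<le> D * ?h \<tau>" for \<tau>
  proof -
    consider "\<tau> \<le> 0" | "0 < \<tau>" "\<tau> \<le> t" | "\<tau> > t" by linarith
    thus ?thesis
    proof cases
      case 1 thus ?thesis using t by (simp add: weight_0)
    next
      case 2
      hence "max \<tau> t = t" by simp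
      hence "weight \<kappa> \<tau> * cmod (profile k ?\<phi> \<tau>) \<le> \<tau> powr (\<kappa> - 1) * (D * t powr (- \<mu>))"
        using prof[OF 2(1)] 2 by (auto simp: weight_pos intro!: mult_left_mono)
      thus ?thesis using 2 by (simp add: mult_ac)
    next
      case 3
      hence "max \<tau> t = \<tau>" "\<tau> > 0" using t by auto
      hence "weight \<kappa> \<tau> * cmod (profile k ?\<phi> \<tau>) \<le> \<tau> powr (\<kappa> - 1) * (D * \<tau> powr (- \<mu>))"
        using prof[of \<tau>] by (auto simp: weight_pos intro!: mult_left_mono)
      also have "\<dots> = D * (\<tau> powr (\<kappa> - 1) * \<tau> powr (- \<mu>))" by simp
      also have "\<tau> powr (\<kappa> - 1) * \<tau> powr (- \<mu>) = \<tau> powr (- 1 - \<nu>)"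
        unfolding powr_add[symmetric]
        by (rule arg_cong[of _ _ "(powr) \<tau>"]) (simp add: \<mu>_def \<kappa>_def \<nu>_def field_simps)
      finally show ?thesis using 3 by simp
    qed
  qed
  have Gp: "Gamma \<kappa> > 0" by (rule Gamma_real_pos[OF \<kappa>])
  have "complex_of_real (lap.heat t x) = U (fourier ?\<phi>)"
    unfolding fourier_gaussian_wave[OF t] lap.heat_conv_eq[OF t, symmetric] heat_conv_def ..
  hence "\<bar>lap.heat t x\<bar> = cmod (U (fourier ?\<phi>))" by (metis norm_of_real)
  also have "\<dots> = 1 / Gamma \<kappa> * cmod (LINT \<tau>|lborel. complex_of_real (weight \<kappa> \<tau>) * profile k ?\<phi> \<tau>)"
    unfolding laplacian_profile[OF \<phi>] using Gp by (simp add: norm_mult norm_divide)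
  also have "\<dots> \<le> 1 / Gamma \<kappa> * (LINT \<tau>|lborel. cmod (complex_of_real (weight \<kappa> \<tau>) * profile k ?\<phi> \<tau>))"
    using Gp by (intro mult_left_mono integral_norm_bound) auto
  also have "(LINT \<tau>|lborel. cmod (complex_of_real (weight \<kappa> \<tau>) * profile k ?\<phi> \<tau>)) = (LINT \<tau>|lborel. weight \<kappa> \<tau> * cmod (profile k ?\<phi> \<tau>))"
    by (simp add: norm_mult weight_nonneg)
  also have "(LINT \<tau>|lborel. weight \<kappa> \<tau> * cmod (profile k ?\<phi> \<tau>)) \<le> (LINT \<tau>|lborel. D * ?h \<tau>)"
    by (intro integral_mono integrable_mult_right hint le weight_profile_integrable[OF \<phi> \<kappa>_def \<kappa>]) (use s1 in auto)
  also have "\<dots> = D * (t powr (- \<nu>) * (1 / \<kappa> + 1 / \<nu>))" by (simp only: integral_mult_right_zero hval)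
  also have "1 / Gamma \<kappa> * (D * (t powr (- \<nu>) * (1 / \<kappa> + 1 / \<nu>))) = S * B * t powr (- \<nu>)"
  proof -
    have \<nu>_inv: "1 / \<nu> = 2 / (s + \<beta>)" by (simp add: \<nu>_def)
    have S_eq: "S = decay_const TYPE('n) \<beta> k * 2 powr (\<beta> / 2 + real k) / Gamma \<kappa> * (1 / \<kappa> + 1 / \<nu>)"
      unfolding \<nu>_inv by (simp only: S_def sup_const_def Let_def k_def \<kappa>_def)
    show ?thesis unfolding S_eq D_def by (simp only: times_divide_eq_left times_divide_eq_right mult_1_left mult_ac)
  qed
  finally show ?thesis using Gp by (simp add: divide_right_mono)
qed

text \<open>Where the time integral diverges the Bochner integral is 0 by default, so
  \<open>u\<close> is everywhere defined and the bounds below hold at such points too.\<close>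

definition u :: "real^'n \<Rightarrow> real" where
  "u x = 1 / Gamma \<alpha> * (LINT t|lborel. weight \<alpha> t * lap.heat t x)"

text \<open>Here the pairing in space is taken before the time integral, so that it converges for
  every Schwartz function; \<open>u\<close> is only shown to be locally integrable, and the two are
  matched on test functions.\<close>

definition V :: "(real^'n \<Rightarrow> complex) \<Rightarrow> complex" where
  "V \<psi> = complex_of_real (1 / Gamma \<alpha>) * (LINT t|lborel. complex_of_real (weight \<alpha> t)
     * (LINT x|lborel. complex_of_real (lap.heat t x) * \<psi> x))"

lemma Gamma_\<alpha>: "Gamma \<alpha> > 0" by (rule Gamma_real_pos[OF \<alpha>])

lemma u_borel [measurable]: "u \<in> borel_measurable borel"
  unfolding u_def[abs_def] by measurable

text \<open>Hedberg's splitting at the time \<open>t\<close> with \<open>L = B t\<^bsup>-\<nu>\<^esup>\<close>.\<close>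

lemma u_bound:
  assumes lam: "L \<ge> 0" "\<And>t. t > 0 \<Longrightarrow> \<bar>lap.heat t x\<bar> \<le> L"
  shows "\<bar>u x\<bar> \<le> pointwise_const TYPE('n) \<beta> s s1 * L powr (1 - \<alpha> / \<nu>) * B powr (\<alpha> / \<nu>)"
proof (cases "L = 0 \<or> B = 0")
  \<comment> \<open>In this degenerate case the splitting time is meaningless; the heat extension
    vanishes at x at all positive times, and so does \<open>u x\<close>.\<close>
  case True
  have "weight \<alpha> t * lap.heat t x = 0" for t
  proof (cases "t > 0")
    case True
    thus ?thesis using lam(2)[OF True] heat_sup_bound[OF True, of x] \<open>L = 0 \<or> B = 0\<close> by auto
  qed (simp add: weight_0)
  note z = this
  have "u x = 0" unfolding u_def z by simp
  thus ?thesis using S_nonneg s1 \<beta> Gamma_\<alpha>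
    by (auto simp: pointwise_const_def S_def[symmetric] \<alpha>_def[symmetric] intro!: mult_nonneg_nonneg add_nonneg_nonneg)
next
  case False
  hence pos: "L > 0" "B > 0" using lam(1) B by auto
  define \<tau> where "\<tau> = (B / L) powr (1 / \<nu>)"
  have \<tau>: "\<tau> > 0" using pos by (simp add: \<tau>_def)
  let ?h = "\<lambda>t. L * (indicator {0<..\<tau>} t * t powr (\<alpha> - 1)) + (S * B) * (indicator {\<tau><..} t * t powr (- 1 - (\<nu> - \<alpha>)))"
  have \<nu>\<alpha>: "\<nu> - \<alpha> > 0" using \<nu> by simp
  have hint: "integrable lborel ?h"
    by (intro Bochner_Integration.integrable_add integrable_mult_right powr_weight_0 powr_weight_inf \<alpha> \<nu>\<alpha> \<tau>)
  have hval: "(LINT t|lborel. ?h t) = L * (\<tau> powr \<alpha> / \<alpha>) + (S * B) * (\<tau> powr (- (\<nu> - \<alpha>)) / (\<nu> - \<alpha>))"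
    by (subst Bochner_Integration.integral_add,
        (intro integrable_mult_right powr_weight_0 powr_weight_inf \<alpha> \<nu>\<alpha> \<tau>)+)
       (simp only: integral_mult_right_zero powr_weight_0(2)[OF \<alpha> \<tau>] powr_weight_inf(2)[OF \<nu>\<alpha> \<tau>])
  have le: "\<bar>weight \<alpha> t * lap.heat t x\<bar> \<le> ?h t" for t
  proof -
    consider "t \<le> 0" | "0 < t" "t \<le> \<tau>" | "t > \<tau>" by linarith
    thus ?thesis
    proof cases
      case 1 thus ?thesis using \<tau> by (simp add: weight_0)
    next
      case 2
      hence "\<bar>weight \<alpha> t * lap.heat t x\<bar> \<le> t powr (\<alpha> - 1) * L"
        using lam(2)[of t] by (simp add: weight_pos abs_mult mult_left_mono)
      thus ?thesis using 2 by (simp add: mult_ac)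
    next
      case 3
      hence "t > 0" using \<tau> by simp
      have "\<bar>weight \<alpha> t * lap.heat t x\<bar> \<le> t powr (\<alpha> - 1) * (S * B * t powr (- \<nu>))"
        using heat_sup_bound[OF \<open>t > 0\<close>, of x] \<open>t > 0\<close> by (simp add: weight_pos abs_mult mult_left_mono)
      also have "\<dots> = S * B * (t powr (\<alpha> - 1) * t powr (- \<nu>))" by simp
      also have "t powr (\<alpha> - 1) * t powr (- \<nu>) = t powr (- 1 - (\<nu> - \<alpha>))"
        unfolding powr_add[symmetric] by (rule arg_cong[of _ _ "(powr) t"]) simp
      finally show ?thesis using 3 by simp
    qed
  qed
  have "\<bar>LINT t|lborel. weight \<alpha> t * lap.heat t x\<bar> \<le> (LINT t|lborel. \<bar>weight \<alpha> t * lap.heat t x\<bar>)"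
    by (rule integral_abs_bound)
  also have "\<dots> \<le> (LINT t|lborel. ?h t)"
  proof (rule integral_mono)
    show "integrable lborel (\<lambda>t. \<bar>weight \<alpha> t * lap.heat t x\<bar>)"
      by (rule Bochner_Integration.integrable_bound[OF hint])
         (use le in \<open>auto intro: order_trans[OF _ abs_ge_self]\<close>)
  qed (intro hint le)+
  also have "\<dots> = (L powr (1 - \<alpha> / \<nu>) * B powr (\<alpha> / \<nu>)) * (1 / \<alpha> + S * (1 / (\<nu> - \<alpha>)))"
  proof -
    have 1: "L * \<tau> powr \<alpha> = L powr (1 - \<alpha> / \<nu>) * B powr (\<alpha> / \<nu>)"
    proof -
      have "\<tau> powr \<alpha> = B powr (\<alpha> / \<nu>) / L powr (\<alpha> / \<nu>)"
        by (simp add: \<tau>_def powr_powr powr_divide)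
      moreover have "L powr (1 - \<alpha> / \<nu>) = L / L powr (\<alpha> / \<nu>)"
        using pos by (simp add: powr_diff)
      ultimately show ?thesis by simp
    qed
    have 2: "B * \<tau> powr (- (\<nu> - \<alpha>)) = L * \<tau> powr \<alpha>"
    proof -
      have "\<tau> powr (- (\<nu> - \<alpha>)) = \<tau> powr \<alpha> / \<tau> powr \<nu>"
        by (simp flip: powr_diff)
      also have "\<tau> powr \<nu> = B / L" using \<nu>_pos pos by (simp add: \<tau>_def powr_powr)
      finally show ?thesis using pos by simp
    qed
    show ?thesis unfolding hval 1[symmetric] using 2 by (simp add: algebra_simps)
  qed
  finally have "\<bar>LINT t|lborel. weight \<alpha> t * lap.heat t x\<bar> \<le> \<dots>" .
  hence "\<bar>u x\<bar> \<le> 1 / Gamma \<alpha> * ((L powr (1 - \<alpha> / \<nu>) * B powr (\<alpha> / \<nu>)) * (1 / \<alpha> + S * (1 / (\<nu> - \<alpha>))))"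
    using Gamma_\<alpha> unfolding u_def abs_mult by (intro mult_mono) auto
  moreover have "1 / \<alpha> = 2 / (s - s1)" by (simp add: \<alpha>_def)
  moreover have "1 / (\<nu> - \<alpha>) = 2 / (s1 + \<beta>)"
  proof -
    have *: "\<nu> - \<alpha> = (s1 + \<beta>) / 2" by (simp add: \<alpha>_def \<nu>_def field_simps)
    show ?thesis unfolding * by simp
  qed
  ultimately show ?thesis
    unfolding pointwise_const_def S_def[symmetric] \<alpha>_def[symmetric] by (simp add: mult_ac)
qed

text \<open>Up to time 1 the local L1 norm is bounded by \<open>heat_local_bound\<close>, and
  \<alpha> > 0 suffices; afterwards the sup bound decays like \<open>t powr (- \<nu>)\<close>, and
  \<nu> > \<alpha> suffices.\<close>

lemma heat_local_integral:
  "(\<integral>\<^sup>+t. (\<integral>\<^sup>+x. ennreal (weight \<alpha> t * \<bar>lap.heat t x\<bar>) * indicator (cball 0 \<rho>) x \<partial>lborel) \<partial>lborel) < \<infinity>"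
proof -
  obtain C where C: "C \<ge> 0" "\<And>t. 0 < t \<Longrightarrow> t \<le> 1 \<Longrightarrow> (\<integral>\<^sup>+x. ennreal \<bar>lap.heat t x\<bar> * indicator (cball 0 \<rho>) x \<partial>lborel) \<le> ennreal C"
    by (rule lap.heat_local_bound[of \<rho>]) (rule that)
  have [measurable]: "(cball 0 \<rho> :: (real^'n) set) \<in> sets borel" by simp
  have fin: "emeasure lborel (cball 0 \<rho> :: (real^'n) set) < \<infinity>" by (intro emeasure_bounded_finite bounded_cball)
  define m where "m = measure lborel (cball 0 \<rho> :: (real^'n) set)"
  have m: "emeasure lborel (cball 0 \<rho> :: (real^'n) set) = ennreal m"
    using fin by (simp add: m_def emeasure_eq_ennreal_measure)
  define K where "K = C + S * B * m"
  have SB: "S * B \<ge> 0" "m \<ge> 0" using S_nonneg B by (auto simp: m_def)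
  have K: "K \<ge> 0" using C(1) SB by (simp add: K_def)
  have le: "(\<integral>\<^sup>+x. ennreal (weight \<alpha> t * \<bar>lap.heat t x\<bar>) * indicator (cball 0 \<rho>) x \<partial>lborel) \<le> ennreal (K * envelope \<alpha> (\<nu> - \<alpha>) t)" for t
  proof (cases "t > 0")
    case True
    define a where "a = (\<integral>\<^sup>+x. ennreal \<bar>lap.heat t x\<bar> * indicator (cball 0 \<rho>) x \<partial>lborel)"
    have a2: "a \<le> ennreal (S * B * m * t powr (- \<nu>))"
    proof -
      have "a \<le> (\<integral>\<^sup>+x. ennreal (S * B * t powr (- \<nu>)) * indicator (cball 0 \<rho> :: (real^'n) set) x \<partial>lborel)"
        unfolding a_def by (intro nn_integral_mono mult_right_mono ennreal_leI heat_sup_bound[OF True]) auto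
      also have "\<dots> = ennreal (S * B * t powr (- \<nu>) * m)"
        using SB by (subst nn_integral_cmult_indicator) (auto simp: m ennreal_mult)
      finally show ?thesis by (simp only: mult_ac)
    qed
    obtain r where r: "a = ennreal r" "r \<ge> 0"
      using a2 by (cases a) (auto simp: top_unique)
    have r1: "r \<le> K" if "t \<le> 1"
      using C(2)[OF True that] r C(1) SB unfolding a_def[symmetric] by (simp add: K_def add_increasing2)
    have r2: "r \<le> K * t powr (- \<nu>)" if "t > 1"
    proof -
      have "r \<le> (S * B * m) * t powr (- \<nu>)" using a2 r SB by simp
      also have "\<dots> \<le> K * t powr (- \<nu>)" using C(1) by (intro mult_right_mono) (auto simp: K_def)
      finally show ?thesis .
    qed
    have "(\<integral>\<^sup>+x. ennreal (weight \<alpha> t * \<bar>lap.heat t x\<bar>) * indicator (cball 0 \<rho>) x \<partial>lborel) = ennreal (weight \<alpha> t) * a"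
      unfolding a_def by (subst nn_integral_cmult[symmetric]) (auto simp: ennreal_mult weight_nonneg mult_ac)
    also have "\<dots> = ennreal (weight \<alpha> t * r)" using r by (simp add: ennreal_mult weight_nonneg)
    also have "\<dots> \<le> ennreal (K * envelope \<alpha> (\<nu> - \<alpha>) t)"
      by (intro ennreal_leI weight_le_envelope K r1 r2)
    finally show ?thesis .
  qed (simp add: weight_0)
  have ei: "integrable lborel (\<lambda>t. K * envelope \<alpha> (\<nu> - \<alpha>) t)"
    using \<alpha> \<nu> by (intro integrable_mult_right envelope_integrable) auto
  have "(\<integral>\<^sup>+t. (\<integral>\<^sup>+x. ennreal (weight \<alpha> t * \<bar>lap.heat t x\<bar>) * indicator (cball 0 \<rho>) x \<partial>lborel) \<partial>lborel)
    \<le> (\<integral>\<^sup>+t. ennreal (K * envelope \<alpha> (\<nu> - \<alpha>) t) \<partial>lborel)"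
    by (intro nn_integral_mono le)
  also have "\<dots> = ennreal (LINT t|lborel. K * envelope \<alpha> (\<nu> - \<alpha>) t)"
    by (rule nn_integral_eq_integral[OF ei]) (auto simp: K envelope_def)
  also have "\<dots> < \<infinity>" by simp
  finally show ?thesis .
qed

text \<open>U is a Weyl integral of order \<kappa> and V adds one of order \<alpha>. Since \<alpha>
  + \<kappa> = k - s1 / 2, the composite is the one that \<open>weyl_formula\<close> attaches to s1
  with the same k, and the Beta factor merges the two Gamma factors.\<close>

lemma V_fourier:
  assumes \<phi>: "schwartz \<phi>"
  shows "((\<lambda>\<epsilon>. T (fourier (symbol_mult \<epsilon> s1 \<phi>))) \<longlongrightarrow> V (fourier \<phi>)) (at_right 0)"
proof -
  have [measurable]: "profile k \<phi> \<in> borel_measurable borel" by (rule profile_borel[OF \<phi>])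
  have sum: "\<alpha> + \<kappa> = real k - s1 / 2" by (simp add: \<alpha>_def \<kappa>_def field_simps)
  have sum_pos: "\<alpha> + \<kappa> > 0" using \<alpha> \<kappa> by simp
  have inner: "complex_of_real (weight \<alpha> t) * (LINT x|lborel. complex_of_real (lap.heat t x) * fourier \<phi> x)
    = complex_of_real (1 / Gamma \<kappa>) * (complex_of_real (weight \<alpha> t) * (LINT \<tau>|lborel. complex_of_real (weight \<kappa> \<tau>) * profile k \<phi> (t + \<tau>)))" for t
  proof (cases "t > 0")
    case True
    have "(LINT x|lborel. complex_of_real (lap.heat t x) * fourier \<phi> x) = U (conv (heat_kernel t) (fourier \<phi>))"
      by (rule lap.heat_pairing(2)[OF True schwartz_fourier[OF \<phi>], symmetric])
    also have "\<dots> = U (fourier (smoothed t 0 \<phi>))"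
      using conv_heat_fourier_smoothed[OF True _ \<phi>, of 0 0] by simp
    also have "\<dots> = complex_of_real (1 / Gamma \<kappa>) * (LINT \<tau>|lborel. complex_of_real (weight \<kappa> \<tau>) * profile k (smoothed t 0 \<phi>) \<tau>)"
      using True by (intro laplacian_profile schwartz_smoothed \<phi>) auto
    also have "(LINT \<tau>|lborel. complex_of_real (weight \<kappa> \<tau>) * profile k (smoothed t 0 \<phi>) \<tau>)
      = (LINT \<tau>|lborel. complex_of_real (weight \<kappa> \<tau>) * profile k \<phi> (t + \<tau>))"
    proof (rule Bochner_Integration.integral_cong[OF refl])
      fix \<tau>
      show "complex_of_real (weight \<kappa> \<tau>) * profile k (smoothed t 0 \<phi>) \<tau> = complex_of_real (weight \<kappa> \<tau>) * profile k \<phi> (t + \<tau>)"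
      proof (cases "\<tau> > 0")
        case \<tau>: True
        have "profile k (smoothed t 0 \<phi>) \<tau> = T (fourier (smoothed \<tau> k (smoothed t 0 \<phi>)))"
          using True by (intro profile_eq[symmetric] \<tau> schwartz_smoothed \<phi>) auto
        also have "\<dots> = profile k \<phi> (\<tau> + t)"
          unfolding smoothed_smoothed using profile_eq[of "\<tau> + t" \<phi> k] \<tau> True \<phi> by simp
        finally show ?thesis by (simp add: add.commute)
      qed (simp add: weight_0)
    qed
    finally show ?thesis by (simp add: mult_ac)
  qed (simp add: weight_0)
  have int: "integrable lborel (\<lambda>r. weight (\<alpha> + \<kappa>) r * cmod (profile k \<phi> r))"
    by (rule weight_profile_integrable[OF \<phi> sum sum_pos s1(1)])
  have "V (fourier \<phi>) = complex_of_real (1 / Gamma \<alpha>) * (complex_of_real (1 / Gamma \<kappa>) *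
      (complex_of_real (Beta \<alpha> \<kappa>) * (LINT r|lborel. complex_of_real (weight (\<alpha> + \<kappa>) r) * profile k \<phi> r)))"
    unfolding V_def inner by (simp only: integral_mult_right_zero weyl_composition[OF \<alpha> \<kappa> profile_borel[OF \<phi>] int])
  also have "\<dots> = complex_of_real (1 / Gamma \<alpha> * (1 / Gamma \<kappa>) * Beta \<alpha> \<kappa>) * (LINT r|lborel. complex_of_real (weight (\<alpha> + \<kappa>) r) * profile k \<phi> r)"
    by (simp only: of_real_mult mult.assoc)
  also have "1 / Gamma \<alpha> * (1 / Gamma \<kappa>) * Beta \<alpha> \<kappa> = 1 / Gamma (\<alpha> + \<kappa>)"
    using Gamma_\<alpha> Gamma_real_pos[OF \<kappa>] by (simp add: Beta_def)
  finally show ?thesis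
    using weyl_formula[OF \<phi> sum sum_pos s1(1)] by simp
qed

text \<open>For t \<le> 1 the seminorm bound of U is used, heat convolution being bounded in each
  seminorm; for t > 1 the sup bound is paired with the L1 norm of \<psi>. \<open>M\<close> is large
  enough for both seminorms.\<close>

lemma V_pairing_bound:
  obtains C M where "C \<ge> 0" "\<And>t \<psi>. schwartz \<psi> \<Longrightarrow>
    weight \<alpha> t * cmod (LINT x|lborel. complex_of_real (lap.heat t x) * \<psi> x) \<le> C * schwartz_seminorm M \<psi> * envelope \<alpha> (\<nu> - \<alpha>) t"
proof -
  obtain C0 N where C0: "C0 \<ge> 0" "\<And>\<phi>. schwartz \<phi> \<Longrightarrow> cmod (U \<phi>) \<le> C0 * schwartz_seminorm N \<phi>"
    using tempered_bound[OF lap.tempered] by metis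
  obtain C1 where C1: "C1 > 0" "\<And>t (\<phi> :: real^'n \<Rightarrow> complex). 0 < t \<Longrightarrow> t \<le> 1 \<Longrightarrow> schwartz \<phi> \<Longrightarrow>
    schwartz_seminorm N (conv (heat_kernel t) \<phi>) \<le> C1 * schwartz_seminorm N \<phi>"
    by (rule heat_conv_seminorm_le[of N]) (rule that)
  define I where "I = (LINT x|lborel. 1 / (1 + norm (x :: real^'n)) ^ (2 * CARD('n)))"
  have I: "I \<ge> 0" unfolding I_def by (intro integral_nonneg_AE) auto
  define M where "M = max N (2 * CARD('n))"
  define C where "C = C0 * C1 + S * B * I"
  have SBI: "S * B * I \<ge> 0" "C0 * C1 \<ge> 0" using S_nonneg B I C0(1) C1(1) by auto
  have C: "C \<ge> 0" using SBI by (simp add: C_def)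
  have "weight \<alpha> t * cmod (LINT x|lborel. complex_of_real (lap.heat t x) * \<psi> x) \<le> (C * schwartz_seminorm M \<psi>) * envelope \<alpha> (\<nu> - \<alpha>) t"
    if \<psi>: "schwartz \<psi>" for t \<psi>
  proof (cases "t > 0")
    case True
    note p0 = schwartz_seminorm_nonneg[OF \<psi>]
    have pair: "(LINT x|lborel. complex_of_real (lap.heat t x) * \<psi> x) = U (conv (heat_kernel t) \<psi>)"
      by (rule lap.heat_pairing(2)[OF True \<psi>, symmetric])
    show ?thesis
    proof (rule weight_le_envelope)
      show "0 \<le> C * schwartz_seminorm M \<psi>" using C p0 by simp
      assume t1: "t \<le> 1"
      have "cmod (U (conv (heat_kernel t) \<psi>)) \<le> C0 * schwartz_seminorm N (conv (heat_kernel t) \<psi>)"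
        by (intro C0 heat_conv_schwartz True \<psi>)
      also have "\<dots> \<le> C0 * (C1 * schwartz_seminorm N \<psi>)" by (intro mult_left_mono C1 True t1 \<psi> C0)
      also have "\<dots> \<le> C0 * (C1 * schwartz_seminorm M \<psi>)"
        using C0(1) C1(1) by (intro mult_left_mono schwartz_seminorm_mono \<psi>) (auto simp: M_def)
      also have "\<dots> = C0 * C1 * schwartz_seminorm M \<psi>" by simp
      also have "\<dots> \<le> C * schwartz_seminorm M \<psi>" using SBI by (intro mult_right_mono p0) (simp add: C_def)
      finally show "cmod (LINT x|lborel. complex_of_real (lap.heat t x) * \<psi> x) \<le> C * schwartz_seminorm M \<psi>"
        unfolding pair .
    next
      have "cmod (LINT x|lborel. complex_of_real (lap.heat t x) * \<psi> x) \<le> (LINT x|lborel. cmod (complex_of_real (lap.heat t x) * \<psi> x))"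
        by (rule integral_norm_bound)
      also have "\<dots> \<le> (LINT x|lborel. (S * B * t powr (- \<nu>)) * cmod (\<psi> x))"
        by (intro integral_mono integrable_norm lap.heat_pairing True \<psi> integrable_mult_right schwartz_integrable)
           (auto simp: norm_mult heat_sup_bound[OF True] intro!: mult_right_mono)
      also have "\<dots> = (S * B * t powr (- \<nu>)) * (LINT x|lborel. cmod (\<psi> x))" by (rule integral_mult_right_zero)
      also have "\<dots> \<le> (S * B * t powr (- \<nu>)) * (schwartz_seminorm (2 * CARD('n)) \<psi> * I)"
        using S_nonneg B unfolding I_def by (intro mult_left_mono schwartz_L1_le \<psi>) auto
      also have "\<dots> \<le> (S * B * t powr (- \<nu>)) * (schwartz_seminorm M \<psi> * I)"
        using S_nonneg B I by (intro mult_left_mono mult_right_mono schwartz_seminorm_mono \<psi>) (auto simp: M_def)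
      also have "\<dots> = S * B * I * (schwartz_seminorm M \<psi> * t powr (- \<nu>))" by (simp only: mult_ac)
      also have "\<dots> \<le> C * (schwartz_seminorm M \<psi> * t powr (- \<nu>))"
        using SBI p0 by (intro mult_right_mono) (auto simp: C_def)
      finally show "cmod (LINT x|lborel. complex_of_real (lap.heat t x) * \<psi> x) \<le> C * schwartz_seminorm M \<psi> * t powr (- \<nu>)"
        by (simp only: mult.assoc)
    qed
  qed (simp add: weight_0 envelope_def)
  thus ?thesis using that C by blast
qed

lemma V_integrable:
  assumes \<psi>: "schwartz \<psi>"
  shows "integrable lborel (\<lambda>t. complex_of_real (weight \<alpha> t) * (LINT x|lborel. complex_of_real (lap.heat t x) * \<psi> x))"
proof -
  have [measurable]: "\<psi> \<in> borel_measurable borel" by (rule schwartz_borel[OF \<psi>])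
  obtain C M where CM: "C \<ge> 0" "\<And>t \<psi>. schwartz \<psi> \<Longrightarrow>
    weight \<alpha> t * cmod (LINT x|lborel. complex_of_real (lap.heat t x) * \<psi> x) \<le> C * schwartz_seminorm M \<psi> * envelope \<alpha> (\<nu> - \<alpha>) t"
    using V_pairing_bound by metis
  have "integrable lborel (\<lambda>t. C * schwartz_seminorm M \<psi> * envelope \<alpha> (\<nu> - \<alpha>) t)"
    using \<alpha> \<nu> by (intro integrable_mult_right envelope_integrable) auto
  thus ?thesis
    by (rule Bochner_Integration.integrable_bound)
       (use CM(2)[OF \<psi>] in \<open>auto simp: norm_mult weight_nonneg intro: order_trans[OF _ abs_ge_self]\<close>)
qed

lemma V_tempered: "tempered_distribution V"
  unfolding tempered_distribution_def
proof (intro conjI allI impI)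
  fix \<phi> \<psi> :: "real^'n \<Rightarrow> complex" assume \<phi>: "schwartz \<phi>" and \<psi>: "schwartz \<psi>"
  have "complex_of_real (weight \<alpha> t) * (LINT x|lborel. complex_of_real (lap.heat t x) * (\<phi> x + \<psi> x))
    = complex_of_real (weight \<alpha> t) * (LINT x|lborel. complex_of_real (lap.heat t x) * \<phi> x)
      + complex_of_real (weight \<alpha> t) * (LINT x|lborel. complex_of_real (lap.heat t x) * \<psi> x)" for t
  proof (cases "t > 0")
    case True
    show ?thesis by (simp add: distrib_left lap.heat_pairing(1)[OF True] \<phi> \<psi>)
  qed (simp add: weight_0)
  thus "V (\<lambda>x. \<phi> x + \<psi> x) = V \<phi> + V \<psi>"
    unfolding V_def by (simp add: V_integrable[OF \<phi>] V_integrable[OF \<psi>] distrib_left)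
next
  fix c and \<phi> :: "real^'n \<Rightarrow> complex" assume \<phi>: "schwartz \<phi>"
  have "complex_of_real (weight \<alpha> t) * (LINT x|lborel. complex_of_real (lap.heat t x) * (c * \<phi> x))
    = c * (complex_of_real (weight \<alpha> t) * (LINT x|lborel. complex_of_real (lap.heat t x) * \<phi> x))" for t
    by (simp add: mult.left_commute)
  thus "V (\<lambda>x. c * \<phi> x) = c * V \<phi>"
    unfolding V_def by (simp add: mult_ac)
next
  obtain C M where CM: "C \<ge> 0" "\<And>t \<psi>. schwartz \<psi> \<Longrightarrow>
    weight \<alpha> t * cmod (LINT x|lborel. complex_of_real (lap.heat t x) * \<psi> x) \<le> C * schwartz_seminorm M \<psi> * envelope \<alpha> (\<nu> - \<alpha>) t"
    using V_pairing_bound by metis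
  define E where "E = (LINT t|lborel. envelope \<alpha> (\<nu> - \<alpha>) t)"
  have "cmod (V \<psi>) \<le> (1 / Gamma \<alpha> * C * E) * schwartz_seminorm M \<psi>" if \<psi>: "schwartz \<psi>" for \<psi>
  proof -
    let ?F = "\<lambda>t. complex_of_real (weight \<alpha> t) * (LINT x|lborel. complex_of_real (lap.heat t x) * \<psi> x)"
    have "cmod (V \<psi>) = 1 / Gamma \<alpha> * cmod (LINT t|lborel. ?F t)"
      unfolding V_def using Gamma_\<alpha> by (simp add: norm_mult norm_divide)
    also have "\<dots> \<le> 1 / Gamma \<alpha> * (LINT t|lborel. cmod (?F t))"
      using Gamma_\<alpha> by (intro mult_left_mono integral_norm_bound) auto
    also have "\<dots> \<le> 1 / Gamma \<alpha> * (LINT t|lborel. C * schwartz_seminorm M \<psi> * envelope \<alpha> (\<nu> - \<alpha>) t)"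
      using Gamma_\<alpha> CM(2)[OF \<psi>] \<alpha> \<nu>
      by (intro mult_left_mono integral_mono integrable_norm V_integrable \<psi> integrable_mult_right envelope_integrable)
         (auto simp: norm_mult weight_nonneg)
    also have "\<dots> = (1 / Gamma \<alpha> * C * E) * schwartz_seminorm M \<psi>"
      unfolding integral_mult_right_zero E_def by (simp only: mult_ac)
    finally show ?thesis .
  qed
  thus "\<exists>C N. \<forall>\<phi>. schwartz \<phi> \<longrightarrow> cmod (V \<phi>) \<le> C * schwartz_seminorm N \<phi>" by blast
qed

lemma V_frac_laplacian: "frac_laplacian s1 T V"
proof (cases "s1 = 0")
  case True
  have "V \<psi> = T \<psi>" if \<psi>: "schwartz \<psi>" for \<psi>
  proof -
    \<comment> \<open>For s1 = 0 the regularised symbol is constantly 1, so \<open>V_fourier\<close>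
      is a limit of a constant; writing \<psi> as a transform covers all Schwartz functions.\<close>
    obtain \<phi> where \<phi>: "schwartz \<phi>" "fourier \<phi> = \<psi>" using fourier_surj[OF \<psi>] .
    have "symbol_mult \<epsilon> s1 \<phi> = \<phi>" if "\<epsilon> > 0" for \<epsilon>
    proof
      fix \<xi> :: "real^'n"
      have "\<epsilon>\<^sup>2 + (norm \<xi>)\<^sup>2 > 0" using that by (simp add: add_pos_nonneg)
      thus "symbol_mult \<epsilon> s1 \<phi> \<xi> = \<phi> \<xi>" using True that by (simp add: symbol_mult_def)
    qed
    hence "\<forall>\<^sub>F \<epsilon> in at_right 0. T (fourier (symbol_mult \<epsilon> s1 \<phi>)) = T \<psi>"
      unfolding eventually_at_right_field by (intro exI[of _ 1]) (auto simp: \<phi>)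
    hence "((\<lambda>\<epsilon>. T (fourier (symbol_mult \<epsilon> s1 \<phi>))) \<longlongrightarrow> T \<psi>) (at_right 0)" by (rule tendsto_eventually)
    from tendsto_unique[OF _ this V_fourier[OF \<phi>(1)]] show ?thesis by (simp add: \<phi>)
  qed
  thus ?thesis using True by (simp add: frac_laplacian_def)
next
  case False
  thus ?thesis using V_fourier by (auto simp: frac_laplacian_def fourier_distr_def symbol_mult_def[abs_def])
qed

text \<open>Formulated for bounded functions of bounded support so as to serve both requirements of
  \<open>given_by\<close>: indicators of compact sets and test functions.\<close>

lemma heat_product_integrable:
  assumes h [measurable]: "h \<in> borel_measurable borel"
    and bound: "\<And>x. cmod (h x) \<le> M * indicator (cball 0 \<rho>) x"
  shows "integrable (lborel \<Otimes>\<^sub>M lborel) (\<lambda>(t, x). complex_of_real (weight \<alpha> t * lap.heat t x) * h x)"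
  unfolding integrable_iff_bounded
proof
  have [measurable]: "(cball 0 \<rho> :: (real^'n) set) \<in> sets borel" by simp
  have "(\<integral>\<^sup>+z. ennreal (norm (case z of (t, x) \<Rightarrow> complex_of_real (weight \<alpha> t * lap.heat t x) * h x)) \<partial>(lborel \<Otimes>\<^sub>M lborel))
    = (\<integral>\<^sup>+t. (\<integral>\<^sup>+x. ennreal (cmod (complex_of_real (weight \<alpha> t * lap.heat t x) * h x)) \<partial>lborel) \<partial>lborel)"
    by (subst lborel.nn_integral_fst[symmetric]) auto
  also have "\<dots> \<le> (\<integral>\<^sup>+t. (\<integral>\<^sup>+x. ennreal \<bar>M\<bar> * (ennreal (weight \<alpha> t * \<bar>lap.heat t x\<bar>) * indicator (cball 0 \<rho>) x) \<partial>lborel) \<partial>lborel)"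
  proof (intro nn_integral_mono)
    fix t and x :: "real^'n"
    have "cmod (complex_of_real (weight \<alpha> t * lap.heat t x) * h x) \<le> (weight \<alpha> t * \<bar>lap.heat t x\<bar>) * (\<bar>M\<bar> * indicator (cball 0 \<rho>) x)"
      unfolding norm_mult norm_of_real abs_mult
      by (intro mult_mono) (auto simp: weight_nonneg intro!: order_trans[OF bound] mult_right_mono)
    thus "ennreal (cmod (complex_of_real (weight \<alpha> t * lap.heat t x) * h x)) \<le> ennreal \<bar>M\<bar> * (ennreal (weight \<alpha> t * \<bar>lap.heat t x\<bar>) * indicator (cball 0 \<rho>) x)"
      by (subst ennreal_indicator[symmetric], subst ennreal_mult[symmetric], (auto simp: weight_nonneg)[2],
          subst ennreal_mult[symmetric], (auto simp: weight_nonneg)[2]) (auto intro!: ennreal_leI simp: mult_ac)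
  qed
  also have "\<dots> = ennreal \<bar>M\<bar> * (\<integral>\<^sup>+t. (\<integral>\<^sup>+x. (ennreal (weight \<alpha> t * \<bar>lap.heat t x\<bar>) * indicator (cball 0 \<rho>) x) \<partial>lborel) \<partial>lborel)"
    by (simp add: nn_integral_cmult)
  also have "\<dots> < \<infinity>" using heat_local_integral[of \<rho>] by (simp add: ennreal_mult_less_top)
  finally show "(\<integral>\<^sup>+z. ennreal (norm (case z of (t, x) \<Rightarrow> complex_of_real (weight \<alpha> t * lap.heat t x) * h x)) \<partial>(lborel \<Otimes>\<^sub>M lborel)) < \<infinity>" .
qed measurable

text \<open>Holds at points of divergence as well, where both sides are 0.\<close>

lemma u_integral:
  "(LINT t|lborel. complex_of_real (weight \<alpha> t * lap.heat t x) * c) = complex_of_real (Gamma \<alpha>) * (complex_of_real (u x) * c)"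
  unfolding integral_mult_left_zero integral_complex_of_real u_def using Gamma_\<alpha> by simp

lemma V_given_by_u: "given_by V u"
  unfolding given_by_def
proof (intro conjI allI impI)
  fix K :: "(real^'n) set" assume K: "compact K"
  have [measurable]: "K \<in> sets borel" using K by (intro borel_closed compact_imp_closed)
  obtain \<rho> where \<rho>: "K \<subseteq> cball 0 \<rho>" using bounded_subset_ballD[OF compact_imp_bounded[OF K], of 0] ball_subset_cball by blast
  let ?h = "\<lambda>x. complex_of_real (indicator K x)"
  have "cmod (?h x) \<le> 1 * indicator (cball 0 \<rho>) x" for x using \<rho> by (auto simp: indicator_def)
  hence "integrable (lborel \<Otimes>\<^sub>M lborel) (\<lambda>(t, x). complex_of_real (weight \<alpha> t * lap.heat t x) * ?h x)"
    by (rule heat_product_integrable[rotated]) measurable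
  from lborel_pair.integrable_snd[OF this]
  have "integrable lborel (\<lambda>x. complex_of_real (Gamma \<alpha>) * (complex_of_real (u x) * ?h x))"
    by (simp only: prod.case u_integral)
  from integrable_mult_right[OF this, of "complex_of_real (1 / Gamma \<alpha>)"]
  have "integrable lborel (\<lambda>x. complex_of_real (u x * indicator K x))"
    using Gamma_\<alpha> by simp
  hence "integrable lborel (\<lambda>x. u x * indicator K x)" using complex_of_real_integrable_eq by blast
  hence "integrable lborel (\<lambda>x. indicator K x *\<^sub>R u x)" by (simp add: mult.commute)
  thus "set_integrable lebesgue K u" unfolding set_integrable_def
    by (subst integrable_completion) auto
next
  fix \<psi> :: "real^'n \<Rightarrow> complex" assume tf: "test_function \<psi>"
  note \<psi> = test_function_schwartz[OF tf]
  have [measurable]: "\<psi> \<in> borel_measurable borel" by (rule schwartz_borel[OF \<psi>])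
  obtain M where M: "M \<ge> 0" "\<And>x. cmod (\<psi> x) \<le> M" using schwartz_bounded[OF \<psi>] by metis
  have cpt: "compact (closure {x. \<psi> x \<noteq> 0})" using tf by (simp add: test_function_def)
  obtain \<rho> where \<rho>: "closure {x. \<psi> x \<noteq> 0} \<subseteq> cball 0 \<rho>"
    using bounded_subset_ballD[OF compact_imp_bounded[OF cpt], of 0] ball_subset_cball by blast
  have "cmod (\<psi> x) \<le> M * indicator (cball 0 \<rho>) x" for x
    using \<rho> closure_subset[of "{x. \<psi> x \<noteq> 0}"] M(2)[of x] by (cases "\<psi> x = 0") (auto simp: indicator_def M(1))
  hence int: "integrable (lborel \<Otimes>\<^sub>M lborel) (\<lambda>(t, x). complex_of_real (weight \<alpha> t * lap.heat t x) * \<psi> x)"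
    by (rule heat_product_integrable[rotated]) measurable
  have "V \<psi> = complex_of_real (1 / Gamma \<alpha>) * (LINT t|lborel. LINT x|lborel. complex_of_real (weight \<alpha> t * lap.heat t x) * \<psi> x)"
    unfolding V_def by (simp add: mult.assoc)
  also have "(LINT t|lborel. LINT x|lborel. complex_of_real (weight \<alpha> t * lap.heat t x) * \<psi> x)
    = (LINT x|lborel. LINT t|lborel. complex_of_real (weight \<alpha> t * lap.heat t x) * \<psi> x)"
    by (rule lborel_pair.Fubini_integral[OF int, symmetric])
  also have "\<dots> = complex_of_real (Gamma \<alpha>) * (LINT x|lborel. complex_of_real (u x) * \<psi> x)"
    unfolding u_integral by (rule integral_mult_right_zero)
  also have "(LINT x|lborel. complex_of_real (u x) * \<psi> x) = (LINT x|lebesgue. complex_of_real (u x) * \<psi> x)"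
    by (rule lebesgue_integral_lborel[symmetric]) measurable
  finally show "V \<psi> = (LINT x|lebesgue. complex_of_real (u x) * \<psi> x)" using Gamma_\<alpha> by simp
qed

end

subsection \<open>The Hardy--Littlewood weak type estimate\<close>

lemma emeasure_cball_scale:
  fixes x :: "real^'n"
  assumes "r > 0"
  shows "emeasure lborel (cball x (5 * r)) = ennreal (5 ^ CARD('n)) * emeasure lborel (cball x r)"
  using assms by (simp add: emeasure_cball power_mult_distrib ennreal_mult[symmetric] mult_ac)

text \<open>Vitali covering: among the balls with large mean there is a countable disjoint subfamily
  whose fivefold enlargements cover E. Each enlargement costs \<open>5 ^ CARD('n)\<close>, and
  disjointness bounds the sum of the masses by the total integral.\<close>

lemma weak_type:
  fixes \<phi> :: "real^'n \<Rightarrow> ennreal"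
  assumes [measurable]: "\<phi> \<in> borel_measurable borel" "E \<in> sets borel"
    and c: "c > 0"
    and E: "\<And>x. x \<in> E \<Longrightarrow> \<exists>r>0. ennreal c * emeasure lborel (cball x r) < (\<integral>\<^sup>+y. \<phi> y * indicator (cball x r) y \<partial>lborel)"
  shows "emeasure lborel E \<le> ennreal (5 ^ CARD('n) / c) * (\<integral>\<^sup>+y. \<phi> y \<partial>lborel)"
proof (cases "(\<integral>\<^sup>+y. \<phi> y \<partial>lborel) = \<infinity>")
  case True
  thus ?thesis using c by (simp add: ennreal_mult_top)
next
  case False
  then obtain I where I: "(\<integral>\<^sup>+y. \<phi> y \<partial>lborel) = ennreal I" "I \<ge> 0" by (cases "\<integral>\<^sup>+y. \<phi> y \<partial>lborel") auto
  obtain r where r: "\<And>x. x \<in> E \<Longrightarrow> r x > 0"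
    "\<And>x. x \<in> E \<Longrightarrow> ennreal c * emeasure lborel (cball x (r x)) < (\<integral>\<^sup>+y. \<phi> y * indicator (cball x (r x)) y \<partial>lborel)"
    using E by metis
  let ?\<omega> = "unit_ball_vol (real CARD('n))"
  have \<omega>: "?\<omega> > 0" by simp
  \<comment> \<open>The covering lemma asks for bounded radii. A ball of radius r \<ge> 1 has volume
    at least r times that of the unit ball, and c times its volume cannot exceed the finite total
    integral I.\<close>
  have bound: "r x \<le> max 1 (I / (c * ?\<omega>))" if x: "x \<in> E" for x
  proof (cases "r x \<le> 1")
    case False
    have "ennreal (c * (?\<omega> * r x ^ CARD('n))) = ennreal c * emeasure lborel (cball x (r x))"
      using r(1)[OF x] c by (simp add: emeasure_cball ennreal_mult)
    also have "\<dots> \<le> (\<integral>\<^sup>+y. \<phi> y * indicator (cball x (r x)) y \<partial>lborel)" using r(2)[OF x] by simp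
    also have "\<dots> \<le> (\<integral>\<^sup>+y. \<phi> y \<partial>lborel)" by (intro nn_integral_mono) (auto simp: indicator_def)
    finally have "c * (?\<omega> * r x ^ CARD('n)) \<le> I" using I by simp
    moreover have "r x ^ 1 \<le> r x ^ CARD('n)" using False by (intro power_increasing) auto
    hence "c * (?\<omega> * r x) \<le> c * (?\<omega> * r x ^ CARD('n))" using c \<omega> by (intro mult_left_mono) auto
    ultimately have "c * (?\<omega> * r x) \<le> I" by linarith
    hence "r x \<le> I / (c * ?\<omega>)" using c \<omega> by (simp add: field_simps)
    thus ?thesis by simp
  qed simp
  obtain C where C: "countable C" "C \<subseteq> E"
     "pairwise (\<lambda>i j. disjnt (cball i (r i)) (cball j (r j))) C"
     "E \<subseteq> (\<Union>i\<in>C. cball i (5 * r i))"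
  proof (rule Vitali_covering_lemma_cballs[where S = E and K = E and a = "\<lambda>x. x" and r = r and B = "max 1 (I / (c * ?\<omega>))"])
    show "E \<subseteq> (\<Union>i\<in>E. cball i (r i))" using r(1) by (intro subsetI UN_I) (auto intro: less_imp_le)
    show "0 < r i \<and> r i \<le> max 1 (I / (c * ?\<omega>))" if "i \<in> E" for i using r(1) bound that by blast
  qed (rule that)
  have [measurable]: "(cball i a :: (real^'n) set) \<in> sets borel" for i a by simp
  have "emeasure lborel E = (\<integral>\<^sup>+x. indicator E x \<partial>lborel)" by simp
  also have "\<dots> \<le> (\<integral>\<^sup>+x. (\<integral>\<^sup>+i. indicator (cball i (5 * r i)) x \<partial>count_space C) \<partial>lborel)"
  proof (rule nn_integral_mono)
    fix x
    show "indicator E x \<le> (\<integral>\<^sup>+i. indicator (cball i (5 * r i)) x \<partial>count_space C)"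
    proof (cases "x \<in> E")
      case True
      then obtain i where i: "i \<in> C" "x \<in> cball i (5 * r i)" using C(4) by blast
      have "(1::ennreal) = (\<integral>\<^sup>+j. indicator {i} j \<partial>count_space C)" using i by (simp add: one_ennreal_def)
      also have "\<dots> \<le> (\<integral>\<^sup>+j. indicator (cball j (5 * r j)) x \<partial>count_space C)"
        using i by (intro nn_integral_mono) (auto simp: indicator_def)
      finally show ?thesis using True by simp
    qed simp
  qed
  also have "\<dots> = (\<integral>\<^sup>+i. (\<integral>\<^sup>+x. indicator (cball i (5 * r i)) x \<partial>lborel) \<partial>count_space C)"
    by (rule nn_integral_count_space_nn_integral[OF C(1)]) measurable
  also have "\<dots> \<le> (\<integral>\<^sup>+i. ennreal (5 ^ CARD('n) / c) * emeasure (density lborel \<phi>) (cball i (r i)) \<partial>count_space C)"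
  proof (rule nn_integral_mono)
    fix i assume "i \<in> space (count_space C)"
    hence i: "i \<in> E" using C(2) by auto
    have "(\<integral>\<^sup>+x. indicator (cball i (5 * r i)) x \<partial>lborel) = ennreal (5 ^ CARD('n)) * emeasure lborel (cball i (r i))"
      by (simp add: emeasure_cball_scale[OF r(1)[OF i]])
    also have "\<dots> = ennreal (5 ^ CARD('n) / c) * (ennreal c * emeasure lborel (cball i (r i)))"
      using c by (simp add: ennreal_mult[symmetric] mult.assoc[symmetric])
    also have "\<dots> \<le> ennreal (5 ^ CARD('n) / c) * emeasure (density lborel \<phi>) (cball i (r i))"
      using r(2)[OF i] by (intro mult_left_mono) (auto simp: emeasure_density)
    finally show "(\<integral>\<^sup>+x. indicator (cball i (5 * r i)) x \<partial>lborel) \<le> \<dots>" .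
  qed
  also have "\<dots> = ennreal (5 ^ CARD('n) / c) * (\<integral>\<^sup>+i. emeasure (density lborel \<phi>) (cball i (r i)) \<partial>count_space C)"
    by (rule nn_integral_cmult) simp
  also have "(\<integral>\<^sup>+i. emeasure (density lborel \<phi>) (cball i (r i)) \<partial>count_space C)
    = emeasure (density lborel \<phi>) (\<Union>i\<in>C. cball i (r i))"
    using C(3) by (intro emeasure_UN_countable[symmetric] C(1))
      (auto simp: disjoint_family_on_def pairwise_def disjnt_def)
  also have "\<dots> \<le> emeasure (density lborel \<phi>) UNIV" by (rule emeasure_mono) auto
  also have "\<dots> = (\<integral>\<^sup>+y. \<phi> y \<partial>lborel)" by (simp add: emeasure_density)
  finally show ?thesis by (simp add: mult_left_mono)
qed

text \<open>The heat kernel is an average of normalised indicator functions of balls, so Gaussian means are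
  bounded by the largest mean over balls.\<close>

lemma exp_layer: "ennreal (exp (- w)) = (\<integral>\<^sup>+v. ennreal (exp (- v)) * indicator {w<..} v \<partial>lborel)"
proof -
  have "(\<integral>\<^sup>+v. ennreal (exp (- v)) * indicator {w..} v \<partial>lborel) = ennreal (0 - (- exp (- w)))"
  proof (rule nn_integral_FTC_atLeast)
    show "((\<lambda>v. - exp (- v)) \<longlongrightarrow> (0::real)) at_top" by real_asymp
    show "DERIV (\<lambda>v. - exp (- v)) x :> exp (- x)" for x :: real by (auto intro!: derivative_eq_intros)
  qed auto
  moreover have "(\<integral>\<^sup>+v. ennreal (exp (- v)) * indicator {w..} v \<partial>lborel) = (\<integral>\<^sup>+v. ennreal (exp (- v)) * indicator {w<..} v \<partial>lborel)"
    by (rule nn_integral_cong_AE) (use AE_lborel_neq[of w] in \<open>eventually_elim, auto simp: indicator_def\<close>)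
  ultimately show ?thesis by simp
qed

lemma gaussian_layer_cake:
  fixes x :: "real^'n"
  assumes t: "t > 0" and [measurable]: "\<phi> \<in> borel_measurable borel"
  shows "(\<integral>\<^sup>+y. \<phi> y * ennreal (heat_kernel t (x - y)) \<partial>lborel)
    = ennreal ((4 * pi * t) powr (- (real CARD('n) / 2))) *
      (\<integral>\<^sup>+v. ennreal (exp (- v)) * indicator {0<..} v * (\<integral>\<^sup>+y. \<phi> y * indicator (ball x (sqrt (4 * t * v))) y \<partial>lborel) \<partial>lborel)"
proof -
  let ?c = "(4 * pi * t) powr (- (real CARD('n) / 2))"
  have ind: "indicator {(norm (x - y))\<^sup>2 / (4 * t)<..} v = (indicator {0<..} v * indicator (ball x (sqrt (4 * t * v))) y :: ennreal)"
    for y and v :: real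
  proof -
    have "(norm (x - y))\<^sup>2 / (4 * t) < v \<longleftrightarrow> (norm (x - y))\<^sup>2 < 4 * t * v" using t by (simp add: field_simps)
    moreover have "(norm (x - y))\<^sup>2 < 4 * t * v \<longleftrightarrow> norm (x - y) < sqrt (4 * t * v)"
      by (metis abs_norm_cancel real_sqrt_abs real_sqrt_less_iff)
    moreover have "v > 0" if "(norm (x - y))\<^sup>2 < 4 * t * v"
    proof -
      have "0 < 4 * t * v" using that by (meson le_less_trans zero_le_power2)
      thus ?thesis using t by (simp add: zero_less_mult_iff)
    qed
    ultimately show ?thesis by (auto simp: indicator_def dist_norm)
  qed
  have "(\<integral>\<^sup>+y. \<phi> y * ennreal (heat_kernel t (x - y)) \<partial>lborel)
    = (\<integral>\<^sup>+y. (\<integral>\<^sup>+v. ennreal ?c * (\<phi> y * (ennreal (exp (- v)) * indicator {(norm (x - y))\<^sup>2 / (4 * t)<..} v)) \<partial>lborel) \<partial>lborel)"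
  proof (rule nn_integral_cong)
    fix y
    have "\<phi> y * ennreal (heat_kernel t (x - y)) = ennreal ?c * (\<phi> y * ennreal (exp (- ((norm (x - y))\<^sup>2 / (4 * t)))))"
      by (simp add: heat_kernel_def ennreal_mult mult_ac)
    also have "\<dots> = (\<integral>\<^sup>+v. ennreal ?c * (\<phi> y * (ennreal (exp (- v)) * indicator {(norm (x - y))\<^sup>2 / (4 * t)<..} v)) \<partial>lborel)"
      by (subst exp_layer) (simp add: nn_integral_cmult)
    finally show "\<phi> y * ennreal (heat_kernel t (x - y)) = \<dots>" .
  qed
  also have "\<dots> = (\<integral>\<^sup>+v. (\<integral>\<^sup>+y. ennreal ?c * (\<phi> y * (ennreal (exp (- v)) * indicator {(norm (x - y))\<^sup>2 / (4 * t)<..} v)) \<partial>lborel) \<partial>lborel)"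
    by (rule lborel_pair.Fubini') (simp add: indicator_def, measurable)
  also have "\<dots> = (\<integral>\<^sup>+v. ennreal ?c * (ennreal (exp (- v)) * indicator {0<..} v * (\<integral>\<^sup>+y. \<phi> y * indicator (ball x (sqrt (4 * t * v))) y \<partial>lborel)) \<partial>lborel)"
  proof (rule nn_integral_cong)
    fix v :: real
    have [measurable]: "(ball x a :: (real^'n) set) \<in> sets borel" for a by simp
    have "(\<integral>\<^sup>+y. ennreal ?c * (\<phi> y * (ennreal (exp (- v)) * indicator {(norm (x - y))\<^sup>2 / (4 * t)<..} v)) \<partial>lborel)
      = (\<integral>\<^sup>+y. (ennreal ?c * (ennreal (exp (- v)) * indicator {0<..} v)) * (\<phi> y * indicator (ball x (sqrt (4 * t * v))) y) \<partial>lborel)"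
      unfolding ind by (simp only: mult_ac)
    also have "\<dots> = (ennreal ?c * (ennreal (exp (- v)) * indicator {0<..} v)) * (\<integral>\<^sup>+y. \<phi> y * indicator (ball x (sqrt (4 * t * v))) y \<partial>lborel)"
      by (rule nn_integral_cmult) measurable
    finally show "(\<integral>\<^sup>+y. ennreal ?c * (\<phi> y * (ennreal (exp (- v)) * indicator {(norm (x - y))\<^sup>2 / (4 * t)<..} v)) \<partial>lborel)
      = ennreal ?c * (ennreal (exp (- v)) * indicator {0<..} v * (\<integral>\<^sup>+y. \<phi> y * indicator (ball x (sqrt (4 * t * v))) y \<partial>lborel))"
      by (simp only: mult_ac)
  qed
  also have "\<dots> = ennreal ?c * (\<integral>\<^sup>+v. ennreal (exp (- v)) * indicator {0<..} v * (\<integral>\<^sup>+y. \<phi> y * indicator (ball x (sqrt (4 * t * v))) y \<partial>lborel) \<partial>lborel)"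
  proof (rule nn_integral_cmult)
    have "(\<lambda>(v, y). \<phi> y * indicator {p. dist x (snd p) < sqrt (4 * t * fst p)} (v, y)) \<in> borel_measurable (borel \<Otimes>\<^sub>M borel)"
      by (simp add: indicator_def, measurable)
    hence "(\<lambda>v. \<integral>\<^sup>+y. \<phi> y * indicator {p. dist x (snd p) < sqrt (4 * t * fst p)} (v, y) \<partial>lborel) \<in> borel_measurable borel"
      by measurable
    thus "(\<lambda>v. ennreal (exp (- v)) * indicator {0<..} v * (\<integral>\<^sup>+y. \<phi> y * indicator (ball x (sqrt (4 * t * v))) y \<partial>lborel)) \<in> borel_measurable lborel"
      by (simp add: indicator_def) measurable
  qed
  finally show ?thesis .
qed

text \<open>The layer-cake formula is used forwards for |g| and backwards for the constant L, whose
  Gaussian mean is L because the kernel has mass 1.\<close>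

lemma gaussian_mean_le:
  fixes x :: "real^'n" and g :: "real^'n \<Rightarrow> real"
  assumes t: "t > 0" and [measurable]: "g \<in> borel_measurable borel" and L: "L \<ge> 0"
    and le: "\<And>r. r > 0 \<Longrightarrow> (\<integral>\<^sup>+y. ennreal \<bar>g y\<bar> * indicator (cball x r) y \<partial>lborel) \<le> ennreal L * emeasure lborel (cball x r)"
  shows "(\<integral>\<^sup>+y. ennreal (\<bar>g y\<bar> * heat_kernel t (x - y)) \<partial>lborel) \<le> ennreal L"
proof -
  have [measurable]: "(ball x a :: (real^'n) set) \<in> sets borel" for a by simp
  have "(\<integral>\<^sup>+y. ennreal (\<bar>g y\<bar> * heat_kernel t (x - y)) \<partial>lborel) = (\<integral>\<^sup>+y. ennreal \<bar>g y\<bar> * ennreal (heat_kernel t (x - y)) \<partial>lborel)"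
    by (simp add: ennreal_mult heat_kernel_nonneg)
  also have "\<dots> = ennreal ((4 * pi * t) powr (- (real CARD('n) / 2))) *
      (\<integral>\<^sup>+v. ennreal (exp (- v)) * indicator {0<..} v * (\<integral>\<^sup>+y. ennreal \<bar>g y\<bar> * indicator (ball x (sqrt (4 * t * v))) y \<partial>lborel) \<partial>lborel)"
    by (rule gaussian_layer_cake[OF t]) measurable
  also have "\<dots> \<le> ennreal ((4 * pi * t) powr (- (real CARD('n) / 2))) *
      (\<integral>\<^sup>+v. ennreal (exp (- v)) * indicator {0<..} v * (\<integral>\<^sup>+y. ennreal L * indicator (ball x (sqrt (4 * t * v))) y \<partial>lborel) \<partial>lborel)"
  proof (rule mult_left_mono[OF nn_integral_mono])
    fix v :: real
    show "ennreal (exp (- v)) * indicator {0<..} v * (\<integral>\<^sup>+y. ennreal \<bar>g y\<bar> * indicator (ball x (sqrt (4 * t * v))) y \<partial>lborel)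
      \<le> ennreal (exp (- v)) * indicator {0<..} v * (\<integral>\<^sup>+y. ennreal L * indicator (ball x (sqrt (4 * t * v))) y \<partial>lborel)"
    proof (cases "v > 0")
      case True
      have r: "sqrt (4 * t * v) > 0" using t True by simp
      have "(\<integral>\<^sup>+y. ennreal \<bar>g y\<bar> * indicator (ball x (sqrt (4 * t * v))) y \<partial>lborel)
        \<le> (\<integral>\<^sup>+y. ennreal \<bar>g y\<bar> * indicator (cball x (sqrt (4 * t * v))) y \<partial>lborel)"
        by (intro nn_integral_mono mult_left_mono) (auto simp: indicator_def)
      also have "\<dots> \<le> ennreal L * emeasure lborel (cball x (sqrt (4 * t * v)))" by (rule le[OF r])
      also have "emeasure lborel (cball x (sqrt (4 * t * v))) = emeasure lborel (ball x (sqrt (4 * t * v)))"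
        using r by (simp add: emeasure_cball emeasure_ball)
      also have "ennreal L * \<dots> = (\<integral>\<^sup>+y. ennreal L * indicator (ball x (sqrt (4 * t * v))) y \<partial>lborel)"
        by (simp add: nn_integral_cmult_indicator)
      finally show ?thesis by (rule mult_left_mono) simp
    qed simp
  qed simp
  also have "\<dots> = (\<integral>\<^sup>+y. ennreal L * ennreal (heat_kernel t (x - y)) \<partial>lborel)"
    by (rule gaussian_layer_cake[OF t, symmetric]) measurable
  also have "\<dots> = ennreal L * (\<integral>\<^sup>+y. ennreal (heat_kernel t (x - y)) \<partial>lborel)"
    by (rule nn_integral_cmult) measurable
  also have "(\<integral>\<^sup>+y. ennreal (heat_kernel t (x - y)) \<partial>lborel) = (\<integral>\<^sup>+y. ennreal (heat_kernel t (y :: real^'n)) \<partial>lborel)"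
    by (rule nn_lborel_reflect) measurable
  also have "\<dots> = 1"
    using heat_kernel_integral[OF t, where 'n = 'n] heat_kernel_integrable[OF t, where 'n = 'n]
    by (subst nn_integral_eq_integral) (auto simp: heat_kernel_nonneg)
  finally show ?thesis by simp
qed

subsection \<open>Young functions\<close>

text \<open>Puts A into the form of a nonnegative Lebesgue integral, ready for Tonelli; extending
  the density by 0 to negative arguments keeps it monotone, hence Borel.\<close>

lemma young_density:
  assumes "young_function A"
  obtains a where "a \<in> borel_measurable borel" "\<And>t. 0 \<le> a t" "\<And>s t. 0 \<le> s \<Longrightarrow> s \<le> t \<Longrightarrow> a s \<le> a t"
    "\<And>t. t \<ge> 0 \<Longrightarrow> 0 \<le> A t"
    "\<And>t. t \<ge> 0 \<Longrightarrow> ennreal (A t) = (\<integral>\<^sup>+\<tau>. ennreal (a \<tau>) * indicator {0<..<t} \<tau> \<partial>lborel)"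
proof -
  from assms obtain b where b: "b 0 = 0" "\<And>t. t \<ge> 0 \<Longrightarrow> 0 \<le> b t" "mono_on {0..} b" "\<And>t. t \<ge> 0 \<Longrightarrow> A t = integral {0..t} b"
    unfolding young_function_def by auto
  define a where "a t = (if t \<ge> 0 then b t else 0)" for t
  have mono: "a s \<le> a t" if "s \<le> t" for s t
    using that b by (auto simp: a_def mono_on_def)
  hence meas [measurable]: "a \<in> borel_measurable borel" by (intro borel_measurable_mono monoI)
  have nn: "0 \<le> a t" for t using b(2) by (simp add: a_def)
  have A: "0 \<le> A t \<and> ennreal (A t) = (\<integral>\<^sup>+\<tau>. ennreal (a \<tau>) * indicator {0<..<t} \<tau> \<partial>lborel)" if t: "t \<ge> 0" for t
  proof -
    have si: "set_integrable lborel {0..t} a"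
      unfolding set_integrable_def
    proof (rule Bochner_Integration.integrable_bound[of _ "\<lambda>x. a t * indicator {0..t} x"])
      show "integrable lborel (\<lambda>x. a t * indicator {0..t} x :: real)"
        using t by (intro integrable_mult_right integrable_real_indicator) auto
    qed (auto simp: indicator_def nn mono)
    have "A t = integral {0..t} a"
      unfolding b(4)[OF t] by (rule integral_cong) (simp add: a_def)
    also have "\<dots> = (LINT x|lborel. indicator {0..t} x *\<^sub>R a x)"
      using set_borel_integral_eq_integral(2)[OF si] by (simp add: set_lebesgue_integral_def)
    finally have 1: "A t = (LINT x|lborel. indicator {0..t} x *\<^sub>R a x)" .
    have "ennreal (A t) = (\<integral>\<^sup>+x. ennreal (indicator {0..t} x *\<^sub>R a x) \<partial>lborel)"
      unfolding 1 by (rule nn_integral_eq_integral[symmetric])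
        (use si nn in \<open>auto simp: set_integrable_def indicator_def\<close>)
    also have "\<dots> = (\<integral>\<^sup>+\<tau>. ennreal (a \<tau>) * indicator {0<..<t} \<tau> \<partial>lborel)"
      by (rule nn_integral_cong_AE)
         (use AE_lborel_neq[of 0] AE_lborel_neq[of t] in \<open>eventually_elim, auto simp: indicator_def\<close>)
    finally have 2: "ennreal (A t) = \<dots>" .
    have "A t \<ge> 0" unfolding 1 by (intro integral_nonneg_AE) (auto simp: nn)
    with 2 show ?thesis by simp
  qed
  show ?thesis by (rule that[of a]) (use meas nn mono A in auto)
qed

text \<open>Convexity together with A 0 = 0, obtained here by rescaling the monotone density. It
  converts a constant in front of the modular into a constant in the norm.\<close>

lemma young_scale_le:
  assumes A: "young_function A" and K: "K \<ge> 1" and y: "y \<ge> 0"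
  shows "A (y / K) \<le> A y / K"
proof -
  obtain a where a: "a \<in> borel_measurable borel" "\<And>t. 0 \<le> a t" "\<And>s t. 0 \<le> s \<Longrightarrow> s \<le> t \<Longrightarrow> a s \<le> a t"
    "\<And>t. t \<ge> 0 \<Longrightarrow> 0 \<le> A t"
    "\<And>t. t \<ge> 0 \<Longrightarrow> ennreal (A t) = (\<integral>\<^sup>+\<tau>. ennreal (a \<tau>) * indicator {0<..<t} \<tau> \<partial>lborel)"
    using young_density[OF A] by blast
  note [measurable] = a(1)
  have yK: "y / K \<ge> 0" using K y by simp
  have "ennreal (A (y / K)) = ennreal (1 / K) * (\<integral>\<^sup>+\<tau>. ennreal (a (0 + 1 / K * \<tau>)) * indicator {0<..<y / K} (0 + 1 / K * \<tau>) \<partial>lborel)"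
    unfolding a(5)[OF yK] using K
    by (subst nn_integral_real_affine[where c = "1 / K" and t = 0]) auto
  also have "\<dots> \<le> ennreal (1 / K) * (\<integral>\<^sup>+\<tau>. ennreal (a \<tau>) * indicator {0<..<y} \<tau> \<partial>lborel)"
  proof (intro mult_left_mono nn_integral_mono)
    fix \<tau> :: real
    show "ennreal (a (0 + 1 / K * \<tau>)) * indicator {0<..<y / K} (0 + 1 / K * \<tau>) \<le> ennreal (a \<tau>) * indicator {0<..<y} \<tau>"
    proof (cases "0 < \<tau> \<and> \<tau> < y")
      case True
      have "\<tau> * 1 \<le> \<tau> * K" using True K by (intro mult_left_mono) auto
      hence "\<tau> / K \<le> \<tau>" using K by (simp add: field_simps)
      hence "a (\<tau> / K) \<le> a \<tau>" using True K by (intro a(3)) auto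
      thus ?thesis using True by (auto simp: indicator_def intro: ennreal_leI)
    next
      case False
      hence "0 + 1 / K * \<tau> \<notin> {0<..<y / K}" using K by (auto simp: divide_less_cancel zero_less_divide_iff)
      thus ?thesis by simp
    qed
  qed simp
  also have "\<dots> = ennreal (1 / K * A y)"
    unfolding a(5)[OF y, symmetric] using K a(4)[OF y] by (simp add: ennreal_mult[symmetric] mult.commute)
  finally show ?thesis using a(4)[OF y] K by simp
qed

lemma sum_singleton: "sum f {j} = (f j :: 'b :: comm_monoid_add)"
  by simp

text \<open>The only use of the \<open>\<nabla>\<^sub>2\<close> condition: summing \<open>A (c\<^sup>-\<^sup>j r) \<le> (2 c)\<^sup>-\<^sup>j A r\<close> over the
  intervals \<open>(c\<^sup>-\<^sup>j\<^sup>-\<^sup>1 r, c\<^sup>-\<^sup>j r]\<close>.\<close>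

lemma nabla2_hardy:
  fixes c :: real
  assumes a: "a \<in> borel_measurable borel" "\<And>t. 0 \<le> a t"
    "\<And>t. t \<ge> 0 \<Longrightarrow> 0 \<le> A t"
    "\<And>t. t \<ge> 0 \<Longrightarrow> ennreal (A t) = (\<integral>\<^sup>+\<tau>. ennreal (a \<tau>) * indicator {0<..<t} \<tau> \<partial>lborel)"
    and c: "c > 1" "\<And>r. r \<ge> 0 \<Longrightarrow> A r \<le> 1 / (2 * c) * A (c * r)"
    and r: "r > 0"
  shows "(\<integral>\<^sup>+\<tau>. ennreal (a \<tau> / \<tau>) * indicator {0<..<r} \<tau> \<partial>lborel) \<le> ennreal (2 * c * A r / r)"
proof -
  note [measurable] = a(1)
  define q where "q j = r / c ^ j" for j
  have q: "q j > 0" for j using r c by (simp add: q_def)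
  have Aq: "A (q j) \<le> A r / (2 * c) ^ j" for j
  proof (induction j)
    case (Suc j)
    have "A (q (Suc j)) \<le> 1 / (2 * c) * A (c * q (Suc j))" using q[of "Suc j"] by (intro c(2)) simp
    also have "c * q (Suc j) = q j" using c by (simp add: q_def)
    also have "1 / (2 * c) * A (q j) \<le> 1 / (2 * c) * (A r / (2 * c) ^ j)" using c by (intro mult_left_mono Suc.IH) auto
    finally show ?case by (simp add: mult_ac)
  qed (simp add: q_def)
  let ?F = "\<lambda>j \<tau>. ennreal (a \<tau> / \<tau>) * indicator {q (Suc j)<..<q j} \<tau>"
  have ae: "AE \<tau> in lborel. \<forall>j. \<tau> \<noteq> q (Suc j)"
    by (simp add: AE_all_countable AE_lborel_neq del: power_Suc)
  have "(\<integral>\<^sup>+\<tau>. ennreal (a \<tau> / \<tau>) * indicator {0<..<r} \<tau> \<partial>lborel) \<le> (\<integral>\<^sup>+\<tau>. (\<Sum>j. ?F j \<tau>) \<partial>lborel)"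
  proof (rule nn_integral_mono_AE, use ae in eventually_elim)
    fix \<tau> assume ne: "\<forall>j. \<tau> \<noteq> q (Suc j)"
    show "ennreal (a \<tau> / \<tau>) * indicator {0<..<r} \<tau> \<le> (\<Sum>j. ?F j \<tau>)"
    proof (cases "0 < \<tau> \<and> \<tau> < r")
      case True
      have "\<exists>j. q (Suc j) < \<tau>"
      proof -
        obtain n where "(1 / c) ^ n < \<tau> / r" using real_arch_pow_inv[of "\<tau> / r" "1 / c"] True r c by auto
        hence "r / c ^ n < \<tau>" using r by (simp add: power_divide field_simps)
        moreover have "r / c ^ Suc n \<le> r / c ^ n" using r c by (intro divide_left_mono) auto
        ultimately show ?thesis unfolding q_def by (meson le_less_trans)
      qed
      \<comment> \<open>The interval containing \<tau> is found by its lower end; the countably many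
        endpoints have been removed as a null set, so \<tau> lies strictly inside.\<close>
      define j where "j = (LEAST j. q (Suc j) < \<tau>)"
      have j: "q (Suc j) < \<tau>" unfolding j_def using \<open>\<exists>j. q (Suc j) < \<tau>\<close> by (rule LeastI_ex)
      have "\<tau> < q j"
      proof (cases j)
        case 0 thus ?thesis using True by (simp add: q_def)
      next
        case (Suc i)
        hence "\<not> q (Suc i) < \<tau>" using not_less_Least[of i "\<lambda>j. q (Suc j) < \<tau>"] by (simp add: j_def)
        thus ?thesis using ne Suc by (metis linorder_neqE_linordered_idom)
      qed
      hence "ennreal (a \<tau> / \<tau>) * indicator {0<..<r} \<tau> = ?F j \<tau>" using True j by simp
      also have "\<dots> = sum (\<lambda>j. ?F j \<tau>) {j}"
        by (rule sum_singleton[symmetric])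
      also have "\<dots> \<le> (\<Sum>j. ?F j \<tau>)" by (rule sum_le_suminf) auto
      finally show ?thesis .
    qed simp
  qed
  also have "\<dots> = (\<Sum>j. \<integral>\<^sup>+\<tau>. ?F j \<tau> \<partial>lborel)" by (rule nn_integral_suminf) measurable
  also have "\<dots> \<le> (\<Sum>j. ennreal (c * A r / r * (1 / 2) ^ j))"
  proof (rule suminf_le)
    fix j
    have "(\<integral>\<^sup>+\<tau>. ?F j \<tau> \<partial>lborel) \<le> (\<integral>\<^sup>+\<tau>. ennreal (1 / q (Suc j)) * (ennreal (a \<tau>) * indicator {0<..<q j} \<tau>) \<partial>lborel)"
    proof (rule nn_integral_mono)
      fix \<tau>
      show "?F j \<tau> \<le> ennreal (1 / q (Suc j)) * (ennreal (a \<tau>) * indicator {0<..<q j} \<tau>)"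
      proof (cases "q (Suc j) < \<tau> \<and> \<tau> < q j")
        case True
        hence \<tau>: "\<tau> > 0" using q[of "Suc j"] by linarith
        have "a \<tau> / \<tau> \<le> a \<tau> / q (Suc j)"
          by (rule divide_left_mono[OF less_imp_le a(2) mult_pos_pos]) (use True \<tau> q[of "Suc j"] in blast)+
        hence "ennreal (a \<tau> / \<tau>) \<le> ennreal (1 / q (Suc j)) * ennreal (a \<tau>)"
          using q[of "Suc j"] a(2) by (subst ennreal_mult[symmetric]) (auto intro!: ennreal_leI)
        thus ?thesis using True \<tau> by (simp del: power_Suc)
      qed (simp del: power_Suc)
    qed
    also have "\<dots> = ennreal (1 / q (Suc j)) * ennreal (A (q j))"
      using q[of j] a(4)[of "q j"] by (subst nn_integral_cmult) auto
    also have "\<dots> = ennreal (1 / q (Suc j) * A (q j))"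
      using q[of j] q[of "Suc j"] a(3)[of "q j"] by (intro ennreal_mult[symmetric]) auto
    also have "\<dots> \<le> ennreal (1 / q (Suc j) * (A r / (2 * c) ^ j))"
      using q[of "Suc j"] by (intro ennreal_leI mult_left_mono Aq) auto
    also have "1 / q (Suc j) * (A r / (2 * c) ^ j) = c * A r / r * (1 / 2) ^ j"
      using c by (simp add: q_def power_mult_distrib power_divide)
    finally show "(\<integral>\<^sup>+\<tau>. ?F j \<tau> \<partial>lborel) \<le> ennreal (c * A r / r * (1 / 2) ^ j)" .
  qed auto
  also have "\<dots> = ennreal (c * A r / r * 2)"
  proof (rule suminf_ennreal_eq)
    show "0 \<le> c * A r / r * (1 / 2) ^ j" for j using c r a(3)[of r] by simp
    have "(\<lambda>j. (1 / 2 :: real) ^ j) sums 2" using geometric_sums[of "1/2 :: real"] by simp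
    thus "(\<lambda>j. c * A r / r * (1 / 2) ^ j) sums (c * A r / r * 2)" by (rule sums_mult)
  qed
  finally show ?thesis by (simp add: mult_ac)
qed


text \<open>Integrating the weak type estimate for \<open>g\<close> truncated at height \<open>\<tau>/2\<close> against \<open>a \<tau>\<close>.\<close>

lemma orlicz_strong_type:
  fixes g w :: "real^'n \<Rightarrow> real" and c :: real
  assumes A: "young_function A" and c: "c > 1" "\<And>r. r \<ge> 0 \<Longrightarrow> A r \<le> 1 / (2 * c) * A (c * r)"
    and [measurable]: "g \<in> borel_measurable borel" "w \<in> borel_measurable borel" and w0: "\<And>x. w x \<ge> 0"
    and w: "\<And>x l. l > 0 \<Longrightarrow> l < w x \<Longrightarrow>
      \<exists>r>0. ennreal l * emeasure lborel (cball x r) < (\<integral>\<^sup>+y. ennreal \<bar>g y\<bar> * indicator (cball x r) y \<partial>lborel)"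
  shows "(\<integral>\<^sup>+x. ennreal (A (w x)) \<partial>lborel) \<le> ennreal (2 * 5 ^ CARD('n) * c) * (\<integral>\<^sup>+x. ennreal (A (2 * \<bar>g x\<bar>)) \<partial>lborel)"
proof -
  obtain a where a: "a \<in> borel_measurable borel" "\<And>t. 0 \<le> a t" "\<And>s t. 0 \<le> s \<Longrightarrow> s \<le> t \<Longrightarrow> a s \<le> a t"
    "\<And>t. t \<ge> 0 \<Longrightarrow> 0 \<le> A t"
    "\<And>t. t \<ge> 0 \<Longrightarrow> ennreal (A t) = (\<integral>\<^sup>+\<tau>. ennreal (a \<tau>) * indicator {0<..<t} \<tau> \<partial>lborel)"
    using young_density[OF A] by blast
  note [measurable] = a(1)
  let ?D = "5 ^ CARD('n) :: real"
  have D: "?D > 0" by simp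
  have weak: "emeasure lborel {x. \<tau> < w x} \<le> ennreal (2 * ?D / \<tau>) * (\<integral>\<^sup>+y. ennreal \<bar>g y\<bar> * indicator {\<tau><..} (2 * \<bar>g y\<bar>) \<partial>lborel)"
    if \<tau>: "\<tau> > 0" for \<tau>
  proof -
    have "emeasure lborel {x. \<tau> < w x} \<le> ennreal (?D / (\<tau> / 2)) * (\<integral>\<^sup>+y. ennreal \<bar>g y\<bar> * indicator {\<tau><..} (2 * \<bar>g y\<bar>) \<partial>lborel)"
    proof (rule weak_type)
      fix x assume "x \<in> {x. \<tau> < w x}"
      hence "\<tau> < w x" by simp
      then obtain r where r: "r > 0" "ennreal \<tau> * emeasure lborel (cball x r) < (\<integral>\<^sup>+y. ennreal \<bar>g y\<bar> * indicator (cball x r) y \<partial>lborel)"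
        using w[OF \<tau>] by blast
      have [measurable]: "(cball x r :: (real^'n) set) \<in> sets borel" by simp
      let ?M = "emeasure lborel (cball x r)" and ?I = "\<integral>\<^sup>+y. ennreal \<bar>g y\<bar> * indicator {\<tau><..} (2 * \<bar>g y\<bar>) * indicator (cball x r) y \<partial>lborel"
      \<comment> \<open>The part of |g| that is at most \<tau> / 2 adds at most \<tau> / 2 to the
        mean over the ball; since the mean exceeds \<tau>, the part above this height has mean
        greater than \<tau> / 2.\<close>
      have "(\<integral>\<^sup>+y. ennreal \<bar>g y\<bar> * indicator (cball x r) y \<partial>lborel)
        \<le> (\<integral>\<^sup>+y. ennreal \<bar>g y\<bar> * indicator {\<tau><..} (2 * \<bar>g y\<bar>) * indicator (cball x r) y + ennreal (\<tau> / 2) * indicator (cball x r) y \<partial>lborel)"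
      proof (rule nn_integral_mono)
        fix y
        show "ennreal \<bar>g y\<bar> * indicator (cball x r) y
          \<le> ennreal \<bar>g y\<bar> * indicator {\<tau><..} (2 * \<bar>g y\<bar>) * indicator (cball x r) y + ennreal (\<tau> / 2) * indicator (cball x r) y"
          using \<tau> by (cases "\<tau> < 2 * \<bar>g y\<bar>"; cases "y \<in> cball x r") (auto intro!: ennreal_leI)
      qed
      also have "\<dots> = ?I + ennreal (\<tau> / 2) * ?M"
        by (subst nn_integral_add) (auto simp: nn_integral_cmult)
      finally have less: "ennreal \<tau> * ?M < ?I + ennreal (\<tau> / 2) * ?M" using r(2) by (rule less_le_trans[rotated])
      have "ennreal \<tau> * ?M = ennreal (\<tau> / 2) * ?M + ennreal (\<tau> / 2) * ?M"
        using \<tau> by (simp flip: distrib_right ennreal_plus)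
      with less have "\<not> ?I + ennreal (\<tau> / 2) * ?M \<le> ennreal (\<tau> / 2) * ?M + ennreal (\<tau> / 2) * ?M"
        by (simp only: not_le)
      hence "ennreal (\<tau> / 2) * ?M < ?I"
        using add_right_mono[of ?I "ennreal (\<tau> / 2) * ?M" "ennreal (\<tau> / 2) * ?M"] by (meson not_less)
      thus "\<exists>r>0. ennreal (\<tau> / 2) * emeasure lborel (cball x r)
        < (\<integral>\<^sup>+y. ennreal \<bar>g y\<bar> * indicator {\<tau><..} (2 * \<bar>g y\<bar>) * indicator (cball x r) y \<partial>lborel)"
        using r(1) by blast
    qed (simp_all add: \<tau>)
    thus ?thesis by (simp add: mult.commute)
  qed
  have "(\<integral>\<^sup>+x. ennreal (A (w x)) \<partial>lborel) = (\<integral>\<^sup>+x. (\<integral>\<^sup>+\<tau>. ennreal (a \<tau>) * indicator {0<..<w x} \<tau> \<partial>lborel) \<partial>lborel)"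
    by (simp add: a(5) w0)
  also have "\<dots> = (\<integral>\<^sup>+\<tau>. (\<integral>\<^sup>+x. ennreal (a \<tau>) * indicator {0<..<w x} \<tau> \<partial>lborel) \<partial>lborel)"
    by (rule lborel_pair.Fubini') (simp add: indicator_def, measurable)
  also have "\<dots> \<le> (\<integral>\<^sup>+\<tau>. (\<integral>\<^sup>+y. ennreal (2 * ?D) * (ennreal \<bar>g y\<bar> * (ennreal (a \<tau> / \<tau>) * indicator {0<..<2 * \<bar>g y\<bar>} \<tau>)) \<partial>lborel) \<partial>lborel)"
  proof (rule nn_integral_mono)
    fix \<tau> :: real
    show "(\<integral>\<^sup>+x. ennreal (a \<tau>) * indicator {0<..<w x} \<tau> \<partial>lborel)
      \<le> (\<integral>\<^sup>+y. ennreal (2 * ?D) * (ennreal \<bar>g y\<bar> * (ennreal (a \<tau> / \<tau>) * indicator {0<..<2 * \<bar>g y\<bar>} \<tau>)) \<partial>lborel)"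
    proof (cases "\<tau> > 0")
      case True
      have "(\<integral>\<^sup>+x. ennreal (a \<tau>) * indicator {0<..<w x} \<tau> \<partial>lborel) = (\<integral>\<^sup>+x. ennreal (a \<tau>) * indicator {x. \<tau> < w x} x \<partial>lborel)"
        using True by (intro nn_integral_cong) (simp add: indicator_def)
      also have "\<dots> = ennreal (a \<tau>) * emeasure lborel {x. \<tau> < w x}"
        by (rule nn_integral_cmult_indicator) measurable
      also have "\<dots> \<le> ennreal (a \<tau>) * (ennreal (2 * ?D / \<tau>) * (\<integral>\<^sup>+y. ennreal \<bar>g y\<bar> * indicator {\<tau><..} (2 * \<bar>g y\<bar>) \<partial>lborel))"
        by (intro mult_left_mono weak True) simp
      also have "\<dots> = (ennreal (a \<tau>) * ennreal (2 * ?D / \<tau>)) * (\<integral>\<^sup>+y. ennreal \<bar>g y\<bar> * indicator {\<tau><..} (2 * \<bar>g y\<bar>) \<partial>lborel)"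
        by (simp only: mult.assoc)
      also have "ennreal (a \<tau>) * ennreal (2 * ?D / \<tau>) = ennreal (2 * ?D) * ennreal (a \<tau> / \<tau>)"
        using True a(2)[of \<tau>] D by (simp add: ennreal_mult[symmetric] mult.commute)
      also have "\<dots> * (\<integral>\<^sup>+y. ennreal \<bar>g y\<bar> * indicator {\<tau><..} (2 * \<bar>g y\<bar>) \<partial>lborel)
        = (\<integral>\<^sup>+y. ennreal (2 * ?D) * ennreal (a \<tau> / \<tau>) * (ennreal \<bar>g y\<bar> * indicator {\<tau><..} (2 * \<bar>g y\<bar>)) \<partial>lborel)"
        by (rule nn_integral_cmult[symmetric]) measurable
      also have "\<dots> = (\<integral>\<^sup>+y. ennreal (2 * ?D) * (ennreal \<bar>g y\<bar> * (ennreal (a \<tau> / \<tau>) * indicator {0<..<2 * \<bar>g y\<bar>} \<tau>)) \<partial>lborel)"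
        using True by (intro nn_integral_cong) (simp add: indicator_def mult_ac)
      finally show ?thesis by simp
    qed simp
  qed
  also have "\<dots> = (\<integral>\<^sup>+y. (\<integral>\<^sup>+\<tau>. ennreal (2 * ?D) * (ennreal \<bar>g y\<bar> * (ennreal (a \<tau> / \<tau>) * indicator {0<..<2 * \<bar>g y\<bar>} \<tau>)) \<partial>lborel) \<partial>lborel)"
    by (rule lborel_pair.Fubini') (simp add: indicator_def, measurable)
  also have "\<dots> \<le> (\<integral>\<^sup>+y. ennreal (2 * ?D * c) * ennreal (A (2 * \<bar>g y\<bar>)) \<partial>lborel)"
  proof (rule nn_integral_mono)
    fix y
    have "(\<integral>\<^sup>+\<tau>. ennreal (2 * ?D) * (ennreal \<bar>g y\<bar> * (ennreal (a \<tau> / \<tau>) * indicator {0<..<2 * \<bar>g y\<bar>} \<tau>)) \<partial>lborel)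
      = ennreal (2 * ?D) * (ennreal \<bar>g y\<bar> * (\<integral>\<^sup>+\<tau>. ennreal (a \<tau> / \<tau>) * indicator {0<..<2 * \<bar>g y\<bar>} \<tau> \<partial>lborel))"
      by (simp add: nn_integral_cmult)
    also have "\<dots> \<le> ennreal (2 * ?D * c) * ennreal (A (2 * \<bar>g y\<bar>))"
    proof (cases "g y = 0")
      case False
      define r where "r = 2 * \<bar>g y\<bar>"
      have r: "r > 0" using False by (simp add: r_def)
      have "ennreal (2 * ?D) * (ennreal \<bar>g y\<bar> * (\<integral>\<^sup>+\<tau>. ennreal (a \<tau> / \<tau>) * indicator {0<..<r} \<tau> \<partial>lborel))
        \<le> ennreal (2 * ?D) * (ennreal \<bar>g y\<bar> * ennreal (2 * c * A r / r))"
        by (intro mult_left_mono nabla2_hardy[OF a(1,2,4,5) c r]) auto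
      also have "\<dots> = ennreal (2 * ?D * (\<bar>g y\<bar> * (2 * c * A r / r)))"
        using r c a(4)[of r] by (simp add: ennreal_mult[symmetric])
      also have "2 * ?D * (\<bar>g y\<bar> * (2 * c * A r / r)) = 2 * ?D * c * A r"
        using r by (simp add: r_def)
      also have "ennreal (2 * ?D * c * A r) = ennreal (2 * ?D * c) * ennreal (A r)"
        using r c a(4)[of r] D by (intro ennreal_mult) auto
      finally show ?thesis by (simp only: r_def)
    qed simp
    finally show "(\<integral>\<^sup>+\<tau>. ennreal (2 * ?D) * (ennreal \<bar>g y\<bar> * (ennreal (a \<tau> / \<tau>) * indicator {0<..<2 * \<bar>g y\<bar>} \<tau>)) \<partial>lborel)
      \<le> ennreal (2 * ?D * c) * ennreal (A (2 * \<bar>g y\<bar>))" .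
  qed
  also have "\<dots> = ennreal (2 * ?D * c) * (\<integral>\<^sup>+y. ennreal (A (2 * \<bar>g y\<bar>)) \<partial>lborel)"
  proof (rule nn_integral_cmult)
    have "(\<lambda>y. \<integral>\<^sup>+\<tau>. ennreal (a \<tau>) * indicator {0<..<2 * \<bar>g y\<bar>} \<tau> \<partial>lborel) \<in> borel_measurable lborel"
      by (simp add: indicator_def) measurable
    thus "(\<lambda>y. ennreal (A (2 * \<bar>g y\<bar>))) \<in> borel_measurable lborel" by (simp add: a(5))
  qed
  finally show ?thesis .
qed

text \<open>A is determined only on nonnegative arguments, so measurability is derived from the
  integral representation there.\<close>

lemma young_compose_borel:
  fixes h :: "'b \<Rightarrow> real"
  assumes A: "young_function A" and [measurable]: "h \<in> borel_measurable M" and h: "\<And>x. h x \<ge> 0"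
  shows "(\<lambda>x. ennreal (A (h x))) \<in> borel_measurable M"
proof -
  obtain a where a: "a \<in> borel_measurable borel" "\<And>t. 0 \<le> a t" "\<And>s t. 0 \<le> s \<Longrightarrow> s \<le> t \<Longrightarrow> a s \<le> a t"
    "\<And>t. t \<ge> 0 \<Longrightarrow> 0 \<le> A t"
    "\<And>t. t \<ge> 0 \<Longrightarrow> ennreal (A t) = (\<integral>\<^sup>+\<tau>. ennreal (a \<tau>) * indicator {0<..<t} \<tau> \<partial>lborel)"
    using young_density[OF A] by blast
  note [measurable] = a(1)
  have "(\<lambda>t. \<integral>\<^sup>+\<tau>. ennreal (a \<tau>) * indicator {0<..<t} \<tau> \<partial>lborel) \<in> borel_measurable borel"
    by (simp add: indicator_def) measurable
  hence "(\<lambda>x. \<integral>\<^sup>+\<tau>. ennreal (a \<tau>) * indicator {0<..<h x} \<tau> \<partial>lborel) \<in> borel_measurable M"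
    by (rule measurable_compose[rotated]) measurable
  thus ?thesis by (simp add: a(5) h)
qed

text \<open>\<open>w\<close> stands for any Borel function below the maximal function of g. Of the
  divisor 2 * K * l, the 2 undoes the doubling in \<open>orlicz_strong_type\<close>, and K \<ge> 1
  absorbs its constant through \<open>young_scale_le\<close>.\<close>

lemma orlicz_modular_maximal:
  fixes g w :: "real^'n \<Rightarrow> real" and c l :: real
  defines "K \<equiv> 2 * 5 ^ CARD('n) * c"
  assumes A: "young_function A" and c: "c > 1" "\<And>r. r \<ge> 0 \<Longrightarrow> A r \<le> 1 / (2 * c) * A (c * r)"
    and [measurable]: "g \<in> borel_measurable borel" "w \<in> borel_measurable borel" and w0: "\<And>x. w x \<ge> 0"
    and w: "\<And>x l. l > 0 \<Longrightarrow> l < w x \<Longrightarrow>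
      \<exists>r>0. ennreal l * emeasure lborel (cball x r) < (\<integral>\<^sup>+y. ennreal \<bar>g y\<bar> * indicator (cball x r) y \<partial>lborel)"
    and l: "l > 0" "(\<integral>\<^sup>+x. ennreal (A (\<bar>g x\<bar> / l)) \<partial>lborel) \<le> 1"
  shows "(\<integral>\<^sup>+x. ennreal (A (w x / (2 * K * l))) \<partial>lborel) \<le> 1"
proof -
  have "(1::real) * 1 \<le> 5 ^ CARD('n) * c" using c(1) by (intro mult_mono) auto
  hence K: "K \<ge> 1" by (simp add: K_def)
  have nn: "A t \<ge> 0" if "t \<ge> 0" for t using young_density[OF A] that by metis
  have "(\<integral>\<^sup>+x. ennreal (A (w x / (2 * K * l))) \<partial>lborel) \<le> (\<integral>\<^sup>+x. ennreal (1 / K) * ennreal (A (w x / (2 * l))) \<partial>lborel)"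
  proof (rule nn_integral_mono)
    fix x
    have "A (w x / (2 * l) / K) \<le> A (w x / (2 * l)) / K" using w0[of x] l by (intro young_scale_le[OF A K]) simp
    also have "w x / (2 * l) / K = w x / (2 * K * l)" by (simp add: mult_ac)
    finally have "ennreal (A (w x / (2 * K * l))) \<le> ennreal (1 / K * A (w x / (2 * l)))" by (intro ennreal_leI) simp
    also have "\<dots> = ennreal (1 / K) * ennreal (A (w x / (2 * l)))"
      using K nn[of "w x / (2 * l)"] w0[of x] l by (intro ennreal_mult) auto
    finally show "ennreal (A (w x / (2 * K * l))) \<le> \<dots>" .
  qed
  also have "\<dots> = ennreal (1 / K) * (\<integral>\<^sup>+x. ennreal (A (w x / (2 * l))) \<partial>lborel)"
    using w0 l by (intro nn_integral_cmult young_compose_borel[OF A]) auto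
  also have "\<dots> \<le> ennreal (1 / K) * (ennreal K * (\<integral>\<^sup>+x. ennreal (A (2 * \<bar>g x / (2 * l)\<bar>)) \<partial>lborel))"
    unfolding K_def
  proof (intro mult_left_mono orlicz_strong_type[OF A c])
    fix x and m :: real
    assume la: "m > 0" "m < w x / (2 * l)"
    have [measurable]: "(cball x r :: (real^'n) set) \<in> sets borel" for r by simp
    have "m * (2 * l) > 0" "m * (2 * l) < w x" using la l(1) by (simp_all add: pos_less_divide_eq)
    then obtain r where r: "r > 0" "ennreal (m * (2 * l)) * emeasure lborel (cball x r) < (\<integral>\<^sup>+y. ennreal \<bar>g y\<bar> * indicator (cball x r) y \<partial>lborel)"
      using w by blast
    have "(\<integral>\<^sup>+y. ennreal \<bar>g y\<bar> * indicator (cball x r) y \<partial>lborel)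
      = (\<integral>\<^sup>+y. ennreal (2 * l) * (ennreal \<bar>g y / (2 * l)\<bar> * indicator (cball x r) y) \<partial>lborel)"
      using l(1) by (intro nn_integral_cong) (simp add: mult.assoc[symmetric] ennreal_mult[symmetric])
    also have "\<dots> = ennreal (2 * l) * (\<integral>\<^sup>+y. ennreal \<bar>g y / (2 * l)\<bar> * indicator (cball x r) y \<partial>lborel)"
      by (rule nn_integral_cmult) measurable
    finally have "ennreal (2 * l) * (ennreal m * emeasure lborel (cball x r))
      < ennreal (2 * l) * (\<integral>\<^sup>+y. ennreal \<bar>g y / (2 * l)\<bar> * indicator (cball x r) y \<partial>lborel)"
      using r(2) l(1) la(1) by (simp add: mult.assoc[symmetric] ennreal_mult[symmetric] mult.commute)
    hence "ennreal m * emeasure lborel (cball x r) < (\<integral>\<^sup>+y. ennreal \<bar>g y / (2 * l)\<bar> * indicator (cball x r) y \<partial>lborel)"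
      by (meson mult_left_mono not_less zero_le)
    thus "\<exists>r>0. ennreal m * emeasure lborel (cball x r) < (\<integral>\<^sup>+y. ennreal \<bar>g y / (2 * l)\<bar> * indicator (cball x r) y \<partial>lborel)"
      using r(1) by blast
  qed (use w0 l in auto)
  also have "\<dots> = (\<integral>\<^sup>+x. ennreal (A (\<bar>g x\<bar> / l)) \<partial>lborel)"
    using K l by (simp add: mult.assoc[symmetric] ennreal_mult[symmetric] del: abs_divide add: abs_divide[of _ "2 * l"])
  also have "\<dots> \<le> 1" by (rule l(2))
  finally show ?thesis .
qed

subsection \<open>The Orlicz estimate\<close>

lemma besov_heat_AE:
  fixes T :: "(real^'n \<Rightarrow> complex) \<Rightarrow> complex"
  assumes T: "T \<in> besov_space \<beta>" and t: "t > 0"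
  shows "AE x in lborel. cmod (heat_conv t T x) \<le> t powr (- (\<beta> / 2)) * enn2real (besov_norm \<beta> T)"
proof -
  let ?B = "enn2real (besov_norm \<beta> T)" and ?h = "\<lambda>x. ennreal (cmod (heat_conv t T x))"
  have B: "besov_norm \<beta> T = ennreal ?B" using T by (simp add: besov_space_def)
  have "AE x in lebesgue. ?h x \<le> esssup lebesgue ?h" by (rule esssup_AE)
  hence "AE x in lborel. ?h x \<le> esssup lebesgue ?h" by (simp only: AE_completion_iff)
  thus ?thesis
  proof eventually_elim
    case (elim x)
    have "ennreal (t powr (\<beta> / 2) * cmod (heat_conv t T x)) = ennreal (t powr (\<beta> / 2)) * ?h x"
      by (simp add: ennreal_mult)
    also have "\<dots> \<le> ennreal (t powr (\<beta> / 2)) * esssup lebesgue ?h" by (intro mult_left_mono elim) simp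
    also have "\<dots> \<le> besov_norm \<beta> T" unfolding besov_norm_def by (rule SUP_upper) (use t in simp)
    also have "\<dots> = ennreal ?B" by (rule B)
    finally have "t powr (\<beta> / 2) * cmod (heat_conv t T x) \<le> ?B" by (simp add: ennreal_le_iff)
    hence "t powr (- (\<beta> / 2)) * (t powr (\<beta> / 2) * cmod (heat_conv t T x)) \<le> t powr (- (\<beta> / 2)) * ?B"
      by (intro mult_left_mono) auto
    moreover have "t powr (- (\<beta> / 2)) * t powr (\<beta> / 2) = 1" using t by (simp flip: powr_add)
    ultimately show ?case by (simp only: mult.assoc[symmetric] mult_1)
  qed
qed

lemma orlicz_norm_le:
  assumes "l > 0" "(\<integral>\<^sup>+x. ennreal (A (\<bar>f x\<bar> / l)) \<partial>lborel) \<le> 1"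
  shows "orlicz_norm A f \<le> ennreal l"
  unfolding orlicz_norm_def using assms by (intro Inf_lower) (auto simp: nn_integral_completion)

text \<open>The infimum need not be attained, so an admissible l slightly above the norm takes its
  place.\<close>

lemma orlicz_norm_approx:
  assumes "orlicz_norm A f < ennreal r"
  obtains l where "0 < l" "l < r" "(\<integral>\<^sup>+x. ennreal (A (\<bar>f x\<bar> / l)) \<partial>lborel) \<le> 1"
proof -
  from assms obtain l where l: "0 < l" "(\<integral>\<^sup>+x. ennreal (A (\<bar>f x\<bar> / l)) \<partial>lebesgue) \<le> 1" "ennreal l < ennreal r"
    unfolding orlicz_norm_def Inf_less_iff by blast
  show ?thesis
    by (rule that[of l]) (use l in \<open>simp_all add: nn_integral_completion ennreal_less_iff\<close>)
qed

context fractional_pair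
begin

text \<open>If all ball averages of \<open>g\<close> at \<open>x\<close> are at most \<open>l\<close>, so are its Gaussian means, and
  \<open>u_bound\<close> applies.\<close>

lemma u_maximal:
  assumes P: "P > 0" "pointwise_const TYPE('n) \<beta> s s1 \<le> P" and D: "D > 0" "B \<le> D"
    and l: "l > 0" "l < (\<bar>u x\<bar> / (P * D powr (\<alpha> / \<nu>))) powr (1 / (1 - \<alpha> / \<nu>))"
  shows "\<exists>r>0. ennreal l * emeasure lborel (cball x r) < (\<integral>\<^sup>+y. ennreal \<bar>g y\<bar> * indicator (cball x r) y \<partial>lborel)"
proof (rule ccontr)
  assume "\<not> ?thesis"
  hence le: "(\<integral>\<^sup>+y. ennreal \<bar>g y\<bar> * indicator (cball x r) y \<partial>lborel) \<le> ennreal l * emeasure lborel (cball x r)"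
    if "r > 0" for r using that by (meson not_less)
  define \<theta> where "\<theta> = \<alpha> / \<nu>"
  have \<theta>: "\<theta> > 0" "1 - \<theta> > 0" using \<alpha> \<nu> \<nu>_pos by (simp_all add: \<theta>_def)
  have "\<bar>lap.heat t x\<bar> \<le> l" if t: "t > 0" for t
  proof -
    have "ennreal \<bar>lap.heat t x\<bar> \<le> (\<integral>\<^sup>+y. ennreal (\<bar>g y\<bar> * heat_kernel t (x - y)) \<partial>lborel)"
      by (rule lap.heat_le_nn_integral[OF t])
    also have "\<dots> \<le> ennreal l" using l le by (intro gaussian_mean_le t lap.f_borel) auto
    finally show ?thesis using l by (simp add: ennreal_le_iff)
  qed
  hence "\<bar>u x\<bar> \<le> pointwise_const TYPE('n) \<beta> s s1 * l powr (1 - \<theta>) * B powr \<theta>"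
    unfolding \<theta>_def using l by (intro u_bound) auto
  also have "\<dots> \<le> P * l powr (1 - \<theta>) * D powr \<theta>"
    using P D B \<theta> by (intro mult_mono powr_mono2 mult_right_mono) auto
  finally have "\<bar>u x\<bar> / (P * D powr \<theta>) \<le> l powr (1 - \<theta>)"
    using P D by (simp add: pos_divide_le_eq mult_ac)
  hence "(\<bar>u x\<bar> / (P * D powr \<theta>)) powr (1 / (1 - \<theta>)) \<le> (l powr (1 - \<theta>)) powr (1 / (1 - \<theta>))"
    using P \<theta> by (intro powr_mono2) auto
  also have "\<dots> = l" using \<theta> l by (simp add: powr_powr)
  finally show False using l(2) unfolding \<theta>_def by simp
qed

text \<open>By \<open>u_maximal\<close>, \<open>?w\<close> lies below the maximal function of g. The
  power 1 / (1 - \<theta>) in \<open>rescaled\<close> is the one in \<open>?w\<close>, so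
  \<open>rescaled\<close> at |u| / M is A at \<open>?w / (2 * K * l)\<close>, and the modular bound
  transfers. \<open>D > 0\<close> replaces B to make the division legitimate when B = 0.\<close>

lemma u_orlicz_le:
  fixes c l :: real
  defines "K \<equiv> 2 * 5 ^ CARD('n) * c"
  assumes A: "young_function A" and c: "c > 1" "\<And>r. r \<ge> 0 \<Longrightarrow> A r \<le> 1 / (2 * c) * A (c * r)"
    and P: "P > 0" "pointwise_const TYPE('n) \<beta> s s1 \<le> P" and D: "D > 0" "B \<le> D"
    and l: "l > 0" "(\<integral>\<^sup>+x. ennreal (A (\<bar>g x\<bar> / l)) \<partial>lborel) \<le> 1"
  shows "orlicz_norm (rescaled (1 / (1 - \<alpha> / \<nu>)) A) u
    \<le> ennreal (P * (2 * K) powr (1 - \<alpha> / \<nu>) * l powr (1 - \<alpha> / \<nu>) * D powr (\<alpha> / \<nu>))"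
proof -
  define \<theta> where "\<theta> = \<alpha> / \<nu>"
  have \<theta>: "\<theta> > 0" "1 - \<theta> > 0" using \<alpha> \<nu> \<nu>_pos by (simp_all add: \<theta>_def)
  have K: "K > 0" using c by (simp add: K_def)
  let ?w = "\<lambda>x. (\<bar>u x\<bar> / (P * D powr \<theta>)) powr (1 / (1 - \<theta>))"
  have mod: "(\<integral>\<^sup>+x. ennreal (A (?w x / (2 * K * l))) \<partial>lborel) \<le> 1"
    unfolding K_def
  proof (rule orlicz_modular_maximal[OF A c lap.f_borel _ _ _ l])
    show "?w \<in> borel_measurable borel" by measurable
    show "\<exists>r>0. ennreal m * emeasure lborel (cball x r) < (\<integral>\<^sup>+y. ennreal \<bar>g y\<bar> * indicator (cball x r) y \<partial>lborel)"
      if "0 < m" "m < ?w x" for m x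
      using u_maximal[OF P D that(1)] that(2) unfolding \<theta>_def by blast
  qed auto
  define M where "M = P * (2 * K) powr (1 - \<theta>) * l powr (1 - \<theta>) * D powr \<theta>"
  have M: "M > 0" using P K l D by (simp add: M_def)
  have "rescaled (1 / (1 - \<theta>)) A (\<bar>u x\<bar> / M) = A (?w x / (2 * K * l))" for x
  proof -
    have "\<bar>u x\<bar> / M = (\<bar>u x\<bar> / (P * D powr \<theta>)) / ((2 * K * l) powr (1 - \<theta>))"
      using K l by (simp add: M_def powr_mult mult_ac)
    hence "(\<bar>u x\<bar> / M) powr (1 / (1 - \<theta>)) = ?w x / ((2 * K * l) powr (1 - \<theta>)) powr (1 / (1 - \<theta>))"
      by (simp only: powr_divide)
    also have "((2 * K * l) powr (1 - \<theta>)) powr (1 / (1 - \<theta>)) = 2 * K * l"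
      using \<theta> K l by (simp add: powr_powr)
    finally show ?thesis by (simp add: rescaled_def)
  qed
  hence "orlicz_norm (rescaled (1 / (1 - \<theta>)) A) u \<le> ennreal M"
    using mod by (intro orlicz_norm_le M) simp
  thus ?thesis by (simp add: M_def \<theta>_def)
qed

text \<open>The norm of g and B are both enlarged by e > 0, which yields admissible positive l and D
  even if they vanish; then e tends to 0, the powers being continuous at 0 because \<theta> and 1 -
  \<theta> are positive.\<close>

lemma u_orlicz:
  fixes c :: real
  defines "K \<equiv> 2 * 5 ^ CARD('n) * c"
  assumes A: "young_function A" and c: "c > 1" "\<And>r. r \<ge> 0 \<Longrightarrow> A r \<le> 1 / (2 * c) * A (c * r)"
    and P: "P > 0" "pointwise_const TYPE('n) \<beta> s s1 \<le> P"
    and N: "orlicz_norm A g < \<infinity>"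
  shows "u \<in> orlicz_space (rescaled (1 / (1 - \<alpha> / \<nu>)) A)"
    and "enn2real (orlicz_norm (rescaled (1 / (1 - \<alpha> / \<nu>)) A) u)
      \<le> P * (2 * K) powr (1 - \<alpha> / \<nu>) * enn2real (orlicz_norm A g) powr (1 - \<alpha> / \<nu>) * B powr (\<alpha> / \<nu>)"
proof -
  define \<theta> where "\<theta> = \<alpha> / \<nu>"
  have \<theta>: "\<theta> > 0" "1 - \<theta> > 0" using \<alpha> \<nu> \<nu>_pos by (simp_all add: \<theta>_def)
  let ?n = "orlicz_norm (rescaled (1 / (1 - \<theta>)) A) u" and ?g = "enn2real (orlicz_norm A g)"
  let ?C = "P * (2 * K) powr (1 - \<theta>)"
  have le: "?n \<le> ennreal (?C * (?g + e) powr (1 - \<theta>) * (B + e) powr \<theta>)" if e: "e > 0" for e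
  proof -
    have "orlicz_norm A g = ennreal ?g" using N by simp
    also have "\<dots> < ennreal (?g + e)" using e by (simp add: ennreal_less_iff)
    finally obtain l where l: "0 < l" "l < ?g + e" "(\<integral>\<^sup>+x. ennreal (A (\<bar>g x\<bar> / l)) \<partial>lborel) \<le> 1"
      by (rule orlicz_norm_approx)
    have "?n \<le> ennreal (?C * l powr (1 - \<theta>) * (B + e) powr \<theta>)"
      unfolding \<theta>_def K_def using B e by (intro u_orlicz_le[OF A c P _ _ l(1,3)]) auto
    also have "\<dots> \<le> ennreal (?C * (?g + e) powr (1 - \<theta>) * (B + e) powr \<theta>)"
      using l P \<theta> by (intro ennreal_leI mult_right_mono mult_left_mono powr_mono2) auto
    finally show ?thesis .
  qed
  have "?n < \<infinity>" using le[of 1] by (simp add: le_less_trans)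
  thus "u \<in> orlicz_space (rescaled (1 / (1 - \<alpha> / \<nu>)) A)"
    using measurable_completion[of u lborel borel] by (simp add: orlicz_space_def \<theta>_def)
  have "enn2real ?n \<le> ?C * (?g + inverse (real (Suc n))) powr (1 - \<theta>) * (B + inverse (real (Suc n))) powr \<theta>" for n
    using P by (intro enn2real_leI le) auto
  moreover have "(\<lambda>n. ?C * (?g + inverse (real (Suc n))) powr (1 - \<theta>) * (B + inverse (real (Suc n))) powr \<theta>)
    \<longlonglongrightarrow> ?C * (?g + 0) powr (1 - \<theta>) * (B + 0) powr \<theta>"
    using \<theta> B by (intro tendsto_intros LIMSEQ_inverse_real_of_nat tendsto_powr') (auto intro!: always_eventually)
  ultimately show "enn2real (orlicz_norm (rescaled (1 / (1 - \<alpha> / \<nu>)) A) u)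
      \<le> P * (2 * K) powr (1 - \<alpha> / \<nu>) * ?g powr (1 - \<alpha> / \<nu>) * B powr (\<alpha> / \<nu>)"
    unfolding \<theta>_def[symmetric] by (intro LIMSEQ_le_const) auto
qed

end

lemma orlicz_norm_cong_AE:
  assumes "AE x in lborel. f x = g x"
  shows "orlicz_norm A f = orlicz_norm A g"
proof -
  have "(\<integral>\<^sup>+x. ennreal (A (\<bar>f x\<bar> / l)) \<partial>lebesgue) = (\<integral>\<^sup>+x. ennreal (A (\<bar>g x\<bar> / l)) \<partial>lebesgue)" for l
    unfolding nn_integral_completion by (rule nn_integral_cong_AE) (use assms in eventually_elim, simp)
  thus ?thesis by (simp only: orlicz_norm_def)
qed

theorem theorem5:
  fixes A :: "real \<Rightarrow> real" and \<beta> s s1 \<theta> :: real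
  assumes "young_function A" and "nabla2 A"
    and "\<beta> > 0" and "0 \<le> s1" and "s1 < s"
    and "\<theta> = (s - s1) / (\<beta> + s)"
  shows "\<exists>C>0. \<forall>(f :: real ^ 'n \<Rightarrow> real) T g U.
           f \<in> borel_measurable lebesgue \<longrightarrow> given_by T f \<longrightarrow> T \<in> besov_space \<beta> \<longrightarrow>
           tempered_distribution U \<longrightarrow> frac_laplacian s T U \<longrightarrow>
           given_by U g \<longrightarrow> g \<in> orlicz_space A \<longrightarrow>
           (\<exists>V u. tempered_distribution V \<and> frac_laplacian s1 T V \<and>
                  given_by V u \<and> u \<in> orlicz_space (rescaled (1 / (1 - \<theta>)) A) \<and>
                  enn2real (orlicz_norm (rescaled (1 / (1 - \<theta>)) A) u)
                    \<le> C * enn2real (orlicz_norm A g) powr (1 - \<theta>)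
                        * enn2real (besov_norm \<beta> T) powr \<theta>)"
proof -
  from assms(2) obtain c where c: "c > 1" "\<And>r. r \<ge> 0 \<Longrightarrow> A r \<le> 1 / (2 * c) * A (c * r)"
    unfolding nabla2_def by blast
  \<comment> \<open>Fixed from n, \<beta>, s and s1 before any function is introduced; the maximum
    with 1 makes the final constant positive.\<close>
  define P where "P = max 1 (pointwise_const TYPE('n) \<beta> s s1)"
  have P: "P > 0" "pointwise_const TYPE('n) \<beta> s s1 \<le> P" by (auto simp: P_def)
  let ?C = "P * (2 * (2 * 5 ^ CARD('n) * c)) powr (1 - \<theta>)"
  show ?thesis
  proof (intro exI[of _ ?C] conjI allI impI)
    show "?C > 0" using P c by simp
    fix f g :: "real^'n \<Rightarrow> real" and T U
    assume T: "given_by T f" "T \<in> besov_space \<beta>" and U: "tempered_distribution U" "frac_laplacian s T U" "given_by U g"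
      and g: "g \<in> orlicz_space A"
    have tempered: "tempered_distribution T" using T(2) by (simp add: besov_space_def)
    \<comment> \<open>Borel representatives replace f and g; the Orlicz norm of g is unaffected by a
      change on a null set.\<close>
    obtain f0 where f0: "represents T f0" using given_by_represents[OF T(1)] by blast
    obtain g0 where g0: "represents U g0" "AE x in lborel. g x = g0 x" using given_by_represents[OF U(3)] by blast
    interpret rT: represented_distribution T f0 using tempered f0 by unfold_locales
    interpret rU: represented_distribution U g0 using U(1) g0(1) by unfold_locales
    interpret fractional_pair T f0 \<beta> "enn2real (besov_norm \<beta> T)" U g0 s s1
    proof unfold_locales
      fix t :: real assume t: "t > 0"
      show "AE x in lborel. \<bar>rT.heat t x\<bar> \<le> t powr (- (\<beta> / 2)) * enn2real (besov_norm \<beta> T)"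
        using besov_heat_AE[OF T(2) t] by (simp add: rT.heat_conv_eq[OF t])
    qed (use assms U in auto)
    have "x / 2 / (y / 2) = x / y" for x y :: real by simp
    hence \<theta>: "\<alpha> / \<nu> = \<theta>" unfolding assms(6) \<alpha>_def \<nu>_def by (simp only: add.commute)
    have norm: "orlicz_norm A g = orlicz_norm A g0" by (rule orlicz_norm_cong_AE[OF g0(2)])
    have "orlicz_norm A g0 < \<infinity>" using g by (simp add: orlicz_space_def norm)
    note u = u_orlicz[OF assms(1) c P this]
    show "\<exists>V u. tempered_distribution V \<and> frac_laplacian s1 T V \<and>
                  given_by V u \<and> u \<in> orlicz_space (rescaled (1 / (1 - \<theta>)) A) \<and>
                  enn2real (orlicz_norm (rescaled (1 / (1 - \<theta>)) A) u)
                    \<le> ?C * enn2real (orlicz_norm A g) powr (1 - \<theta>)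
                        * enn2real (besov_norm \<beta> T) powr \<theta>"
      using V_tempered V_frac_laplacian V_given_by_u u unfolding \<theta> norm by blast
  qed
qed

end
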